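(* Assume the data-generating, density, regularity and envelope assumptions stated in the context. For $t\in[T]$ let $(\hat\theta_t,\hat\eta_t,\hat\alpha_t,\hat\sigma_t)$ be $\mathcal F_{t-1}$-measurable estimators of $(\theta_{P_e},\eta_{P_e},\alpha_{P_e},\sigma_t)$. Let $w_t=\pi_e(A_t\mid C_t)/\pi_t(A_t\mid C_t)$, $\varphi_t=\varphi_{P_e}(Z_t)$, $\hat A_T:=\sum_{t=1}^T\hat\sigma_t^{-1}w_t$ and $$\hat\Psi_T^{\mathrm{os}}:=\hat A_T^{-1}\sum_{t=1}^T\hat\sigma_t^{-1}w_t\left(m_{\hat\theta_t}(Z_t)-\partial_\theta\ell_{\hat\theta_t,\hat\eta_t}(Z_t)[\hat\alpha_t]\right).$$ Assume: (a) $\frac1T\sum_{t=1}^T\|\hat\theta_t-\theta_{P_e}\|_\Theta^4=o_p(T^{-1})$, $\frac1T\sum_{t=1}^T\|\hat\eta_t-\eta_{P_e}\|_\Upsilon^4=o_p(T^{-1})$ and $\frac1T\sum_{t=1}^T\|\hat\alpha_t-\alpha_{P_e}\|_\Theta^4=o_p(T^{-1})$; (b) for every $\varepsilon>0$, $\frac1T\sum_{t=1}^T\mathbb E\left[w_t^2\varphi_t^2\mathbf 1\{|w_t\varphi_t|>\varepsilon\sqrt T\}\mid\mathcal F_{t-1}\right]\to0$ in probability; (c) $\sup_{t\in[T]}\sup_{(c,a)\in\mathcal C\times\mathcal A}\frac{\pi_e(a\mid c)}{\pi_t(a\mid c)}=O(T^{1/3})$ almost surely; (d) $\frac1T\sum_{t=1}^T\sigma_t^2/\hat\sigma_t^2-1=o_p(1)$,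 and for some constant $c>0$, $\min_{t\in[T]}\hat\sigma_t^2>c$ almost surely. Then, as $T\to\infty$, $$\frac{\hat A_T}{\sqrt T}\left(\hat\Psi_T^{\mathrm{os}}-\Psi_e(\theta_{P_e})\right)\xrightarrow{d}N(0,1).$$
   Context: Setup. A contextual bandit runs for $T$ rounds. At round $t$ a context $C_t\in\mathcal C$ is observed, an action $A_t\in\mathcal A$ is drawn from $\Pi_t(\cdot\mid C_t)$, and an outcome $Y_t\in\mathbb R$ is observed; $Z_t=(C_t,A_t,Y_t)\in\mathcal Z=\mathcal C\times\mathcal A\times\mathbb R$, $\mathcal F_{t}=\sigma(Z_1,\dots,Z_{t})$, and the policy $\Pi_t$ is $\mathcal F_{t-1}$-measurable. Asymptotics are as $T\to\infty$; policies and estimators may depend on the horizon $T$ (suppressed in the notation). $[T]=\{1,\dots,T\}$. Data-generating assumption: the $C_t$ are i.i.d. with law $P_C$ and $C_t$ is independent of $\mathcal F_{t-1}$; there is a fixed conditional law $P_Y(\cdot\mid c,a)$ with $Y_t\mid C_t,A_t\sim P_Y(\cdot\mid C_t,A_t)$ and $Y_t$ conditionally independent of $\mathcal F_{t-1}$ given $(C_t,A_t)$. Density assumption: $\Pi_e(\cdot\mid c)$ is a fixed (history-independent) evaluation policy; there is a common dominating measure $\mu(\cdot\mid c)$ with $\Pi_t(\cdot\mid c),\Pi_e(\cdot\mid c)\ll\mu(\cdot\mid c)$ for all $t$, with known densities $\pi_t(\cdot\mid c),\pi_e(\cdot\mid c)$, and $\Pi_e(\cdot\mid c)\ll\Pi_t(\cdot\mid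 c)$ almost surely. $P_e$ is the law of $Z=(C,A,Y)$ with $C\sim P_C$, $A\mid C\sim\Pi_e(\cdot\mid C)$, $Y\mid C,A\sim P_Y(\cdot\mid C,A)$. Target. $(\Theta,\|\cdot\|_\Theta)$, $(\Upsilon,\|\cdot\|_\Upsilon)$ are normed linear spaces; $\ell_{\theta,\eta}(z)$ is a real-valued loss indexed by $(\theta,\eta)\in\Theta\times\Upsilon$; $\eta_{P_e}\in\Upsilon$ is a nuisance function; $\theta_{P_e}:=\arg\min_{\theta\in\Theta}\mathbb E_{P_e}[\ell_{\theta,\eta_{P_e}}(Z)]$; $m:\Theta\times\mathcal Z\to\mathbb R$, written $m_\theta(z)$, is measurable; $\Psi_e(\theta):=\mathbb E_{P_e}[m_\theta(Z)]$. Derivatives: $\partial_\theta f_{\theta,\eta}(z)[h]:=\frac{d}{d\epsilon}f_{\theta+\epsilon h,\eta}(z)|_{\epsilon=0}$, $\partial_\theta^2f_{\theta,\eta}(z)[h,u]:=\frac{\partial^2}{\partial\epsilon\,\partial\delta}f_{\theta+\epsilon h+\delta u,\eta}(z)|_{\epsilon=\delta=0}$, $\partial_\eta\partial_\theta f_{\theta,\eta}(z)[h,v]:=\frac{\partial^2}{\partial\delta\,\partial\epsilon}f_{\theta+\epsilon h,\eta+\delta v}(z)|_{\epsilon=\delta=0}$, for $h,u\in\Theta$, $v\in\Upsilon$. Regularity assumption: $\theta_{P_e}$ exists and is unique; (i) $\ell_{\theta,\eta}(z)$ is twice Fréchet differentiable in $\theta$ and $m_\theta(z)$ once Fréchet differentiable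 in $\theta$ in a neighborhood of $\theta_{P_e}$; (ii) $\mathbb E_{P_e}[\partial_\theta\ell_{\theta_{P_e},\eta_{P_e}}(Z)[h]]=0$ for all $h\in\Theta$; (iii) $\mathbb E_{P_e}[\partial_\eta\partial_\theta\ell_{\theta_{P_e},\eta_{P_e}}(Z)[h,u]]=0$ for all $h\in\Theta,u\in\Upsilon$; (iv) with $H_{P_e}(u,h):=\mathbb E_{P_e}[\partial_\theta^2\ell_{\theta_{P_e},\eta_{P_e}}(Z)[h,u]]$, there is $c>0$ with $c\|h\|_\Theta^2\le H_{P_e}(h,h)$ for all $h\in\Theta$. Envelope assumption: there are $\epsilon_\Theta,\epsilon_\Upsilon>0$ and measurable $C:\mathcal Z\to\mathbb R_+$ with $\mathbb E_{P_e}[C(Z)^4]<\infty$ such that, whenever $\|\theta-\theta_{P_e}\|_\Theta,\|\theta'-\theta_{P_e}\|_\Theta\le\epsilon_\Theta$ and $\|\eta-\eta_{P_e}\|_\Upsilon,\|\eta'-\eta_{P_e}\|_\Upsilon\le\epsilon_\Upsilon$, for all $z$ and all $h,u\in\Theta$, $v\in\Upsilon$: $|m_\theta(z)|\le C(z)$; $|\partial_\theta m_\theta(z)[h]|\le C(z)\|h\|_\Theta$; $|\partial_\theta\ell_{\theta_{P_e},\eta_{P_e}}(z)[h]|\le C(z)\|h\|_\Theta$; $|\partial_\theta^2\ell_{\theta,\eta}(z)[h,u]|\le C(z)\|h\|_\Theta\|u\|_\Theta$; $|\partial_\eta\partial_\theta\ell_{\theta,\eta}(z)[h,v]|\le C(z)\|h\|_\Theta\|v\|_\Upsilon$;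 $|\partial_\theta m_\theta(z)[h]-\partial_\theta m_{\theta'}(z)[h]|\le C(z)\|\theta-\theta'\|_\Theta\|h\|_\Theta$; $|\partial_\eta\partial_\theta\ell_{\theta,\eta}(z)[h,v]-\partial_\eta\partial_\theta\ell_{\theta',\eta'}(z)[h,v]|\le C(z)(\|\theta-\theta'\|_\Theta+\|\eta-\eta'\|_\Upsilon)\|h\|_\Theta\|v\|_\Upsilon$; $|\partial_\theta^2\ell_{\theta,\eta}(z)[h,u]-\partial_\theta^2\ell_{\theta',\eta'}(z)[h,u]|\le C(z)(\|\theta-\theta'\|_\Theta+\|\eta-\eta'\|_\Upsilon)\|h\|_\Theta\|u\|_\Theta$. Riesz representer and influence function. $\bar\Theta$ is the completion of $\Theta$ in the norm $H_{P_e}(h,h)^{1/2}$; $\|\cdot\|_\Theta$, $H_{P_e}$ and the derivative maps (in their $\Theta$-direction arguments) extend continuously to $\bar\Theta$. $\alpha_{P_e}\in\bar\Theta$ is the unique element with $\mathbb E_{P_e}[\partial_\theta m_{\theta_{P_e}}(Z)[h]]=H_{P_e}(\alpha_{P_e},h)$ for all $h\in\Theta$. $\varphi_{P_e}(z):=m_{\theta_{P_e}}(z)-\Psi_e(\theta_{P_e})-\partial_\theta\ell_{\theta_{P_e},\eta_{P_e}}(z)[\alpha_{P_e}]$, and $\sigma_t^2:=\mathrm{Var}(w_t\varphi_t\mid\mathcal F_{t-1})=\mathbb E[w_t^2\varphi_t^2\mid\mathcal F_{t-1}]$. Estimators satisfy $\hat\theta_t,\hat\alpha_t\in\Theta$,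 $\hat\eta_t\in\Upsilon$. *)

theory Defs
  imports "HOL-Probability.Probability"
begin

section \<open>Probabilistic notions\<close>

text \<open>The conditional law of \<open>X\<close> (with values in \<open>N\<close>) given the sub-sigma-algebra \<open>G\<close> is the
  random measure \<open>K\<close>.\<close>

definition cond_law ::
  "'w measure \<Rightarrow> 'w measure \<Rightarrow> 'b measure \<Rightarrow> ('w \<Rightarrow> 'b) \<Rightarrow> ('w \<Rightarrow> 'b measure) \<Rightarrow> bool" where
  "cond_law M G N X K \<longleftrightarrow>
     (\<forall>B\<in>sets N. AE \<omega> in M.
        real_cond_exp M G (\<lambda>\<omega>. indicator B (X \<omega>)) \<omega> = measure (K \<omega>) B)"

text \<open>\<open>X\<close> (with values in \<open>N\<close>) and the sigma-algebra \<open>H\<close> are conditionally independent given \<open>G\<close>.\<close>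

definition cond_indep ::
  "'w measure \<Rightarrow> 'w measure \<Rightarrow> 'b measure \<Rightarrow> ('w \<Rightarrow> 'b) \<Rightarrow> 'w measure \<Rightarrow> bool" where
  "cond_indep M G N X H \<longleftrightarrow>
     (\<forall>B\<in>sets N. \<forall>E\<in>sets H. AE \<omega> in M.
        real_cond_exp M G (\<lambda>\<omega>. indicator B (X \<omega>) * indicator E \<omega>) \<omega> =
        real_cond_exp M G (\<lambda>\<omega>. indicator B (X \<omega>)) \<omega> * real_cond_exp M G (indicator E) \<omega>)"

definition cond_var :: "'w measure \<Rightarrow> 'w measure \<Rightarrow> ('w \<Rightarrow> real) \<Rightarrow> 'w \<Rightarrow> real" where
  "cond_var M G X = real_cond_exp M G (\<lambda>\<omega>. (X \<omega> - real_cond_exp M G X \<omega>)\<^sup>2)"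

text \<open>\<open>X\<^sub>T = o\<^sub>p(a\<^sub>T)\<close> as \<open>T\<close> tends to infinity.\<close>

definition little_o_p :: "'w measure \<Rightarrow> (nat \<Rightarrow> 'w \<Rightarrow> real) \<Rightarrow> (nat \<Rightarrow> real) \<Rightarrow> bool" where
  "little_o_p M X a \<longleftrightarrow>
     (\<forall>\<epsilon>>0. (\<lambda>T. measure M {\<omega> \<in> space M. \<bar>X T \<omega>\<bar> > \<epsilon> * a T}) \<longlonglongrightarrow> 0)"

text \<open>Expectation of a real random variable that need not be integrable; the undefined case
  \<open>\<infinity> - \<infinity>\<close> evaluates to \<open>\<infinity>\<close>.\<close>

definition ext_expectation :: "'z measure \<Rightarrow> ('z \<Rightarrow> real) \<Rightarrow> ereal" where
  "ext_expectation P f =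
     enn2ereal (\<integral>\<^sup>+z. ennreal (f z) \<partial>P) - enn2ereal (\<integral>\<^sup>+z. ennreal (- f z) \<partial>P)"


section \<open>Contextual bandits\<close>

text \<open>An observation is a triple \<open>(c, a, y)\<close> of context, action and outcome.\<close>

abbreviation ctx :: "'c \<times> 'a \<times> real \<Rightarrow> 'c" where "ctx z \<equiv> fst z"
abbreviation act :: "'c \<times> 'a \<times> real \<Rightarrow> 'a" where "act z \<equiv> fst (snd z)"
abbreviation outc :: "'c \<times> 'a \<times> real \<Rightarrow> real" where "outc z \<equiv> snd (snd z)"

definition obs_space :: "'c measure \<Rightarrow> 'a measure \<Rightarrow> ('c \<times> 'a \<times> real) measure" where
  "obs_space MC MA = MC \<Otimes>\<^sub>M (MA \<Otimes>\<^sub>M borel)"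

text \<open>The sigma-algebra generated by \<open>Z\<^sub>1, \<dots>, Z\<^sub>t\<close>.\<close>

definition history :: "'w measure \<Rightarrow> 'z measure \<Rightarrow> (nat \<Rightarrow> 'w \<Rightarrow> 'z) \<Rightarrow> nat \<Rightarrow> 'w measure" where
  "history M N Z t =
     vimage_algebra (space M) (\<lambda>\<omega>. \<lambda>i\<in>{1..t}. Z i \<omega>) (PiM {1..t} (\<lambda>_. N))"

text \<open>The sigma-algebra generated by \<open>F\<close> and the random variable \<open>X\<close>.\<close>

definition enlarge :: "'w measure \<Rightarrow> ('w \<Rightarrow> 'b) \<Rightarrow> 'b measure \<Rightarrow> 'w measure" where
  "enlarge F X N = vimage_algebra (space F) (\<lambda>\<omega>. (\<omega>, X \<omega>)) (F \<Otimes>\<^sub>M N)"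

text \<open>The first index of \<open>Z\<close> and of \<open>Pi\<close> is the horizon \<open>T\<close>, the second one the round \<open>t \<in> {1..T}\<close>:
  the policies, hence also the data they generate, may depend on the horizon.  All horizons live on
  one probability space, with no restriction on the joint law across horizons.\<close>

locale bandit_data = prob_space M for M :: "'w measure" +
  fixes MC :: "'c measure" and MA :: "'a measure"
    and PC :: "'c measure" and PY :: "'c \<times> 'a \<Rightarrow> real measure"
    and Z :: "nat \<Rightarrow> nat \<Rightarrow> 'w \<Rightarrow> 'c \<times> 'a \<times> real"
    and Pi :: "nat \<Rightarrow> nat \<Rightarrow> 'w \<Rightarrow> 'c \<Rightarrow> 'a measure"
  assumes PC: "PC \<in> space (prob_algebra MC)"
    and PY: "PY \<in> MC \<Otimes>\<^sub>M MA \<rightarrow>\<^sub>M prob_algebra borel"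
    and Z_measurable: "\<And>T t. t \<in> {1..T} \<Longrightarrow> Z T t \<in> M \<rightarrow>\<^sub>M obs_space MC MA"
    and policy_measurable: "\<And>T t. t \<in> {1..T} \<Longrightarrow>
      (\<lambda>(\<omega>, c). Pi T t \<omega> c)
        \<in> history M (obs_space MC MA) (Z T) (t - 1) \<Otimes>\<^sub>M MC \<rightarrow>\<^sub>M prob_algebra MA"
    and ctx_indep: "\<And>T. indep_vars (\<lambda>_. MC) (\<lambda>t \<omega>. ctx (Z T t \<omega>)) {1..T}"
    and ctx_law: "\<And>T t. t \<in> {1..T} \<Longrightarrow> distr M MC (\<lambda>\<omega>. ctx (Z T t \<omega>)) = PC"
    and ctx_indep_history: "\<And>T t. t \<in> {1..T} \<Longrightarrow>
      indep_set (sets (vimage_algebra (space M) (\<lambda>\<omega>. ctx (Z T t \<omega>)) MC))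
                (sets (history M (obs_space MC MA) (Z T) (t - 1)))"
    and act_law: "\<And>T t. t \<in> {1..T} \<Longrightarrow>
      cond_law M (enlarge (history M (obs_space MC MA) (Z T) (t - 1)) (\<lambda>\<omega>. ctx (Z T t \<omega>)) MC)
        MA (\<lambda>\<omega>. act (Z T t \<omega>)) (\<lambda>\<omega>. Pi T t \<omega> (ctx (Z T t \<omega>)))"
    and outc_law: "\<And>T t. t \<in> {1..T} \<Longrightarrow>
      cond_law M
        (vimage_algebra (space M) (\<lambda>\<omega>. (ctx (Z T t \<omega>), act (Z T t \<omega>))) (MC \<Otimes>\<^sub>M MA))
        borel (\<lambda>\<omega>. outc (Z T t \<omega>)) (\<lambda>\<omega>. PY (ctx (Z T t \<omega>), act (Z T t \<omega>)))"
    and outc_indep_history: "\<And>T t. t \<in> {1..T} \<Longrightarrow>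
      cond_indep M
        (vimage_algebra (space M) (\<lambda>\<omega>. (ctx (Z T t \<omega>), act (Z T t \<omega>))) (MC \<Otimes>\<^sub>M MA))
        borel (\<lambda>\<omega>. outc (Z T t \<omega>)) (history M (obs_space MC MA) (Z T) (t - 1))"

text \<open>\<open>dens T t \<omega> c\<close> and \<open>dens_e c\<close> are densities of the policies with respect to \<open>mu c\<close>.
  Note that \<open>absolutely_continuous Q R\<close> says that \<open>R\<close> is dominated by \<open>Q\<close>.\<close>

locale bandit_density = bandit_data M MC MA PC PY Z Pi
  for M :: "'w measure" and MC :: "'c measure" and MA :: "'a measure"
    and PC :: "'c measure" and PY :: "'c \<times> 'a \<Rightarrow> real measure"
    and Z :: "nat \<Rightarrow> nat \<Rightarrow> 'w \<Rightarrow> 'c \<times> 'a \<times> real"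
    and Pi :: "nat \<Rightarrow> nat \<Rightarrow> 'w \<Rightarrow> 'c \<Rightarrow> 'a measure" +
  fixes Pi_e :: "'c \<Rightarrow> 'a measure" and mu :: "'c \<Rightarrow> 'a measure"
    and dens :: "nat \<Rightarrow> nat \<Rightarrow> 'w \<Rightarrow> 'c \<Rightarrow> 'a \<Rightarrow> real" and dens_e :: "'c \<Rightarrow> 'a \<Rightarrow> real"
  assumes Pi_e: "Pi_e \<in> MC \<rightarrow>\<^sub>M prob_algebra MA"
    and sets_mu: "\<And>c. c \<in> space MC \<Longrightarrow> sets (mu c) = sets MA"
    and dens_e_measurable: "(\<lambda>(c, a). dens_e c a) \<in> borel_measurable (MC \<Otimes>\<^sub>M MA)"
    and dens_e_nonneg: "\<And>c a. c \<in> space MC \<Longrightarrow> a \<in> space MA \<Longrightarrow> 0 \<le> dens_e c a"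
    and dens_e: "\<And>c. c \<in> space MC \<Longrightarrow> Pi_e c = density (mu c) (\<lambda>a. ennreal (dens_e c a))"
    and dens_measurable: "\<And>T t. t \<in> {1..T} \<Longrightarrow>
      (\<lambda>(\<omega>, c, a). dens T t \<omega> c a)
        \<in> borel_measurable (history M (obs_space MC MA) (Z T) (t - 1) \<Otimes>\<^sub>M (MC \<Otimes>\<^sub>M MA))"
    and dens_nonneg: "\<And>T t \<omega> c a. t \<in> {1..T} \<Longrightarrow> \<omega> \<in> space M \<Longrightarrow> c \<in> space MC \<Longrightarrow>
      a \<in> space MA \<Longrightarrow> 0 \<le> dens T t \<omega> c a"
    and dens: "\<And>T t \<omega> c. t \<in> {1..T} \<Longrightarrow> \<omega> \<in> space M \<Longrightarrow> c \<in> space MC \<Longrightarrow>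
      Pi T t \<omega> c = density (mu c) (\<lambda>a. ennreal (dens T t \<omega> c a))"
    and overlap: "\<And>T t. t \<in> {1..T} \<Longrightarrow>
      AE \<omega> in M. AE c in PC. absolutely_continuous (Pi T t \<omega> c) (Pi_e c)"

text \<open>The law of \<open>(C, A, Y)\<close> under the evaluation policy.\<close>

definition eval_law ::
  "'c measure \<Rightarrow> 'a measure \<Rightarrow> 'c measure \<Rightarrow> ('c \<Rightarrow> 'a measure) \<Rightarrow> ('c \<times> 'a \<Rightarrow> real measure)
    \<Rightarrow> ('c \<times> 'a \<times> real) measure" where
  "eval_law MC MA PC Pi_e PY =
     PC \<bind> (\<lambda>c. Pi_e c \<bind> (\<lambda>a. PY (c, a) \<bind> (\<lambda>y. return (obs_space MC MA) (c, a, y))))"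


section \<open>Directional derivatives and regularity\<close>

definition d_theta ::
  "('th::real_normed_vector \<Rightarrow> 'z \<Rightarrow> real) \<Rightarrow> 'th \<Rightarrow> 'z \<Rightarrow> 'th \<Rightarrow> real" where
  "d_theta f \<theta> z h = deriv (\<lambda>\<epsilon>. f (\<theta> + \<epsilon> *\<^sub>R h) z) 0"

definition dd_theta ::
  "('th::real_normed_vector \<Rightarrow> 'z \<Rightarrow> real) \<Rightarrow> 'th \<Rightarrow> 'z \<Rightarrow> 'th \<Rightarrow> 'th \<Rightarrow> real" where
  "dd_theta f \<theta> z h u =
     deriv (\<lambda>\<epsilon>. deriv (\<lambda>\<delta>. f (\<theta> + \<epsilon> *\<^sub>R h + \<delta> *\<^sub>R u) z) 0) 0"

definition d_eta_theta ::
  "('th::real_normed_vector \<Rightarrow> 'up::real_normed_vector \<Rightarrow> 'z \<Rightarrow> real)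
    \<Rightarrow> 'th \<Rightarrow> 'up \<Rightarrow> 'z \<Rightarrow> 'th \<Rightarrow> 'up \<Rightarrow> real" where
  "d_eta_theta f \<theta> \<eta> z h v =
     deriv (\<lambda>\<delta>. deriv (\<lambda>\<epsilon>. f (\<theta> + \<epsilon> *\<^sub>R h) (\<eta> + \<delta> *\<^sub>R v) z) 0) 0"

text \<open>The derivative maps of the loss with respect to its first argument.\<close>

abbreviation score ::
  "('th::real_normed_vector \<Rightarrow> 'up \<Rightarrow> 'z \<Rightarrow> real) \<Rightarrow> 'th \<Rightarrow> 'up \<Rightarrow> 'z \<Rightarrow> 'th \<Rightarrow> real" where
  "score l \<theta> \<eta> z h \<equiv> d_theta (\<lambda>\<theta>. l \<theta> \<eta>) \<theta> z h"

abbreviation score2 ::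
  "('th::real_normed_vector \<Rightarrow> 'up \<Rightarrow> 'z \<Rightarrow> real) \<Rightarrow> 'th \<Rightarrow> 'up \<Rightarrow> 'z \<Rightarrow> 'th \<Rightarrow> 'th \<Rightarrow> real" where
  "score2 l \<theta> \<eta> z h u \<equiv> dd_theta (\<lambda>\<theta>. l \<theta> \<eta>) \<theta> z h u"

definition hessian ::
  "'z measure \<Rightarrow> ('th::real_normed_vector \<Rightarrow> 'up \<Rightarrow> 'z \<Rightarrow> real) \<Rightarrow> 'th \<Rightarrow> 'up \<Rightarrow> 'th \<Rightarrow> 'th \<Rightarrow> real"
  where "hessian P l \<theta> \<eta> u h = (\<integral>z. score2 l \<theta> \<eta> z h u \<partial>P)"

definition twice_frechet_differentiable_on ::
  "('b::real_normed_vector \<Rightarrow> real) \<Rightarrow> 'b set \<Rightarrow> bool" where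
  "twice_frechet_differentiable_on f S \<longleftrightarrow>
     (\<exists>f' :: 'b \<Rightarrow> ('b \<Rightarrow>\<^sub>L real).
        \<forall>x\<in>S. (f has_derivative blinfun_apply (f' x)) (at x) \<and> f' differentiable (at x))"

text \<open>\<open>P\<close> is the law of one observation.  The parameter and nuisance spaces carry their Borel
  sigma-algebras.  Joint measurability of the score is required explicitly, because on
  non-separable spaces it does not follow from that of the loss.  Condition \<open>mixed\<close> makes explicit
  that the derivative \<open>d_eta_theta\<close>, which the remaining conditions refer to, exists near the
  truth.\<close>

locale regularity =
  fixes P :: "'z measure"
    and l :: "'th::real_normed_vector \<Rightarrow> 'up::real_normed_vector \<Rightarrow> 'z \<Rightarrow> real"
    and m :: "'th \<Rightarrow> 'z \<Rightarrow> real"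
    and \<theta>\<^sub>0 :: 'th and \<eta>\<^sub>0 :: 'up
  assumes l_measurable: "\<And>\<theta> \<eta>. l \<theta> \<eta> \<in> borel_measurable P"
    and score_measurable: "(\<lambda>(\<theta>, \<eta>, h, z). score l \<theta> \<eta> z h)
      \<in> borel_measurable (borel \<Otimes>\<^sub>M (borel \<Otimes>\<^sub>M (borel \<Otimes>\<^sub>M P)))"
    and m_measurable: "(\<lambda>(\<theta>, z). m \<theta> z) \<in> borel_measurable (borel \<Otimes>\<^sub>M P)"
    and unique_minimizer:
      "\<And>\<theta>. is_arg_min (\<lambda>\<theta>. ext_expectation P (l \<theta> \<eta>\<^sub>0)) (\<lambda>_. True) \<theta> \<longleftrightarrow> \<theta> = \<theta>\<^sub>0"
    and loss_differentiable: "\<exists>r>0. \<forall>z\<in>space P. \<forall>\<eta>\<in>ball \<eta>\<^sub>0 r.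
      twice_frechet_differentiable_on (\<lambda>\<theta>. l \<theta> \<eta> z) (ball \<theta>\<^sub>0 r)"
    and m_differentiable: "\<exists>r>0. \<forall>z\<in>space P. \<forall>\<theta>\<in>ball \<theta>\<^sub>0 r. (\<lambda>\<theta>. m \<theta> z) differentiable (at \<theta>)"
    and mixed: "\<exists>r>0. \<forall>z\<in>space P. \<forall>\<theta>\<in>ball \<theta>\<^sub>0 r. \<forall>\<eta>\<in>ball \<eta>\<^sub>0 r. \<forall>h v.
      (\<lambda>\<delta>::real. score l \<theta> (\<eta> + \<delta> *\<^sub>R v) z h) differentiable (at 0)"
    and first_order: "\<And>h. (\<integral>z. score l \<theta>\<^sub>0 \<eta>\<^sub>0 z h \<partial>P) = 0"
    and orthogonality: "\<And>h u. (\<integral>z. d_eta_theta l \<theta>\<^sub>0 \<eta>\<^sub>0 z h u \<partial>P) = 0"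
    and coercive: "\<exists>c>0. \<forall>h. c * (norm h)\<^sup>2 \<le> hessian P l \<theta>\<^sub>0 \<eta>\<^sub>0 h h"

definition envelope ::
  "'z measure \<Rightarrow> ('th::real_normed_vector \<Rightarrow> 'up::real_normed_vector \<Rightarrow> 'z \<Rightarrow> real)
    \<Rightarrow> ('th \<Rightarrow> 'z \<Rightarrow> real) \<Rightarrow> 'th \<Rightarrow> 'up \<Rightarrow> bool" where
  "envelope P l m \<theta>\<^sub>0 \<eta>\<^sub>0 \<longleftrightarrow>
    (\<exists>\<epsilon>\<^sub>\<Theta>>0. \<exists>\<epsilon>\<^sub>\<Upsilon>>0. \<exists>C. C \<in> borel_measurable P \<and> (\<forall>z\<in>space P. 0 \<le> C z) \<and>
      integrable P (\<lambda>z. C z ^ 4) \<and>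
      (\<forall>\<theta> \<theta>' \<eta> \<eta>'. norm (\<theta> - \<theta>\<^sub>0) \<le> \<epsilon>\<^sub>\<Theta> \<longrightarrow> norm (\<theta>' - \<theta>\<^sub>0) \<le> \<epsilon>\<^sub>\<Theta> \<longrightarrow>
         norm (\<eta> - \<eta>\<^sub>0) \<le> \<epsilon>\<^sub>\<Upsilon> \<longrightarrow> norm (\<eta>' - \<eta>\<^sub>0) \<le> \<epsilon>\<^sub>\<Upsilon> \<longrightarrow>
         (\<forall>z\<in>space P. \<forall>h u v.
            \<bar>m \<theta> z\<bar> \<le> C z \<and>
            \<bar>d_theta m \<theta> z h\<bar> \<le> C z * norm h \<and>
            \<bar>score l \<theta>\<^sub>0 \<eta>\<^sub>0 z h\<bar> \<le> C z * norm h \<and>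
            \<bar>score2 l \<theta> \<eta> z h u\<bar> \<le> C z * norm h * norm u \<and>
            \<bar>d_eta_theta l \<theta> \<eta> z h v\<bar> \<le> C z * norm h * norm v \<and>
            \<bar>d_theta m \<theta> z h - d_theta m \<theta>' z h\<bar> \<le> C z * norm (\<theta> - \<theta>') * norm h \<and>
            \<bar>d_eta_theta l \<theta> \<eta> z h v - d_eta_theta l \<theta>' \<eta>' z h v\<bar>
              \<le> C z * (norm (\<theta> - \<theta>') + norm (\<eta> - \<eta>')) * norm h * norm v \<and>
            \<bar>score2 l \<theta> \<eta> z h u - score2 l \<theta>' \<eta>' z h u\<bar>
              \<le> C z * (norm (\<theta> - \<theta>') + norm (\<eta> - \<eta>')) * norm h * norm u)))"


section \<open>Completion, Riesz representer and influence function\<close>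

text \<open>\<open>'b\<close>, with the embedding \<open>\<iota>\<close>, is the completion of \<open>'th\<close> in the norm \<open>nrm\<close> (which differs from
  the norm of the type \<open>'th\<close>).\<close>

definition is_completion ::
  "('th::real_vector \<Rightarrow> real) \<Rightarrow> ('th \<Rightarrow> 'b::banach) \<Rightarrow> bool" where
  "is_completion nrm \<iota> \<longleftrightarrow>
     linear \<iota> \<and> (\<forall>h. norm (\<iota> h) = nrm h) \<and> closure (range \<iota>) = UNIV"

text \<open>The continuous extension of \<open>f\<close> along \<open>\<iota>\<close>: the limit of \<open>f h\<close> as \<open>\<iota> h\<close> tends to \<open>x\<close>.\<close>

definition cont_ext :: "('th \<Rightarrow> 'b::topological_space) \<Rightarrow> ('th \<Rightarrow> real) \<Rightarrow> 'b \<Rightarrow> real" where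
  "cont_ext \<iota> f x = Lim (filtercomap \<iota> (nhds x)) f"

definition riesz_representer ::
  "'z measure \<Rightarrow> ('th::real_normed_vector \<Rightarrow> 'up \<Rightarrow> 'z \<Rightarrow> real) \<Rightarrow> ('th \<Rightarrow> 'z \<Rightarrow> real)
    \<Rightarrow> 'th \<Rightarrow> 'up \<Rightarrow> ('th \<Rightarrow> 'b::banach) \<Rightarrow> 'b \<Rightarrow> bool" where
  "riesz_representer P l m \<theta>\<^sub>0 \<eta>\<^sub>0 \<iota> \<alpha> \<longleftrightarrow>
     (\<forall>h. (\<integral>z. d_theta m \<theta>\<^sub>0 z h \<partial>P) = cont_ext \<iota> (\<lambda>u. hessian P l \<theta>\<^sub>0 \<eta>\<^sub>0 u h) \<alpha>)"

definition influence ::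
  "'z measure \<Rightarrow> ('th::real_normed_vector \<Rightarrow> 'up \<Rightarrow> 'z \<Rightarrow> real) \<Rightarrow> ('th \<Rightarrow> 'z \<Rightarrow> real)
    \<Rightarrow> 'th \<Rightarrow> 'up \<Rightarrow> ('th \<Rightarrow> 'b::banach) \<Rightarrow> 'b \<Rightarrow> 'z \<Rightarrow> real" where
  "influence P l m \<theta>\<^sub>0 \<eta>\<^sub>0 \<iota> \<alpha> z =
     m \<theta>\<^sub>0 z - (\<integral>z'. m \<theta>\<^sub>0 z' \<partial>P) - cont_ext \<iota> (\<lambda>h. score l \<theta>\<^sub>0 \<eta>\<^sub>0 z h) \<alpha>"


section \<open>The weighted one-step estimator\<close>

definition A_hat :: "(nat \<Rightarrow> nat \<Rightarrow> 'w \<Rightarrow> real) \<Rightarrow> (nat \<Rightarrow> nat \<Rightarrow> 'w \<Rightarrow> real) \<Rightarrow> nat \<Rightarrow> 'w \<Rightarrow> real"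
  where "A_hat w \<sigma>h T \<omega> = (\<Sum>t=1..T. inverse (\<sigma>h T t \<omega>) * w T t \<omega>)"

definition Psi_os ::
  "('th::real_normed_vector \<Rightarrow> 'up \<Rightarrow> 'z \<Rightarrow> real) \<Rightarrow> ('th \<Rightarrow> 'z \<Rightarrow> real)
    \<Rightarrow> (nat \<Rightarrow> nat \<Rightarrow> 'w \<Rightarrow> 'z) \<Rightarrow> (nat \<Rightarrow> nat \<Rightarrow> 'w \<Rightarrow> real)
    \<Rightarrow> (nat \<Rightarrow> nat \<Rightarrow> 'w \<Rightarrow> 'th) \<Rightarrow> (nat \<Rightarrow> nat \<Rightarrow> 'w \<Rightarrow> 'up) \<Rightarrow> (nat \<Rightarrow> nat \<Rightarrow> 'w \<Rightarrow> 'th)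
    \<Rightarrow> (nat \<Rightarrow> nat \<Rightarrow> 'w \<Rightarrow> real) \<Rightarrow> nat \<Rightarrow> 'w \<Rightarrow> real" where
  "Psi_os l m Z w \<theta>h \<eta>h \<alpha>h \<sigma>h T \<omega> =
     inverse (A_hat w \<sigma>h T \<omega>) *
     (\<Sum>t=1..T. inverse (\<sigma>h T t \<omega>) * w T t \<omega> *
        (m (\<theta>h T t \<omega>) (Z T t \<omega>) - score l (\<theta>h T t \<omega>) (\<eta>h T t \<omega>) (Z T t \<omega>) (\<alpha>h T t \<omega>)))"

end

theory Submission
  imports Defs
begin

text \<open>
  Write the statistic as \<open>\<Sum>\<^sub>t X\<^sub>t + \<Sum>\<^sub>t Y\<^sub>t + bias\<close>, where \<open>X\<^sub>t\<close> is the weighted influence function at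
  \<open>Z\<^sub>t\<close> and \<open>Y\<^sub>t\<close> the centred contribution of the estimation errors, both divided by \<open>\<surd>T\<close> times the
  estimate of \<open>\<sigma>\<^sub>t\<close>. Importance weighting makes the conditional mean given the past an integral under \<open>Pe\<close>, so that the first-order
  error terms cancel (orthogonality, first-order condition, Riesz representer) and the bias is bounded by
  \<open>T\<^sup>-\<^sup>1\<^sup>/\<^sup>2 \<Sum>\<^sub>t err\<^sub>t\<^sup>2\<close>, which vanishes by Cauchy-Schwarz and the fourth-moment rates. The predictable
  quadratic variation of \<open>Y\<close> is at most a constant times \<open>T\<^sup>1\<^sup>/\<^sup>3 T\<^sup>-\<^sup>1 \<Sum>\<^sub>t err\<^sub>t\<^sup>2\<close> plus a smaller term, so
  \<open>\<Sum>\<^sub>t Y\<^sub>t\<close> vanishes by Lenglart's inequality.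
  The martingale central limit theorem applied to \<open>X\<close> gives the normal limit; it is proved by comparing
  \<open>exp (\<i> r S\<^sub>t + r\<^sup>2 V\<^sub>t / 2)\<close> with a martingale, after freezing the sums once the quadratic
  variation \<open>V\<^sub>t\<close> exceeds \<open>2\<close>.
\<close>

section \<open>Convergence in probability\<close>

text \<open>The obstacle is that hardly anything is bounded or finite outright. The weights obey
  their growth bound only almost surely, with a constant and a starting horizon that depend on the
  sample point, so the weighted influence function need not be square integrable and its conditional
  variance may be infinite at some horizons. Hence conditional second moments, and with them
  \<open>vanishes_in_prob\<close>, take values in \<open>ennreal\<close>; the limit theorem asks for
  first moments only; and exceptional events enter the bounds as summands with value
  \<open>top\<close>. The envelope is available only near the truth, so the perturbation is set to 0
  elsewhere; a vanishing sum of fourth powers then puts all rounds of one horizon near the truth at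
  once, with probability tending to 1. The representer lies in a completion whose elements need not
  be parameters: every statement about it is obtained as a limit along one fixed sequence of
  parameters.\<close>

definition vanishes_in_prob :: "'w measure \<Rightarrow> (nat \<Rightarrow> 'w \<Rightarrow> ennreal) \<Rightarrow> bool" where
  "vanishes_in_prob M Y \<longleftrightarrow>
     (\<forall>\<delta>>0. (\<lambda>n. measure M {\<omega>\<in>space M. ennreal \<delta> < Y n \<omega>}) \<longlonglongrightarrow> 0)"

lemma vanishes_in_probI:
  assumes "\<And>\<delta>. 0 < \<delta> \<Longrightarrow> (\<lambda>n. measure M {\<omega>\<in>space M. ennreal \<delta> < Y n \<omega>}) \<longlonglongrightarrow> 0"
  shows "vanishes_in_prob M Y"
  using assms by (simp add: vanishes_in_prob_def)

lemma vanishes_in_probD: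
  assumes "vanishes_in_prob M Y" "0 < \<delta>"
  shows "(\<lambda>n. measure M {\<omega>\<in>space M. ennreal \<delta> < Y n \<omega>}) \<longlonglongrightarrow> 0"
  using assms by (simp add: vanishes_in_prob_def)

lemma tendsto_zero_squeeze:
  fixes f g :: "nat \<Rightarrow> real"
  assumes "g \<longlonglongrightarrow> 0" "\<And>n. 0 \<le> f n" "eventually (\<lambda>n. f n \<le> g n) sequentially"
  shows "f \<longlonglongrightarrow> 0"
  by (rule tendsto_sandwich[OF _ assms(3) tendsto_const assms(1)]) (simp add: assms(2))

text \<open>The null sequence \<open>g\<close> may depend on \<open>e\<close>. This is the form in
  which truncation arguments end: a bad event of probability at most \<open>e\<close>, or a cut-off
  chosen after \<open>e\<close>.\<close>

lemma tendsto_zero_le_epsilon: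
  fixes f :: "nat \<Rightarrow> real"
  assumes "\<And>n. 0 \<le> f n"
    and "\<And>e. 0 < e \<Longrightarrow> \<exists>g. g \<longlonglongrightarrow> 0 \<and> (\<forall>\<^sub>F n in sequentially. f n \<le> g n + e)"
  shows "f \<longlonglongrightarrow> 0"
proof (rule LIMSEQ_I)
  fix r :: real assume "0 < r"
  then obtain g where g: "g \<longlonglongrightarrow> 0" "\<forall>\<^sub>F n in sequentially. f n \<le> g n + r / 2"
    using assms(2)[of "r / 2"] by auto
  have "\<forall>\<^sub>F n in sequentially. g n < r / 2"
    by (rule order_tendstoD(2)[OF g(1)]) (use \<open>0 < r\<close> in simp)
  with g(2) have "\<forall>\<^sub>F n in sequentially. norm (f n - 0) < r"
    by eventually_elim (use assms(1) in auto)
  then show "\<exists>no. \<forall>n\<ge>no. norm (f n - 0) < r"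
    by (simp add: eventually_sequentially)
qed

context prob_space
begin

lemma vanishes_in_prob_le:
  assumes Y: "vanishes_in_prob M Y" and [measurable]: "\<And>n. Y n \<in> borel_measurable M"
    and le: "\<And>n. AE \<omega> in M. Y' n \<omega> \<le> Y n \<omega>"
  shows "vanishes_in_prob M Y'"
proof (rule vanishes_in_probI)
  fix \<delta> :: real assume "0 < \<delta>"
  show "(\<lambda>n. prob {\<omega>\<in>space M. ennreal \<delta> < Y' n \<omega>}) \<longlonglongrightarrow> 0"
  proof (rule tendsto_zero_squeeze[OF vanishes_in_probD[OF Y \<open>0 < \<delta>\<close>]])
    show "\<forall>\<^sub>F n in sequentially. prob {\<omega>\<in>space M. ennreal \<delta> < Y' n \<omega>}
        \<le> prob {\<omega>\<in>space M. ennreal \<delta> < Y n \<omega>}"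
    proof (rule always_eventually, rule allI, rule finite_measure_mono_AE)
      fix n show "AE \<omega> in M. \<omega> \<in> {\<omega> \<in> space M. ennreal \<delta> < Y' n \<omega>} \<longrightarrow>
          \<omega> \<in> {\<omega> \<in> space M. ennreal \<delta> < Y n \<omega>}"
        using le[of n] by eventually_elim auto
    qed simp
  qed simp
qed

lemma vanishes_in_prob_add:
  assumes Y: "vanishes_in_prob M Y" and Y': "vanishes_in_prob M Y'"
    and [measurable]: "\<And>n. Y n \<in> borel_measurable M" "\<And>n. Y' n \<in> borel_measurable M"
  shows "vanishes_in_prob M (\<lambda>n \<omega>. Y n \<omega> + Y' n \<omega>)"
proof (rule vanishes_in_probI)
  fix \<delta> :: real assume "0 < \<delta>"
  then have d: "0 < \<delta> / 2" by simp
  have *: "ennreal \<delta> = ennreal (\<delta> / 2) + ennreal (\<delta> / 2)"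
    using \<open>0 < \<delta>\<close> by (simp flip: ennreal_plus)
  show "(\<lambda>n. prob {\<omega>\<in>space M. ennreal \<delta> < Y n \<omega> + Y' n \<omega>}) \<longlonglongrightarrow> 0"
  proof (rule tendsto_zero_squeeze)
    show "(\<lambda>n. prob {\<omega>\<in>space M. ennreal (\<delta> / 2) < Y n \<omega>} +
        prob {\<omega>\<in>space M. ennreal (\<delta> / 2) < Y' n \<omega>}) \<longlonglongrightarrow> 0"
      using tendsto_add[OF vanishes_in_probD[OF Y d] vanishes_in_probD[OF Y' d]] by simp
    have "prob {\<omega>\<in>space M. ennreal \<delta> < Y n \<omega> + Y' n \<omega>} \<le>
        prob ({\<omega>\<in>space M. ennreal (\<delta> / 2) < Y n \<omega>} \<union> {\<omega>\<in>space M. ennreal (\<delta> / 2) < Y' n \<omega>})" for n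
      by (rule finite_measure_mono)
        (auto simp: *, metis add_mono leD not_le)
    also have "\<dots> n \<le> prob {\<omega>\<in>space M. ennreal (\<delta> / 2) < Y n \<omega>} +
        prob {\<omega>\<in>space M. ennreal (\<delta> / 2) < Y' n \<omega>}" for n
      by (rule measure_Un_le) auto
    finally show "\<forall>\<^sub>F n in sequentially. prob {\<omega>\<in>space M. ennreal \<delta> < Y n \<omega> + Y' n \<omega>} \<le>
        prob {\<omega>\<in>space M. ennreal (\<delta> / 2) < Y n \<omega>} + prob {\<omega>\<in>space M. ennreal (\<delta> / 2) < Y' n \<omega>}"
      by simp
  qed simp
qed

lemma vanishes_in_prob_sqrt:
  assumes Y: "vanishes_in_prob M (\<lambda>n \<omega>. ennreal ((Y n \<omega>)\<^sup>2))" and nonneg: "\<And>n \<omega>. 0 \<le> Y n \<omega>"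
  shows "vanishes_in_prob M (\<lambda>n \<omega>. ennreal (Y n \<omega>))"
proof (rule vanishes_in_probI)
  fix \<delta> :: real assume "0 < \<delta>"
  have "(ennreal \<delta> < ennreal (Y n \<omega>)) \<longleftrightarrow> (ennreal (\<delta>\<^sup>2) < ennreal ((Y n \<omega>)\<^sup>2))" for n \<omega>
    using \<open>0 < \<delta>\<close> nonneg[of n \<omega>]
    by (auto simp: ennreal_less_iff intro!: power_strict_mono dest: power_less_imp_less_base)
  then show "(\<lambda>n. prob {\<omega>\<in>space M. ennreal \<delta> < ennreal (Y n \<omega>)}) \<longlonglongrightarrow> 0"
    using vanishes_in_probD[OF Y, of "\<delta>\<^sup>2"] \<open>0 < \<delta>\<close> by simp
qed

text \<open>The bounding constant may depend on the sample point, and need not be measurable.\<close>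

lemma vanishes_in_prob_random_bound:
  assumes Y: "vanishes_in_prob M Y"
    and [measurable]: "\<And>n. Y n \<in> borel_measurable M" "\<And>n. Y' n \<in> borel_measurable M"
    and le: "AE \<omega> in M. \<exists>K. \<forall>\<^sub>F n in sequentially. Y' n \<omega> \<le> ennreal K * Y n \<omega>"
  shows "vanishes_in_prob M Y'"
proof (rule vanishes_in_probI)
  fix \<delta> :: real assume \<delta>: "0 < \<delta>"
  \<comment> \<open>One index serves as constant and as starting time at once, so the sets increase
    to a set of full measure. This replaces the pointwise choice of \<open>K\<close> by measurable
    events.\<close>
  define A where "A k = {\<omega>\<in>space M. \<forall>n\<in>{k..}. Y' n \<omega> \<le> ennreal (real k) * Y n \<omega>}" for k :: nat
  have A[measurable]: "A k \<in> sets M" for k unfolding A_def by measurable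
  have "incseq A"
  proof (rule incseq_SucI, unfold A_def, safe)
    fix k \<omega> n assume *: "\<forall>n\<in>{k..}. Y' n \<omega> \<le> ennreal (real k) * Y n \<omega>" "Suc k \<le> n"
    then have "Y' n \<omega> \<le> ennreal (real k) * Y n \<omega>" by simp
    also have "\<dots> \<le> ennreal (real (Suc k)) * Y n \<omega>"
      by (intro mult_right_mono ennreal_leI) auto
    finally show "Y' n \<omega> \<le> ennreal (real (Suc k)) * Y n \<omega>" .
  qed
  then have "(\<lambda>k. prob (A k)) \<longlonglongrightarrow> prob (\<Union>k. A k)"
    by (intro finite_Lim_measure_incseq) auto
  moreover have "prob (\<Union>k. A k) = 1"
  proof (subst prob_eq_1)
    show "AE \<omega> in M. \<omega> \<in> (\<Union>k. A k)" using le AE_space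
    proof eventually_elim
      case (elim \<omega>)
      then obtain K N where K: "\<And>n. n \<ge> N \<Longrightarrow> Y' n \<omega> \<le> ennreal K * Y n \<omega>"
        by (auto simp: eventually_sequentially)
      define k where "k = max N (nat \<lceil>K\<rceil>)"
      have "K \<le> real k" unfolding k_def by linarith
      have "Y' n \<omega> \<le> ennreal (real k) * Y n \<omega>" if "n \<ge> k" for n
      proof -
        have "Y' n \<omega> \<le> ennreal K * Y n \<omega>" using K[of n] that unfolding k_def by simp
        also have "\<dots> \<le> ennreal (real k) * Y n \<omega>"
          using \<open>K \<le> real k\<close> by (intro mult_right_mono ennreal_leI) auto
        finally show ?thesis .
      qed
      then show ?case using elim by (auto simp: A_def)
    qed
  qed auto
  ultimately have lim: "(\<lambda>k. prob (A k)) \<longlonglongrightarrow> 1" by simp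
  show "(\<lambda>n. prob {\<omega>\<in>space M. ennreal \<delta> < Y' n \<omega>}) \<longlonglongrightarrow> 0"
  proof (rule tendsto_zero_le_epsilon)
    fix e :: real assume "0 < e"
    then have "\<forall>\<^sub>F k in sequentially. 1 - e < prob (A k)"
      using order_tendstoD(1)[OF lim, of "1 - e"] by simp
    then obtain k0 where "\<And>k. k \<ge> k0 \<Longrightarrow> 1 - e < prob (A k)"
      by (auto simp: eventually_sequentially)
    \<comment> \<open>The successor makes \<open>k\<close> positive, since \<delta> is divided by
      \<open>k\<close> below.\<close>
    then have "1 - e < prob (A (Suc k0))" by simp
    then obtain k where k: "1 - e < prob (A k)" "0 < k" by blast
    have "prob {\<omega>\<in>space M. ennreal \<delta> < Y' n \<omega>}
        \<le> prob {\<omega>\<in>space M. ennreal (\<delta> / real k) < Y n \<omega>} + e" if "n \<ge> k" for n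
    proof -
      have "{\<omega>\<in>space M. ennreal \<delta> < Y' n \<omega>}
          \<subseteq> {\<omega>\<in>space M. ennreal (\<delta> / real k) < Y n \<omega>} \<union> (space M - A k)"
      proof safe
        fix \<omega> assume \<omega>: "\<omega> \<in> space M" "ennreal \<delta> < Y' n \<omega>" "\<omega> \<in> A k"
        show "ennreal (\<delta> / real k) < Y n \<omega>"
        proof (rule ccontr)
          assume "\<not> ?thesis"
          then have "ennreal (real k) * Y n \<omega> \<le> ennreal (real k) * ennreal (\<delta> / real k)"
            by (intro mult_left_mono) auto
          also have "\<dots> = ennreal \<delta>" using k(2) \<delta> by (simp flip: ennreal_mult)
          finally have "ennreal (real k) * Y n \<omega> \<le> ennreal \<delta>" .
          moreover have "Y' n \<omega> \<le> ennreal (real k) * Y n \<omega>"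
            using \<omega> that by (auto simp: A_def)
          ultimately show False using \<omega>(2) by order
        qed
      qed
      then have "prob {\<omega>\<in>space M. ennreal \<delta> < Y' n \<omega>}
          \<le> prob ({\<omega>\<in>space M. ennreal (\<delta> / real k) < Y n \<omega>} \<union> (space M - A k))"
        by (intro finite_measure_mono) auto
      also have "\<dots> \<le> prob {\<omega>\<in>space M. ennreal (\<delta> / real k) < Y n \<omega>} + prob (space M - A k)"
        by (rule measure_Un_le) auto
      also have "prob (space M - A k) \<le> e" using k by (subst prob_compl) auto
      finally show ?thesis by simp
    qed
    then show "\<exists>g. g \<longlonglongrightarrow> 0 \<and>
        (\<forall>\<^sub>F n in sequentially. prob {\<omega>\<in>space M. ennreal \<delta> < Y' n \<omega>} \<le> g n + e)"
      using vanishes_in_probD[OF Y, of "\<delta> / real k"] \<delta> k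
      by (intro exI[of _ "\<lambda>n. prob {\<omega>\<in>space M. ennreal (\<delta> / real k) < Y n \<omega>}"])
        (auto simp: eventually_sequentially)
  qed simp
qed

text \<open>Below the level \<open>e\<close> the integrand contributes at most \<open>e\<close>,
  above it at most \<open>B\<close> times a vanishing probability.\<close>

lemma vanishes_in_prob_bounded_integral:
  fixes Y :: "nat \<Rightarrow> 'a \<Rightarrow> real"
  assumes Y: "vanishes_in_prob M (\<lambda>n \<omega>. ennreal (Y n \<omega>))"
    and [measurable]: "\<And>n. Y n \<in> borel_measurable M"
    and bound: "\<And>n. AE \<omega> in M. 0 \<le> Y n \<omega> \<and> Y n \<omega> \<le> B"
  shows "(\<lambda>n. \<integral>\<omega>. Y n \<omega> \<partial>M) \<longlonglongrightarrow> 0"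
proof (rule tendsto_zero_le_epsilon)
  show "0 \<le> (\<integral>\<omega>. Y n \<omega> \<partial>M)" for n
    by (intro integral_nonneg_AE) (use bound[of n] in auto)
  fix e :: real assume e: "0 < e"
  have int: "integrable M (Y n)" for n
    by (rule integrable_const_bound[of _ B]) (use bound[of n] in auto)
  let ?A = "\<lambda>n. {\<omega>\<in>space M. ennreal e < ennreal (Y n \<omega>)}"
  have intA: "integrable M (\<lambda>\<omega>. B * indicator (?A n) \<omega>)" for n
    by (intro integrable_mult_right integrable_real_indicator) (auto simp: emeasure_eq_measure)
  have "(\<integral>\<omega>. Y n \<omega> \<partial>M) \<le> (\<integral>\<omega>. B * indicator (?A n) \<omega> + e \<partial>M)" for n
  proof (rule integral_mono_AE[OF int])
    show "AE \<omega> in M. Y n \<omega> \<le> B * indicator (?A n) \<omega> + e"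
      using bound[of n] AE_space
      by eventually_elim (use e in \<open>auto simp: indicator_def ennreal_less_iff\<close>)
    show "integrable M (\<lambda>\<omega>. B * indicator (?A n) \<omega> + e)"
      by (intro Bochner_Integration.integrable_add intA) simp
  qed
  also have "(\<integral>\<omega>. B * indicator (?A n) \<omega> + e \<partial>M) = B * prob (?A n) + e" for n
    by (subst Bochner_Integration.integral_add[OF intA]) (simp_all add: prob_space)
  finally have "(\<integral>\<omega>. Y n \<omega> \<partial>M) \<le> B * prob (?A n) + e" for n .
  moreover have "(\<lambda>n. B * prob (?A n)) \<longlonglongrightarrow> 0"
    using tendsto_mult_left[OF vanishes_in_probD[OF Y e], of B] by simp
  ultimately show "\<exists>g. g \<longlonglongrightarrow> 0 \<and> (\<forall>\<^sub>F n in sequentially. (\<integral>\<omega>. Y n \<omega> \<partial>M) \<le> g n + e)"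
    by (intro exI[of _ "\<lambda>n. B * prob (?A n)"]) (simp add: always_eventually)
qed

lemma little_o_p_imp_vanishes:
  assumes "little_o_p M X (\<lambda>_. 1)"
  shows "vanishes_in_prob M (\<lambda>n \<omega>. ennreal \<bar>X n \<omega>\<bar>)"
  using assms by (auto simp: little_o_p_def vanishes_in_prob_def ennreal_less_iff)

end

lemma norm_integral_le:
  fixes f :: "'w \<Rightarrow> 'b::{banach, second_countable_topology}"
  assumes g: "integrable M g" and le: "AE x in M. norm (f x) \<le> g x"
  shows "norm (\<integral>x. f x \<partial>M) \<le> (\<integral>x. g x \<partial>M)"
proof -
  have "AE x in M. 0 \<le> g x" using le by eventually_elim (rule order_trans[OF norm_ge_zero])
  then show ?thesis
    using integral_mono_AE'[OF g le] integral_norm_bound[of M f] by linarith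
qed

lemma char_integral:
  assumes "X \<in> borel_measurable M"
  shows "char (distr M borel X) t = (\<integral>\<omega>. iexp (t * X \<omega>) \<partial>M)"
  unfolding char_def by (subst integral_distr) (use assms in auto)

lemma norm_iexp_diff_le: "norm (iexp x - iexp y) \<le> \<bar>x - y\<bar>"
proof -
  have "iexp x - iexp y = iexp y * (iexp (x - y) - 1)"
    by (simp add: algebra_simps flip: exp_add)
  then have "norm (iexp x - iexp y) = norm (iexp (x - y) - 1)"
    by (simp add: norm_mult)
  then show ?thesis using iexp_approx1[of "x - y" 0] by simp
qed

text \<open>The two characters differ by at most the mean of \<open>min 2 (|t| |R n|)\<close>.
  Truncation at 2 is free because both exponentials have modulus 1, and it lets convergence in
  probability of \<open>R n\<close> suffice.\<close>

lemma (in prob_space) slutsky_char: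
  assumes [measurable]: "\<And>n. S n \<in> borel_measurable M" "\<And>n. R n \<in> borel_measurable M"
    and R: "vanishes_in_prob M (\<lambda>n \<omega>. ennreal \<bar>R n \<omega>\<bar>)"
    and lim: "(\<lambda>n. char (distr M borel (S n)) t) \<longlonglongrightarrow> c"
  shows "(\<lambda>n. char (distr M borel (\<lambda>\<omega>. S n \<omega> + R n \<omega>)) t) \<longlonglongrightarrow> c"
proof -
  let ?D = "\<lambda>n \<omega>. min 2 (\<bar>t\<bar> * \<bar>R n \<omega>\<bar>)"
  have "vanishes_in_prob M (\<lambda>n \<omega>. ennreal (?D n \<omega>))"
  proof (rule vanishes_in_prob_random_bound[OF R])
    show "AE \<omega> in M. \<exists>K. \<forall>\<^sub>F n in sequentially.
        ennreal (?D n \<omega>) \<le> ennreal K * ennreal \<bar>R n \<omega>\<bar>"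
      by (intro AE_I2 exI[of _ "\<bar>t\<bar>"] always_eventually allI)
        (simp add: ennreal_leI flip: ennreal_mult)
  qed auto
  then have D: "(\<lambda>n. \<integral>\<omega>. ?D n \<omega> \<partial>M) \<longlonglongrightarrow> 0"
    by (rule vanishes_in_prob_bounded_integral[where B = 2]) auto
  have "norm (char (distr M borel (\<lambda>\<omega>. S n \<omega> + R n \<omega>)) t - char (distr M borel (S n)) t)
      \<le> (\<integral>\<omega>. ?D n \<omega> \<partial>M)" for n
  proof -
    have int: "integrable M (\<lambda>\<omega>. iexp (t * (S n \<omega> + R n \<omega>)))" "integrable M (\<lambda>\<omega>. iexp (t * S n \<omega>))"
      by (intro integrable_iexp; simp)+
    have "char (distr M borel (\<lambda>\<omega>. S n \<omega> + R n \<omega>)) t - char (distr M borel (S n)) t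
        = (\<integral>\<omega>. iexp (t * (S n \<omega> + R n \<omega>)) \<partial>M) - (\<integral>\<omega>. iexp (t * S n \<omega>) \<partial>M)"
      by (subst (1 2) char_integral) simp_all
    also have "\<dots> = (\<integral>\<omega>. iexp (t * (S n \<omega> + R n \<omega>)) - iexp (t * S n \<omega>) \<partial>M)"
      by (rule Bochner_Integration.integral_diff[OF int, symmetric])
    also have "norm \<dots> \<le> (\<integral>\<omega>. ?D n \<omega> \<partial>M)"
    proof (rule norm_integral_le, safe intro!: AE_I2)
      show "integrable M (?D n)" by (intro integrable_const_bound[of _ 2]) auto
      fix \<omega>
      have "norm (iexp (t * (S n \<omega> + R n \<omega>)) - iexp (t * S n \<omega>)) \<le> 2"
        by (rule order_trans[OF norm_triangle_ineq4]) simp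
      moreover have "norm (iexp (t * (S n \<omega> + R n \<omega>)) - iexp (t * S n \<omega>)) \<le> \<bar>t\<bar> * \<bar>R n \<omega>\<bar>"
        by (rule order_trans[OF norm_iexp_diff_le]) (simp add: algebra_simps abs_mult)
      ultimately show "norm (iexp (t * (S n \<omega> + R n \<omega>)) - iexp (t * S n \<omega>)) \<le> ?D n \<omega>"
        by simp
    qed
    finally show ?thesis .
  qed
  then have "(\<lambda>n. char (distr M borel (\<lambda>\<omega>. S n \<omega> + R n \<omega>)) t - char (distr M borel (S n)) t) \<longlonglongrightarrow> 0"
    by (intro Lim_null_comparison[OF _ D]) auto
  from tendsto_add[OF this lim] show ?thesis by simp
qed

section \<open>Martingale central limit theorem\<close>

locale martingale_differences = prob_space M for M :: "'w measure" +
  fixes F :: "nat \<Rightarrow> 'w measure" and X :: "nat \<Rightarrow> 'w \<Rightarrow> real" and N :: nat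
  assumes subalg: "\<And>t. t \<le> N \<Longrightarrow> subalgebra M (F t)"
    and filtration: "\<And>s t. s \<le> t \<Longrightarrow> t \<le> N \<Longrightarrow> subalgebra (F t) (F s)"
    and adapted: "\<And>t. t \<in> {1..N} \<Longrightarrow> X t \<in> borel_measurable (F t)"
    and integrable: "\<And>t. t \<in> {1..N} \<Longrightarrow> integrable M (X t)"
    and centred: "\<And>t. t \<in> {1..N} \<Longrightarrow> AE \<omega> in M. real_cond_exp M (F (t - 1)) (X t) \<omega> = 0"
begin

text \<open>\<open>real_cond_exp\<close> would report an infinite conditional second moment as 0. In
  \<open>ennreal\<close> it stays visible, and the cut-off on \<open>qvar\<close> removes
  it.\<close>

definition cvar :: "nat \<Rightarrow> 'w \<Rightarrow> ennreal" where
  "cvar t = nn_cond_exp M (F (t - 1)) (\<lambda>\<omega>. ennreal ((X t \<omega>)\<^sup>2))"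

definition qvar :: "nat \<Rightarrow> 'w \<Rightarrow> ennreal" where
  "qvar t \<omega> = (\<Sum>s=1..t. cvar s \<omega>)"

definition lindeberg :: "real \<Rightarrow> nat \<Rightarrow> 'w \<Rightarrow> ennreal" where
  "lindeberg \<epsilon> t = nn_cond_exp M (F (t - 1))
     (\<lambda>\<omega>. ennreal ((X t \<omega>)\<^sup>2 * (if \<epsilon> < \<bar>X t \<omega>\<bar> then 1 else 0)))"

text \<open>Freezing the sequence once the predictable quadratic variation exceeds \<open>b\<close> makes all second
  moments finite without any integrability assumption on \<open>X\<close>.\<close>

definition stopped :: "real \<Rightarrow> nat \<Rightarrow> 'w \<Rightarrow> real" where
  "stopped b t \<omega> = (if qvar t \<omega> \<le> ennreal b then X t \<omega> else 0)"

text \<open>The conditional second moment of \<open>stopped b t\<close>. It can be real valued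
  because \<open>cvar t\<close> is finite wherever \<open>qvar t\<close> is at most
  \<open>b\<close>.\<close>

definition svar :: "real \<Rightarrow> nat \<Rightarrow> 'w \<Rightarrow> real" where
  "svar b t \<omega> = (if qvar t \<omega> \<le> ennreal b then enn2real (cvar t \<omega>) else 0)"

lemma sigma_finite_F: "t \<le> N \<Longrightarrow> sigma_finite_subalgebra M (F t)"
  by (intro finite_measure_subalgebra_is_sigma_finite finite_measure_subalgebra.intro
      finite_measure_subalgebra_axioms.intro subalg finite_measure_axioms)

lemma measurable_F_mono: "f \<in> measurable (F s) K \<Longrightarrow> s \<le> t \<Longrightarrow> t \<le> N \<Longrightarrow> f \<in> measurable (F t) K"
  using measurable_from_subalg filtration by blast

lemma measurable_F_M: "f \<in> measurable (F t) K \<Longrightarrow> t \<le> N \<Longrightarrow> f \<in> measurable M K"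
  using measurable_from_subalg subalg by blast

lemma X_measurable[measurable]: "t \<in> {1..N} \<Longrightarrow> X t \<in> borel_measurable M"
  using integrable by auto

lemma cvar_measurable: "cvar t \<in> borel_measurable (F (t - 1))"
  unfolding cvar_def by simp

lemma cvar_measurable_M[measurable]: "cvar t \<in> borel_measurable M"
  unfolding cvar_def by simp

text \<open>Predictability: \<open>qvar t\<close> contains the conditional variance of step
  \<open>t\<close> and is nevertheless known at time \<open>t - 1\<close>. The cut-off can therefore
  be moved through conditional expectations given \<open>F (t - 1)\<close>.\<close>

lemma qvar_measurable: "t - 1 \<le> k \<Longrightarrow> k \<le> N \<Longrightarrow> qvar t \<in> borel_measurable (F k)"
  unfolding qvar_def
  by (intro borel_measurable_sum measurable_F_mono[OF cvar_measurable]) auto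

lemma qvar_measurable_M[measurable]: "qvar t \<in> borel_measurable M"
  unfolding qvar_def by simp

lemma qvar_mono: "s \<le> t \<Longrightarrow> qvar s \<omega> \<le> qvar t \<omega>"
  unfolding qvar_def by (intro sum_mono2) auto

lemma cvar_le_qvar: "t \<in> {1..k} \<Longrightarrow> cvar t \<omega> \<le> qvar k \<omega>"
  unfolding qvar_def by (rule member_le_sum) auto

lemma svar_measurable: "t - 1 \<le> k \<Longrightarrow> k \<le> N \<Longrightarrow> svar b t \<in> borel_measurable (F k)"
proof -
  assume k: "t - 1 \<le> k" "k \<le> N"
  note [measurable] = qvar_measurable[OF k] measurable_F_mono[OF cvar_measurable k]
  show ?thesis unfolding svar_def by measurable
qed

lemma svar_measurable_M[measurable]: "svar b t \<in> borel_measurable M"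
  unfolding svar_def by measurable

lemma stopped_measurable: "t \<in> {1..k} \<Longrightarrow> k \<le> N \<Longrightarrow> stopped b t \<in> borel_measurable (F k)"
proof -
  assume k: "t \<in> {1..k}" "k \<le> N"
  have [measurable]: "qvar t \<in> borel_measurable (F k)" "X t \<in> borel_measurable (F k)"
    using k by (auto intro!: qvar_measurable measurable_F_mono[OF adapted])
  show ?thesis unfolding stopped_def by measurable
qed

lemma stopped_measurable_M[measurable]: "t \<in> {1..N} \<Longrightarrow> stopped b t \<in> borel_measurable M"
  unfolding stopped_def by measurable

lemma svar_nonneg[simp]: "0 \<le> svar b t \<omega>"
  by (simp add: svar_def)

lemma ennreal_svar: "t \<ge> 1 \<Longrightarrow> ennreal (svar b t \<omega>) = (if qvar t \<omega> \<le> ennreal b then cvar t \<omega> else 0)"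
proof -
  assume "t \<ge> 1"
  have "cvar t \<omega> < top" if "qvar t \<omega> \<le> ennreal b"
    using cvar_le_qvar[of t t \<omega>] that \<open>t \<ge> 1\<close> ennreal_less_top[of b] by (simp add: order_le_less_trans)
  then show ?thesis by (simp add: svar_def)
qed

lemma sum_svar_le: "0 \<le> b \<Longrightarrow> (\<Sum>t=1..k. svar b t \<omega>) \<le> b"
proof (induction k)
  case (Suc k)
  show ?case
  proof (cases "qvar (Suc k) \<omega> \<le> ennreal b")
    case True
    have "ennreal (\<Sum>t=1..Suc k. svar b t \<omega>) = (\<Sum>t=1..Suc k. ennreal (svar b t \<omega>))"
      by (rule sum_ennreal[symmetric]) simp
    also have "\<dots> = qvar (Suc k) \<omega>"
      unfolding qvar_def
    proof (rule sum.cong[OF refl])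
      fix t assume t: "t \<in> {1..Suc k}"
      then have "qvar t \<omega> \<le> ennreal b" using order_trans[OF qvar_mono[of t "Suc k" \<omega>] True] by simp
      then show "ennreal (svar b t \<omega>) = cvar t \<omega>" using t by (simp add: ennreal_svar)
    qed
    finally have "ennreal (\<Sum>t=1..Suc k. svar b t \<omega>) \<le> ennreal b" using True by simp
    then show ?thesis using Suc.prems by (subst (asm) ennreal_le_iff)
  next
    case False
    then have "svar b (Suc k) \<omega> = 0" by (simp add: svar_def)
    then show ?thesis using Suc by simp
  qed
qed simp

lemma svar_le: "0 \<le> b \<Longrightarrow> 1 \<le> t \<Longrightarrow> svar b t \<omega> \<le> b"
  using sum_svar_le[of b \<omega> t] member_le_sum[of t "{1..t}" "\<lambda>t. svar b t \<omega>"] by simp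

text \<open>The cut-off is past-measurable and is absorbed into the test function \<open>h\<close>.
  Working in \<open>ennreal\<close> avoids any integrability condition at this stage.\<close>

lemma nn_integral_stopped_sq:
  assumes t: "t \<in> {1..N}" and h: "h \<in> borel_measurable (F (t - 1))"
  shows "(\<integral>\<^sup>+\<omega>. h \<omega> * ennreal ((stopped b t \<omega>)\<^sup>2) \<partial>M) = (\<integral>\<^sup>+\<omega>. h \<omega> * ennreal (svar b t \<omega>) \<partial>M)"
proof -
  interpret sigma_finite_subalgebra M "F (t - 1)" using t by (intro sigma_finite_F) auto
  note [measurable] = t h
  have [measurable]: "qvar t \<in> borel_measurable (F (t - 1))" using t by (intro qvar_measurable) auto
  let ?I = "\<lambda>\<omega>. h \<omega> * (if qvar t \<omega> \<le> ennreal b then 1 else 0)"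
  have "(\<integral>\<^sup>+\<omega>. h \<omega> * ennreal ((stopped b t \<omega>)\<^sup>2) \<partial>M) = (\<integral>\<^sup>+\<omega>. ?I \<omega> * ennreal ((X t \<omega>)\<^sup>2) \<partial>M)"
    by (intro nn_integral_cong) (auto simp: stopped_def)
  also have "\<dots> = (\<integral>\<^sup>+\<omega>. ?I \<omega> * cvar t \<omega> \<partial>M)"
    unfolding cvar_def by (rule nn_cond_exp_intg[symmetric]) measurable
  also have "\<dots> = (\<integral>\<^sup>+\<omega>. h \<omega> * ennreal (svar b t \<omega>) \<partial>M)"
    using t by (intro nn_integral_cong) (auto simp: ennreal_svar)
  finally show ?thesis .
qed

lemma integrable_svar: "0 \<le> b \<Longrightarrow> t \<in> {1..N} \<Longrightarrow> integrable M (svar b t)"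
  by (rule integrable_const_bound[of _ b]) (auto simp: svar_le)

lemma integrable_stopped_sq:
  assumes "0 \<le> b" "t \<in> {1..N}"
  shows "integrable M (\<lambda>\<omega>. (stopped b t \<omega>)\<^sup>2)"
    and "(\<integral>\<omega>. (stopped b t \<omega>)\<^sup>2 \<partial>M) = (\<integral>\<omega>. svar b t \<omega> \<partial>M)"
proof -
  have *: "(\<integral>\<^sup>+\<omega>. ennreal ((stopped b t \<omega>)\<^sup>2) \<partial>M) = (\<integral>\<^sup>+\<omega>. ennreal (svar b t \<omega>) \<partial>M)"
    using nn_integral_stopped_sq[OF assms(2), of "\<lambda>_. 1" b] by simp
  also have "\<dots> = ennreal (\<integral>\<omega>. svar b t \<omega> \<partial>M)"
    by (rule nn_integral_eq_integral[OF integrable_svar[OF assms]]) simp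
  finally have **: "(\<integral>\<^sup>+\<omega>. ennreal ((stopped b t \<omega>)\<^sup>2) \<partial>M) = ennreal (\<integral>\<omega>. svar b t \<omega> \<partial>M)" .
  show "integrable M (\<lambda>\<omega>. (stopped b t \<omega>)\<^sup>2)"
    by (rule integrableI_nonneg) (use assms in \<open>auto simp: **\<close>)
  show "(\<integral>\<omega>. (stopped b t \<omega>)\<^sup>2 \<partial>M) = (\<integral>\<omega>. svar b t \<omega> \<partial>M)"
    by (subst integral_eq_nn_integral) (use assms in \<open>auto simp: ** integral_nonneg_AE\<close>)
qed

lemma integrable_stopped:
  assumes "t \<in> {1..N}" shows "integrable M (stopped b t)"
  by (rule Bochner_Integration.integrable_bound[OF integrable[OF assms]])
    (use assms in \<open>auto simp: stopped_def\<close>)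

lemma integral_mult_stopped:
  assumes t: "t \<in> {1..N}" and H: "H \<in> borel_measurable (F (t - 1))"
    and int: "integrable M (\<lambda>\<omega>. H \<omega> * stopped b t \<omega>)"
  shows "(\<integral>\<omega>. H \<omega> * stopped b t \<omega> \<partial>M) = 0"
proof -
  interpret sigma_finite_subalgebra M "F (t - 1)" using t by (intro sigma_finite_F) auto
  note [measurable] = t H
  have [measurable]: "qvar t \<in> borel_measurable (F (t - 1))" using t by (intro qvar_measurable) auto
  let ?H = "\<lambda>\<omega>. H \<omega> * (if qvar t \<omega> \<le> ennreal b then 1 else 0)"
  have eq: "(\<lambda>\<omega>. H \<omega> * stopped b t \<omega>) = (\<lambda>\<omega>. ?H \<omega> * X t \<omega>)"
    by (auto simp: stopped_def)
  have "(\<integral>\<omega>. ?H \<omega> * X t \<omega> \<partial>M) = (\<integral>\<omega>. ?H \<omega> * real_cond_exp M (F (t - 1)) (X t) \<omega> \<partial>M)"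
    using int unfolding eq by (intro real_cond_exp_intg(2)[symmetric]) measurable
  also have "\<dots> = (\<integral>\<omega>. 0 \<partial>M)"
  proof (rule integral_cong_AE)
    have [measurable]: "H \<in> borel_measurable M" using measurable_F_M[OF H] t by auto
    show "(\<lambda>\<omega>. ?H \<omega> * real_cond_exp M (F (t - 1)) (X t) \<omega>) \<in> borel_measurable M" by measurable
  qed (use centred[OF t] in auto)
  finally show ?thesis unfolding eq by simp
qed

text \<open>Testing on past events identifies \<open>svar\<close> as the conditional expectation of
  the squared increment; this admits past-measurable multipliers of either sign.\<close>

lemma integral_mult_stopped_sq:
  assumes b: "0 \<le> b" and t: "t \<in> {1..N}" and H: "H \<in> borel_measurable (F (t - 1))"
    and int: "integrable M (\<lambda>\<omega>. H \<omega> * (stopped b t \<omega>)\<^sup>2)"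
  shows "(\<integral>\<omega>. H \<omega> * (stopped b t \<omega>)\<^sup>2 \<partial>M) = (\<integral>\<omega>. H \<omega> * svar b t \<omega> \<partial>M)"
proof -
  interpret sigma_finite_subalgebra M "F (t - 1)" using t by (intro sigma_finite_F) auto
  note [measurable] = t H
  have [measurable]: "H \<in> borel_measurable M" using measurable_F_M[OF H] t by auto
  have "AE \<omega> in M. ennreal (svar b t \<omega>)
      = nn_cond_exp M (F (t - 1)) (\<lambda>\<omega>. ennreal ((stopped b t \<omega>)\<^sup>2)) \<omega>"
  proof (rule nn_cond_exp_charact)
    fix A assume "A \<in> sets (F (t - 1))"
    then show "(\<integral>\<^sup>+\<omega>\<in>A. ennreal ((stopped b t \<omega>)\<^sup>2) \<partial>M) = (\<integral>\<^sup>+\<omega>\<in>A. ennreal (svar b t \<omega>) \<partial>M)"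
      using nn_integral_stopped_sq[OF t, of "indicator A" b] by (simp add: mult.commute)
  next
    have [measurable]: "svar b t \<in> borel_measurable (F (t - 1))"
      using t by (intro svar_measurable) auto
    show "(\<lambda>\<omega>. ennreal (svar b t \<omega>)) \<in> borel_measurable (F (t - 1))" by measurable
  qed measurable
  moreover have "AE \<omega> in M. nn_cond_exp M (F (t - 1)) (\<lambda>\<omega>. ennreal (- (stopped b t \<omega>)\<^sup>2)) \<omega> = 0"
    using nn_cond_exp_F_meas[of "\<lambda>_. 0"] by (auto simp: ennreal_neg)
  ultimately have ae: "AE \<omega> in M. real_cond_exp M (F (t - 1)) (\<lambda>\<omega>. (stopped b t \<omega>)\<^sup>2) \<omega> = svar b t \<omega>"
    unfolding real_cond_exp_def by eventually_elim (metis diff_zero enn2real_0 enn2real_ennreal svar_nonneg)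
  have "(\<integral>\<omega>. H \<omega> * (stopped b t \<omega>)\<^sup>2 \<partial>M)
      = (\<integral>\<omega>. H \<omega> * real_cond_exp M (F (t - 1)) (\<lambda>\<omega>. (stopped b t \<omega>)\<^sup>2) \<omega> \<partial>M)"
    by (intro real_cond_exp_intg(2)[symmetric] int) measurable
  also have "\<dots> = (\<integral>\<omega>. H \<omega> * svar b t \<omega> \<partial>M)"
  proof (rule integral_cong_AE)
    show "AE \<omega> in M. H \<omega> * real_cond_exp M (F (t - 1)) (\<lambda>\<omega>. (stopped b t \<omega>)\<^sup>2) \<omega> = H \<omega> * svar b t \<omega>"
      using ae by eventually_elim simp
  qed measurable
  finally show ?thesis .
qed

lemma stopped_eq_X: "qvar N \<omega> \<le> ennreal b \<Longrightarrow> t \<in> {1..N} \<Longrightarrow> stopped b t \<omega> = X t \<omega>"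
  using qvar_mono[of t N \<omega>] by (auto simp: stopped_def)

text \<open>Orthogonality of increments: when one step is added, the cross term integrates to 0
  because the earlier sum is known one step before.\<close>

lemma second_moment_sum_stopped:
  assumes b: "0 \<le> b" and k: "k \<le> N"
  shows "integrable M (\<lambda>\<omega>. (\<Sum>t=1..k. stopped b t \<omega>)\<^sup>2)"
    and "(\<integral>\<omega>. (\<Sum>t=1..k. stopped b t \<omega>)\<^sup>2 \<partial>M) = (\<integral>\<omega>. (\<Sum>t=1..k. svar b t \<omega>) \<partial>M)"
proof -
  have "integrable M (\<lambda>\<omega>. (\<Sum>t=1..k. stopped b t \<omega>)\<^sup>2) \<and>
    (\<integral>\<omega>. (\<Sum>t=1..k. stopped b t \<omega>)\<^sup>2 \<partial>M) = (\<integral>\<omega>. (\<Sum>t=1..k. svar b t \<omega>) \<partial>M)"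
    using k
  proof (induction k)
    case (Suc k)
    let ?S = "\<lambda>\<omega>. \<Sum>t=1..k. stopped b t \<omega>" and ?x = "stopped b (Suc k)"
    have IH: "integrable M (\<lambda>\<omega>. (?S \<omega>)\<^sup>2)" "(\<integral>\<omega>. (?S \<omega>)\<^sup>2 \<partial>M) = (\<integral>\<omega>. (\<Sum>t=1..k. svar b t \<omega>) \<partial>M)"
      using Suc by auto
    have t: "Suc k \<in> {1..N}" using Suc.prems by simp
    have S: "?S \<in> borel_measurable (F k)"
      using Suc.prems by (intro borel_measurable_sum stopped_measurable) auto
    have [measurable]: "?S \<in> borel_measurable M" using measurable_F_M[OF S] Suc.prems by simp
    note [measurable] = stopped_measurable_M[OF t]
    note x2 = integrable_stopped_sq[OF b t]
    have cross: "integrable M (\<lambda>\<omega>. ?S \<omega> * ?x \<omega>)"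
    proof (rule Bochner_Integration.integrable_bound)
      show "integrable M (\<lambda>\<omega>. (?S \<omega>)\<^sup>2 + (?x \<omega>)\<^sup>2)" using IH x2 by simp
      have "\<bar>u * v\<bar> \<le> u\<^sup>2 + v\<^sup>2" for u v :: real
      proof -
        have "2 * (\<bar>u\<bar> * \<bar>v\<bar>) \<le> u\<^sup>2 + v\<^sup>2"
          using zero_le_power2[of "\<bar>u\<bar> - \<bar>v\<bar>"] by (simp add: power2_diff)
        moreover have "0 \<le> \<bar>u\<bar> * \<bar>v\<bar>" by simp
        ultimately show ?thesis unfolding abs_mult by linarith
      qed
      then show "AE \<omega> in M. norm (?S \<omega> * ?x \<omega>) \<le> norm ((?S \<omega>)\<^sup>2 + (?x \<omega>)\<^sup>2)"
        by auto
    qed measurable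
    then have cross0: "(\<integral>\<omega>. ?S \<omega> * ?x \<omega> \<partial>M) = 0"
      using S by (intro integral_mult_stopped[OF t]) auto
    have eq: "(\<lambda>\<omega>. (\<Sum>t=1..Suc k. stopped b t \<omega>)\<^sup>2) = (\<lambda>\<omega>. (?S \<omega>)\<^sup>2 + (2 * (?S \<omega> * ?x \<omega>) + (?x \<omega>)\<^sup>2))"
      by (auto simp: power2_sum)
    have "(\<integral>\<omega>. (\<Sum>t=1..Suc k. svar b t \<omega>) \<partial>M) = (\<integral>\<omega>. (\<Sum>t=1..k. svar b t \<omega>) \<partial>M) + (\<integral>\<omega>. svar b (Suc k) \<omega> \<partial>M)"
      using Suc.prems b by (subst Bochner_Integration.integral_add[symmetric]) (auto intro!: integrable_svar)
    then show ?case unfolding eq using IH x2 cross cross0 by simp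
  qed simp
  then show "integrable M (\<lambda>\<omega>. (\<Sum>t=1..k. stopped b t \<omega>)\<^sup>2)"
    "(\<integral>\<omega>. (\<Sum>t=1..k. stopped b t \<omega>)\<^sup>2 \<partial>M) = (\<integral>\<omega>. (\<Sum>t=1..k. svar b t \<omega>) \<partial>M)" by auto
qed

text \<open>Where \<open>qvar N\<close> is at most \<open>b\<close>, the stopped sum equals the
  original one. Chebyshev for the stopped sum costs at most \<open>b / \<epsilon>\<^sup>2\<close>,
  its second moment being the mean of a sum bounded by \<open>b\<close>.\<close>

lemma lenglart:
  assumes b: "0 \<le> b" and \<epsilon>: "0 < \<epsilon>"
  shows "prob {\<omega>\<in>space M. \<epsilon> < \<bar>\<Sum>t=1..N. X t \<omega>\<bar>} \<le> prob {\<omega>\<in>space M. ennreal b < qvar N \<omega>} + b / \<epsilon>\<^sup>2"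
proof -
  let ?S = "\<lambda>\<omega>. \<Sum>t=1..N. stopped b t \<omega>"
  have [measurable]: "?S \<in> borel_measurable M" by measurable
  have "{\<omega>\<in>space M. \<epsilon> < \<bar>\<Sum>t=1..N. X t \<omega>\<bar>}
      \<subseteq> {\<omega>\<in>space M. ennreal b < qvar N \<omega>} \<union> {\<omega>\<in>space M. \<epsilon>\<^sup>2 \<le> (?S \<omega>)\<^sup>2}"
  proof (intro subsetI UnCI)
    fix \<omega> assume "\<omega> \<in> {\<omega>\<in>space M. \<epsilon> < \<bar>\<Sum>t=1..N. X t \<omega>\<bar>}"
      and "\<omega> \<notin> {\<omega>\<in>space M. \<epsilon>\<^sup>2 \<le> (?S \<omega>)\<^sup>2}"
    then have *: "\<omega> \<in> space M" "\<epsilon> < \<bar>\<Sum>t=1..N. X t \<omega>\<bar>" "(?S \<omega>)\<^sup>2 < \<epsilon>\<^sup>2" by auto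
    have "\<not> qvar N \<omega> \<le> ennreal b"
    proof
      assume "qvar N \<omega> \<le> ennreal b"
      then have "?S \<omega> = (\<Sum>t=1..N. X t \<omega>)"
      by (intro sum.cong refl stopped_eq_X) auto
      then have "\<bar>\<epsilon>\<bar> \<le> \<bar>?S \<omega>\<bar>" using * \<epsilon> by simp
      then show False using * by (simp add: abs_le_square_iff)
    qed
    then show "\<omega> \<in> {\<omega>\<in>space M. ennreal b < qvar N \<omega>}" using * by auto
  qed
  then have "prob {\<omega>\<in>space M. \<epsilon> < \<bar>\<Sum>t=1..N. X t \<omega>\<bar>}
      \<le> prob ({\<omega>\<in>space M. ennreal b < qvar N \<omega>} \<union> {\<omega>\<in>space M. \<epsilon>\<^sup>2 \<le> (?S \<omega>)\<^sup>2})"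
    by (intro finite_measure_mono) auto
  also have "\<dots> \<le> prob {\<omega>\<in>space M. ennreal b < qvar N \<omega>} + prob {\<omega>\<in>space M. \<epsilon>\<^sup>2 \<le> (?S \<omega>)\<^sup>2}"
    by (rule measure_Un_le) auto
  also have "prob {\<omega>\<in>space M. \<epsilon>\<^sup>2 \<le> (?S \<omega>)\<^sup>2} \<le> (\<integral>\<omega>. (?S \<omega>)\<^sup>2 \<partial>M) / \<epsilon>\<^sup>2"
    using second_moment_sum_stopped(1)[OF b order_refl] \<epsilon>
    by (intro integral_Markov_inequality_measure[where A = "{}"]) auto
  also have "(\<integral>\<omega>. (?S \<omega>)\<^sup>2 \<partial>M) \<le> (\<integral>\<omega>. b \<partial>M)"
    unfolding second_moment_sum_stopped(2)[OF b order_refl]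
    using b by (intro integral_mono sum_svar_le Bochner_Integration.integrable_sum integrable_svar) auto
  finally show ?thesis using \<epsilon> by (simp add: prob_space divide_right_mono)
qed

end

text \<open>The quadratic Taylor remainder is at most |r x|^2 and also at most |r x|^3 / 6. The
  first bound is used for large \<open>x\<close> and produces the Lindeberg term; the second is used
  for small \<open>x\<close>, where one factor |x| is traded for \<epsilon>.\<close>

lemma iexp_quadratic_approx:
  assumes "0 < \<epsilon>"
  shows "norm (iexp (r * x) - (1 + \<i> * of_real (r * x) - of_real ((r * x)\<^sup>2 / 2)))
    \<le> r\<^sup>2 * (x\<^sup>2 * (if \<epsilon> < \<bar>x\<bar> then 1 else 0)) + \<bar>r\<bar> ^ 3 * \<epsilon> / 6 * x\<^sup>2"
proof -
  have sum: "(\<Sum>k\<le>2. (\<i> * of_real (r * x)) ^ k / fact k) = 1 + \<i> * of_real (r * x) - of_real ((r * x)\<^sup>2 / 2)"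
    by (simp add: numeral_2_eq_2 complex_eq_iff)
  show ?thesis
  proof (cases "\<epsilon> < \<bar>x\<bar>")
    case True
    have "norm (iexp (r * x) - (1 + \<i> * of_real (r * x) - of_real ((r * x)\<^sup>2 / 2))) \<le> 2 * \<bar>r * x\<bar>\<^sup>2 / fact 2"
      using iexp_approx2[of "r * x" 2] unfolding sum .
    also have "\<dots> = r\<^sup>2 * x\<^sup>2" by (simp add: power_mult_distrib)
    finally show ?thesis using True assms
      by (simp add: add_increasing2)
  next
    case False
    have "norm (iexp (r * x) - (1 + \<i> * of_real (r * x) - of_real ((r * x)\<^sup>2 / 2))) \<le> \<bar>r * x\<bar> ^ Suc 2 / fact (Suc 2)"
      using iexp_approx1[of "r * x" 2] unfolding sum .
    also have "\<dots> = \<bar>r\<bar> ^ 3 / 6 * \<bar>x\<bar> ^ 3"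
      by (simp add: abs_mult power_mult_distrib fact_numeral)
    also have "\<dots> = \<bar>r\<bar> ^ 3 / 6 * (\<bar>x\<bar> * x\<^sup>2)"
      by (simp add: power3_eq_cube power2_eq_square mult.assoc)
    also have "\<dots> \<le> \<bar>r\<bar> ^ 3 / 6 * (\<epsilon> * x\<^sup>2)"
      using False by (intro mult_left_mono mult_right_mono) auto
    finally show ?thesis using False by simp
  qed
qed

text \<open>For the upper bound, (1 + y + y^2/2)(1 - y + y^2/2) = 1 + (y^2/2)^2 is at least 1, and
  the first factor is at most exp y.\<close>

lemma exp_minus_quadratic_approx:
  fixes y :: real
  assumes "0 \<le> y"
  shows "\<bar>exp (- y) - (1 - y)\<bar> \<le> y\<^sup>2 / 2"
proof -
  have "1 - y \<le> exp (- y)" using exp_ge_add_one_self[of "- y"] by simp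
  moreover have "exp (- y) \<le> 1 - y + y\<^sup>2 / 2"
  proof -
    have "0 \<le> 1 - y + y\<^sup>2 / 2"
      using zero_le_power2[of "y - 1"] by (simp add: power2_diff)
    then have "(1 + y + y\<^sup>2 / 2) * (1 - y + y\<^sup>2 / 2) \<le> exp y * (1 - y + y\<^sup>2 / 2)"
      using exp_lower_Taylor_quadratic[OF assms] by (intro mult_right_mono) auto
    moreover have "(1 + y + y\<^sup>2 / 2) * (1 - y + y\<^sup>2 / 2) = 1 + (y\<^sup>2 / 2)\<^sup>2"
      by (simp add: field_simps power2_eq_square)
    moreover have "0 \<le> (y\<^sup>2 / 2)\<^sup>2" by simp
    ultimately have "1 \<le> exp y * (1 - y + y\<^sup>2 / 2)" by linarith
    then show ?thesis by (simp add: exp_minus field_simps)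
  qed
  ultimately show ?thesis by simp
qed

lemma integral_complex_eq_0:
  assumes "integrable M f" "(\<integral>x. Re (f x) \<partial>M) = 0" "(\<integral>x. Im (f x) \<partial>M) = 0"
  shows "(\<integral>x. f x \<partial>M) = 0"
  using assms by (simp add: complex_eq_iff)

section \<open>The compensated characteristic function of the stopped sum\<close>

context martingale_differences
begin

lemma integral_cmult_stopped:
  fixes W :: "'w \<Rightarrow> complex"
  assumes t: "t \<in> {1..N}" and W: "W \<in> borel_measurable (F (t - 1))" "\<And>\<omega>. norm (W \<omega>) \<le> B"
  shows "integrable M (\<lambda>\<omega>. W \<omega> * of_real (stopped b t \<omega>))"
    and "(\<integral>\<omega>. W \<omega> * of_real (stopped b t \<omega>) \<partial>M) = 0"
proof -
  have [measurable]: "W \<in> borel_measurable M" using measurable_F_M[OF W(1)] t by auto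
  note [measurable] = stopped_measurable_M[OF t]
  show int: "integrable M (\<lambda>\<omega>. W \<omega> * of_real (stopped b t \<omega>))"
  proof (rule Bochner_Integration.integrable_bound)
    show "integrable M (\<lambda>\<omega>. B * stopped b t \<omega>)" using integrable_stopped[OF t] by simp
    show "AE \<omega> in M. norm (W \<omega> * of_real (stopped b t \<omega>)) \<le> norm (B * stopped b t \<omega>)"
      using W(2) by (intro AE_I2) (auto simp: norm_mult abs_mult intro!: mult_right_mono order_trans[OF W(2)])
  qed measurable
  show "(\<integral>\<omega>. W \<omega> * of_real (stopped b t \<omega>) \<partial>M) = 0"
  proof (rule integral_complex_eq_0[OF int])
    have Re_W: "(\<lambda>\<omega>. Re (W \<omega>)) \<in> borel_measurable (F (t - 1))"
      and Im_W: "(\<lambda>\<omega>. Im (W \<omega>)) \<in> borel_measurable (F (t - 1))" using W(1) by measurable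
    show "(\<integral>\<omega>. Re (W \<omega> * of_real (stopped b t \<omega>)) \<partial>M) = 0"
      using integral_mult_stopped[OF t Re_W, of b] integrable_Re[OF int] by simp
    show "(\<integral>\<omega>. Im (W \<omega> * of_real (stopped b t \<omega>)) \<partial>M) = 0"
      using integral_mult_stopped[OF t Im_W, of b] integrable_Im[OF int] by simp
  qed
qed

lemma integral_cmult_stopped_sq:
  fixes W :: "'w \<Rightarrow> complex"
  assumes b: "0 \<le> b" and t: "t \<in> {1..N}"
    and W: "W \<in> borel_measurable (F (t - 1))" "\<And>\<omega>. norm (W \<omega>) \<le> B"
  shows "integrable M (\<lambda>\<omega>. W \<omega> * of_real ((stopped b t \<omega>)\<^sup>2 - svar b t \<omega>))"
    and "(\<integral>\<omega>. W \<omega> * of_real ((stopped b t \<omega>)\<^sup>2 - svar b t \<omega>) \<partial>M) = 0"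
proof -
  have [measurable]: "W \<in> borel_measurable M" using measurable_F_M[OF W(1)] t by auto
  note [measurable] = stopped_measurable_M[OF t]
  note x2 = integrable_stopped_sq(1)[OF b t] and u = integrable_svar[OF b t]
  have bound: "integrable M (\<lambda>\<omega>. V \<omega> * y \<omega>)"
    if "integrable M y" "V \<in> borel_measurable M" "\<And>\<omega>. norm (V \<omega>) \<le> B"
    for y :: "'w \<Rightarrow> 'x::{real_normed_field,banach,second_countable_topology}" and V
  proof (rule Bochner_Integration.integrable_bound)
    show "integrable M (\<lambda>\<omega>. of_real B * y \<omega>)" using that by simp
    show "AE \<omega> in M. norm (V \<omega> * y \<omega>) \<le> norm (of_real B * y \<omega>)"
      using that by (intro AE_I2) (auto simp: norm_mult intro!: mult_right_mono order_trans[OF that(3)])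
    show "(\<lambda>\<omega>. V \<omega> * y \<omega>) \<in> borel_measurable M" using that by auto
  qed
  show int: "integrable M (\<lambda>\<omega>. W \<omega> * of_real ((stopped b t \<omega>)\<^sup>2 - svar b t \<omega>))"
    using x2 u by (intro bound W integrable_of_real) auto
  have zero: "(\<integral>\<omega>. H \<omega> * ((stopped b t \<omega>)\<^sup>2 - svar b t \<omega>) \<partial>M) = 0"
    if H: "H \<in> borel_measurable (F (t - 1))" "\<And>\<omega>. norm (H \<omega>) \<le> B" for H :: "'w \<Rightarrow> real"
  proof -
    have [measurable]: "H \<in> borel_measurable M" using measurable_F_M[OF H(1)] t by auto
    have i1: "integrable M (\<lambda>\<omega>. H \<omega> * (stopped b t \<omega>)\<^sup>2)" by (intro bound H x2) auto
    have i2: "integrable M (\<lambda>\<omega>. H \<omega> * svar b t \<omega>)" by (intro bound H u) auto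
    show ?thesis
      using integral_mult_stopped_sq[OF b t H(1) i1] i1 i2 by (simp add: right_diff_distrib)
  qed
  show "(\<integral>\<omega>. W \<omega> * of_real ((stopped b t \<omega>)\<^sup>2 - svar b t \<omega>) \<partial>M) = 0"
  proof (rule integral_complex_eq_0[OF int])
    have Re_W: "(\<lambda>\<omega>. Re (W \<omega>)) \<in> borel_measurable (F (t - 1))"
      and Im_W: "(\<lambda>\<omega>. Im (W \<omega>)) \<in> borel_measurable (F (t - 1))" using W(1) by measurable
    show "(\<integral>\<omega>. Re (W \<omega> * of_real ((stopped b t \<omega>)\<^sup>2 - svar b t \<omega>)) \<partial>M) = 0"
      using zero[OF Re_W] order_trans[OF abs_Re_le_cmod W(2)] by simp
    show "(\<integral>\<omega>. Im (W \<omega> * of_real ((stopped b t \<omega>)\<^sup>2 - svar b t \<omega>)) \<partial>M) = 0"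
      using zero[OF Im_W] order_trans[OF abs_Im_le_cmod W(2)] by simp
  qed
qed

definition tail :: "real \<Rightarrow> real \<Rightarrow> nat \<Rightarrow> 'w \<Rightarrow> real" where
  "tail b \<epsilon> t \<omega> = (stopped b t \<omega>)\<^sup>2 * (if \<epsilon> < \<bar>stopped b t \<omega>\<bar> then 1 else 0)"

text \<open>The compensated characteristic function \<open>exp (\<i> r S + r\<^sup>2 V / 2)\<close> of the stopped sequence is
  almost a martingale.\<close>

definition cchar :: "real \<Rightarrow> real \<Rightarrow> nat \<Rightarrow> 'w \<Rightarrow> complex" where
  "cchar b r k \<omega> = iexp (r * (\<Sum>t=1..k. stopped b t \<omega>)) * of_real (exp (r\<^sup>2 / 2 * (\<Sum>t=1..k. svar b t \<omega>)))"

lemma tail_measurable[measurable]: "t \<in> {1..N} \<Longrightarrow> tail b \<epsilon> t \<in> borel_measurable M"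
  unfolding tail_def by measurable

lemma tail_nonneg[simp]: "0 \<le> tail b \<epsilon> t \<omega>" by (simp add: tail_def)

lemma integrable_tail: "0 \<le> b \<Longrightarrow> t \<in> {1..N} \<Longrightarrow> integrable M (tail b \<epsilon> t)"
  by (rule Bochner_Integration.integrable_bound[OF integrable_stopped_sq(1)]) (auto simp: tail_def)

lemma cchar_measurable: "k \<le> N \<Longrightarrow> cchar b r k \<in> borel_measurable M"
proof -
  assume "k \<le> N"
  then have [measurable]: "\<And>t. t \<in> {1..k} \<Longrightarrow> stopped b t \<in> borel_measurable M" by auto
  show ?thesis unfolding cchar_def by measurable
qed

lemma norm_cchar_le: "0 \<le> b \<Longrightarrow> norm (cchar b r k \<omega>) \<le> exp (r\<^sup>2 / 2 * b)"
  unfolding cchar_def norm_mult norm_exp_i_times norm_of_real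
  using mult_left_mono[OF sum_svar_le[of b \<omega> k], of "r\<^sup>2 / 2"] by simp

lemma integrable_cchar: "0 \<le> b \<Longrightarrow> k \<le> N \<Longrightarrow> integrable M (cchar b r k)"
  by (rule integrable_const_bound[OF AE_I2[OF norm_cchar_le]]) (auto simp: cchar_measurable)

text \<open>Both values of \<open>cchar\<close> share the factor \<open>W\<close>, which combines
  the old sum with the new variance: the later one is \<open>W\<close> times
  \<open>iexp (r x)\<close>, the earlier one \<open>W\<close> times
  \<open>exp (- r\<^sup>2 u / 2)\<close>. To second order the two factors differ by a multiple of
  \<open>x\<close> and a multiple of \<open>x\<^sup>2 - u\<close>, both of conditional mean 0, so
  only remainders are left.\<close>

lemma cchar_step:
  assumes b: "0 \<le> b" and \<epsilon>: "0 < \<epsilon>" and k: "k < N"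
  shows "norm ((\<integral>\<omega>. cchar b r (Suc k) \<omega> \<partial>M) - (\<integral>\<omega>. cchar b r k \<omega> \<partial>M))
    \<le> exp (r\<^sup>2 / 2 * b) * ((r\<^sup>2 + r ^ 4 / 8 * b) * (\<integral>\<omega>. tail b \<epsilon> (Suc k) \<omega> \<partial>M)
      + (\<bar>r\<bar> ^ 3 * \<epsilon> / 6 + r ^ 4 / 8 * \<epsilon>\<^sup>2) * (\<integral>\<omega>. svar b (Suc k) \<omega> \<partial>M))"
proof -
  let ?x = "stopped b (Suc k)" and ?u = "svar b (Suc k)" and ?l = "tail b \<epsilon> (Suc k)"
  let ?B = "exp (r\<^sup>2 / 2 * b)"
  have t: "Suc k \<in> {1..N}" using k by auto
  \<comment> \<open>The variance sum already includes step \<open>k + 1\<close>. As variances are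
    predictable, \<open>W\<close> is still measurable at time \<open>k\<close>.\<close>
  define W where "W \<omega> = iexp (r * (\<Sum>t=1..k. stopped b t \<omega>)) * of_real (exp (r\<^sup>2 / 2 * (\<Sum>t=1..Suc k. svar b t \<omega>)))" for \<omega>
  have W_le: "norm (W \<omega>) \<le> ?B" for \<omega>
    unfolding W_def norm_mult norm_exp_i_times norm_of_real
    using mult_left_mono[OF sum_svar_le[OF b, of \<omega> "Suc k"], of "r\<^sup>2 / 2"] by simp
  have W_F: "W \<in> borel_measurable (F (Suc k - 1))"
  proof -
    have [measurable]: "\<And>t. t \<in> {1..k} \<Longrightarrow> stopped b t \<in> borel_measurable (F k)"
      "\<And>t. t \<in> {1..Suc k} \<Longrightarrow> svar b t \<in> borel_measurable (F k)"
      using k by (auto intro!: stopped_measurable svar_measurable)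
    have "W \<in> borel_measurable (F k)" unfolding W_def by measurable
    then show ?thesis by simp
  qed
  note x0 = integral_cmult_stopped[OF t W_F W_le, of b]
  note xx0 = integral_cmult_stopped_sq[OF b t W_F W_le]
  note int_l = integrable_tail[OF b t, of \<epsilon>] and int_u = integrable_svar[OF b t]
    and int_x2 = integrable_stopped_sq[OF b t]
  note [measurable] = stopped_measurable_M[OF t]
  have int_u2: "integrable M (\<lambda>\<omega>. (?u \<omega>)\<^sup>2)"
    by (rule integrable_const_bound[of _ "b\<^sup>2"]) (auto intro!: power_mono svar_le b)
  \<comment> \<open>The correction terms integrate to 0 against \<open>W\<close>, so
    \<open>D\<close> has the mean of the increment of \<open>cchar\<close> but lacks its first- and
    second-order terms.\<close>
  define D where "D \<omega> = (cchar b r (Suc k) \<omega> - cchar b r k \<omega>) - \<i> * of_real r * (W \<omega> * of_real (?x \<omega>))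
      + of_real (r\<^sup>2 / 2) * (W \<omega> * of_real ((?x \<omega>)\<^sup>2 - ?u \<omega>))" for \<omega>
  have int_D: "(\<integral>\<omega>. cchar b r (Suc k) \<omega> \<partial>M) - (\<integral>\<omega>. cchar b r k \<omega> \<partial>M) = (\<integral>\<omega>. D \<omega> \<partial>M)"
  proof -
    have "integrable M (\<lambda>\<omega>. cchar b r (Suc k) \<omega> - cchar b r k \<omega>)"
      using k by (intro Bochner_Integration.integrable_diff integrable_cchar b) auto
    then show ?thesis
      unfolding D_def using x0 xx0 k
      by (subst Bochner_Integration.integral_add Bochner_Integration.integral_diff;
          simp add: integrable_cchar b del: of_real_diff of_real_power)+
  qed
  have "norm (\<integral>\<omega>. D \<omega> \<partial>M) \<le> (\<integral>\<omega>. ?B * (r\<^sup>2 * ?l \<omega> + \<bar>r\<bar> ^ 3 * \<epsilon> / 6 * (?x \<omega>)\<^sup>2 + r ^ 4 / 8 * (?u \<omega>)\<^sup>2) \<partial>M)"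
  proof (rule norm_integral_le, safe intro!: AE_I2)
    show "integrable M (\<lambda>\<omega>. ?B * (r\<^sup>2 * ?l \<omega> + \<bar>r\<bar> ^ 3 * \<epsilon> / 6 * (?x \<omega>)\<^sup>2 + r ^ 4 / 8 * (?u \<omega>)\<^sup>2))"
      using int_l int_x2 int_u2 by simp
    fix \<omega>
    let ?y = "r\<^sup>2 / 2 * ?u \<omega>"
    have norm_diff_of_real: "norm (a - of_real c) \<le> norm a + \<bar>c\<bar>" for a :: complex and c :: real
      using norm_triangle_ineq4[of a "of_real c"] by simp
    have Q1: "cchar b r (Suc k) \<omega> = W \<omega> * iexp (r * ?x \<omega>)"
      by (simp add: cchar_def W_def algebra_simps exp_add)
    have Q2: "cchar b r k \<omega> = W \<omega> * of_real (exp (- ?y))"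
      unfolding cchar_def W_def by (simp add: algebra_simps flip: exp_add of_real_mult)
    have "D \<omega> = W \<omega> * ((iexp (r * ?x \<omega>) - (1 + \<i> * of_real (r * ?x \<omega>) - of_real ((r * ?x \<omega>)\<^sup>2 / 2)))
        - of_real (exp (- ?y) - (1 - ?y)))"
      unfolding D_def Q1 Q2 by (simp add: algebra_simps power_mult_distrib add_divide_distrib diff_divide_distrib)
    also have "norm \<dots> \<le> ?B * (norm (iexp (r * ?x \<omega>) - (1 + \<i> * of_real (r * ?x \<omega>) - of_real ((r * ?x \<omega>)\<^sup>2 / 2)))
        + \<bar>exp (- ?y) - (1 - ?y)\<bar>)"
      unfolding norm_mult
      by (intro mult_mono W_le norm_diff_of_real) auto
    also have "\<dots> \<le> ?B * ((r\<^sup>2 * ?l \<omega> + \<bar>r\<bar> ^ 3 * \<epsilon> / 6 * (?x \<omega>)\<^sup>2) + ?y\<^sup>2 / 2)"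
      unfolding tail_def
      by (intro mult_left_mono add_mono iexp_quadratic_approx exp_minus_quadratic_approx \<epsilon>) auto
    \<comment> \<open>The constant \<open>r ^ 4 / 8\<close> is \<open>?y\<^sup>2 / 2\<close> with
      \<open>?y = r\<^sup>2 / 2 * ?u \<omega>\<close>.\<close>
    also have "\<dots> = ?B * (r\<^sup>2 * ?l \<omega> + \<bar>r\<bar> ^ 3 * \<epsilon> / 6 * (?x \<omega>)\<^sup>2 + r ^ 4 / 8 * (?u \<omega>)\<^sup>2)"
      by (simp add: power2_eq_square eval_nat_numeral)
    finally show "norm (D \<omega>) \<le> ?B * (r\<^sup>2 * ?l \<omega> + \<bar>r\<bar> ^ 3 * \<epsilon> / 6 * (?x \<omega>)\<^sup>2 + r ^ 4 / 8 * (?u \<omega>)\<^sup>2)"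
      by simp
  qed
  also have "\<dots> = ?B * (r\<^sup>2 * (\<integral>\<omega>. ?l \<omega> \<partial>M) + \<bar>r\<bar> ^ 3 * \<epsilon> / 6 * (\<integral>\<omega>. ?u \<omega> \<partial>M) + r ^ 4 / 8 * (\<integral>\<omega>. (?u \<omega>)\<^sup>2 \<partial>M))"
    using int_l int_x2 int_u2 by simp
  also have "\<dots> \<le> ?B * (r\<^sup>2 * (\<integral>\<omega>. ?l \<omega> \<partial>M) + \<bar>r\<bar> ^ 3 * \<epsilon> / 6 * (\<integral>\<omega>. ?u \<omega> \<partial>M)
      + r ^ 4 / 8 * (\<epsilon>\<^sup>2 * (\<integral>\<omega>. ?u \<omega> \<partial>M) + b * (\<integral>\<omega>. ?l \<omega> \<partial>M)))"
  proof (intro mult_left_mono add_left_mono)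
    have u_F: "?u \<in> borel_measurable (F (Suc k - 1))" using k by (intro svar_measurable) auto
    have int_ux: "integrable M (\<lambda>\<omega>. ?u \<omega> * (?x \<omega>)\<^sup>2)"
    proof (rule Bochner_Integration.integrable_bound)
      show "integrable M (\<lambda>\<omega>. b * (?x \<omega>)\<^sup>2)" using int_x2 by simp
      show "AE \<omega> in M. norm (?u \<omega> * (?x \<omega>)\<^sup>2) \<le> norm (b * (?x \<omega>)\<^sup>2)"
        using b by (intro AE_I2) (auto simp: abs_mult intro!: mult_right_mono svar_le)
    qed measurable
    \<comment> \<open>One factor \<open>u\<close> is replaced by the squared increment, whose
      conditional mean it is. Where the increment is at most \<epsilon>, this leaves \<epsilon>^2
      times \<open>u\<close>; elsewhere the other factor is bounded by \<open>b\<close> and the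
      square is counted by the tail.\<close>
    have "(\<integral>\<omega>. (?u \<omega>)\<^sup>2 \<partial>M) = (\<integral>\<omega>. ?u \<omega> * (?x \<omega>)\<^sup>2 \<partial>M)"
      using integral_mult_stopped_sq[OF b t u_F int_ux] by (simp add: power2_eq_square)
    also have "\<dots> \<le> (\<integral>\<omega>. \<epsilon>\<^sup>2 * ?u \<omega> + b * ?l \<omega> \<partial>M)"
    proof (rule integral_mono[OF int_ux])
      show "integrable M (\<lambda>\<omega>. \<epsilon>\<^sup>2 * ?u \<omega> + b * ?l \<omega>)" using int_u int_l by simp
      fix \<omega>
      have u: "0 \<le> ?u \<omega>" "?u \<omega> \<le> b" using b by (auto intro: svar_le)
      show "?u \<omega> * (?x \<omega>)\<^sup>2 \<le> \<epsilon>\<^sup>2 * ?u \<omega> + b * ?l \<omega>"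
      proof (cases "\<epsilon> < \<bar>?x \<omega>\<bar>")
        case True
        then have "?u \<omega> * (?x \<omega>)\<^sup>2 \<le> b * ?l \<omega>" using u by (auto simp: tail_def intro!: mult_right_mono)
        then show ?thesis using u by (simp add: add_increasing)
      next
        case False
        then have "(?x \<omega>)\<^sup>2 \<le> \<epsilon>\<^sup>2" using \<epsilon> by (simp add: abs_le_square_iff[symmetric])
        from mult_left_mono[OF this u(1)] show ?thesis using False by (simp add: tail_def mult.commute)
      qed
    qed
    also have "\<dots> = \<epsilon>\<^sup>2 * (\<integral>\<omega>. ?u \<omega> \<partial>M) + b * (\<integral>\<omega>. ?l \<omega> \<partial>M)" using int_u int_l by simp
    finally show "(\<integral>\<omega>. (?u \<omega>)\<^sup>2 \<partial>M) \<le> \<epsilon>\<^sup>2 * (\<integral>\<omega>. ?u \<omega> \<partial>M) + b * (\<integral>\<omega>. ?l \<omega> \<partial>M)" .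
  qed auto
  also have "\<dots> = ?B * ((r\<^sup>2 + r ^ 4 / 8 * b) * (\<integral>\<omega>. ?l \<omega> \<partial>M)
      + (\<bar>r\<bar> ^ 3 * \<epsilon> / 6 + r ^ 4 / 8 * \<epsilon>\<^sup>2) * (\<integral>\<omega>. ?u \<omega> \<partial>M))"
    by (simp add: algebra_simps)
  finally show ?thesis unfolding int_D .
qed

text \<open>Telescoping from \<open>cchar b r 0 = 1\<close>. The variances sum to at most
  \<open>b\<close>, so the second part of the bound is small with \<epsilon> whatever the length of
  the row, and only the tail depends on the row.\<close>

lemma cchar_bound:
  assumes b: "0 \<le> b" and \<epsilon>: "0 < \<epsilon>"
  shows "norm ((\<integral>\<omega>. cchar b r N \<omega> \<partial>M) - 1)
    \<le> exp (r\<^sup>2 / 2 * b) * ((r\<^sup>2 + r ^ 4 / 8 * b) * (\<integral>\<omega>. (\<Sum>t=1..N. tail b \<epsilon> t \<omega>) \<partial>M)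
      + (\<bar>r\<bar> ^ 3 * \<epsilon> / 6 + r ^ 4 / 8 * \<epsilon>\<^sup>2) * b)"
proof -
  let ?B = "exp (r\<^sup>2 / 2 * b)" and ?K = "r\<^sup>2 + r ^ 4 / 8 * b" and ?L = "\<bar>r\<bar> ^ 3 * \<epsilon> / 6 + r ^ 4 / 8 * \<epsilon>\<^sup>2"
  have "norm ((\<integral>\<omega>. cchar b r k \<omega> \<partial>M) - 1)
    \<le> ?B * (?K * (\<Sum>t=1..k. \<integral>\<omega>. tail b \<epsilon> t \<omega> \<partial>M) + ?L * (\<Sum>t=1..k. \<integral>\<omega>. svar b t \<omega> \<partial>M))" if "k \<le> N" for k
    using that
  proof (induction k)
    case 0
    show ?case by (simp add: cchar_def prob_space)
  next
    case (Suc k)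
    let ?Q = "\<lambda>k. \<integral>\<omega>. cchar b r k \<omega> \<partial>M"
    have "norm (?Q (Suc k) - 1) \<le> norm (?Q (Suc k) - ?Q k) + norm (?Q k - 1)"
      using norm_triangle_ineq[of "?Q (Suc k) - ?Q k" "?Q k - 1"] by simp
    also have "\<dots> \<le> ?B * (?K * (\<integral>\<omega>. tail b \<epsilon> (Suc k) \<omega> \<partial>M) + ?L * (\<integral>\<omega>. svar b (Suc k) \<omega> \<partial>M))
        + ?B * (?K * (\<Sum>t=1..k. \<integral>\<omega>. tail b \<epsilon> t \<omega> \<partial>M) + ?L * (\<Sum>t=1..k. \<integral>\<omega>. svar b t \<omega> \<partial>M))"
      using Suc by (intro add_mono cchar_step b \<epsilon>) auto
    also have "\<dots> = ?B * (?K * (\<Sum>t=1..Suc k. \<integral>\<omega>. tail b \<epsilon> t \<omega> \<partial>M) + ?L * (\<Sum>t=1..Suc k. \<integral>\<omega>. svar b t \<omega> \<partial>M))"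
      by (simp add: algebra_simps)
    finally show ?case .
  qed
  from this[OF order_refl] have "norm ((\<integral>\<omega>. cchar b r N \<omega> \<partial>M) - 1)
    \<le> ?B * (?K * (\<Sum>t=1..N. \<integral>\<omega>. tail b \<epsilon> t \<omega> \<partial>M) + ?L * (\<Sum>t=1..N. \<integral>\<omega>. svar b t \<omega> \<partial>M))" .
  also have "(\<Sum>t=1..N. \<integral>\<omega>. tail b \<epsilon> t \<omega> \<partial>M) = (\<integral>\<omega>. (\<Sum>t=1..N. tail b \<epsilon> t \<omega>) \<partial>M)"
    by (intro Bochner_Integration.integral_sum[symmetric] integrable_tail b) auto
  also have "(\<Sum>t=1..N. \<integral>\<omega>. svar b t \<omega> \<partial>M) = (\<integral>\<omega>. (\<Sum>t=1..N. svar b t \<omega>) \<partial>M)"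
    by (intro Bochner_Integration.integral_sum[symmetric] integrable_svar b) auto
  also have "?B * (?K * (\<integral>\<omega>. (\<Sum>t=1..N. tail b \<epsilon> t \<omega>) \<partial>M) + ?L * (\<integral>\<omega>. (\<Sum>t=1..N. svar b t \<omega>) \<partial>M))
    \<le> ?B * (?K * (\<integral>\<omega>. (\<Sum>t=1..N. tail b \<epsilon> t \<omega>) \<partial>M) + ?L * (\<integral>\<omega>. b \<partial>M))"
    using b \<epsilon> by (intro mult_left_mono add_left_mono integral_mono sum_svar_le
        Bochner_Integration.integrable_sum integrable_svar) auto
  finally show ?thesis by (simp add: prob_space)
qed

end

section \<open>Tails and variances of the stopped sequence\<close>

context martingale_differences
begin

text \<open>The hypothesis of the limit theorem concerns conditional tails in probability,
  \<open>cchar_bound\<close> needs a mean. \<open>L\<close> is the sum of the conditional tails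
  under the cut-off: it has the right mean, is dominated by the Lindeberg sum, and is bounded by
  \<open>b\<close> because each conditional tail is at most the conditional variance. Bounded
  convergence then applies to it.\<close>

lemma tail_sum_dominated:
  assumes b: "0 \<le> b" and \<epsilon>: "0 < \<epsilon>"
  obtains L where "L \<in> borel_measurable M" "AE \<omega> in M. 0 \<le> L \<omega> \<and> L \<omega> \<le> b"
    "AE \<omega> in M. ennreal (L \<omega>) \<le> (\<Sum>t=1..N. lindeberg \<epsilon> t \<omega>)"
    "(\<integral>\<omega>. (\<Sum>t=1..N. tail b \<epsilon> t \<omega>) \<partial>M) = (\<integral>\<omega>. L \<omega> \<partial>M)"
proof -
  define l where "l t \<omega> = (if qvar t \<omega> \<le> ennreal b then enn2real (lindeberg \<epsilon> t \<omega>) else 0)" for t \<omega>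
  have [measurable]: "lindeberg \<epsilon> t \<in> borel_measurable M" for t unfolding lindeberg_def by simp
  have [measurable]: "l t \<in> borel_measurable M" for t unfolding l_def by measurable
  have l_props: "AE \<omega> in M. l t \<omega> \<le> svar b t \<omega> \<and>
      ennreal (l t \<omega>) = (if qvar t \<omega> \<le> ennreal b then lindeberg \<epsilon> t \<omega> else 0)"
    and tail_l: "(\<integral>\<^sup>+\<omega>. ennreal (tail b \<epsilon> t \<omega>) \<partial>M) = (\<integral>\<^sup>+\<omega>. ennreal (l t \<omega>) \<partial>M)" if t: "t \<in> {1..N}" for t
  proof -
    interpret sigma_finite_subalgebra M "F (t - 1)" using t by (intro sigma_finite_F) auto
    note [measurable] = X_measurable[OF t]
    have [measurable]: "qvar t \<in> borel_measurable (F (t - 1))" using t by (intro qvar_measurable) auto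
    have "AE \<omega> in M. lindeberg \<epsilon> t \<omega> \<le> cvar t \<omega>"
      unfolding lindeberg_def cvar_def by (rule nn_cond_exp_mono) (auto intro!: ennreal_leI)
    then show l: "AE \<omega> in M. l t \<omega> \<le> svar b t \<omega> \<and>
      ennreal (l t \<omega>) = (if qvar t \<omega> \<le> ennreal b then lindeberg \<epsilon> t \<omega> else 0)"
    proof eventually_elim
      case (elim \<omega>)
      show ?case
      proof (cases "qvar t \<omega> \<le> ennreal b")
        case True
        have "cvar t \<omega> < top"
          using cvar_le_qvar[of t t \<omega>] True t ennreal_less_top[of b] by (simp add: order_le_less_trans)
        with elim show ?thesis using True by (auto simp: l_def svar_def enn2real_mono)
      qed (simp add: l_def svar_def)
    qed
    let ?I = "\<lambda>\<omega>. (if qvar t \<omega> \<le> ennreal b then 1 else 0 :: ennreal)"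
    have "(\<integral>\<^sup>+\<omega>. ennreal (tail b \<epsilon> t \<omega>) \<partial>M)
        = (\<integral>\<^sup>+\<omega>. ?I \<omega> * ennreal ((X t \<omega>)\<^sup>2 * (if \<epsilon> < \<bar>X t \<omega>\<bar> then 1 else 0)) \<partial>M)"
      using \<epsilon> by (intro nn_integral_cong) (auto simp: tail_def stopped_def)
    also have "\<dots> = (\<integral>\<^sup>+\<omega>. ?I \<omega> * lindeberg \<epsilon> t \<omega> \<partial>M)"
      unfolding lindeberg_def by (rule nn_cond_exp_intg[symmetric]) measurable
    also have "\<dots> = (\<integral>\<^sup>+\<omega>. ennreal (l t \<omega>) \<partial>M)"
      by (rule nn_integral_cong_AE) (use l in eventually_elim, auto)
    finally show "(\<integral>\<^sup>+\<omega>. ennreal (tail b \<epsilon> t \<omega>) \<partial>M) = (\<integral>\<^sup>+\<omega>. ennreal (l t \<omega>) \<partial>M)" .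
  qed
  have l_nonneg: "0 \<le> l t \<omega>" for t \<omega> by (simp add: l_def)
  have all: "AE \<omega> in M. \<forall>t\<in>{1..N}. l t \<omega> \<le> svar b t \<omega> \<and>
      ennreal (l t \<omega>) = (if qvar t \<omega> \<le> ennreal b then lindeberg \<epsilon> t \<omega> else 0)"
    using l_props by (subst AE_ball_countable) auto
  have int_l: "integrable M (l t)" "(\<integral>\<omega>. tail b \<epsilon> t \<omega> \<partial>M) = (\<integral>\<omega>. l t \<omega> \<partial>M)" if t: "t \<in> {1..N}" for t
  proof -
    have "AE \<omega> in M. norm (l t \<omega>) \<le> norm (svar b t \<omega>)"
      using l_props[OF t] by eventually_elim (auto simp: l_nonneg)
    then show "integrable M (l t)"
      by (intro Bochner_Integration.integrable_bound[OF integrable_svar[OF b t]]) auto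
    show "(\<integral>\<omega>. tail b \<epsilon> t \<omega> \<partial>M) = (\<integral>\<omega>. l t \<omega> \<partial>M)"
      using tail_l[OF t] t by (subst (1 2) integral_eq_nn_integral) (auto simp: l_nonneg)
  qed
  let ?L = "\<lambda>\<omega>. \<Sum>t=1..N. l t \<omega>"
  show thesis
  proof (rule that[of ?L])
    show "AE \<omega> in M. 0 \<le> ?L \<omega> \<and> ?L \<omega> \<le> b" using all
    proof eventually_elim
      case (elim \<omega>)
      have "?L \<omega> \<le> (\<Sum>t=1..N. svar b t \<omega>)" using elim by (intro sum_mono) auto
      then show ?case using sum_svar_le[OF b, of \<omega> N] by (auto intro!: sum_nonneg l_nonneg)
    qed
    show "AE \<omega> in M. ennreal (?L \<omega>) \<le> (\<Sum>t=1..N. lindeberg \<epsilon> t \<omega>)" using all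
    proof eventually_elim
      case (elim \<omega>)
      have "ennreal (?L \<omega>) = (\<Sum>t=1..N. ennreal (l t \<omega>))"
        by (rule sum_ennreal[symmetric]) (simp add: l_nonneg)
      also have "\<dots> \<le> (\<Sum>t=1..N. lindeberg \<epsilon> t \<omega>)" using elim by (intro sum_mono) auto
      finally show ?case .
    qed
    show "(\<integral>\<omega>. (\<Sum>t=1..N. tail b \<epsilon> t \<omega>) \<partial>M) = (\<integral>\<omega>. ?L \<omega> \<partial>M)"
      by (subst (1 2) Bochner_Integration.integral_sum) (auto simp: int_l integrable_tail b)
  qed measurable
qed

text \<open>Subtraction in \<open>ennreal\<close> is truncated at 0, so the sum of the two
  differences is the distance of \<open>qvar N\<close> from 1, also when \<open>qvar N\<close> is
  infinite.\<close>

lemma qvar_dist_ge_1: "\<not> qvar N \<omega> \<le> ennreal 2 \<Longrightarrow> 1 \<le> (qvar N \<omega> - 1) + (1 - qvar N \<omega>)"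
proof -
  assume "\<not> qvar N \<omega> \<le> ennreal 2"
  then have "2 - 1 \<le> qvar N \<omega> - 1" by (intro ennreal_minus_mono) (auto simp: not_le)
  moreover have "(2 :: ennreal) - 1 = 1" using ennreal_minus[of 1 2] by simp
  ultimately show ?thesis by (simp add: add_increasing2)
qed

text \<open>Below the cut-off both sides agree. Above it the left side is at most 1, because the sum
  lies between 0 and 2, and the right side is at least 1; this fits the cut-off 2.\<close>

lemma sum_svar_dist: "ennreal \<bar>(\<Sum>t=1..N. svar 2 t \<omega>) - 1\<bar> \<le> (qvar N \<omega> - 1) + (1 - qvar N \<omega>)"
proof (cases "qvar N \<omega> \<le> ennreal 2")
  case True
  have "ennreal (\<Sum>t=1..N. svar 2 t \<omega>) = (\<Sum>t=1..N. ennreal (svar 2 t \<omega>))"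
    by (rule sum_ennreal[symmetric]) simp
  also have "\<dots> = qvar N \<omega>"
    unfolding qvar_def
  proof (rule sum.cong[OF refl])
    fix t assume t: "t \<in> {1..N}"
    then have "qvar t \<omega> \<le> ennreal 2" using order_trans[OF qvar_mono[of t N \<omega>] True] by simp
    then show "ennreal (svar 2 t \<omega>) = cvar t \<omega>" using t ennreal_svar[of t 2 \<omega>] by simp
  qed
  finally have eq: "qvar N \<omega> = ennreal (\<Sum>t=1..N. svar 2 t \<omega>)" by simp
  have "0 \<le> (\<Sum>t=1..N. svar 2 t \<omega>)" by (intro sum_nonneg) simp
  then show ?thesis unfolding eq
    by (cases "1 \<le> (\<Sum>t=1..N. svar 2 t \<omega>)") (auto simp: ennreal_minus ennreal_neg simp flip: ennreal_1)
next
  case False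
  have "0 \<le> (\<Sum>t=1..N. svar 2 t \<omega>)" "(\<Sum>t=1..N. svar 2 t \<omega>) \<le> 2"
    using sum_svar_le[of 2 \<omega> N] by (auto intro: sum_nonneg)
  then have "ennreal \<bar>(\<Sum>t=1..N. svar 2 t \<omega>) - 1\<bar> \<le> 1" by (subst ennreal_le_1) auto
  then show ?thesis using qvar_dist_ge_1[OF False] by order
qed

end

text \<open>The character times \<open>exp (r\<^sup>2 / 2)\<close> is compared with 1 at three
  costs: stopping matters only where \<open>qvar\<close> exceeds 2; replacing the stopped variance
  by 1 costs a multiple of its mean distance from 1; and the mean of \<open>cchar\<close> is close
  to 1.\<close>

theorem (in prob_space) martingale_central_limit_theorem:
  fixes F :: "nat \<Rightarrow> nat \<Rightarrow> 'a measure" and X :: "nat \<Rightarrow> nat \<Rightarrow> 'a \<Rightarrow> real"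
  assumes mds: "\<And>n. martingale_differences M (F n) (X n) n"
    and var: "vanishes_in_prob M (\<lambda>n \<omega>.
      (martingale_differences.qvar M (F n) (X n) n \<omega> - 1) + (1 - martingale_differences.qvar M (F n) (X n) n \<omega>))"
    and lind: "\<And>\<epsilon>. 0 < \<epsilon> \<Longrightarrow> vanishes_in_prob M (\<lambda>n \<omega>.
      \<Sum>t=1..n. martingale_differences.lindeberg M (F n) (X n) \<epsilon> t \<omega>)"
  shows "(\<lambda>n. char (distr M borel (\<lambda>\<omega>. \<Sum>t=1..n. X n t \<omega>)) r) \<longlonglongrightarrow> of_real (exp (- r\<^sup>2 / 2))"
proof -
  interpret m: martingale_differences M "F n" "X n" n for n by (rule mds)
  let ?V = "\<lambda>n \<omega>. \<Sum>t=1..n. m.svar n 2 t \<omega>" and ?S = "\<lambda>n \<omega>. \<Sum>t=1..n. m.stopped n 2 t \<omega>"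
  let ?B = "exp (r\<^sup>2 / 2 * 2)"
  have [measurable]: "?V n \<in> borel_measurable M" "?S n \<in> borel_measurable M"
    "(\<lambda>\<omega>. \<Sum>t=1..n. X n t \<omega>) \<in> borel_measurable M" for n
    by measurable
  have V: "0 \<le> ?V n \<omega>" "?V n \<omega> \<le> 2" for n \<omega>
    using m.sum_svar_le[of 2 n \<omega> n] by (auto intro: sum_nonneg)

  have Q: "(\<lambda>n. norm ((\<integral>\<omega>. m.cchar n 2 r n \<omega> \<partial>M) - 1)) \<longlonglongrightarrow> 0"
  proof (rule tendsto_zero_le_epsilon)
    fix e :: real assume e: "0 < e"
    \<comment> \<open>This is the part of \<open>cchar_bound\<close> that does not involve the tail.
      It tends to 0 with \<epsilon>, so \<epsilon> is fixed after \<open>e\<close> and before the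
      limit along the rows.\<close>
    let ?g = "\<lambda>\<epsilon>. ?B * ((\<bar>r\<bar> ^ 3 * \<epsilon> / 6 + r ^ 4 / 8 * \<epsilon>\<^sup>2) * 2)"
    have "(?g \<longlongrightarrow> ?g 0) (at_right 0)" by (intro tendsto_intros) auto
    then have "\<forall>\<^sub>F \<epsilon> in at_right 0. ?g \<epsilon> < e" using e by (intro order_tendstoD) auto
    moreover have "\<forall>\<^sub>F \<epsilon> in at_right (0::real). 0 < \<epsilon>" by (simp add: eventually_at_right_less)
    ultimately have "\<forall>\<^sub>F \<epsilon> in at_right 0. 0 < \<epsilon> \<and> ?g \<epsilon> < e" by eventually_elim simp
    then obtain \<epsilon> where \<epsilon>: "0 < \<epsilon>" "?g \<epsilon> < e"
      using eventually_happens[of _ "at_right (0::real)"] by auto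
    define P where "P n L \<longleftrightarrow> L \<in> borel_measurable M \<and> (AE \<omega> in M. 0 \<le> L \<omega> \<and> L \<omega> \<le> 2) \<and>
      (AE \<omega> in M. ennreal (L \<omega>) \<le> (\<Sum>t=1..n. m.lindeberg n \<epsilon> t \<omega>)) \<and>
      (\<integral>\<omega>. (\<Sum>t=1..n. m.tail n 2 \<epsilon> t \<omega>) \<partial>M) = (\<integral>\<omega>. L \<omega> \<partial>M)" for n L
    have "\<exists>L. P n L" for n
      by (rule m.tail_sum_dominated[of 2 \<epsilon> n]) (use \<epsilon> in \<open>auto simp: P_def\<close>)
    then obtain L where "\<And>n. P n (L n)" using choice[of P] by blast
    then have L: "\<And>n. L n \<in> borel_measurable M" "\<And>n. AE \<omega> in M. 0 \<le> L n \<omega> \<and> L n \<omega> \<le> 2"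
      "\<And>n. AE \<omega> in M. ennreal (L n \<omega>) \<le> (\<Sum>t=1..n. m.lindeberg n \<epsilon> t \<omega>)"
      "\<And>n. (\<integral>\<omega>. (\<Sum>t=1..n. m.tail n 2 \<epsilon> t \<omega>) \<partial>M) = (\<integral>\<omega>. L n \<omega> \<partial>M)"
      unfolding P_def by blast+
    have "vanishes_in_prob M (\<lambda>n \<omega>. ennreal (L n \<omega>))"
      by (rule vanishes_in_prob_le[OF lind[OF \<epsilon>(1)] _ L(3)]) (simp add: m.lindeberg_def)
    then have lim: "(\<lambda>n. \<integral>\<omega>. L n \<omega> \<partial>M) \<longlonglongrightarrow> 0"
      by (rule vanishes_in_prob_bounded_integral[OF _ L(1,2)])
    let ?h = "\<lambda>n. ?B * ((r\<^sup>2 + r ^ 4 / 8 * 2) * (\<integral>\<omega>. L n \<omega> \<partial>M))"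
    have "?h \<longlonglongrightarrow> 0" by (intro tendsto_mult_right_zero lim)
    moreover have "norm ((\<integral>\<omega>. m.cchar n 2 r n \<omega> \<partial>M) - 1) \<le> ?h n + e" for n
    proof -
      have "norm ((\<integral>\<omega>. m.cchar n 2 r n \<omega> \<partial>M) - 1) \<le> ?h n + ?g \<epsilon>"
        using m.cchar_bound[of 2 \<epsilon> n r] \<epsilon> unfolding L(4) by (simp add: distrib_left)
      then show ?thesis using \<epsilon>(2) by linarith
    qed
    ultimately show "\<exists>g. g \<longlonglongrightarrow> 0 \<and>
        (\<forall>\<^sub>F n in sequentially. norm ((\<integral>\<omega>. m.cchar n 2 r n \<omega> \<partial>M) - 1) \<le> g n + e)"
      by (intro exI[of _ ?h]) auto
  qed simp

  have "vanishes_in_prob M (\<lambda>n \<omega>. ennreal \<bar>?V n \<omega> - 1\<bar>)"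
    by (rule vanishes_in_prob_le[OF var _ AE_I2[OF m.sum_svar_dist]]) measurable
  then have V_lim: "(\<lambda>n. \<integral>\<omega>. \<bar>?V n \<omega> - 1\<bar> \<partial>M) \<longlonglongrightarrow> 0"
  proof (rule vanishes_in_prob_bounded_integral[where B = 1])
    show "AE \<omega> in M. 0 \<le> \<bar>?V n \<omega> - 1\<bar> \<and> \<bar>?V n \<omega> - 1\<bar> \<le> 1" for n
    proof (rule AE_I2)
      fix \<omega> show "0 \<le> \<bar>?V n \<omega> - 1\<bar> \<and> \<bar>?V n \<omega> - 1\<bar> \<le> 1" using V[of n \<omega>] by linarith
    qed
  qed measurable

  \<comment> \<open>Two numbers of modulus 1 differ by at most 2, and the two sums coincide where
    the cut-off is not reached. Where it is reached, \<open>qvar\<close> is at distance at least 1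
    from 1, so \<open>?D\<close> is at most twice that distance.\<close>
  let ?D = "\<lambda>n \<omega>. (if m.qvar n n \<omega> \<le> ennreal 2 then 0 else 2 :: real)"
  have [measurable]: "?D n \<in> borel_measurable M" for n by measurable
  have "vanishes_in_prob M (\<lambda>n \<omega>. ennreal (?D n \<omega>))"
  proof (rule vanishes_in_prob_random_bound[OF var])
    show "AE \<omega> in M. \<exists>K. \<forall>\<^sub>F n in sequentially. ennreal (?D n \<omega>)
        \<le> ennreal K * ((m.qvar n n \<omega> - 1) + (1 - m.qvar n n \<omega>))"
    proof (intro AE_I2 exI[of _ 2] always_eventually allI)
      fix \<omega> n
      show "ennreal (?D n \<omega>) \<le> ennreal 2 * ((m.qvar n n \<omega> - 1) + (1 - m.qvar n n \<omega>))"
        using mult_left_mono[OF m.qvar_dist_ge_1[of n \<omega>], of "ennreal 2"] by simp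
    qed
  qed measurable
  then have D_lim: "(\<lambda>n. \<integral>\<omega>. ?D n \<omega> \<partial>M) \<longlonglongrightarrow> 0"
    by (rule vanishes_in_prob_bounded_integral[where B = 2]) auto

  let ?E = "of_real (exp (r\<^sup>2 / 2)) :: complex"
  \<comment> \<open>By convexity exp x - exp y is at most exp x (x - y); \<open>?B\<close> bounds
    both exponentials because \<open>v\<close> is at most 2.\<close>
  have exp_diff: "\<bar>exp (r\<^sup>2 / 2 * v) - exp (r\<^sup>2 / 2)\<bar> \<le> ?B * (r\<^sup>2 / 2) * \<bar>v - 1\<bar>" if "0 \<le> v" "v \<le> 2" for v :: real
  proof -
    have *: "exp x - exp y \<le> exp x * (x - y)" for x y :: real
      using mult_left_mono[OF exp_ge_add_one_self[of "y - x"], of "exp x"]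
      by (simp add: algebra_simps flip: exp_add)
    have le: "exp (r\<^sup>2 / 2 * v) \<le> ?B" "exp (r\<^sup>2 / 2) \<le> ?B"
      using that mult_left_mono[of v 2 "r\<^sup>2 / 2"] by auto
    show ?thesis
    proof (cases "1 \<le> v")
      case True
      have "exp (r\<^sup>2 / 2 * v) - exp (r\<^sup>2 / 2) \<le> exp (r\<^sup>2 / 2 * v) * (r\<^sup>2 / 2 * v - r\<^sup>2 / 2)" by (rule *)
      also have "\<dots> = exp (r\<^sup>2 / 2 * v) * (r\<^sup>2 / 2 * (v - 1))" by (simp add: algebra_simps)
      also have "\<dots> \<le> ?B * (r\<^sup>2 / 2 * (v - 1))" using le True by (intro mult_right_mono) auto
      finally show ?thesis using True mult_left_mono[OF True, of "r\<^sup>2 / 2"] by (simp add: mult.assoc)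
    next
      case False
      have "exp (r\<^sup>2 / 2) - exp (r\<^sup>2 / 2 * v) \<le> exp (r\<^sup>2 / 2) * (r\<^sup>2 / 2 - r\<^sup>2 / 2 * v)" by (rule *)
      also have "\<dots> = exp (r\<^sup>2 / 2) * (r\<^sup>2 / 2 * (1 - v))" by (simp add: algebra_simps)
      also have "\<dots> \<le> ?B * (r\<^sup>2 / 2 * (1 - v))" using le False by (intro mult_right_mono) auto
      finally show ?thesis using False mult_left_mono[of v 1 "r\<^sup>2 / 2"] by (simp add: mult.assoc)
    qed
  qed
  have int_S: "integrable M (\<lambda>\<omega>. iexp (r * ?S n \<omega>))" "integrable M (\<lambda>\<omega>. iexp (r * (\<Sum>t=1..n. X n t \<omega>)))" for n
    by (intro integrable_iexp; simp)+
  have bound: "norm (char (distr M borel (\<lambda>\<omega>. \<Sum>t=1..n. X n t \<omega>)) r * ?E - 1)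
      \<le> exp (r\<^sup>2 / 2) * (\<integral>\<omega>. ?D n \<omega> \<partial>M) + ?B * (r\<^sup>2 / 2) * (\<integral>\<omega>. \<bar>?V n \<omega> - 1\<bar> \<partial>M)
        + norm ((\<integral>\<omega>. m.cchar n 2 r n \<omega> \<partial>M) - 1)" for n
  proof -
    let ?c = "\<integral>\<omega>. iexp (r * (\<Sum>t=1..n. X n t \<omega>)) \<partial>M" and ?s = "\<integral>\<omega>. iexp (r * ?S n \<omega>) \<partial>M"
      and ?q = "\<integral>\<omega>. m.cchar n 2 r n \<omega> \<partial>M"
    have "norm (?c - ?s) \<le> (\<integral>\<omega>. ?D n \<omega> \<partial>M)"
    proof -
      have "?c - ?s = (\<integral>\<omega>. iexp (r * (\<Sum>t=1..n. X n t \<omega>)) - iexp (r * ?S n \<omega>) \<partial>M)"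
        by (rule Bochner_Integration.integral_diff[OF int_S(2,1), symmetric])
      moreover have "norm (\<integral>\<omega>. iexp (r * (\<Sum>t=1..n. X n t \<omega>)) - iexp (r * ?S n \<omega>) \<partial>M) \<le> (\<integral>\<omega>. ?D n \<omega> \<partial>M)"
      proof (rule norm_integral_le, safe intro!: AE_I2)
        show "integrable M (?D n)" by (rule integrable_const_bound[of _ 2]) auto
        fix \<omega>
        show "norm (iexp (r * (\<Sum>t=1..n. X n t \<omega>)) - iexp (r * ?S n \<omega>)) \<le> ?D n \<omega>"
        proof (cases "m.qvar n n \<omega> \<le> ennreal 2")
          case True
          have "?S n \<omega> = (\<Sum>t=1..n. X n t \<omega>)"
            by (rule sum.cong[OF refl]) (rule m.stopped_eq_X[OF True])
          then show ?thesis using True by simp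
        next
          case False
          have "norm (iexp (r * (\<Sum>t=1..n. X n t \<omega>)) - iexp (r * ?S n \<omega>)) \<le> 1 + 1"
            by (rule order_trans[OF norm_triangle_ineq4]) (simp only: norm_exp_i_times order_refl)
          then show ?thesis using False by simp
        qed
      qed
      ultimately show ?thesis by simp
    qed
    moreover have "norm (?s * ?E - ?q) \<le> ?B * (r\<^sup>2 / 2) * (\<integral>\<omega>. \<bar>?V n \<omega> - 1\<bar> \<partial>M)"
    proof -
      have "?s * ?E - ?q = (\<integral>\<omega>. iexp (r * ?S n \<omega>) * ?E - m.cchar n 2 r n \<omega> \<partial>M)"
        using int_S(1)[of n] m.integrable_cchar[of 2 n n r]
        by (subst Bochner_Integration.integral_diff) (simp_all del: of_real_mult of_real_sum)
      moreover have "norm (\<integral>\<omega>. iexp (r * ?S n \<omega>) * ?E - m.cchar n 2 r n \<omega> \<partial>M)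
          \<le> (\<integral>\<omega>. ?B * (r\<^sup>2 / 2) * \<bar>?V n \<omega> - 1\<bar> \<partial>M)"
      proof (rule norm_integral_le, safe intro!: AE_I2)
        have "integrable M (?V n)" by (rule integrable_const_bound[of _ 2]) (use V in auto)
        then show "integrable M (\<lambda>\<omega>. ?B * (r\<^sup>2 / 2) * \<bar>?V n \<omega> - 1\<bar>)" by simp
        fix \<omega>
        have "iexp (r * ?S n \<omega>) * ?E - m.cchar n 2 r n \<omega>
            = iexp (r * ?S n \<omega>) * of_real (exp (r\<^sup>2 / 2) - exp (r\<^sup>2 / 2 * ?V n \<omega>))"
          unfolding m.cchar_def by (simp only: of_real_diff right_diff_distrib)
        then have "norm (iexp (r * ?S n \<omega>) * ?E - m.cchar n 2 r n \<omega>)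
            = \<bar>exp (r\<^sup>2 / 2 * ?V n \<omega>) - exp (r\<^sup>2 / 2)\<bar>"
          by (simp only: norm_mult norm_exp_i_times norm_of_real abs_minus_commute mult_1)
        also have "\<dots> \<le> ?B * (r\<^sup>2 / 2) * \<bar>?V n \<omega> - 1\<bar>" by (rule exp_diff[OF V])
        finally show "norm (iexp (r * ?S n \<omega>) * ?E - m.cchar n 2 r n \<omega>) \<le> ?B * (r\<^sup>2 / 2) * \<bar>?V n \<omega> - 1\<bar>" .
      qed
      ultimately show ?thesis by simp
    qed
    moreover have "?c * ?E - 1 = (?c - ?s) * ?E + (?s * ?E - ?q) + (?q - 1)" by (simp add: algebra_simps)
    then have "norm (?c * ?E - 1) \<le> norm ((?c - ?s) * ?E) + norm (?s * ?E - ?q) + norm (?q - 1)"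
      by (metis norm_triangle_le norm_triangle_ineq add_right_mono)
    moreover have "norm ((?c - ?s) * ?E) = exp (r\<^sup>2 / 2) * norm (?c - ?s)"
      by (simp only: norm_mult norm_of_real abs_exp_cancel mult.commute)
    moreover have "exp (r\<^sup>2 / 2) * norm (?c - ?s) \<le> exp (r\<^sup>2 / 2) * (\<integral>\<omega>. ?D n \<omega> \<partial>M)"
      using calculation(1) by (rule mult_left_mono) simp
    ultimately have "norm (?c * ?E - 1) \<le> exp (r\<^sup>2 / 2) * (\<integral>\<omega>. ?D n \<omega> \<partial>M)
        + ?B * (r\<^sup>2 / 2) * (\<integral>\<omega>. \<bar>?V n \<omega> - 1\<bar> \<partial>M) + norm (?q - 1)" by linarith
    moreover have "char (distr M borel (\<lambda>\<omega>. \<Sum>t=1..n. X n t \<omega>)) r = ?c"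
      by (rule char_integral) measurable
    ultimately show ?thesis by (simp only:)
  qed
  have "(\<lambda>n. exp (r\<^sup>2 / 2) * (\<integral>\<omega>. ?D n \<omega> \<partial>M) + ?B * (r\<^sup>2 / 2) * (\<integral>\<omega>. \<bar>?V n \<omega> - 1\<bar> \<partial>M)
        + norm ((\<integral>\<omega>. m.cchar n 2 r n \<omega> \<partial>M) - 1)) \<longlonglongrightarrow> 0"
    by (intro tendsto_add_zero tendsto_mult_right_zero D_lim V_lim Q)
  then have "(\<lambda>n. char (distr M borel (\<lambda>\<omega>. \<Sum>t=1..n. X n t \<omega>)) r * ?E - 1) \<longlonglongrightarrow> 0"
    by (rule Lim_null_comparison[rotated]) (intro always_eventually allI bound)
  then have "(\<lambda>n. char (distr M borel (\<lambda>\<omega>. \<Sum>t=1..n. X n t \<omega>)) r * ?E) \<longlonglongrightarrow> 1"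
    by (simp add: LIM_zero_iff)
  then have "(\<lambda>n. char (distr M borel (\<lambda>\<omega>. \<Sum>t=1..n. X n t \<omega>)) r * ?E * of_real (exp (- r\<^sup>2 / 2)))
      \<longlonglongrightarrow> 1 * of_real (exp (- r\<^sup>2 / 2))"
    by (rule tendsto_mult_right)
  moreover have "?E * of_real (exp (- r\<^sup>2 / 2)) = 1"
    by (simp flip: of_real_mult exp_add)
  ultimately show ?thesis by (simp only: mult.assoc mult_1 mult_1_right)
qed

section \<open>Negligible martingale sums, rare events and rates\<close>

context prob_space
begin

lemma martingale_sum_vanishes:
  fixes F :: "nat \<Rightarrow> nat \<Rightarrow> 'a measure" and X :: "nat \<Rightarrow> nat \<Rightarrow> 'a \<Rightarrow> real"
  assumes mds: "\<And>n. martingale_differences M (F n) (X n) n"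
    and var: "vanishes_in_prob M (\<lambda>n. martingale_differences.qvar M (F n) (X n) n)"
  shows "vanishes_in_prob M (\<lambda>n \<omega>. ennreal \<bar>\<Sum>t=1..n. X n t \<omega>\<bar>)"
proof (rule vanishes_in_probI)
  interpret m: martingale_differences M "F n" "X n" n for n by (rule mds)
  fix \<delta> :: real assume \<delta>: "0 < \<delta>"
  show "(\<lambda>n. prob {\<omega>\<in>space M. ennreal \<delta> < ennreal \<bar>\<Sum>t=1..n. X n t \<omega>\<bar>}) \<longlonglongrightarrow> 0"
  proof (rule tendsto_zero_le_epsilon)
    fix e :: real assume e: "0 < e"
    \<comment> \<open>The level \<open>e * \<delta>\<^sup>2\<close> makes the second summand of
      \<open>lenglart\<close> equal to \<open>e\<close>.\<close>
    have "prob {\<omega>\<in>space M. ennreal \<delta> < ennreal \<bar>\<Sum>t=1..n. X n t \<omega>\<bar>}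
        \<le> prob {\<omega>\<in>space M. ennreal (e * \<delta>\<^sup>2) < m.qvar n n \<omega>} + e" for n
      using m.lenglart[of "e * \<delta>\<^sup>2" \<delta> n] e \<delta> by (simp add: ennreal_less_iff)
    moreover have "(\<lambda>n. prob {\<omega>\<in>space M. ennreal (e * \<delta>\<^sup>2) < m.qvar n n \<omega>}) \<longlonglongrightarrow> 0"
      using e \<delta> by (intro vanishes_in_probD[OF var]) simp
    ultimately show "\<exists>g. g \<longlonglongrightarrow> 0 \<and> (\<forall>\<^sub>F n in sequentially.
        prob {\<omega>\<in>space M. ennreal \<delta> < ennreal \<bar>\<Sum>t=1..n. X n t \<omega>\<bar>} \<le> g n + e)"
      by (intro exI[of _ "\<lambda>n. prob {\<omega>\<in>space M. ennreal (e * \<delta>\<^sup>2) < m.qvar n n \<omega>}"]) (simp add: always_eventually)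
  qed simp
qed

text \<open>With the value \<open>top\<close> on the event, an upper bound containing this summand
  holds trivially there; the summand itself disappears in probability.\<close>

lemma vanishes_in_prob_event:
  fixes Y :: "nat \<Rightarrow> 'a \<Rightarrow> real"
  assumes Y: "vanishes_in_prob M (\<lambda>n \<omega>. ennreal (Y n \<omega>))" and [measurable]: "\<And>n. Y n \<in> borel_measurable M"
    and \<delta>: "0 < \<delta>" and P: "\<And>n \<omega>. \<omega> \<in> space M \<Longrightarrow> P n \<omega> \<Longrightarrow> \<delta> \<le> Y n \<omega>"
  shows "vanishes_in_prob M (\<lambda>n \<omega>. if P n \<omega> then top else 0)"
proof (rule vanishes_in_probI)
  fix \<epsilon> :: real assume "0 < \<epsilon>"
  have "prob {\<omega>\<in>space M. ennreal \<epsilon> < (if P n \<omega> then top else 0)} \<le> prob {\<omega>\<in>space M. ennreal (\<delta> / 2) < ennreal (Y n \<omega>)}" for n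
    using \<delta> P[of _ n] by (intro finite_measure_mono) (fastforce simp: ennreal_less_iff split: if_splits)+
  then show "(\<lambda>n. prob {\<omega>\<in>space M. ennreal \<epsilon> < (if P n \<omega> then top else 0)}) \<longlonglongrightarrow> 0"
    using \<delta> by (intro tendsto_zero_squeeze[OF vanishes_in_probD[OF Y, of "\<delta> / 2"]]) auto
qed

lemma vanishes_in_prob_eventually_zero:
  assumes [measurable]: "\<And>n. Y n \<in> borel_measurable M"
    and "AE \<omega> in M. \<forall>\<^sub>F n in sequentially. Y n \<omega> = 0"
  shows "vanishes_in_prob M Y"
proof (rule vanishes_in_prob_random_bound[where Y = "\<lambda>_ _. 0"])
  show "AE \<omega> in M. \<exists>K. \<forall>\<^sub>F n in sequentially. Y n \<omega> \<le> ennreal K * 0"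
    using assms(2) by eventually_elim simp
qed (simp_all add: vanishes_in_prob_def)

text \<open>The factor \<open>1 / real T\<close> of the average cancels against the rate
  \<open>1 / real T\<close>, so the rate conditions say that plain sums vanish. The cancellation
  needs a positive \<open>T\<close>, hence the eventual equality.\<close>

lemma little_o_p_inverse_imp_vanishes:
  assumes "little_o_p M (\<lambda>T \<omega>. 1 / real T * S T \<omega>) (\<lambda>T. 1 / real T)" "\<And>T \<omega>. 0 \<le> S T \<omega>"
  shows "vanishes_in_prob M (\<lambda>T \<omega>. ennreal (S T \<omega>))"
proof (rule vanishes_in_probI)
  fix \<delta> :: real assume \<delta>: "0 < \<delta>"
  have "(\<lambda>T. prob {\<omega>\<in>space M. \<bar>1 / real T * S T \<omega>\<bar> > \<delta> * (1 / real T)}) \<longlonglongrightarrow> 0"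
    using assms(1) \<delta> by (simp add: little_o_p_def)
  moreover have eq: "{\<omega>\<in>space M. \<bar>1 / real T * S T \<omega>\<bar> > \<delta> * (1 / real T)}
      = {\<omega>\<in>space M. ennreal \<delta> < ennreal (S T \<omega>)}" if "0 < T" for T
    using \<delta> assms(2) that by (auto simp: abs_mult divide_less_cancel ennreal_less_iff)
  have "\<forall>\<^sub>F T in sequentially. prob {\<omega>\<in>space M. \<bar>1 / real T * S T \<omega>\<bar> > \<delta> * (1 / real T)}
      = prob {\<omega>\<in>space M. ennreal \<delta> < ennreal (S T \<omega>)}"
    by (rule eventually_mono[OF eventually_gt_at_top[of 0]]) (simp only: eq)
  ultimately show "(\<lambda>T. prob {\<omega>\<in>space M. ennreal \<delta> < ennreal (S T \<omega>)}) \<longlonglongrightarrow> 0"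
    by (rule Lim_transform_eventually)
qed

end

section \<open>Expansion of the one-step score\<close>

text \<open>\<open>Lim\<close> has a meaning only where the limit exists and the filter is proper.
  The Lipschitz bound makes the values along one approximating sequence Cauchy, and their limit is
  the limit along the whole filter; the same sequence shows that the filter is proper.\<close>

lemma cont_ext_sequentially:
  fixes f :: "'th \<Rightarrow> real" and \<iota> :: "'th \<Rightarrow> 'b::real_normed_vector"
  assumes K: "0 \<le> K" and lip: "\<And>h h'. \<bar>f h - f h'\<bar> \<le> K * norm (\<iota> h - \<iota> h')"
    and a: "(\<lambda>n. \<iota> (a n)) \<longlonglongrightarrow> x"
  shows "(\<lambda>n. f (a n)) \<longlonglongrightarrow> cont_ext \<iota> f x"
proof -
  have "Cauchy (\<lambda>n. f (a n))"
  proof (rule metric_CauchyI)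
    fix e :: real assume e: "0 < e"
    then have "0 < e / (K + 1)" using K by simp
    from metric_CauchyD[OF LIMSEQ_imp_Cauchy[OF a] this] obtain N where
      N: "\<And>m n. m \<ge> N \<Longrightarrow> n \<ge> N \<Longrightarrow> norm (\<iota> (a m) - \<iota> (a n)) < e / (K + 1)"
      by (auto simp: dist_norm)
    show "\<exists>M. \<forall>m\<ge>M. \<forall>n\<ge>M. dist (f (a m)) (f (a n)) < e"
    proof (intro exI allI impI)
      fix m n assume mn: "N \<le> m" "N \<le> n"
      have "\<bar>f (a m) - f (a n)\<bar> \<le> (K + 1) * norm (\<iota> (a m) - \<iota> (a n))"
        using lip[of "a m" "a n"] by (simp add: distrib_right add_increasing2)
      also have "\<dots> < e" using N[OF mn] K by (simp add: field_simps)
      finally show "dist (f (a m)) (f (a n)) < e" by (simp add: dist_real_def)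
    qed
  qed
  then obtain L where L: "(\<lambda>n. f (a n)) \<longlonglongrightarrow> L"
    using Cauchy_convergent convergent_def by blast
  have "(f \<longlongrightarrow> L) (filtercomap \<iota> (nhds x))"
  proof (rule tendstoI)
    fix e :: real assume e: "0 < e"
    \<comment> \<open>One third of \<open>e\<close> is spent on the distance of
      \<open>f (a n)\<close> from \<open>L\<close>, two thirds on the Lipschitz bound across twice
      this radius; the added 1 covers \<open>K = 0\<close>.\<close>
    then have e': "0 < e / (3 * (K + 1))" using K by simp
    have "\<forall>\<^sub>F n in sequentially. dist (f (a n)) L < e / 3 \<and> dist (\<iota> (a n)) x < e / (3 * (K + 1))"
      using tendstoD[OF L, of "e / 3"] tendstoD[OF a e'] e by (auto intro: eventually_conj)
    then obtain n where n: "\<bar>f (a n) - L\<bar> < e / 3" "norm (\<iota> (a n) - x) < e / (3 * (K + 1))"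
      by (auto dest!: eventually_happens simp: dist_real_def dist_norm)
    have ev: "\<forall>\<^sub>F y in nhds x. norm (y - x) < e / (3 * (K + 1))"
      using e' by (auto simp: eventually_nhds_metric dist_norm)
    have close: "dist (f h) L < e" if h: "norm (\<iota> h - x) < e / (3 * (K + 1))" for h
    proof -
      have lip': "\<bar>f h - f (a n)\<bar> \<le> (K + 1) * norm (\<iota> h - \<iota> (a n))"
        using lip[of h "a n"] by (simp add: distrib_right add_increasing2)
      have "norm (\<iota> h - \<iota> (a n)) \<le> norm (\<iota> h - x) + norm (\<iota> (a n) - x)"
        using norm_triangle_ineq4[of "\<iota> h - x" "\<iota> (a n) - x"] by simp
      also have "\<dots> \<le> 2 * (e / (3 * (K + 1)))" using h n by simp
      finally have "(K + 1) * norm (\<iota> h - \<iota> (a n)) \<le> (K + 1) * (2 * (e / (3 * (K + 1))))"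
        using K by (intro mult_left_mono) auto
      also have "\<dots> = 2 * e / 3" using K by (simp add: field_simps)
      finally show ?thesis using n(1) lip' unfolding dist_real_def by linarith
    qed
    show "\<forall>\<^sub>F h in filtercomap \<iota> (nhds x). dist (f h) L < e"
      by (rule eventually_mono[OF eventually_filtercomapI[OF ev] close])
  qed
  moreover have "filtercomap \<iota> (nhds x) \<noteq> bot"
  proof (rule filtercomap_neq_bot)
    fix P assume "\<forall>\<^sub>F y in nhds x. P y"
    then have "\<forall>\<^sub>F n in sequentially. P (\<iota> (a n))"
      using eventually_compose_filterlim[OF _ a] by blast
    then show "\<exists>h. P (\<iota> h)" by (auto dest: eventually_happens)
  qed
  ultimately have "cont_ext \<iota> f x = L" unfolding cont_ext_def by (intro tendsto_Lim)
  then show ?thesis using L by simp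
qed

text \<open>The derivative at 0 is the pointwise limit of the difference quotients with steps 1/(n +
  1), each of which is measurable.\<close>

lemma borel_measurable_deriv_parameter:
  fixes g :: "real \<Rightarrow> 'z \<Rightarrow> real"
  assumes g: "\<And>s. g s \<in> borel_measurable P"
    and d: "\<And>z. z \<in> space P \<Longrightarrow> ((\<lambda>s. g s z) has_real_derivative g' z) (at 0)"
  shows "g' \<in> borel_measurable P"
proof (rule borel_measurable_LIMSEQ_real)
  let ?q = "\<lambda>n z. (g (inverse (real (Suc n))) z - g 0 z) / inverse (real (Suc n))"
  show "?q n \<in> borel_measurable P" for n using g by measurable
  fix z assume "z \<in> space P"
  from d[OF this] have "((\<lambda>s. (g s z - g 0 z) / s) \<longlongrightarrow> g' z) (at 0)"
    by (simp add: DERIV_def)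
  moreover have "filterlim (\<lambda>n. inverse (real (Suc n))) (at 0) sequentially"
    by (auto simp: filterlim_at LIMSEQ_inverse_real_of_nat simp del: of_nat_Suc)
  ultimately show "(\<lambda>n. ?q n z) \<longlonglongrightarrow> g' z" by (rule filterlim_compose)
qed

lemma has_derivative_along_line:
  fixes f :: "'b::real_normed_vector \<Rightarrow> real"
  assumes "(f has_derivative f') (at (x + s *\<^sub>R h))"
  shows "((\<lambda>s. f (x + s *\<^sub>R h)) has_real_derivative f' h) (at s)"
proof -
  have "((\<lambda>s. x + s *\<^sub>R h) has_derivative (\<lambda>t. t *\<^sub>R h)) (at s)"
    by (auto intro!: derivative_eq_intros)
  from has_derivative_compose[OF this assms]
  have "((\<lambda>s. f (x + s *\<^sub>R h)) has_derivative (\<lambda>t. f' (t *\<^sub>R h))) (at s)" .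
  moreover have "f' (t *\<^sub>R h) = f' h * t" for t
    using linear_scale[OF has_derivative_linear[OF assms]] by simp
  ultimately show ?thesis by (simp add: has_field_derivative_def mult.commute[of _ "f' h"])
qed

lemma has_real_derivative_shift:
  fixes g :: "real \<Rightarrow> real"
  assumes "((\<lambda>d. g (s + d)) has_real_derivative D) (at 0)"
  shows "(g has_real_derivative D) (at s)"
  using assms DERIV_shift[of g D 0 s] by (simp add: add.commute)

lemma mvt_unit_interval:
  fixes g :: "real \<Rightarrow> real"
  assumes "\<And>s. 0 \<le> s \<Longrightarrow> s \<le> 1 \<Longrightarrow> (g has_real_derivative g' s) (at s)"
  obtains s where "0 < s" "s < 1" "g 1 - g 0 = g' s"
  using MVT2[of 0 1 g g'] assms by auto

lemma segment_in_ball: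
  fixes x y :: "'b::real_normed_vector"
  assumes "norm (y - x) < r" "0 \<le> s" "s \<le> 1"
  shows "x + s *\<^sub>R (y - x) \<in> ball x r" and "norm (s *\<^sub>R (y - x)) \<le> norm (y - x)"
proof -
  show "norm (s *\<^sub>R (y - x)) \<le> norm (y - x)" using assms by (simp add: mult_left_le_one_le)
  then show "x + s *\<^sub>R (y - x) \<in> ball x r" using assms by (simp add: dist_norm)
qed

text \<open>Regularity and envelope for one observation, with all existential radii merged into
  \<open>\<rho>\<close> and the envelope function named \<open>C\<close>, so that no further choices
  are necessary.\<close>

locale one_step = prob_space P for P :: "'z measure" +
  fixes l :: "'th::real_normed_vector \<Rightarrow> 'up::real_normed_vector \<Rightarrow> 'z \<Rightarrow> real"
    and m :: "'th \<Rightarrow> 'z \<Rightarrow> real" and \<theta>\<^sub>0 :: 'th and \<eta>\<^sub>0 :: 'up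
    and \<iota> :: "'th \<Rightarrow> 'b::banach" and \<alpha> :: 'b and \<rho> :: real and C :: "'z \<Rightarrow> real"
  assumes score_measurable: "(\<lambda>(\<theta>, \<eta>, h, z). score l \<theta> \<eta> z h)
      \<in> borel_measurable (borel \<Otimes>\<^sub>M (borel \<Otimes>\<^sub>M (borel \<Otimes>\<^sub>M P)))"
    and m_measurable: "(\<lambda>(\<theta>, z). m \<theta> z) \<in> borel_measurable (borel \<Otimes>\<^sub>M P)"
    and radius: "0 < \<rho>"
    and loss_differentiable: "\<And>z \<eta>. z \<in> space P \<Longrightarrow> \<eta> \<in> ball \<eta>\<^sub>0 \<rho> \<Longrightarrow>
      twice_frechet_differentiable_on (\<lambda>\<theta>. l \<theta> \<eta> z) (ball \<theta>\<^sub>0 \<rho>)"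
    and m_differentiable: "\<And>z \<theta>. z \<in> space P \<Longrightarrow> \<theta> \<in> ball \<theta>\<^sub>0 \<rho> \<Longrightarrow> (\<lambda>\<theta>. m \<theta> z) differentiable (at \<theta>)"
    and mixed: "\<And>z \<theta> \<eta> h v. z \<in> space P \<Longrightarrow> \<theta> \<in> ball \<theta>\<^sub>0 \<rho> \<Longrightarrow> \<eta> \<in> ball \<eta>\<^sub>0 \<rho> \<Longrightarrow>
      (\<lambda>\<delta>::real. score l \<theta> (\<eta> + \<delta> *\<^sub>R v) z h) differentiable (at 0)"
    and first_order: "\<And>h. (\<integral>z. score l \<theta>\<^sub>0 \<eta>\<^sub>0 z h \<partial>P) = 0"
    and orthogonality: "\<And>h u. (\<integral>z. d_eta_theta l \<theta>\<^sub>0 \<eta>\<^sub>0 z h u \<partial>P) = 0"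
    and coercive: "\<exists>c>0. \<forall>h. c * (norm h)\<^sup>2 \<le> hessian P l \<theta>\<^sub>0 \<eta>\<^sub>0 h h"
    and completion: "is_completion (\<lambda>h. sqrt (hessian P l \<theta>\<^sub>0 \<eta>\<^sub>0 h h)) \<iota>"
    and riesz: "riesz_representer P l m \<theta>\<^sub>0 \<eta>\<^sub>0 \<iota> \<alpha>"
    and C_measurable[measurable]: "C \<in> borel_measurable P"
    and C_nonneg: "\<And>z. z \<in> space P \<Longrightarrow> 0 \<le> C z"
    and C_moment: "integrable P (\<lambda>z. C z ^ 4)"
    and envelope: "\<And>\<theta> \<theta>' \<eta> \<eta>' z h u v. \<theta> \<in> ball \<theta>\<^sub>0 \<rho> \<Longrightarrow> \<theta>' \<in> ball \<theta>\<^sub>0 \<rho> \<Longrightarrow>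
      \<eta> \<in> ball \<eta>\<^sub>0 \<rho> \<Longrightarrow> \<eta>' \<in> ball \<eta>\<^sub>0 \<rho> \<Longrightarrow> z \<in> space P \<Longrightarrow>
        \<bar>m \<theta> z\<bar> \<le> C z \<and>
        \<bar>d_theta m \<theta> z h\<bar> \<le> C z * norm h \<and>
        \<bar>score l \<theta>\<^sub>0 \<eta>\<^sub>0 z h\<bar> \<le> C z * norm h \<and>
        \<bar>score2 l \<theta> \<eta> z h u\<bar> \<le> C z * norm h * norm u \<and>
        \<bar>d_eta_theta l \<theta> \<eta> z h v\<bar> \<le> C z * norm h * norm v \<and>
        \<bar>d_theta m \<theta> z h - d_theta m \<theta>' z h\<bar> \<le> C z * norm (\<theta> - \<theta>') * norm h \<and>
        \<bar>d_eta_theta l \<theta> \<eta> z h v - d_eta_theta l \<theta>' \<eta>' z h v\<bar>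
          \<le> C z * (norm (\<theta> - \<theta>') + norm (\<eta> - \<eta>')) * norm h * norm v \<and>
        \<bar>score2 l \<theta> \<eta> z h u - score2 l \<theta>' \<eta>' z h u\<bar>
          \<le> C z * (norm (\<theta> - \<theta>') + norm (\<eta> - \<eta>')) * norm h * norm u"
begin

declare radius[simp]

lemma center[simp]: "\<theta>\<^sub>0 \<in> ball \<theta>\<^sub>0 \<rho>" "\<eta>\<^sub>0 \<in> ball \<eta>\<^sub>0 \<rho>"
  using radius by auto

text \<open>\<open>d_theta\<close> and \<open>dd_theta\<close> are derivatives along lines and are
  not linear by definition. Frechet differentiability identifies the score with
  \<open>f' \<theta>\<close> and the second derivative with the derivative of \<open>f'\<close>,
  whose values are linear maps. The first identification holds on an open ball, so it may be
  differentiated once more.\<close>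

lemma score_properties:
  assumes z: "z \<in> space P" and \<eta>: "\<eta> \<in> ball \<eta>\<^sub>0 \<rho>"
  shows score_linear: "\<theta> \<in> ball \<theta>\<^sub>0 \<rho> \<Longrightarrow> linear (score l \<theta> \<eta> z)"
    and score2_linear: "\<theta> \<in> ball \<theta>\<^sub>0 \<rho> \<Longrightarrow> linear (score2 l \<theta> \<eta> z h)"
    and score_deriv: "\<theta> + s *\<^sub>R h \<in> ball \<theta>\<^sub>0 \<rho> \<Longrightarrow>
      ((\<lambda>s. score l (\<theta> + s *\<^sub>R h) \<eta> z u) has_real_derivative score2 l (\<theta> + s *\<^sub>R h) \<eta> z h u) (at s)"
proof -
  obtain f' where f': "\<And>x. x \<in> ball \<theta>\<^sub>0 \<rho> \<Longrightarrow> ((\<lambda>\<theta>. l \<theta> \<eta> z) has_derivative blinfun_apply (f' x)) (at x)"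
    and f'_diff: "\<And>x. x \<in> ball \<theta>\<^sub>0 \<rho> \<Longrightarrow> f' differentiable (at x)"
    using loss_differentiable[OF z \<eta>] unfolding twice_frechet_differentiable_on_def by blast
  have score: "score l \<theta> \<eta> z h = blinfun_apply (f' \<theta>) h" if "\<theta> \<in> ball \<theta>\<^sub>0 \<rho>" for \<theta> h
    unfolding d_theta_def
    by (intro DERIV_imp_deriv has_derivative_along_line[where s = 0, simplified]) (use f'[OF that] in simp)
  have blinfun_linear: "linear (blinfun_apply A)" for A :: "'th \<Rightarrow>\<^sub>L real"
    by (rule bounded_linear.linear[OF blinfun.bounded_linear_right])
  show "linear (score l \<theta> \<eta> z)" if "\<theta> \<in> ball \<theta>\<^sub>0 \<rho>"
  proof -
    have "score l \<theta> \<eta> z = blinfun_apply (f' \<theta>)" using score[OF that] by auto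
    then show ?thesis by (simp add: blinfun_linear)
  qed
  have deriv: "((\<lambda>s. score l (\<theta> + s *\<^sub>R h) \<eta> z u) has_real_derivative blinfun_apply (F h) u) (at s)"
    if x: "\<theta> + s *\<^sub>R h \<in> ball \<theta>\<^sub>0 \<rho>" and F: "(f' has_derivative F) (at (\<theta> + s *\<^sub>R h))" for \<theta> s h u F
  proof -
    have "((\<lambda>x. blinfun_apply (f' x) u) has_derivative (\<lambda>h. blinfun_apply (F h) u)) (at (\<theta> + s *\<^sub>R h))"
      using F by (auto intro!: derivative_eq_intros)
    from has_derivative_along_line[OF this]
    have d: "((\<lambda>s. blinfun_apply (f' (\<theta> + s *\<^sub>R h)) u) has_real_derivative blinfun_apply (F h) u) (at s)" .
    have "open ((\<lambda>s. \<theta> + s *\<^sub>R h) -` ball \<theta>\<^sub>0 \<rho>)"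
      by (intro open_vimage open_ball continuous_intros)
    then have "\<forall>\<^sub>F s in nhds s. s \<in> (\<lambda>s. \<theta> + s *\<^sub>R h) -` ball \<theta>\<^sub>0 \<rho>"
      using x by (intro eventually_nhds_in_open) auto
    then have ev: "\<forall>\<^sub>F s in nhds s. blinfun_apply (f' (\<theta> + s *\<^sub>R h)) u = score l (\<theta> + s *\<^sub>R h) \<eta> z u"
      by eventually_elim (simp add: score)
    show ?thesis by (rule DERIV_cong_ev[OF refl ev refl, THEN iffD1]) (rule d)
  qed
  have score2: "score2 l \<theta> \<eta> z h u = blinfun_apply (F h) u"
    if x: "\<theta> \<in> ball \<theta>\<^sub>0 \<rho>" and F: "(f' has_derivative F) (at \<theta>)" for \<theta> h u F
  proof -
    have "((\<lambda>s. score l (\<theta> + s *\<^sub>R h) \<eta> z u) has_real_derivative blinfun_apply (F h) u) (at 0)"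
      using x F by (intro deriv) auto
    then show ?thesis unfolding dd_theta_def d_theta_def by (rule DERIV_imp_deriv)
  qed
  show "linear (score2 l \<theta> \<eta> z h)" if \<theta>: "\<theta> \<in> ball \<theta>\<^sub>0 \<rho>"
  proof -
    obtain F where F: "(f' has_derivative F) (at \<theta>)" using f'_diff[OF \<theta>] by (auto simp: differentiable_def)
    have "score2 l \<theta> \<eta> z h = blinfun_apply (F h)" using score2[OF \<theta> F] by auto
    then show ?thesis by (simp add: blinfun_linear)
  qed
  show "((\<lambda>s. score l (\<theta> + s *\<^sub>R h) \<eta> z u) has_real_derivative score2 l (\<theta> + s *\<^sub>R h) \<eta> z h u) (at s)"
    if x: "\<theta> + s *\<^sub>R h \<in> ball \<theta>\<^sub>0 \<rho>"
  proof -
    obtain F where F: "(f' has_derivative F) (at (\<theta> + s *\<^sub>R h))"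
      using f'_diff[OF x] by (auto simp: differentiable_def)
    show ?thesis using deriv[OF x F] score2[OF x F] by simp
  qed
qed

lemma m_deriv:
  assumes z: "z \<in> space P" and x: "\<theta> + s *\<^sub>R h \<in> ball \<theta>\<^sub>0 \<rho>"
  shows "((\<lambda>s. m (\<theta> + s *\<^sub>R h) z) has_real_derivative d_theta m (\<theta> + s *\<^sub>R h) z h) (at s)"
proof -
  obtain m' where m': "((\<lambda>\<theta>. m \<theta> z) has_derivative m') (at (\<theta> + s *\<^sub>R h))"
    using m_differentiable[OF z x] by (auto simp: differentiable_def)
  have "((\<lambda>d. m (\<theta> + s *\<^sub>R h + d *\<^sub>R h) z) has_real_derivative m' h) (at 0)"
    using m' by (intro has_derivative_along_line) simp
  then have "d_theta m (\<theta> + s *\<^sub>R h) z h = m' h" unfolding d_theta_def by (rule DERIV_imp_deriv)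
  then show ?thesis using has_derivative_along_line[OF m'] by simp
qed

text \<open>\<open>mixed\<close> gives differentiability at 0 from every base point near the truth.
  Taking the base point on the line yields it at every parameter of the line.\<close>

lemma score_eta_deriv:
  assumes z: "z \<in> space P" and \<theta>: "\<theta> \<in> ball \<theta>\<^sub>0 \<rho>" and \<eta>: "\<eta> + s *\<^sub>R v \<in> ball \<eta>\<^sub>0 \<rho>"
  shows "((\<lambda>s. score l \<theta> (\<eta> + s *\<^sub>R v) z h) has_real_derivative d_eta_theta l \<theta> (\<eta> + s *\<^sub>R v) z h v) (at s)"
proof (rule has_real_derivative_shift)
  have "((\<lambda>d. score l \<theta> (\<eta> + s *\<^sub>R v + d *\<^sub>R v) z h) has_real_derivative
      deriv (\<lambda>d. score l \<theta> (\<eta> + s *\<^sub>R v + d *\<^sub>R v) z h) 0) (at 0)"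
    using mixed[OF z \<theta> \<eta>, of v h] by (simp add: DERIV_deriv_iff_real_differentiable)
  then show "((\<lambda>d. score l \<theta> (\<eta> + (s + d) *\<^sub>R v) z h) has_real_derivative
      d_eta_theta l \<theta> (\<eta> + s *\<^sub>R v) z h v) (at 0)"
    unfolding d_eta_theta_def d_theta_def by (simp add: scaleR_add_left add.assoc)
qed

lemma m_section[measurable]: "m \<theta> \<in> borel_measurable P"
  using measurable_compose[OF measurable_Pair1'[of \<theta> borel P] m_measurable] by simp

lemma score_section[measurable]: "(\<lambda>z. score l \<theta> \<eta> z h) \<in> borel_measurable P"
proof -
  have "(\<lambda>z. (\<theta>, \<eta>, h, z)) \<in> P \<rightarrow>\<^sub>M borel \<Otimes>\<^sub>M (borel \<Otimes>\<^sub>M (borel \<Otimes>\<^sub>M P))" by measurable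
  from measurable_compose[OF this score_measurable] show ?thesis by simp
qed

lemma d_theta_m_section[measurable]: "(\<lambda>z. d_theta m \<theta>\<^sub>0 z h) \<in> borel_measurable P"
  by (rule borel_measurable_deriv_parameter[of "\<lambda>s. m (\<theta>\<^sub>0 + s *\<^sub>R h)"])
    (use radius m_deriv[where s = 0 and \<theta> = \<theta>\<^sub>0] in auto)

lemma score2_section[measurable]: "(\<lambda>z. score2 l \<theta>\<^sub>0 \<eta>\<^sub>0 z h u) \<in> borel_measurable P"
  by (rule borel_measurable_deriv_parameter[of "\<lambda>s z. score l (\<theta>\<^sub>0 + s *\<^sub>R h) \<eta>\<^sub>0 z u"])
    (use radius score_deriv[where s = 0 and \<theta> = \<theta>\<^sub>0] in auto)

lemma d_eta_theta_section[measurable]: "(\<lambda>z. d_eta_theta l \<theta>\<^sub>0 \<eta>\<^sub>0 z h v) \<in> borel_measurable P"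
  by (rule borel_measurable_deriv_parameter[of "\<lambda>s z. score l \<theta>\<^sub>0 (\<eta>\<^sub>0 + s *\<^sub>R v) z h"])
    (use radius score_eta_deriv[where s = 0 and \<eta> = \<eta>\<^sub>0] in auto)

lemma integrable_C: "integrable P C" and integrable_C_sq: "integrable P (\<lambda>z. (C z)\<^sup>2)"
proof -
  have *: "x \<le> 1 + x ^ 4" "x\<^sup>2 \<le> 1 + x ^ 4" if "0 \<le> x" for x :: real
  proof -
    have "2 * x\<^sup>2 \<le> 1 + x ^ 4" using zero_le_power2[of "x\<^sup>2 - 1"] unfolding power2_diff by simp
    moreover have "2 * x \<le> 1 + x\<^sup>2" using zero_le_power2[of "x - 1"] unfolding power2_diff by simp
    moreover have "0 \<le> x\<^sup>2" "0 \<le> x ^ 4" by simp_all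
    ultimately show "x \<le> 1 + x ^ 4" "x\<^sup>2 \<le> 1 + x ^ 4" by linarith+
  qed
  have int: "integrable P (\<lambda>z. 1 + C z ^ 4)" using C_moment by simp
  show "integrable P C"
    by (rule Bochner_Integration.integrable_bound[OF int]) (auto intro!: AE_I2 simp: C_nonneg *)
  show "integrable P (\<lambda>z. (C z)\<^sup>2)"
    by (rule Bochner_Integration.integrable_bound[OF int]) (auto intro!: AE_I2 simp: C_nonneg *)
qed

lemma integrable_le_C:
  assumes "f \<in> borel_measurable P" "\<And>z. z \<in> space P \<Longrightarrow> \<bar>f z\<bar> \<le> C z * k"
  shows "integrable P f" and "\<bar>\<integral>z. f z \<partial>P\<bar> \<le> (\<integral>z. C z \<partial>P) * k"
proof -
  have int: "integrable P (\<lambda>z. C z * k)" using integrable_C by simp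
  show f: "integrable P f"
    by (rule Bochner_Integration.integrable_bound[OF int])
      (use assms in \<open>auto intro!: AE_I2 intro: order_trans[OF _ abs_ge_self]\<close>)
  have "\<bar>\<integral>z. f z \<partial>P\<bar> \<le> (\<integral>z. \<bar>f z\<bar> \<partial>P)" by (rule integral_abs_bound)
  also have "\<dots> \<le> (\<integral>z. C z * k \<partial>P)" using f int assms(2) by (intro integral_mono) auto
  finally show "\<bar>\<integral>z. f z \<partial>P\<bar> \<le> (\<integral>z. C z \<partial>P) * k" by simp
qed

end

section \<open>Taylor remainders and the representer in the completion\<close>

context one_step
begin

text \<open>Mean value theorem on the segment from the truth: the envelope bounds the derivative at
  the intermediate point, and its Lipschitz condition moves that point back to the truth. The two
  lemmas on the score follow the same pattern.\<close>

lemma m_increment: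
  assumes z: "z \<in> space P" and \<theta>: "\<theta> \<in> ball \<theta>\<^sub>0 \<rho>"
  shows "\<bar>m \<theta> z - m \<theta>\<^sub>0 z\<bar> \<le> C z * norm (\<theta> - \<theta>\<^sub>0)"
    and "\<bar>m \<theta> z - m \<theta>\<^sub>0 z - d_theta m \<theta>\<^sub>0 z (\<theta> - \<theta>\<^sub>0)\<bar> \<le> C z * (norm (\<theta> - \<theta>\<^sub>0))\<^sup>2"
proof -
  let ?h = "\<theta> - \<theta>\<^sub>0"
  have n: "norm ?h < \<rho>" using \<theta> by (simp add: dist_norm norm_minus_commute)
  note seg = segment_in_ball[OF n]
  obtain s where s: "0 < s" "s < 1" "m (\<theta>\<^sub>0 + 1 *\<^sub>R ?h) z - m (\<theta>\<^sub>0 + 0 *\<^sub>R ?h) z = d_theta m (\<theta>\<^sub>0 + s *\<^sub>R ?h) z ?h"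
    by (rule mvt_unit_interval[OF m_deriv[OF z seg(1)]]) auto
  let ?\<theta> = "\<theta>\<^sub>0 + s *\<^sub>R ?h"
  have in_ball: "?\<theta> \<in> ball \<theta>\<^sub>0 \<rho>" using s by (intro seg) auto
  have le: "norm (?\<theta> - \<theta>\<^sub>0) \<le> norm ?h" using seg(2)[of s] s by simp
  have eq: "m \<theta> z - m \<theta>\<^sub>0 z = d_theta m ?\<theta> z ?h" using s(3) by simp
  show "\<bar>m \<theta> z - m \<theta>\<^sub>0 z\<bar> \<le> C z * norm ?h"
    unfolding eq using envelope[OF in_ball in_ball center(2) center(2) z, of ?h] by blast
  have "\<bar>d_theta m ?\<theta> z ?h - d_theta m \<theta>\<^sub>0 z ?h\<bar> \<le> C z * norm (?\<theta> - \<theta>\<^sub>0) * norm ?h"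
    using envelope[OF in_ball center(1) center(2) center(2) z, of ?h] by blast
  also have "\<dots> \<le> C z * norm ?h * norm ?h"
    using le C_nonneg[OF z] by (intro mult_right_mono mult_left_mono) auto
  finally show "\<bar>m \<theta> z - m \<theta>\<^sub>0 z - d_theta m \<theta>\<^sub>0 z ?h\<bar> \<le> C z * (norm ?h)\<^sup>2"
    unfolding eq by (simp add: power2_eq_square mult.assoc)
qed

lemma score_theta_increment:
  assumes z: "z \<in> space P" and \<theta>: "\<theta> \<in> ball \<theta>\<^sub>0 \<rho>" and \<eta>: "\<eta> \<in> ball \<eta>\<^sub>0 \<rho>"
  shows "\<bar>score l \<theta> \<eta> z a - score l \<theta>\<^sub>0 \<eta> z a\<bar> \<le> C z * norm (\<theta> - \<theta>\<^sub>0) * norm a"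
    and "\<bar>score l \<theta> \<eta> z a - score l \<theta>\<^sub>0 \<eta> z a - score2 l \<theta>\<^sub>0 \<eta>\<^sub>0 z (\<theta> - \<theta>\<^sub>0) a\<bar>
      \<le> C z * (norm (\<theta> - \<theta>\<^sub>0) + norm (\<eta> - \<eta>\<^sub>0)) * norm (\<theta> - \<theta>\<^sub>0) * norm a"
proof -
  let ?h = "\<theta> - \<theta>\<^sub>0"
  have n: "norm ?h < \<rho>" using \<theta> by (simp add: dist_norm norm_minus_commute)
  note seg = segment_in_ball[OF n]
  obtain s where s: "0 < s" "s < 1"
    "score l (\<theta>\<^sub>0 + 1 *\<^sub>R ?h) \<eta> z a - score l (\<theta>\<^sub>0 + 0 *\<^sub>R ?h) \<eta> z a = score2 l (\<theta>\<^sub>0 + s *\<^sub>R ?h) \<eta> z ?h a"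
    by (rule mvt_unit_interval[OF score_deriv[OF z \<eta> seg(1)]]) auto
  let ?\<theta> = "\<theta>\<^sub>0 + s *\<^sub>R ?h"
  have in_ball: "?\<theta> \<in> ball \<theta>\<^sub>0 \<rho>" using s by (intro seg) auto
  have le: "norm (?\<theta> - \<theta>\<^sub>0) \<le> norm ?h" using seg(2)[of s] s by simp
  have eq: "score l \<theta> \<eta> z a - score l \<theta>\<^sub>0 \<eta> z a = score2 l ?\<theta> \<eta> z ?h a" using s(3) by simp
  show "\<bar>score l \<theta> \<eta> z a - score l \<theta>\<^sub>0 \<eta> z a\<bar> \<le> C z * norm ?h * norm a"
    unfolding eq using envelope[OF in_ball in_ball \<eta> \<eta> z, of ?h a] by blast
  \<comment> \<open>The Lipschitz condition moves both arguments at once, so the expansion in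
    \<theta> at an estimated nuisance ends with the second derivative at the true nuisance.\<close>
  have "\<bar>score2 l ?\<theta> \<eta> z ?h a - score2 l \<theta>\<^sub>0 \<eta>\<^sub>0 z ?h a\<bar>
      \<le> C z * (norm (?\<theta> - \<theta>\<^sub>0) + norm (\<eta> - \<eta>\<^sub>0)) * norm ?h * norm a"
    using envelope[OF in_ball center(1) \<eta> center(2) z, of ?h a] by blast
  also have "\<dots> \<le> C z * (norm ?h + norm (\<eta> - \<eta>\<^sub>0)) * norm ?h * norm a"
    using le C_nonneg[OF z] by (intro mult_right_mono mult_left_mono add_right_mono) auto
  finally show "\<bar>score l \<theta> \<eta> z a - score l \<theta>\<^sub>0 \<eta> z a - score2 l \<theta>\<^sub>0 \<eta>\<^sub>0 z ?h a\<bar>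
      \<le> C z * (norm ?h + norm (\<eta> - \<eta>\<^sub>0)) * norm ?h * norm a"
    unfolding eq .
qed

lemma score_eta_increment:
  assumes z: "z \<in> space P" and \<eta>: "\<eta> \<in> ball \<eta>\<^sub>0 \<rho>"
  shows "\<bar>score l \<theta>\<^sub>0 \<eta> z a - score l \<theta>\<^sub>0 \<eta>\<^sub>0 z a\<bar> \<le> C z * norm a * norm (\<eta> - \<eta>\<^sub>0)"
    and "\<bar>score l \<theta>\<^sub>0 \<eta> z a - score l \<theta>\<^sub>0 \<eta>\<^sub>0 z a - d_eta_theta l \<theta>\<^sub>0 \<eta>\<^sub>0 z a (\<eta> - \<eta>\<^sub>0)\<bar>
      \<le> C z * (norm (\<eta> - \<eta>\<^sub>0))\<^sup>2 * norm a"
proof -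
  let ?v = "\<eta> - \<eta>\<^sub>0"
  have n: "norm ?v < \<rho>" using \<eta> by (simp add: dist_norm norm_minus_commute)
  note seg = segment_in_ball[OF n]
  obtain s where s: "0 < s" "s < 1"
    "score l \<theta>\<^sub>0 (\<eta>\<^sub>0 + 1 *\<^sub>R ?v) z a - score l \<theta>\<^sub>0 (\<eta>\<^sub>0 + 0 *\<^sub>R ?v) z a = d_eta_theta l \<theta>\<^sub>0 (\<eta>\<^sub>0 + s *\<^sub>R ?v) z a ?v"
    by (rule mvt_unit_interval[OF score_eta_deriv[OF z center(1) seg(1)]]) auto
  let ?\<eta> = "\<eta>\<^sub>0 + s *\<^sub>R ?v"
  have in_ball: "?\<eta> \<in> ball \<eta>\<^sub>0 \<rho>" using s by (intro seg) auto
  have le: "norm (?\<eta> - \<eta>\<^sub>0) \<le> norm ?v" using seg(2)[of s] s by simp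
  have eq: "score l \<theta>\<^sub>0 \<eta> z a - score l \<theta>\<^sub>0 \<eta>\<^sub>0 z a = d_eta_theta l \<theta>\<^sub>0 ?\<eta> z a ?v" using s(3) by simp
  show "\<bar>score l \<theta>\<^sub>0 \<eta> z a - score l \<theta>\<^sub>0 \<eta>\<^sub>0 z a\<bar> \<le> C z * norm a * norm ?v"
    unfolding eq using envelope[OF center(1) center(1) in_ball in_ball z, of a _ ?v] by blast
  have "\<bar>d_eta_theta l \<theta>\<^sub>0 ?\<eta> z a ?v - d_eta_theta l \<theta>\<^sub>0 \<eta>\<^sub>0 z a ?v\<bar>
      \<le> C z * (norm (\<theta>\<^sub>0 - \<theta>\<^sub>0) + norm (?\<eta> - \<eta>\<^sub>0)) * norm a * norm ?v"
    using envelope[OF center(1) center(1) in_ball center(2) z, of a _ ?v] by blast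
  also have "\<dots> \<le> C z * (norm (\<theta>\<^sub>0 - \<theta>\<^sub>0) + norm ?v) * norm a * norm ?v"
    using le C_nonneg[OF z] by (intro mult_right_mono mult_left_mono add_left_mono) auto
  also have "\<dots> = C z * (norm ?v)\<^sup>2 * norm a" by (simp add: power2_eq_square)
  finally show "\<bar>score l \<theta>\<^sub>0 \<eta> z a - score l \<theta>\<^sub>0 \<eta>\<^sub>0 z a - d_eta_theta l \<theta>\<^sub>0 \<eta>\<^sub>0 z a ?v\<bar>
      \<le> C z * (norm ?v)\<^sup>2 * norm a"
    unfolding eq .
qed

lemma \<iota>_linear: "linear \<iota>" using completion by (simp add: is_completion_def)

lemma norm_\<iota>: "norm (\<iota> h) = sqrt (hessian P l \<theta>\<^sub>0 \<eta>\<^sub>0 h h)"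
  using completion by (simp add: is_completion_def)

text \<open>Coercivity in the form used below: what is continuous for the norm of the parameter
  space is continuous for the Hessian norm, and therefore extends to the completion.\<close>

lemma norm_le_\<iota>: "\<exists>k\<ge>0. \<forall>h. norm h \<le> k * norm (\<iota> h)"
proof -
  obtain c where c: "0 < c" "\<And>h. c * (norm h)\<^sup>2 \<le> hessian P l \<theta>\<^sub>0 \<eta>\<^sub>0 h h" using coercive by blast
  have "norm h \<le> inverse (sqrt c) * norm (\<iota> h)" for h
  proof -
    have "sqrt (c * (norm h)\<^sup>2) \<le> norm (\<iota> h)" unfolding norm_\<iota> using c by simp
    then show ?thesis using c by (simp add: real_sqrt_mult field_simps)
  qed
  then show ?thesis using c by (intro exI[of _ "inverse (sqrt c)"]) auto
qed

text \<open>One sequence serves all extensions, so the extended values of different functionals are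
  limits along the same parameters and inequalities between them pass to the limit.\<close>

definition approx :: "nat \<Rightarrow> 'th" where
  "approx = (SOME a. (\<lambda>n. \<iota> (a n)) \<longlonglongrightarrow> \<alpha>)"

lemma approx: "(\<lambda>n. \<iota> (approx n)) \<longlonglongrightarrow> \<alpha>"
proof -
  have "\<alpha> \<in> closure (range \<iota>)" using completion by (simp add: is_completion_def)
  then obtain b where b: "\<forall>n. b n \<in> range \<iota>" "b \<longlonglongrightarrow> \<alpha>" by (auto simp: closure_sequential)
  then have "\<forall>n. \<exists>a. b n = \<iota> a" by auto
  then obtain a where "\<And>n. b n = \<iota> (a n)" by metis
  then have "b = (\<lambda>n. \<iota> (a n))" by auto
  then have "(\<lambda>n. \<iota> (a n)) \<longlonglongrightarrow> \<alpha>" using b by simp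
  then show ?thesis unfolding approx_def by (rule someI[of "\<lambda>a. (\<lambda>n. \<iota> (a n)) \<longlonglongrightarrow> \<alpha>"])
qed

lemma cont_ext_approx:
  assumes lin: "linear f" and bound: "\<And>h. \<bar>f h\<bar> \<le> k * norm h" "0 \<le> k"
  shows "(\<lambda>n. f (approx n)) \<longlonglongrightarrow> cont_ext \<iota> f \<alpha>"
proof -
  obtain k' where k': "0 \<le> k'" "\<And>h. norm h \<le> k' * norm (\<iota> h)" using norm_le_\<iota> by blast
  show ?thesis
  proof (rule cont_ext_sequentially[where \<iota> = \<iota> and K = "k * k'", OF _ _ approx])
    show "0 \<le> k * k'" using bound k' by simp
    fix h h' :: 'th
    have "\<bar>f h - f h'\<bar> = \<bar>f (h - h')\<bar>" by (simp add: linear_diff[OF lin])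
    also have "\<dots> \<le> k * norm (h - h')" by (rule bound)
    also have "\<dots> \<le> k * (k' * norm (\<iota> (h - h')))" using k' bound by (intro mult_left_mono) auto
    finally show "\<bar>f h - f h'\<bar> \<le> k * k' * norm (\<iota> h - \<iota> h')"
      by (simp add: linear_diff[OF \<iota>_linear] mult.assoc)
  qed
qed

text \<open>The extended parameter norm of \<open>\<iota> a - \<alpha>\<close>, as opposed to the
  norm of the completion. This is the distance that the rate condition for the representer controls;
  \<open>ext_dist 0\<close> is the extended norm of \<alpha>.\<close>

definition ext_dist :: "'th \<Rightarrow> real" where
  "ext_dist a = cont_ext \<iota> norm (\<iota> a - \<alpha>)"

lemma ext_dist: "(\<lambda>n. norm (a - approx n)) \<longlonglongrightarrow> ext_dist a"
proof -
  obtain k' where k': "0 \<le> k'" "\<And>h. norm h \<le> k' * norm (\<iota> h)" using norm_le_\<iota> by blast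
  show ?thesis unfolding ext_dist_def
  proof (rule cont_ext_sequentially[where \<iota> = \<iota> and f = norm and a = "\<lambda>n. a - approx n", OF k'(1)])
    fix h h' :: 'th
    have "\<bar>norm h - norm h'\<bar> \<le> norm (h - h')" by (rule norm_triangle_ineq3)
    also have "\<dots> \<le> k' * norm (\<iota> (h - h'))" by (rule k')
    finally show "\<bar>norm h - norm h'\<bar> \<le> k' * norm (\<iota> h - \<iota> h')"
      by (simp add: linear_diff[OF \<iota>_linear])
    show "(\<lambda>n. \<iota> (a - approx n)) \<longlonglongrightarrow> \<iota> a - \<alpha>"
      unfolding linear_diff[OF \<iota>_linear] by (intro tendsto_intros approx)
  qed
qed

lemma ext_dist_nonneg: "0 \<le> ext_dist a"
  by (rule LIMSEQ_le_const[OF ext_dist]) auto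

lemma ext_dist_measurable[measurable]: "ext_dist \<in> borel_measurable borel"
  by (rule borel_measurable_LIMSEQ_real[OF ext_dist])
    (intro borel_measurable_continuous_onI continuous_intros)

lemma norm_le_ext_dist: "norm a \<le> ext_dist a + ext_dist 0"
proof (rule LIMSEQ_le_const[OF tendsto_add[OF ext_dist[of a] ext_dist[of 0]]])
  show "\<exists>N. \<forall>n\<ge>N. norm a \<le> norm (a - approx n) + norm (0 - approx n)"
    using norm_triangle_ineq[of "a - approx n" "approx n" for n] by auto
qed

text \<open>The inequality is a limit of |f a - f (approx n)| <= k norm (a - approx n). It stands in
  for the bound on \<open>f\<close> at the difference of \<open>a\<close> and \<alpha>, which need
  not be a parameter.\<close>

lemma linear_cont_ext_diff:
  assumes lin: "linear f" and bound: "\<And>h. \<bar>f h\<bar> \<le> k * norm h" "0 \<le> k"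
  shows "\<bar>f a - cont_ext \<iota> f \<alpha>\<bar> \<le> k * ext_dist a"
proof (rule LIMSEQ_le)
  show "(\<lambda>n. \<bar>f a - f (approx n)\<bar>) \<longlonglongrightarrow> \<bar>f a - cont_ext \<iota> f \<alpha>\<bar>"
    by (intro tendsto_intros cont_ext_approx[OF assms])
  show "(\<lambda>n. k * norm (a - approx n)) \<longlonglongrightarrow> k * ext_dist a"
    by (intro tendsto_intros ext_dist)
  show "\<exists>N. \<forall>n\<ge>N. \<bar>f a - f (approx n)\<bar> \<le> k * norm (a - approx n)"
    using bound(1)[of "a - approx n" for n] by (auto simp: linear_diff[OF lin])
qed

definition ext_score :: "'z \<Rightarrow> real" where
  "ext_score z = cont_ext \<iota> (\<lambda>h. score l \<theta>\<^sub>0 \<eta>\<^sub>0 z h) \<alpha>"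

lemma score_bound: "z \<in> space P \<Longrightarrow> \<bar>score l \<theta>\<^sub>0 \<eta>\<^sub>0 z h\<bar> \<le> C z * norm h"
  using envelope[OF center(1) center(1) center(2) center(2), of z h] by blast

lemma ext_score_approx:
  assumes z: "z \<in> space P"
  shows "(\<lambda>n. score l \<theta>\<^sub>0 \<eta>\<^sub>0 z (approx n)) \<longlonglongrightarrow> ext_score z"
    and "\<bar>score l \<theta>\<^sub>0 \<eta>\<^sub>0 z a - ext_score z\<bar> \<le> C z * ext_dist a"
  unfolding ext_score_def
  using cont_ext_approx[OF score_linear[OF z center(2) center(1)] score_bound[OF z] C_nonneg[OF z]]
    linear_cont_ext_diff[OF score_linear[OF z center(2) center(1)] score_bound[OF z] C_nonneg[OF z]]
  by simp_all

lemma ext_score_measurable[measurable]: "ext_score \<in> borel_measurable P"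
  by (rule borel_measurable_LIMSEQ_real[OF ext_score_approx(1)]) auto

lemma ext_score_bound: "z \<in> space P \<Longrightarrow> \<bar>ext_score z\<bar> \<le> C z * ext_dist 0"
  using ext_score_approx(2)[of z 0] linear_0[OF score_linear[of z \<eta>\<^sub>0 \<theta>\<^sub>0]] by simp

text \<open>The first-order condition holds for each parameter \<open>approx n\<close>. Its score
  differs from the extended one by at most \<open>C z * ext_dist (approx n)\<close>, and
  \<open>ext_dist (approx n)\<close> tends to 0 because it is at most a multiple of the distance in
  the completion.\<close>

lemma integral_ext_score: "(\<integral>z. ext_score z \<partial>P) = 0"
proof -
  let ?EC = "\<integral>z. C z \<partial>P"
  have 1: "\<bar>\<integral>z. ext_score z \<partial>P\<bar> \<le> ?EC * ext_dist (approx n)" for n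
  proof -
    have "integrable P ext_score" "integrable P (\<lambda>z. score l \<theta>\<^sub>0 \<eta>\<^sub>0 z (approx n))"
      by (rule integrable_le_C(1)[OF _ ext_score_bound] integrable_le_C(1)[OF _ score_bound]; simp)+
    then have "(\<integral>z. score l \<theta>\<^sub>0 \<eta>\<^sub>0 z (approx n) - ext_score z \<partial>P) = - (\<integral>z. ext_score z \<partial>P)"
      by (simp add: first_order)
    moreover have "\<bar>\<integral>z. score l \<theta>\<^sub>0 \<eta>\<^sub>0 z (approx n) - ext_score z \<partial>P\<bar> \<le> ?EC * ext_dist (approx n)"
      by (rule integrable_le_C(2)) (auto intro: ext_score_approx(2))
    ultimately show ?thesis by simp
  qed
  have "ext_dist (approx n) \<le> k * norm (\<iota> (approx n) - \<alpha>)" if "\<And>h. norm h \<le> k * norm (\<iota> h)" for n k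
  proof (rule LIMSEQ_le[OF ext_dist])
    show "(\<lambda>j. k * norm (\<iota> (approx n) - \<iota> (approx j))) \<longlonglongrightarrow> k * norm (\<iota> (approx n) - \<alpha>)"
      by (intro tendsto_intros approx)
    show "\<exists>N. \<forall>j\<ge>N. norm (approx n - approx j) \<le> k * norm (\<iota> (approx n) - \<iota> (approx j))"
      using that[of "approx n - approx j" for j] by (auto simp: linear_diff[OF \<iota>_linear])
  qed
  then obtain k where k: "\<And>n. ext_dist (approx n) \<le> k * norm (\<iota> (approx n) - \<alpha>)" "0 \<le> k"
    using norm_le_\<iota> by metis
  have "0 \<le> ?EC" by (intro integral_nonneg_AE AE_I2 C_nonneg)
  then have 2: "\<bar>\<integral>z. ext_score z \<partial>P\<bar> \<le> ?EC * (k * norm (\<iota> (approx n) - \<alpha>))" for n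
    using order_trans[OF 1 mult_left_mono[OF k(1)]] by simp
  have "(\<lambda>n. ?EC * (k * norm (\<iota> (approx n) - \<alpha>))) \<longlonglongrightarrow> ?EC * (k * norm (\<alpha> - \<alpha>))"
    by (intro tendsto_intros approx)
  from LIMSEQ_le_const[OF this, of "\<bar>\<integral>z. ext_score z \<partial>P\<bar>"] 2 show ?thesis by auto
qed

text \<open>At \<alpha> itself the two integrals agree by the Riesz property. The Hessian is linear
  in the argument that carries the representer, the last one of \<open>score2\<close>, so putting
  \<open>a\<close> there costs a multiple of \<open>ext_dist a\<close>.\<close>

lemma hessian_riesz:
  "\<bar>(\<integral>z. score2 l \<theta>\<^sub>0 \<eta>\<^sub>0 z h a \<partial>P) - (\<integral>z. d_theta m \<theta>\<^sub>0 z h \<partial>P)\<bar> \<le> (\<integral>z. C z \<partial>P) * norm h * ext_dist a"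
proof -
  let ?f = "\<lambda>u. hessian P l \<theta>\<^sub>0 \<eta>\<^sub>0 u h"
  have bound: "\<bar>score2 l \<theta>\<^sub>0 \<eta>\<^sub>0 z h u\<bar> \<le> C z * (norm h * norm u)" if "z \<in> space P" for z u
    using envelope[OF center(1) center(1) center(2) center(2) that, of h u] by (simp add: mult.assoc)
  note int = integrable_le_C[OF score2_section bound]
  have "linear ?f"
  proof (rule linearI)
    fix u v and r :: real
    have "?f (u + v) = (\<integral>z. score2 l \<theta>\<^sub>0 \<eta>\<^sub>0 z h u + score2 l \<theta>\<^sub>0 \<eta>\<^sub>0 z h v \<partial>P)"
      unfolding hessian_def
      by (rule Bochner_Integration.integral_cong[OF refl]) (rule linear_add[OF score2_linear]; simp)
    then show "?f (u + v) = ?f u + ?f v" unfolding hessian_def by (simp add: int)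
    have "?f (r *\<^sub>R u) = (\<integral>z. r * score2 l \<theta>\<^sub>0 \<eta>\<^sub>0 z h u \<partial>P)"
      unfolding hessian_def
      by (rule Bochner_Integration.integral_cong[OF refl])
        (subst linear_scale[OF score2_linear]; simp)
    then show "?f (r *\<^sub>R u) = r *\<^sub>R ?f u" unfolding hessian_def by simp
  qed
  moreover have "\<bar>?f u\<bar> \<le> ((\<integral>z. C z \<partial>P) * norm h) * norm u" for u
    unfolding hessian_def using int(2)[of u] by (simp add: mult.assoc)
  moreover have "0 \<le> (\<integral>z. C z \<partial>P) * norm h"
    by (intro mult_nonneg_nonneg integral_nonneg_AE AE_I2 C_nonneg) auto
  ultimately have "\<bar>?f a - cont_ext \<iota> ?f \<alpha>\<bar> \<le> ((\<integral>z. C z \<partial>P) * norm h) * ext_dist a"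
    by (rule linear_cont_ext_diff)
  moreover have "cont_ext \<iota> ?f \<alpha> = (\<integral>z. d_theta m \<theta>\<^sub>0 z h \<partial>P)"
    using riesz by (simp add: riesz_representer_def)
  ultimately show ?thesis by (simp add: hessian_def)
qed

definition perturbation :: "'th \<Rightarrow> 'up \<Rightarrow> 'th \<Rightarrow> 'z \<Rightarrow> real" where
  "perturbation \<theta> \<eta> a z = (m \<theta> z - score l \<theta> \<eta> z a) - (m \<theta>\<^sub>0 z - ext_score z)"

definition err :: "'th \<Rightarrow> 'up \<Rightarrow> 'th \<Rightarrow> real" where
  "err \<theta> \<eta> a = norm (\<theta> - \<theta>\<^sub>0) + norm (\<eta> - \<eta>\<^sub>0) + ext_dist a"

lemma err_nonneg: "0 \<le> err \<theta> \<eta> a" by (simp add: err_def ext_dist_nonneg)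

lemma perturbation_measurable[measurable]: "perturbation \<theta> \<eta> a \<in> borel_measurable P"
  unfolding perturbation_def by measurable

text \<open>Telescoping by exchanging one argument at a time: \<theta>, then \<eta>, then the
  direction. The condition on \<open>a\<close> bounds \<open>norm a\<close> by
  \<open>1 + ext_dist 0\<close>; together with the increment of \<open>m\<close> this gives the
  factor \<open>2 + ext_dist 0\<close>.\<close>

lemma perturbation_bound:
  assumes z: "z \<in> space P" and \<theta>: "\<theta> \<in> ball \<theta>\<^sub>0 \<rho>" and \<eta>: "\<eta> \<in> ball \<eta>\<^sub>0 \<rho>" and a: "ext_dist a \<le> 1"
  shows "\<bar>perturbation \<theta> \<eta> a z\<bar> \<le> C z * ((2 + ext_dist 0) * err \<theta> \<eta> a)"
proof -
  let ?A = "1 + ext_dist 0" and ?h = "norm (\<theta> - \<theta>\<^sub>0)" and ?v = "norm (\<eta> - \<eta>\<^sub>0)" and ?e = "ext_dist a"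
  have A: "norm a \<le> ?A" using norm_le_ext_dist[of a] a by simp
  have C: "0 \<le> C z" by (rule C_nonneg[OF z])
  have "\<bar>perturbation \<theta> \<eta> a z\<bar> \<le> \<bar>m \<theta> z - m \<theta>\<^sub>0 z\<bar> + \<bar>score l \<theta> \<eta> z a - score l \<theta>\<^sub>0 \<eta> z a\<bar>
      + \<bar>score l \<theta>\<^sub>0 \<eta> z a - score l \<theta>\<^sub>0 \<eta>\<^sub>0 z a\<bar> + \<bar>score l \<theta>\<^sub>0 \<eta>\<^sub>0 z a - ext_score z\<bar>"
    unfolding perturbation_def by linarith
  also have "\<dots> \<le> C z * ?h + C z * ?h * norm a + C z * norm a * ?v + C z * ?e"
    by (intro add_mono m_increment score_theta_increment score_eta_increment ext_score_approx assms)
  also have "\<dots> = C z * (?h + ?h * norm a + ?v * norm a + ?e)" by (simp add: algebra_simps)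
  also have "\<dots> \<le> C z * ((2 + ext_dist 0) * err \<theta> \<eta> a)"
  proof (rule mult_left_mono[OF _ C])
    have "?h * norm a \<le> ?h * ?A" "?v * norm a \<le> ?v * ?A" using A by (auto intro: mult_left_mono)
    moreover have "0 \<le> ext_dist 0 * ?e + ?e + ?v" by (simp add: ext_dist_nonneg)
    ultimately show "?h + ?h * norm a + ?v * norm a + ?e \<le> (2 + ext_dist 0) * err \<theta> \<eta> a"
      unfolding err_def by (simp add: algebra_simps)
  qed
  finally show ?thesis .
qed

text \<open>The first-order terms cancel: the \<open>\<eta>\<close>-direction by orthogonality, the \<open>\<theta>\<close>-direction because
  \<open>\<alpha>\<close> represents the derivative of \<open>m\<close>, and the \<open>\<alpha>\<close>-direction by the first-order condition.\<close>

lemma integral_perturbation_bound: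
  assumes \<theta>: "\<theta> \<in> ball \<theta>\<^sub>0 \<rho>" and \<eta>: "\<eta> \<in> ball \<eta>\<^sub>0 \<rho>" and a: "ext_dist a \<le> 1"
  shows "\<bar>\<integral>z. perturbation \<theta> \<eta> a z \<partial>P\<bar> \<le> (\<integral>z. C z \<partial>P) * (2 + ext_dist 0) * (err \<theta> \<eta> a)\<^sup>2"
proof -
  let ?A = "1 + ext_dist 0" and ?h = "norm (\<theta> - \<theta>\<^sub>0)" and ?v = "norm (\<eta> - \<eta>\<^sub>0)" and ?e = "ext_dist a"
    and ?EC = "\<integral>z. C z \<partial>P"
  have A: "norm a \<le> ?A" using norm_le_ext_dist[of a] a by simp
  have EC: "0 \<le> ?EC" by (intro integral_nonneg_AE AE_I2 C_nonneg)
  note bounds = envelope[OF center(1) center(1) center(2) center(2)]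
  let ?dm = "\<lambda>z. d_theta m \<theta>\<^sub>0 z (\<theta> - \<theta>\<^sub>0)" and ?s2 = "\<lambda>z. score2 l \<theta>\<^sub>0 \<eta>\<^sub>0 z (\<theta> - \<theta>\<^sub>0) a"
    and ?de = "\<lambda>z. d_eta_theta l \<theta>\<^sub>0 \<eta>\<^sub>0 z a (\<eta> - \<eta>\<^sub>0)" and ?s = "\<lambda>z. score l \<theta>\<^sub>0 \<eta>\<^sub>0 z a"
  have dm: "\<bar>?dm z\<bar> \<le> C z * ?h" and s2: "\<bar>?s2 z\<bar> \<le> C z * (?h * norm a)"
    and de: "\<bar>?de z\<bar> \<le> C z * (norm a * ?v)" if "z \<in> space P" for z
    using bounds[OF that, of "\<theta> - \<theta>\<^sub>0" a] bounds[OF that, of a _ "\<eta> - \<eta>\<^sub>0"] by (simp_all add: mult.assoc)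
  note int = integrable_le_C(1)[OF d_theta_m_section dm] integrable_le_C(1)[OF score2_section s2]
    integrable_le_C(1)[OF d_eta_theta_section de] integrable_le_C(1)[OF score_section score_bound]
    integrable_le_C(1)[OF ext_score_measurable ext_score_bound]
    integrable_le_C(1)[OF perturbation_measurable perturbation_bound[OF _ assms]]
  \<comment> \<open>\<open>r\<close> is the sum of three second-order Taylor remainders, those of
    \<open>m\<close>, of the score in \<theta> and of the score in \<eta>; the last two summands
    account for the exchange of the exact representer for \<open>a\<close>.\<close>
  define r where "r z = perturbation \<theta> \<eta> a z - ?dm z + ?s2 z + ?de z + ?s z - ext_score z" for z
  have r_meas: "r \<in> borel_measurable P" unfolding r_def by measurable
  have r_bound: "\<bar>r z\<bar> \<le> C z * ((?h)\<^sup>2 + (?h + ?v) * ?h * norm a + (?v)\<^sup>2 * norm a)" if z: "z \<in> space P" for z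
  proof -
    have "\<bar>r z\<bar> \<le> \<bar>m \<theta> z - m \<theta>\<^sub>0 z - ?dm z\<bar> + \<bar>score l \<theta> \<eta> z a - score l \<theta>\<^sub>0 \<eta> z a - ?s2 z\<bar>
        + \<bar>score l \<theta>\<^sub>0 \<eta> z a - score l \<theta>\<^sub>0 \<eta>\<^sub>0 z a - ?de z\<bar>"
      unfolding r_def perturbation_def by linarith
    also have "\<dots> \<le> C z * (?h)\<^sup>2 + C z * (?h + ?v) * ?h * norm a + C z * (?v)\<^sup>2 * norm a"
      by (intro add_mono m_increment score_theta_increment score_eta_increment z \<theta> \<eta>)
    also have "\<dots> = C z * ((?h)\<^sup>2 + (?h + ?v) * ?h * norm a + (?v)\<^sup>2 * norm a)" by (simp add: algebra_simps)
    finally show ?thesis .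
  qed
  \<comment> \<open>Three first-order terms have mean 0 and disappear. The remaining pair cancels
    only up to the product of the errors in \<theta> and in the representer, by
    \<open>hessian_riesz\<close>; that product is again of second order.\<close>
  have "(\<integral>z. r z \<partial>P) = (\<integral>z. perturbation \<theta> \<eta> a z \<partial>P) - (\<integral>z. ?dm z \<partial>P) + (\<integral>z. ?s2 z \<partial>P)"
    unfolding r_def using int first_order orthogonality integral_ext_score by simp
  then have "\<bar>\<integral>z. perturbation \<theta> \<eta> a z \<partial>P\<bar> \<le> \<bar>\<integral>z. r z \<partial>P\<bar> + \<bar>(\<integral>z. ?s2 z \<partial>P) - (\<integral>z. ?dm z \<partial>P)\<bar>"
    by linarith
  also have "\<dots> \<le> ?EC * ((?h)\<^sup>2 + (?h + ?v) * ?h * norm a + (?v)\<^sup>2 * norm a) + ?EC * ?h * ?e"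
    by (intro add_mono integrable_le_C(2) r_meas r_bound hessian_riesz)
  also have "\<dots> = ?EC * ((?h)\<^sup>2 + (?h + ?v) * ?h * norm a + (?v)\<^sup>2 * norm a + ?h * ?e)" by (simp add: algebra_simps)
  also have "\<dots> \<le> ?EC * ((2 + ext_dist 0) * (err \<theta> \<eta> a)\<^sup>2)"
  proof (rule mult_left_mono[OF _ EC])
    have nn: "0 \<le> ?h" "0 \<le> ?v" "0 \<le> ?e" by (simp_all add: ext_dist_nonneg)
    have "((?h + ?v) * ?h + (?v)\<^sup>2) * norm a \<le> ((?h + ?v) * ?h + (?v)\<^sup>2) * ?A"
      using A nn by (intro mult_left_mono) auto
    also have "\<dots> \<le> (err \<theta> \<eta> a)\<^sup>2 * ?A"
    proof (rule mult_right_mono)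
      have "(?h + ?v) * ?h + (?v)\<^sup>2 \<le> (?h + ?v)\<^sup>2" using nn by (simp add: power2_eq_square algebra_simps)
      also have "\<dots> \<le> (err \<theta> \<eta> a)\<^sup>2" unfolding err_def using nn by (intro power_mono) auto
      finally show "(?h + ?v) * ?h + (?v)\<^sup>2 \<le> (err \<theta> \<eta> a)\<^sup>2" .
    qed (simp add: ext_dist_nonneg)
    finally have 1: "((?h + ?v) * ?h + (?v)\<^sup>2) * norm a \<le> (err \<theta> \<eta> a)\<^sup>2 * ?A" .
    have "(?h)\<^sup>2 + ?h * ?e \<le> (?h + ?e)\<^sup>2" using nn by (simp add: power2_eq_square algebra_simps)
    also have "\<dots> \<le> (err \<theta> \<eta> a)\<^sup>2" unfolding err_def using nn by (intro power_mono) auto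
    finally have 2: "(?h)\<^sup>2 + ?h * ?e \<le> (err \<theta> \<eta> a)\<^sup>2" .
    from 1 2 show "(?h)\<^sup>2 + (?h + ?v) * ?h * norm a + (?v)\<^sup>2 * norm a + ?h * ?e \<le> (2 + ext_dist 0) * (err \<theta> \<eta> a)\<^sup>2"
      by (simp add: algebra_simps)
  qed
  finally show ?thesis by (simp add: mult.assoc)
qed

lemma influence_eq: "influence P l m \<theta>\<^sub>0 \<eta>\<^sub>0 \<iota> \<alpha> z = m \<theta>\<^sub>0 z - (\<integral>z. m \<theta>\<^sub>0 z \<partial>P) - ext_score z"
  by (simp add: influence_def ext_score_def)

lemma m_bound: "z \<in> space P \<Longrightarrow> \<bar>m \<theta>\<^sub>0 z\<bar> \<le> C z"
  using envelope[OF center(1) center(1) center(2) center(2)] by blast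

lemma influence_measurable[measurable]: "influence P l m \<theta>\<^sub>0 \<eta>\<^sub>0 \<iota> \<alpha> \<in> borel_measurable P"
  unfolding influence_eq[abs_def] by measurable

lemma integrable_influence: "integrable P (influence P l m \<theta>\<^sub>0 \<eta>\<^sub>0 \<iota> \<alpha>)"
  and integral_influence: "(\<integral>z. influence P l m \<theta>\<^sub>0 \<eta>\<^sub>0 \<iota> \<alpha> z \<partial>P) = 0"
  and integrable_influence_sq: "integrable P (\<lambda>z. (influence P l m \<theta>\<^sub>0 \<eta>\<^sub>0 \<iota> \<alpha> z)\<^sup>2)"
proof -
  have int: "integrable P (m \<theta>\<^sub>0)" "integrable P ext_score"
    by (rule integrable_le_C(1)[of _ 1] integrable_le_C(1)[OF _ ext_score_bound]; simp add: m_bound)+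
  show "integrable P (influence P l m \<theta>\<^sub>0 \<eta>\<^sub>0 \<iota> \<alpha>)"
    "(\<integral>z. influence P l m \<theta>\<^sub>0 \<eta>\<^sub>0 \<iota> \<alpha> z \<partial>P) = 0"
    unfolding influence_eq[abs_def] using int integral_ext_score by (simp_all add: prob_space)
  let ?\<Psi> = "\<integral>z. m \<theta>\<^sub>0 z \<partial>P" and ?A = "1 + ext_dist 0"
  show "integrable P (\<lambda>z. (influence P l m \<theta>\<^sub>0 \<eta>\<^sub>0 \<iota> \<alpha> z)\<^sup>2)"
  proof (rule Bochner_Integration.integrable_bound)
    show "integrable P (\<lambda>z. 2 * (?A\<^sup>2 * (C z)\<^sup>2) + 2 * ?\<Psi>\<^sup>2)" using integrable_C_sq by simp
    show "AE z in P. norm ((influence P l m \<theta>\<^sub>0 \<eta>\<^sub>0 \<iota> \<alpha> z)\<^sup>2) \<le> norm (2 * (?A\<^sup>2 * (C z)\<^sup>2) + 2 * ?\<Psi>\<^sup>2)"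
    proof (rule AE_I2)
      fix z assume z: "z \<in> space P"
      have "\<bar>influence P l m \<theta>\<^sub>0 \<eta>\<^sub>0 \<iota> \<alpha> z\<bar> \<le> \<bar>?A * C z + \<bar>?\<Psi>\<bar>\<bar>"
        unfolding influence_eq using m_bound[OF z] ext_score_bound[OF z] by (simp add: algebra_simps)
      then have "(influence P l m \<theta>\<^sub>0 \<eta>\<^sub>0 \<iota> \<alpha> z)\<^sup>2 \<le> (?A * C z + \<bar>?\<Psi>\<bar>)\<^sup>2"
        by (simp only: abs_le_square_iff)
      also have "\<dots> \<le> 2 * (?A * C z)\<^sup>2 + 2 * \<bar>?\<Psi>\<bar>\<^sup>2"
        using zero_le_power2[of "?A * C z - \<bar>?\<Psi>\<bar>"] unfolding power2_sum power2_diff by linarith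
      finally show "norm ((influence P l m \<theta>\<^sub>0 \<eta>\<^sub>0 \<iota> \<alpha> z)\<^sup>2) \<le> norm (2 * (?A\<^sup>2 * (C z)\<^sup>2) + 2 * ?\<Psi>\<^sup>2)"
        by (simp add: power_mult_distrib)
    qed
  qed measurable
qed

end

section \<open>Importance weighting\<close>

text \<open>Rectangles are stable under intersection and generate the product sigma-algebra. Both
  identifications of laws on a product below rest on this.\<close>

lemma pair_measure_eqI_rectangles:
  assumes sets: "sets L1 = sets (A \<Otimes>\<^sub>M B)" "sets L2 = sets (A \<Otimes>\<^sub>M B)"
    and fin: "finite_measure L1"
    and eq: "\<And>a b. a \<in> sets A \<Longrightarrow> b \<in> sets B \<Longrightarrow> emeasure L1 (a \<times> b) = emeasure L2 (a \<times> b)"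
  shows "L1 = L2"
proof (rule measure_eqI_generator_eq)
  let ?E = "{a \<times> b | a b. a \<in> sets A \<and> b \<in> sets B}" and ?\<Omega> = "space A \<times> space B"
  show "Int_stable ?E" by (rule Int_stable_pair_measure_generator)
  show "?E \<subseteq> Pow ?\<Omega>" using sets.space_closed[of A] sets.space_closed[of B] by auto
  show "sets L1 = sigma_sets ?\<Omega> ?E" "sets L2 = sigma_sets ?\<Omega> ?E"
    using sets by (simp_all add: sets_pair_measure)
  show "\<And>X. X \<in> ?E \<Longrightarrow> emeasure L1 X = emeasure L2 X" using eq by auto
  show "range (\<lambda>_::nat. ?\<Omega>) \<subseteq> ?E" by auto
  show "(\<Union>i::nat. ?\<Omega>) = ?\<Omega>" by simp
  show "\<And>i::nat. emeasure L1 ?\<Omega> \<noteq> \<infinity>"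
    using finite_measure.finite_emeasure_space[OF fin] sets_eq_imp_space_eq[OF sets(1)]
    by (simp add: space_pair_measure)
qed

lemma (in prob_space) sigma_finite_subalgebraI: "subalgebra M G \<Longrightarrow> sigma_finite_subalgebra M G"
  by (intro finite_measure_subalgebra_is_sigma_finite finite_measure_subalgebra.intro
      finite_measure_subalgebra_axioms.intro finite_measure_axioms)

text \<open>\<open>cond_law\<close> fixes one conditional probability at a time, with a null set
  depending on the event. The joint law of the identity into \<open>G\<close> and of
  \<open>X\<close> is compared with the mixture of the kernel on rectangles, where this information
  suffices; \<open>g\<close> may then depend on \<omega> through \<open>G\<close>.\<close>

lemma (in prob_space) cond_law_nn_integral:
  assumes G: "subalgebra M G" and X[measurable]: "X \<in> M \<rightarrow>\<^sub>M N" and K: "K \<in> G \<rightarrow>\<^sub>M prob_algebra N"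
    and law: "cond_law M G N X K" and g: "g \<in> borel_measurable (G \<Otimes>\<^sub>M N)"
  shows "(\<integral>\<^sup>+\<omega>. g (\<omega>, X \<omega>) \<partial>M) = (\<integral>\<^sup>+\<omega>. \<integral>\<^sup>+x. g (\<omega>, x) \<partial>K \<omega> \<partial>M)"
proof -
  interpret sigma_finite_subalgebra M G by (rule sigma_finite_subalgebraI[OF G])
  let ?R = "restr_to_subalg M G"
  have idG: "(\<lambda>\<omega>. \<omega>) \<in> M \<rightarrow>\<^sub>M G" by (rule measurable_from_subalg[OF G]) simp
  have pairX: "(\<lambda>\<omega>. (\<omega>, X \<omega>)) \<in> M \<rightarrow>\<^sub>M G \<Otimes>\<^sub>M N" using idG X by (rule measurable_Pair)
  \<comment> \<open>\<open>k \<omega>\<close> is the point mass at \<omega> times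
    \<open>K \<omega>\<close>; binding it to the restriction of \<open>M\<close> to \<open>G\<close>
    gives the candidate for the joint law.\<close>
  define k where "k \<omega> = distr (K \<omega>) (G \<Otimes>\<^sub>M N) (\<lambda>x. (\<omega>, x))" for \<omega>
  have Ks: "K \<in> G \<rightarrow>\<^sub>M subprob_algebra N" by (rule measurable_prob_algebraD[OF K])
  have k: "k \<in> G \<rightarrow>\<^sub>M subprob_algebra (G \<Otimes>\<^sub>M N)"
    unfolding k_def by (rule measurable_distr2[OF _ Ks]) simp
  have kR: "k \<in> ?R \<rightarrow>\<^sub>M subprob_algebra (G \<Otimes>\<^sub>M N)" by (rule measurable_in_subalg[OF G k])
  have spG: "space G = space M" using G by (simp add: subalgebra_def)
  have setsK: "sets (K \<omega>) = sets N" and probK: "prob_space (K \<omega>)" if "\<omega> \<in> space M" for \<omega>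
    using measurable_space[OF K, of \<omega>] that spG by (auto simp: space_prob_algebra)
  have k_int: "(\<integral>\<^sup>+z. f z \<partial>k \<omega>) = (\<integral>\<^sup>+x. f (\<omega>, x) \<partial>K \<omega>)"
    if f: "f \<in> borel_measurable (G \<Otimes>\<^sub>M N)" and \<omega>: "\<omega> \<in> space M" for f :: "_ \<Rightarrow> ennreal" and \<omega>
  proof -
    have "(\<lambda>x. (\<omega>, x)) \<in> K \<omega> \<rightarrow>\<^sub>M G \<Otimes>\<^sub>M N"
      using \<omega> spG by (subst measurable_cong_sets[OF setsK[OF \<omega>] refl]) simp
    from nn_integral_distr[OF this, of f] f show ?thesis unfolding k_def by simp
  qed
  have bind_int: "(\<integral>\<^sup>+z. f z \<partial>(?R \<bind> k)) = (\<integral>\<^sup>+\<omega>. \<integral>\<^sup>+x. f (\<omega>, x) \<partial>K \<omega> \<partial>M)"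
    if f: "f \<in> borel_measurable (G \<Otimes>\<^sub>M N)" for f :: "_ \<Rightarrow> ennreal"
  proof -
    have "(\<integral>\<^sup>+z. f z \<partial>(?R \<bind> k)) = (\<integral>\<^sup>+\<omega>. \<integral>\<^sup>+z. f z \<partial>k \<omega> \<partial>?R)" by (rule nn_integral_bind[OF f kR])
    also have "\<dots> = (\<integral>\<^sup>+\<omega>. \<integral>\<^sup>+z. f z \<partial>k \<omega> \<partial>M)"
      by (rule nn_integral_subalgebra2[OF G]) (rule measurable_compose[OF k nn_integral_measurable_subprob_algebra[OF f]])
    also have "\<dots> = (\<integral>\<^sup>+\<omega>. \<integral>\<^sup>+x. f (\<omega>, x) \<partial>K \<omega> \<partial>M)"
      by (intro nn_integral_cong k_int f)
    finally show ?thesis .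
  qed
  have "distr M (G \<Otimes>\<^sub>M N) (\<lambda>\<omega>. (\<omega>, X \<omega>)) = ?R \<bind> k"
  proof (rule pair_measure_eqI_rectangles)
    have "space ?R \<noteq> {}" using not_empty by (simp add: space_restr_to_subalg)
    then show "sets (?R \<bind> k) = sets (G \<Otimes>\<^sub>M N)"
      by (intro sets_bind sets_kernel[OF kR])
    show "finite_measure (distr M (G \<Otimes>\<^sub>M N) (\<lambda>\<omega>. (\<omega>, X \<omega>)))"
      by (rule finite_measure_distr[OF pairX])
    fix a b assume a: "a \<in> sets G" and b: "b \<in> sets N"
    have a_M[measurable]: "a \<in> sets M" using a G by (auto simp: subalgebra_def)
    have ab: "a \<times> b \<in> sets (G \<Otimes>\<^sub>M N)" using a b by simp
    have int: "integrable M (\<lambda>\<omega>. indicator b (X \<omega>) :: real)"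
      using b by (intro integrable_const_bound[of _ 1]) auto
    have int': "integrable M (\<lambda>\<omega>. indicator a \<omega> * indicator b (X \<omega>) :: real)"
      using b by (intro integrable_const_bound[of _ 1]) (auto split: split_indicator)
    have "emeasure (distr M (G \<Otimes>\<^sub>M N) (\<lambda>\<omega>. (\<omega>, X \<omega>))) (a \<times> b)
        = (\<integral>\<^sup>+z. indicator (a \<times> b) z \<partial>distr M (G \<Otimes>\<^sub>M N) (\<lambda>\<omega>. (\<omega>, X \<omega>)))" using ab by simp
    also have "\<dots> = (\<integral>\<^sup>+\<omega>. indicator (a \<times> b) (\<omega>, X \<omega>) \<partial>M)"
      using ab by (intro nn_integral_distr pairX) simp
    also have "\<dots> = (\<integral>\<^sup>+\<omega>. ennreal (indicator a \<omega> * indicator b (X \<omega>)) \<partial>M)"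
      by (intro nn_integral_cong) (auto split: split_indicator)
    also have "\<dots> = ennreal (\<integral>\<omega>. indicator a \<omega> * indicator b (X \<omega>) \<partial>M)"
      by (rule nn_integral_eq_integral[OF int']) simp
    also have "(\<integral>\<omega>. indicator a \<omega> * indicator b (X \<omega>) \<partial>M)
        = (\<integral>\<omega>. indicator a \<omega> * real_cond_exp M G (\<lambda>\<omega>. indicator b (X \<omega>)) \<omega> \<partial>M)"
      using a b int' by (intro real_cond_exp_intg(2)[symmetric]) auto
    also have "\<dots> = (\<integral>\<omega>. indicator a \<omega> * measure (K \<omega>) b \<partial>M)"
    proof (rule integral_cong_AE)
      have "(\<lambda>\<omega>. measure (K \<omega>) b) \<in> borel_measurable G"
        using measurable_compose[OF Ks measurable_measure_subprob_algebra[OF b]] .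
      from measurable_from_subalg[OF G this]
      show "(\<lambda>\<omega>. indicator a \<omega> * measure (K \<omega>) b) \<in> borel_measurable M" by measurable
      show "AE \<omega> in M. indicator a \<omega> * real_cond_exp M G (\<lambda>\<omega>. indicator b (X \<omega>)) \<omega>
          = indicator a \<omega> * measure (K \<omega>) b"
        using law[unfolded cond_law_def, rule_format, OF b] by eventually_elim simp
    qed measurable
    also have "ennreal \<dots> = (\<integral>\<^sup>+\<omega>. ennreal (indicator a \<omega> * measure (K \<omega>) b) \<partial>M)"
    proof (rule nn_integral_eq_integral[symmetric])
      have "(\<lambda>\<omega>. measure (K \<omega>) b) \<in> borel_measurable G"
        using measurable_compose[OF Ks measurable_measure_subprob_algebra[OF b]] .
      from measurable_from_subalg[OF G this]
      have [measurable]: "(\<lambda>\<omega>. measure (K \<omega>) b) \<in> borel_measurable M" .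
      show "integrable M (\<lambda>\<omega>. indicator a \<omega> * measure (K \<omega>) b)"
        using prob_space.prob_le_1[OF probK]
        by (intro integrable_const_bound[of _ 1]) (auto intro!: AE_I2 split: split_indicator)
    qed simp
    also have "\<dots> = (\<integral>\<^sup>+\<omega>. \<integral>\<^sup>+x. indicator (a \<times> b) (\<omega>, x) \<partial>K \<omega> \<partial>M)"
    proof (rule nn_integral_cong)
      fix \<omega> assume \<omega>: "\<omega> \<in> space M"
      interpret K: prob_space "K \<omega>" by (rule probK[OF \<omega>])
      have "(\<integral>\<^sup>+x. indicator (a \<times> b) (\<omega>, x) \<partial>K \<omega>) = (\<integral>\<^sup>+x. indicator a \<omega> * indicator b x \<partial>K \<omega>)"
        by (intro nn_integral_cong) (auto split: split_indicator)
      also have "\<dots> = indicator a \<omega> * emeasure (K \<omega>) b"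
        using b setsK[OF \<omega>] by (simp add: nn_integral_cmult)
      finally show "ennreal (indicator a \<omega> * measure (K \<omega>) b) = (\<integral>\<^sup>+x. indicator (a \<times> b) (\<omega>, x) \<partial>K \<omega>)"
        by (simp add: K.emeasure_eq_measure ennreal_mult ennreal_indicator)
    qed
    also have "\<dots> = emeasure (?R \<bind> k) (a \<times> b)"
    proof -
      have "space ?R \<noteq> {}" using not_empty by (simp add: space_restr_to_subalg)
      then have "sets (?R \<bind> k) = sets (G \<Otimes>\<^sub>M N)" by (intro sets_bind sets_kernel[OF kR])
      then show ?thesis
        using bind_int[of "indicator (a \<times> b)"] ab by simp
    qed
    finally show "emeasure (distr M (G \<Otimes>\<^sub>M N) (\<lambda>\<omega>. (\<omega>, X \<omega>))) (a \<times> b) = emeasure (?R \<bind> k) (a \<times> b)" .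
  qed simp
  moreover have "(\<integral>\<^sup>+z. g z \<partial>distr M (G \<Otimes>\<^sub>M N) (\<lambda>\<omega>. (\<omega>, X \<omega>))) = (\<integral>\<^sup>+\<omega>. g (\<omega>, X \<omega>) \<partial>M)"
    by (rule nn_integral_distr[OF pairX]) (simp add: g)
  ultimately show ?thesis using bind_int[OF g] by simp
qed

section \<open>Conditioning on the past together with the current context and action\<close>

lemma space_enlarge[simp]: "space (enlarge F X N) = space F"
  by (simp add: enlarge_def)

lemma measurable_enlarge:
  assumes "X \<in> space F \<rightarrow> space N"
  shows measurable_enlarge_pair: "(\<lambda>\<omega>. (\<omega>, X \<omega>)) \<in> enlarge F X N \<rightarrow>\<^sub>M F \<Otimes>\<^sub>M N"
    and measurable_enlarge_id: "(\<lambda>\<omega>. \<omega>) \<in> enlarge F X N \<rightarrow>\<^sub>M F"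
    and measurable_enlarge_snd: "X \<in> enlarge F X N \<rightarrow>\<^sub>M N"
proof -
  show *: "(\<lambda>\<omega>. (\<omega>, X \<omega>)) \<in> enlarge F X N \<rightarrow>\<^sub>M F \<Otimes>\<^sub>M N"
    unfolding enlarge_def using assms by (intro measurable_vimage_algebra1) (auto simp: space_pair_measure)
  show "(\<lambda>\<omega>. \<omega>) \<in> enlarge F X N \<rightarrow>\<^sub>M F" "X \<in> enlarge F X N \<rightarrow>\<^sub>M N"
    using measurable_compose[OF * measurable_fst] measurable_compose[OF * measurable_snd] by simp_all
qed

lemma subalgebra_vimage:
  assumes "f \<in> M \<rightarrow>\<^sub>M N" shows "subalgebra M (vimage_algebra (space M) f N)"
  unfolding subalgebra_def using sets_image_in_sets[OF refl assms] by simp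

lemma subalgebra_enlarge:
  assumes F: "subalgebra M F" and X: "X \<in> M \<rightarrow>\<^sub>M N"
  shows "subalgebra M (enlarge F X N)"
proof -
  have "(\<lambda>\<omega>. \<omega>) \<in> M \<rightarrow>\<^sub>M F" by (rule measurable_from_subalg[OF F]) simp
  then have "(\<lambda>\<omega>. (\<omega>, X \<omega>)) \<in> M \<rightarrow>\<^sub>M F \<Otimes>\<^sub>M N" using X by (rule measurable_Pair)
  moreover have "space F = space M" using F by (simp add: subalgebra_def)
  ultimately show ?thesis unfolding enlarge_def by (simp add: subalgebra_vimage)
qed

lemma (in prob_space) cond_law_indep:
  assumes F: "subalgebra M F" and X[measurable]: "X \<in> M \<rightarrow>\<^sub>M N"
    and indep: "indep_set (sets (vimage_algebra (space M) X N)) (sets F)"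
  shows "cond_law M F N X (\<lambda>_. distr M N X)"
  unfolding cond_law_def
proof
  interpret sigma_finite_subalgebra M F by (rule sigma_finite_subalgebraI[OF F])
  fix B assume B[measurable]: "B \<in> sets N"
  let ?f = "\<lambda>\<omega>. indicator B (X \<omega>) :: real"
  have int: "integrable M ?f" by (intro integrable_const_bound[of _ 1]) auto
  show "AE \<omega> in M. real_cond_exp M F ?f \<omega> = measure (distr M N X) B"
  proof (rule real_cond_exp_charact[OF _ int])
    fix A assume "A \<in> sets F"
    then have [measurable]: "A \<in> sets M" using F by (auto simp: subalgebra_def)
    have "X -` B \<inter> space M \<in> sets (vimage_algebra (space M) X N)"
      by (rule in_vimage_algebra[OF B])
    from indep_setD[OF indep this \<open>A \<in> sets F\<close>]
    have "prob (X -` B \<inter> space M \<inter> A) = prob (X -` B \<inter> space M) * prob A" .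
    moreover have "(\<integral>\<omega>\<in>A. ?f \<omega> \<partial>M) = (\<integral>\<omega>. indicator (X -` B \<inter> space M \<inter> A) \<omega> \<partial>M)"
      unfolding set_lebesgue_integral_def
      by (rule Bochner_Integration.integral_cong) (auto split: split_indicator)
    ultimately show "(\<integral>\<omega>\<in>A. ?f \<omega> \<partial>M) = (\<integral>\<omega>\<in>A. measure (distr M N X) B \<partial>M)"
      by (simp add: measure_distr set_lebesgue_integral_def mult.commute)
  qed simp_all
qed

text \<open>The hypotheses describe \<open>X\<close> given \<open>V\<close> alone and relate it to
  \<open>F\<close> by conditional independence. On a rectangle of a past event and an event of
  \<open>V\<close>, the past event is projected to the sigma-algebra of \<open>V\<close>, split off
  by conditional independence, and projected back. Uniqueness of measures extends the equality to
  all events of the enlarged sigma-algebra.\<close>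

lemma (in prob_space) cond_law_enlarge:
  assumes F: "subalgebra M F" and V: "V \<in> M \<rightarrow>\<^sub>M NV" and X[measurable]: "X \<in> M \<rightarrow>\<^sub>M N"
    and K: "K \<in> NV \<rightarrow>\<^sub>M prob_algebra N"
    and law: "cond_law M (vimage_algebra (space M) V NV) N X (\<lambda>\<omega>. K (V \<omega>))"
    and indep: "cond_indep M (vimage_algebra (space M) V NV) N X F"
  shows "cond_law M (enlarge F V NV) N X (\<lambda>\<omega>. K (V \<omega>))"
  unfolding cond_law_def
proof
  let ?V = "vimage_algebra (space M) V NV" and ?E = "enlarge F V NV"
  have subV: "subalgebra M ?V" by (rule subalgebra_vimage[OF V])
  have subE: "subalgebra M ?E" by (rule subalgebra_enlarge[OF F V])
  interpret V: sigma_finite_subalgebra M ?V by (rule sigma_finite_subalgebraI[OF subV])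
  interpret E: sigma_finite_subalgebra M ?E by (rule sigma_finite_subalgebraI[OF subE])
  have spF: "space F = space M" using F by (simp add: subalgebra_def)
  have V_space: "V \<in> space F \<rightarrow> space NV" using V spF by (auto simp: measurable_def)
  note [measurable] = V
  have idF: "(\<lambda>\<omega>. \<omega>) \<in> M \<rightarrow>\<^sub>M F" by (rule measurable_from_subalg[OF F]) simp
  then have pair: "(\<lambda>\<omega>. (\<omega>, V \<omega>)) \<in> M \<rightarrow>\<^sub>M F \<Otimes>\<^sub>M NV" using V by (rule measurable_Pair)
  fix B assume B[measurable]: "B \<in> sets N"
  let ?f = "\<lambda>\<omega>. indicator B (X \<omega>) :: real" and ?q = "\<lambda>\<omega>. measure (K (V \<omega>)) B"
  have q0: "(\<lambda>v. measure (K v) B) \<in> borel_measurable NV"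
    using measurable_compose[OF measurable_prob_algebraD[OF K] measurable_measure_subprob_algebra[OF B]] .
  have qM[measurable]: "?q \<in> borel_measurable M" using measurable_compose[OF V q0] .
  have qV: "?q \<in> borel_measurable ?V"
    using measurable_compose[OF measurable_vimage_algebra1 q0, of V "space M"] V
    by (auto simp: measurable_def)
  have qE: "?q \<in> borel_measurable ?E" using measurable_compose[OF measurable_enlarge_snd[OF V_space] q0] .
  have q_le: "?q \<omega> \<le> 1" if "\<omega> \<in> space M" for \<omega>
    using measurable_space[OF K measurable_space[OF V that]]
    by (auto simp: space_prob_algebra prob_space.prob_le_1)
  have int_f: "integrable M ?f" by (intro integrable_const_bound[of _ 1]) auto
  have int_q: "integrable M ?q" by (intro integrable_const_bound[of _ 1]) (auto intro!: AE_I2 q_le)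
  \<comment> \<open>Equality of these two measures is the defining property of the conditional
    expectation given \<open>enlarge F V NV\<close>, whose events are the preimages of their
    measurable sets.\<close>
  let ?L1 = "distr (density M (\<lambda>\<omega>. ennreal (?f \<omega>))) (F \<Otimes>\<^sub>M NV) (\<lambda>\<omega>. (\<omega>, V \<omega>))"
    and ?L2 = "distr (density M (\<lambda>\<omega>. ennreal (?q \<omega>))) (F \<Otimes>\<^sub>M NV) (\<lambda>\<omega>. (\<omega>, V \<omega>))"
  have emeasure_L: "emeasure (distr (density M (\<lambda>\<omega>. ennreal (g \<omega>))) (F \<Otimes>\<^sub>M NV) (\<lambda>\<omega>. (\<omega>, V \<omega>))) S
      = ennreal (\<integral>\<omega>. g \<omega> * indicator S (\<omega>, V \<omega>) \<partial>M)"
    if g: "integrable M g" "\<And>\<omega>. 0 \<le> g \<omega>" and S: "S \<in> sets (F \<Otimes>\<^sub>M NV)" for g :: "'a \<Rightarrow> real" and S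
  proof -
    have [measurable]: "(\<lambda>\<omega>. (\<omega>, V \<omega>)) -` S \<inter> space M \<in> sets M" using pair S by (rule measurable_sets)
    have "emeasure (distr (density M (\<lambda>\<omega>. ennreal (g \<omega>))) (F \<Otimes>\<^sub>M NV) (\<lambda>\<omega>. (\<omega>, V \<omega>))) S
        = (\<integral>\<^sup>+\<omega>. ennreal (g \<omega>) * indicator ((\<lambda>\<omega>. (\<omega>, V \<omega>)) -` S \<inter> space M) \<omega> \<partial>M)"
      using g S pair by (simp add: emeasure_distr emeasure_density)
    also have "\<dots> = (\<integral>\<^sup>+\<omega>. ennreal (g \<omega> * indicator S (\<omega>, V \<omega>)) \<partial>M)"
      by (intro nn_integral_cong) (auto split: split_indicator)
    also have "\<dots> = ennreal (\<integral>\<omega>. g \<omega> * indicator S (\<omega>, V \<omega>) \<partial>M)"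
    proof (rule nn_integral_eq_integral)
      have "integrable M (\<lambda>\<omega>. g \<omega> * indicator ((\<lambda>\<omega>. (\<omega>, V \<omega>)) -` S \<inter> space M) \<omega>)"
        by (rule integrable_real_mult_indicator) (use g in auto)
      then show "integrable M (\<lambda>\<omega>. g \<omega> * indicator S (\<omega>, V \<omega>))"
        by (rule Bochner_Integration.integrable_cong[THEN iffD1, OF refl, rotated])
          (auto split: split_indicator)
    qed (use g in auto)
    finally show ?thesis .
  qed
  have "?L1 = ?L2"
  proof (rule pair_measure_eqI_rectangles)
    have "emeasure ?L1 (space (F \<Otimes>\<^sub>M NV)) < \<infinity>"
      by (subst emeasure_L[OF int_f]) auto
    then show "finite_measure ?L1" by (intro finite_measureI) simp
    fix A D assume A: "A \<in> sets F" and D: "D \<in> sets NV"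
    have A_M[measurable]: "A \<in> sets M" using A F by (auto simp: subalgebra_def)
    let ?d = "\<lambda>\<omega>. indicator D (V \<omega>) :: real"
    have dV: "?d \<in> borel_measurable ?V"
      using measurable_compose[OF measurable_vimage_algebra1 borel_measurable_indicator[OF D], of V "space M"] V
      by (auto simp: measurable_def)
    have [measurable]: "?d \<in> borel_measurable M" using measurable_compose[OF V borel_measurable_indicator[OF D]] .
    have bnd: "integrable M h" if "h \<in> borel_measurable M" "\<And>\<omega>. \<omega> \<in> space M \<Longrightarrow> \<bar>h \<omega>\<bar> \<le> 1" for h :: "'a \<Rightarrow> real"
      using that by (intro integrable_const_bound[of _ 1]) (auto intro!: AE_I2)
    have "(\<integral>\<omega>. ?f \<omega> * indicator (A \<times> D) (\<omega>, V \<omega>) \<partial>M) = (\<integral>\<omega>. ?d \<omega> * (?f \<omega> * indicator A \<omega>) \<partial>M)"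
      by (rule Bochner_Integration.integral_cong) (auto split: split_indicator)
    also have "\<dots> = (\<integral>\<omega>. ?d \<omega> * real_cond_exp M ?V (\<lambda>\<omega>. ?f \<omega> * indicator A \<omega>) \<omega> \<partial>M)"
      using dV by (intro V.real_cond_exp_intg(2)[symmetric] bnd) (auto split: split_indicator)
    also have "\<dots> = (\<integral>\<omega>. (?d \<omega> * ?q \<omega>) * real_cond_exp M ?V (indicator A) \<omega> \<partial>M)"
    proof (rule integral_cong_AE)
      show "AE \<omega> in M. ?d \<omega> * real_cond_exp M ?V (\<lambda>\<omega>. ?f \<omega> * indicator A \<omega>) \<omega>
          = (?d \<omega> * ?q \<omega>) * real_cond_exp M ?V (indicator A) \<omega>"
        using indep[unfolded cond_indep_def, rule_format, OF B A] law[unfolded cond_law_def, rule_format, OF B]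
        by eventually_elim simp
    qed measurable
    also have "\<dots> = (\<integral>\<omega>. (?d \<omega> * ?q \<omega>) * indicator A \<omega> \<partial>M)"
      using dV qV by (intro V.real_cond_exp_intg(2) bnd) (auto split: split_indicator intro: q_le)
    also have "\<dots> = (\<integral>\<omega>. ?q \<omega> * indicator (A \<times> D) (\<omega>, V \<omega>) \<partial>M)"
      by (rule Bochner_Integration.integral_cong) (auto split: split_indicator)
    finally show "emeasure ?L1 (A \<times> D) = emeasure ?L2 (A \<times> D)"
      using A D by (simp add: emeasure_L int_f int_q)
  qed simp_all
  note L_eq = this
  show "AE \<omega> in M. real_cond_exp M ?E ?f \<omega> = ?q \<omega>"
  proof (rule E.real_cond_exp_charact[OF _ int_f int_q qE])
    fix S assume "S \<in> sets ?E"
    then obtain R where R: "R \<in> sets (F \<Otimes>\<^sub>M NV)" "S = (\<lambda>\<omega>. (\<omega>, V \<omega>)) -` R \<inter> space M"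
      unfolding enlarge_def using V_space spF
      by (subst (asm) sets_vimage_algebra2) (auto simp: space_pair_measure)
    have "ennreal (\<integral>\<omega>. ?f \<omega> * indicator R (\<omega>, V \<omega>) \<partial>M) = ennreal (\<integral>\<omega>. ?q \<omega> * indicator R (\<omega>, V \<omega>) \<partial>M)"
      using emeasure_L[OF int_f _ R(1)] emeasure_L[OF int_q _ R(1)] L_eq by simp
    then have "(\<integral>\<omega>. ?f \<omega> * indicator R (\<omega>, V \<omega>) \<partial>M) = (\<integral>\<omega>. ?q \<omega> * indicator R (\<omega>, V \<omega>) \<partial>M)"
      by (subst (asm) ennreal_inj) (auto intro!: integral_nonneg_AE)
    moreover have "(\<integral>\<omega>\<in>S. g \<omega> \<partial>M) = (\<integral>\<omega>. g \<omega> * indicator R (\<omega>, V \<omega>) \<partial>M)" for g :: "'a \<Rightarrow> real"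
      unfolding set_lebesgue_integral_def R(2)
      by (rule Bochner_Integration.integral_cong) (auto split: split_indicator)
    ultimately show "(\<integral>\<omega>\<in>S. ?f \<omega> \<partial>M) = (\<integral>\<omega>\<in>S. ?q \<omega> \<partial>M)" by simp
  qed
qed

section \<open>The filtration of histories\<close>

lemma subalgebra_history:
  assumes "\<And>i. i \<in> {1..t} \<Longrightarrow> Z i \<in> M \<rightarrow>\<^sub>M N"
  shows "subalgebra M (history M N Z t)"
  unfolding history_def by (rule subalgebra_vimage) (intro measurable_restrict assms)

lemma measurable_history_component:
  assumes Z: "\<And>i. i \<in> {1..t} \<Longrightarrow> Z i \<in> M \<rightarrow>\<^sub>M N" and i: "i \<in> {1..t}"
  shows "Z i \<in> history M N Z t \<rightarrow>\<^sub>M N"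
proof -
  have "(\<lambda>\<omega>. \<lambda>i\<in>{1..t}. Z i \<omega>) \<in> M \<rightarrow>\<^sub>M PiM {1..t} (\<lambda>_. N)"
    by (intro measurable_restrict Z)
  then have "(\<lambda>\<omega>. \<lambda>i\<in>{1..t}. Z i \<omega>) \<in> space M \<rightarrow> space (PiM {1..t} (\<lambda>_. N))"
    by (auto simp: measurable_def)
  from measurable_compose[OF measurable_vimage_algebra1[OF this] measurable_component_singleton[OF i]]
  show ?thesis unfolding history_def using i by simp
qed

lemma subalgebra_history_mono:
  assumes Z: "\<And>i. i \<in> {1..t} \<Longrightarrow> Z i \<in> M \<rightarrow>\<^sub>M N" and st: "s \<le> t"
  shows "subalgebra (history M N Z t) (history M N Z s)"
proof -
  have sp: "space (history M N Z k) = space M" for k by (simp add: history_def)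
  have "(\<lambda>\<omega>. \<lambda>i\<in>{1..s}. Z i \<omega>) \<in> history M N Z t \<rightarrow>\<^sub>M PiM {1..s} (\<lambda>_. N)"
    using st by (intro measurable_restrict measurable_history_component Z) auto
  from subalgebra_vimage[OF this] show ?thesis
    unfolding sp history_def[of M N Z s] .
qed

section \<open>From the policy of a round to the evaluation policy\<close>

context bandit_density
begin

abbreviation Obs where "Obs \<equiv> obs_space MC MA"
abbreviation past where "past T t \<equiv> history M Obs (Z T) (t - 1)"
abbreviation Pe where "Pe \<equiv> eval_law MC MA PC Pi_e PY"

text \<open>A function of an arbitrary observation, because second moments leave one weight inside
  an integral under \<open>Pe\<close>.\<close>

definition weight :: "nat \<Rightarrow> nat \<Rightarrow> 'w \<Rightarrow> 'c \<times> 'a \<times> real \<Rightarrow> real" where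
  "weight T t \<omega> z = dens_e (ctx z) (act z) / dens T t \<omega> (ctx z) (act z)"

lemma subalgebra_past: "t \<in> {1..T} \<Longrightarrow> subalgebra M (past T t)"
  by (intro subalgebra_history Z_measurable) auto

lemma PC_prob: "prob_space PC" and sets_PC: "sets PC = sets MC"
  using PC by (auto simp: space_prob_algebra)

lemma ctx_measurable: "t \<in> {1..T} \<Longrightarrow> (\<lambda>\<omega>. ctx (Z T t \<omega>)) \<in> M \<rightarrow>\<^sub>M MC"
  and act_measurable: "t \<in> {1..T} \<Longrightarrow> (\<lambda>\<omega>. act (Z T t \<omega>)) \<in> M \<rightarrow>\<^sub>M MA"
  and outc_measurable: "t \<in> {1..T} \<Longrightarrow> (\<lambda>\<omega>. outc (Z T t \<omega>)) \<in> M \<rightarrow>\<^sub>M borel"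
  using Z_measurable[of t T] unfolding obs_space_def by measurable

text \<open>Where the density of the round vanishes, the real quotient is 0 by convention and would
  lose the mass of the evaluation policy there; absolute continuity makes this set null for
  \<open>Pi_e c\<close>. Elsewhere the densities cancel.\<close>

lemma nn_integral_change_policy:
  assumes t: "t \<in> {1..T}" and \<omega>: "\<omega> \<in> space M" and c: "c \<in> space MC"
    and ac: "absolutely_continuous (Pi T t \<omega> c) (Pi_e c)" and q: "q \<in> borel_measurable MA"
  shows "(\<integral>\<^sup>+a. ennreal (dens_e c a / dens T t \<omega> c a) * q a \<partial>Pi T t \<omega> c) = (\<integral>\<^sup>+a. q a \<partial>Pi_e c)"
proof -
  let ?f = "\<lambda>a. dens T t \<omega> c a" and ?e = "\<lambda>a. dens_e c a"
  note eqs = dens[OF t \<omega> c] dens_e[OF c]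
  have sp: "\<omega> \<in> space (past T t)" using \<omega> by (simp add: history_def)
  have f: "?f \<in> borel_measurable (mu c)"
    using measurable_compose[OF measurable_Pair1'[OF c] measurable_compose[OF measurable_Pair1'[OF sp] dens_measurable[OF t]]]
    by (subst measurable_cong_sets[OF sets_mu[OF c] refl]) simp
  have e: "?e \<in> borel_measurable (mu c)"
    using measurable_compose[OF measurable_Pair1'[OF c] dens_e_measurable]
    by (subst measurable_cong_sets[OF sets_mu[OF c] refl]) simp
  have q': "q \<in> borel_measurable (mu c)"
    using q by (subst measurable_cong_sets[OF sets_mu[OF c] refl])
  note [measurable] = f e q'
  have sp_mu: "space (mu c) = space MA" by (rule sets_eq_imp_space_eq[OF sets_mu[OF c]])
  let ?N = "{a \<in> space (mu c). ?f a = 0}"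
  have N[measurable]: "?N \<in> sets (mu c)" by measurable
  have "emeasure (Pi T t \<omega> c) ?N = (\<integral>\<^sup>+a. ennreal (?f a) * indicator ?N a \<partial>mu c)"
    unfolding eqs by (rule emeasure_density) measurable
  also have "\<dots> = (\<integral>\<^sup>+a. 0 \<partial>mu c)" by (intro nn_integral_cong) (auto split: split_indicator)
  finally have "?N \<in> null_sets (Pi T t \<omega> c)" using N by (auto simp: null_sets_def eqs)
  then have "?N \<in> null_sets (Pi_e c)" using ac by (auto simp: absolutely_continuous_def)
  then have ae: "AE a in Pi_e c. ?f a \<noteq> 0"
    by (rule AE_I') (auto simp: eqs(2))
  have "(\<integral>\<^sup>+a. ennreal (?e a / ?f a) * q a \<partial>Pi T t \<omega> c)
      = (\<integral>\<^sup>+a. ennreal (?f a) * (ennreal (?e a / ?f a) * q a) \<partial>mu c)"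
    unfolding eqs by (rule nn_integral_density) measurable
  also have "\<dots> = (\<integral>\<^sup>+a. ennreal (?e a) * (if ?f a = 0 then 0 else q a) \<partial>mu c)"
  proof (rule nn_integral_cong)
    fix a assume "a \<in> space (mu c)"
    then have "0 \<le> ?f a" "0 \<le> ?e a"
      using dens_nonneg[OF t \<omega> c] dens_e_nonneg[OF c] sp_mu by auto
    then show "ennreal (?f a) * (ennreal (?e a / ?f a) * q a) = ennreal (?e a) * (if ?f a = 0 then 0 else q a)"
      by (cases "?f a = 0") (simp_all add: mult.assoc[symmetric] flip: ennreal_mult)
  qed
  also have "\<dots> = (\<integral>\<^sup>+a. (if ?f a = 0 then 0 else q a) \<partial>Pi_e c)"
    unfolding eqs by (rule nn_integral_density[symmetric]) measurable
  also have "\<dots> = (\<integral>\<^sup>+a. q a \<partial>Pi_e c)"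
    by (rule nn_integral_cong_AE) (use ae in eventually_elim, simp)
  finally show ?thesis .
qed

lemma kernels:
  shows kernel_y: "(\<lambda>ca. PY ca \<bind> (\<lambda>y. return Obs (fst ca, snd ca, y))) \<in> MC \<Otimes>\<^sub>M MA \<rightarrow>\<^sub>M prob_algebra Obs"
    and kernel_ay: "(\<lambda>c. Pi_e c \<bind> (\<lambda>a. PY (c, a) \<bind> (\<lambda>y. return Obs (c, a, y)))) \<in> MC \<rightarrow>\<^sub>M prob_algebra Obs"
proof -
  show y: "(\<lambda>ca. PY ca \<bind> (\<lambda>y. return Obs (fst ca, snd ca, y))) \<in> MC \<Otimes>\<^sub>M MA \<rightarrow>\<^sub>M prob_algebra Obs"
    by (rule measurable_bind_prob_space2[OF PY]) (unfold obs_space_def, measurable)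
  have "(\<lambda>(c, a). PY (c, a) \<bind> (\<lambda>y. return Obs (c, a, y))) \<in> MC \<Otimes>\<^sub>M MA \<rightarrow>\<^sub>M prob_algebra Obs"
    using y by (simp add: case_prod_beta')
  then show "(\<lambda>c. Pi_e c \<bind> (\<lambda>a. PY (c, a) \<bind> (\<lambda>y. return Obs (c, a, y)))) \<in> MC \<rightarrow>\<^sub>M prob_algebra Obs"
    by (intro measurable_bind_prob_space2[OF Pi_e]) simp
qed

lemma Pe_in_prob_algebra: "Pe \<in> space (prob_algebra Obs)"
proof -
  \<comment> \<open>Membership of a single measure is read off from a constant kernel, to which the
    rule for binding kernels applies.\<close>
  have "(\<lambda>_. Pe) \<in> PC \<rightarrow>\<^sub>M prob_algebra Obs"
    unfolding eval_law_def
  proof (rule measurable_bind_prob_space2)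
    show "(\<lambda>_. PC) \<in> PC \<rightarrow>\<^sub>M prob_algebra MC" using PC by simp
    show "(\<lambda>(x, c). Pi_e c \<bind> (\<lambda>a. PY (c, a) \<bind> (\<lambda>y. return Obs (c, a, y)))) \<in> PC \<Otimes>\<^sub>M MC \<rightarrow>\<^sub>M prob_algebra Obs"
      using measurable_compose[OF measurable_snd kernel_ay] by (simp add: case_prod_beta')
  qed
  moreover obtain c where "c \<in> space PC" using prob_space.not_empty[OF PC_prob] by blast
  ultimately show ?thesis by (rule measurable_space)
qed

lemma prob_space_Pe: "prob_space Pe" and sets_Pe: "sets Pe = sets Obs"
  using Pe_in_prob_algebra by (auto simp: space_prob_algebra)

lemma nn_integral_Pe:
  assumes g: "g \<in> borel_measurable Obs"
  shows "(\<integral>\<^sup>+z. g z \<partial>Pe) = (\<integral>\<^sup>+c. \<integral>\<^sup>+a. \<integral>\<^sup>+y. g (c, a, y) \<partial>PY (c, a) \<partial>Pi_e c \<partial>PC)"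
proof -
  have "(\<integral>\<^sup>+z. g z \<partial>Pe) = (\<integral>\<^sup>+c. \<integral>\<^sup>+z. g z \<partial>(Pi_e c \<bind> (\<lambda>a. PY (c, a) \<bind> (\<lambda>y. return Obs (c, a, y)))) \<partial>PC)"
    unfolding eval_law_def
  proof (rule nn_integral_bind[OF g])
    show "(\<lambda>c. Pi_e c \<bind> (\<lambda>a. PY (c, a) \<bind> (\<lambda>y. return Obs (c, a, y)))) \<in> PC \<rightarrow>\<^sub>M subprob_algebra Obs"
      using measurable_prob_algebraD[OF kernel_ay]
      by (subst measurable_cong_sets[OF sets_PC refl])
  qed
  also have "\<dots> = (\<integral>\<^sup>+c. \<integral>\<^sup>+a. \<integral>\<^sup>+y. g (c, a, y) \<partial>PY (c, a) \<partial>Pi_e c \<partial>PC)"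
  proof (rule nn_integral_cong)
    fix c assume "c \<in> space PC"
    then have c: "c \<in> space MC" using sets_eq_imp_space_eq[OF sets_PC] by simp
    have sets_e: "sets (Pi_e c) = sets MA" using measurable_space[OF Pi_e c] by (simp add: space_prob_algebra)
    have "(\<integral>\<^sup>+z. g z \<partial>(Pi_e c \<bind> (\<lambda>a. PY (c, a) \<bind> (\<lambda>y. return Obs (c, a, y)))))
        = (\<integral>\<^sup>+a. \<integral>\<^sup>+z. g z \<partial>(PY (c, a) \<bind> (\<lambda>y. return Obs (c, a, y))) \<partial>Pi_e c)"
    proof (rule nn_integral_bind[OF g])
      show "(\<lambda>a. PY (c, a) \<bind> (\<lambda>y. return Obs (c, a, y))) \<in> Pi_e c \<rightarrow>\<^sub>M subprob_algebra Obs"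
        using measurable_compose[OF measurable_Pair1'[OF c] measurable_prob_algebraD[OF kernel_y]]
        by (subst measurable_cong_sets[OF sets_e refl]) simp
    qed
    also have "\<dots> = (\<integral>\<^sup>+a. \<integral>\<^sup>+y. g (c, a, y) \<partial>PY (c, a) \<partial>Pi_e c)"
    proof (rule nn_integral_cong)
      fix a assume "a \<in> space (Pi_e c)"
      then have a: "a \<in> space MA" using sets_eq_imp_space_eq[OF sets_e] by simp
      have ca: "(c, a) \<in> space (MC \<Otimes>\<^sub>M MA)" using c a by (simp add: space_pair_measure)
      have sets_y: "sets (PY (c, a)) = sets borel" using measurable_space[OF PY ca] by (simp add: space_prob_algebra)
      have pair: "(\<lambda>y. (c, a, y)) \<in> borel \<rightarrow>\<^sub>M Obs" unfolding obs_space_def using c a by measurable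
      have "(\<integral>\<^sup>+z. g z \<partial>(PY (c, a) \<bind> (\<lambda>y. return Obs (c, a, y)))) = (\<integral>\<^sup>+y. \<integral>\<^sup>+z. g z \<partial>return Obs (c, a, y) \<partial>PY (c, a))"
      proof (rule nn_integral_bind[OF g])
        show "(\<lambda>y. return Obs (c, a, y)) \<in> PY (c, a) \<rightarrow>\<^sub>M subprob_algebra Obs"
          using measurable_compose[OF pair return_measurable]
          by (subst measurable_cong_sets[OF sets_y refl])
      qed
      also have "\<dots> = (\<integral>\<^sup>+y. g (c, a, y) \<partial>PY (c, a))"
        using g measurable_space[OF pair] by (intro nn_integral_cong nn_integral_return) auto
      finally show "(\<integral>\<^sup>+z. g z \<partial>(PY (c, a) \<bind> (\<lambda>y. return Obs (c, a, y)))) = (\<integral>\<^sup>+y. g (c, a, y) \<partial>PY (c, a))" .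
    qed
    finally show "(\<integral>\<^sup>+z. g z \<partial>(Pi_e c \<bind> (\<lambda>a. PY (c, a) \<bind> (\<lambda>y. return Obs (c, a, y)))))
        = (\<integral>\<^sup>+a. \<integral>\<^sup>+y. g (c, a, y) \<partial>PY (c, a) \<partial>Pi_e c)" .
  qed
  finally show ?thesis .
qed

lemma weight_measurable:
  "t \<in> {1..T} \<Longrightarrow> (\<lambda>(\<omega>, z). weight T t \<omega> z) \<in> borel_measurable (past T t \<Otimes>\<^sub>M Obs)"
proof -
  assume t: "t \<in> {1..T}"
  have 1: "(\<lambda>p. (ctx (snd p), act (snd p))) \<in> past T t \<Otimes>\<^sub>M Obs \<rightarrow>\<^sub>M MC \<Otimes>\<^sub>M MA"
    and 2: "(\<lambda>p. (fst p, ctx (snd p), act (snd p))) \<in> past T t \<Otimes>\<^sub>M Obs \<rightarrow>\<^sub>M past T t \<Otimes>\<^sub>M (MC \<Otimes>\<^sub>M MA)"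
    unfolding obs_space_def by measurable
  from measurable_compose[OF 1 dens_e_measurable] measurable_compose[OF 2 dens_measurable[OF t]]
  show ?thesis unfolding weight_def by (simp add: case_prod_beta')
qed

text \<open>Disintegrate over outcome, action and context; the weight then turns the policy of round \<open>t\<close>
  into the evaluation policy.\<close>

lemma nn_integral_weight:
  assumes t: "t \<in> {1..T}" and g: "g \<in> borel_measurable (past T t \<Otimes>\<^sub>M Obs)"
  shows "(\<integral>\<^sup>+\<omega>. ennreal (weight T t \<omega> (Z T t \<omega>)) * g (\<omega>, Z T t \<omega>) \<partial>M)
    = (\<integral>\<^sup>+\<omega>. \<integral>\<^sup>+z. g (\<omega>, z) \<partial>Pe \<partial>M)"
proof -
  let ?F = "past T t" and ?C = "\<lambda>\<omega>. ctx (Z T t \<omega>)" and ?A = "\<lambda>\<omega>. act (Z T t \<omega>)" and ?Y = "\<lambda>\<omega>. outc (Z T t \<omega>)"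
  let ?V = "\<lambda>\<omega>. (?C \<omega>, ?A \<omega>)" and ?CA = "MC \<Otimes>\<^sub>M MA"
  let ?EV = "enlarge ?F ?V ?CA" and ?EC = "enlarge ?F ?C MC"
  note F = subalgebra_past[OF t]
  note C = ctx_measurable[OF t] and A = act_measurable[OF t] and Y = outc_measurable[OF t]
  have V: "?V \<in> M \<rightarrow>\<^sub>M ?CA" using C A by measurable
  have spF: "space ?F = space M" using F by (simp add: subalgebra_def)
  have V_sp: "?V \<in> space ?F \<rightarrow> space ?CA" and C_sp: "?C \<in> space ?F \<rightarrow> space MC"
    using V C spF by (auto simp: measurable_def)
  define wt where "wt \<omega> ca = ennreal (dens_e (fst ca) (snd ca) / dens T t \<omega> (fst ca) (snd ca))" for \<omega> ca
  have wt_m: "(\<lambda>(\<omega>, ca). wt \<omega> ca) \<in> borel_measurable (?F \<Otimes>\<^sub>M ?CA)"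
  proof -
    have 1: "(\<lambda>p. snd p) \<in> ?F \<Otimes>\<^sub>M ?CA \<rightarrow>\<^sub>M ?CA" by measurable
    show ?thesis unfolding wt_def
      using measurable_compose[OF 1 dens_e_measurable] dens_measurable[OF t]
      by (simp add: case_prod_beta')
  qed
  have gassoc: "(\<lambda>((\<omega>, ca), y). g (\<omega>, fst ca, snd ca, y)) \<in> borel_measurable ((?F \<Otimes>\<^sub>M ?CA) \<Otimes>\<^sub>M borel)"
  proof -
    have "(\<lambda>p. (fst (fst p), fst (snd (fst p)), snd (snd (fst p)), snd p)) \<in> (?F \<Otimes>\<^sub>M ?CA) \<Otimes>\<^sub>M borel \<rightarrow>\<^sub>M ?F \<Otimes>\<^sub>M Obs"
      unfolding obs_space_def by measurable
    from measurable_compose[OF this g] show ?thesis by (simp add: case_prod_beta')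
  qed
  have gassoc': "(\<lambda>p. g (fst (fst p), fst (snd (fst p)), snd (snd (fst p)), snd p))
      \<in> borel_measurable ((?F \<Otimes>\<^sub>M ?CA) \<Otimes>\<^sub>M borel)"
    using gassoc by (simp add: case_prod_beta')
  have law_Y: "cond_law M ?EV borel ?Y (\<lambda>\<omega>. PY (?V \<omega>))"
    by (rule cond_law_enlarge[OF F V Y PY outc_law[OF t] outc_indep_history[OF t]])
  have PY_EV: "(\<lambda>\<omega>. PY (?V \<omega>)) \<in> ?EV \<rightarrow>\<^sub>M prob_algebra borel"
    by (rule measurable_compose[OF measurable_enlarge_snd[OF V_sp] PY])
  \<comment> \<open>\<open>g1\<close>, \<open>h\<close> and \<open>k\<close> are the integrand
    before integration, after integrating out the outcome, and after integrating out the action as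
    well; \<open>h1\<close> is \<open>h\<close> at the observed context. Each conditioning step
    needs joint measurability in the past and the variables still present.\<close>
  define g1 where "g1 p = (case p of (\<omega>, y) \<Rightarrow> wt \<omega> (?V \<omega>) * g (\<omega>, ?C \<omega>, ?A \<omega>, y))" for p
  have g1: "g1 \<in> borel_measurable (?EV \<Otimes>\<^sub>M borel)"
  proof -
    have p: "(\<lambda>p. (fst p, ?V (fst p))) \<in> ?EV \<Otimes>\<^sub>M (borel :: real measure) \<rightarrow>\<^sub>M ?F \<Otimes>\<^sub>M ?CA"
      by (rule measurable_compose[OF measurable_fst measurable_enlarge_pair[OF V_sp]])
    then have "(\<lambda>p. ((fst p, ?V (fst p)), snd p)) \<in> ?EV \<Otimes>\<^sub>M (borel :: real measure) \<rightarrow>\<^sub>M (?F \<Otimes>\<^sub>M ?CA) \<Otimes>\<^sub>M borel"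
      by measurable
    from measurable_compose[OF p wt_m] measurable_compose[OF this gassoc']
    show ?thesis unfolding g1_def by (simp add: case_prod_beta')
  qed
  define h where "h p = (case p of (\<omega>, ca) \<Rightarrow> wt \<omega> ca * (\<integral>\<^sup>+y. g (\<omega>, fst ca, snd ca, y) \<partial>PY ca))" for p
  have h: "h \<in> borel_measurable (?F \<Otimes>\<^sub>M ?CA)"
  proof -
    have PY': "(\<lambda>p. PY (snd p)) \<in> ?F \<Otimes>\<^sub>M ?CA \<rightarrow>\<^sub>M subprob_algebra borel"
      by (rule measurable_compose[OF measurable_snd measurable_prob_algebraD[OF PY]])
    have "(\<lambda>p. \<integral>\<^sup>+y. g (fst p, fst (snd p), snd (snd p), y) \<partial>PY (snd p)) \<in> borel_measurable (?F \<Otimes>\<^sub>M ?CA)"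
      by (rule nn_integral_measurable_subprob_algebra2[OF _ PY']) (use gassoc' in \<open>simp add: case_prod_beta'\<close>)
    with wt_m show ?thesis unfolding h_def by (simp add: case_prod_beta')
  qed
  have PiF: "(\<lambda>p. Pi T t (fst p) (snd p)) \<in> ?F \<Otimes>\<^sub>M MC \<rightarrow>\<^sub>M prob_algebra MA"
    using policy_measurable[OF t] by (simp add: case_prod_beta')
  have Pi_EC: "(\<lambda>\<omega>. Pi T t \<omega> (?C \<omega>)) \<in> ?EC \<rightarrow>\<^sub>M prob_algebra MA"
    using measurable_compose[OF measurable_enlarge_pair[OF C_sp] PiF] by simp
  have hassoc: "(\<lambda>p. h (fst (fst p), snd (fst p), snd p)) \<in> borel_measurable ((?F \<Otimes>\<^sub>M MC) \<Otimes>\<^sub>M MA)"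
  proof -
    have "(\<lambda>p. (fst (fst p), snd (fst p), snd p)) \<in> (?F \<Otimes>\<^sub>M MC) \<Otimes>\<^sub>M MA \<rightarrow>\<^sub>M ?F \<Otimes>\<^sub>M ?CA" by measurable
    from measurable_compose[OF this h] show ?thesis .
  qed
  define h1 where "h1 p = (case p of (\<omega>, a) \<Rightarrow> h (\<omega>, ?C \<omega>, a))" for p
  have h1: "h1 \<in> borel_measurable (?EC \<Otimes>\<^sub>M MA)"
  proof -
    have p: "(\<lambda>p. (fst p, ?C (fst p))) \<in> ?EC \<Otimes>\<^sub>M MA \<rightarrow>\<^sub>M ?F \<Otimes>\<^sub>M MC"
      by (rule measurable_compose[OF measurable_fst measurable_enlarge_pair[OF C_sp]])
    then have "(\<lambda>p. ((fst p, ?C (fst p)), snd p)) \<in> ?EC \<Otimes>\<^sub>M MA \<rightarrow>\<^sub>M (?F \<Otimes>\<^sub>M MC) \<Otimes>\<^sub>M MA"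
      by measurable
    from measurable_compose[OF this hassoc] show ?thesis unfolding h1_def by (simp add: case_prod_beta')
  qed
  define k where "k p = (case p of (\<omega>, c) \<Rightarrow> \<integral>\<^sup>+a. h (\<omega>, c, a) \<partial>Pi T t \<omega> c)" for p
  have k: "k \<in> borel_measurable (?F \<Otimes>\<^sub>M MC)"
    unfolding k_def case_prod_beta'
    by (rule nn_integral_measurable_subprob_algebra2[OF _ measurable_prob_algebraD[OF PiF]])
      (use hassoc in \<open>simp add: case_prod_beta'\<close>)
  have law_C: "cond_law M ?F MC ?C (\<lambda>_. PC)"
    using cond_law_indep[OF F C ctx_indep_history[OF t]] ctx_law[OF t] by simp

  have "(\<integral>\<^sup>+\<omega>. ennreal (weight T t \<omega> (Z T t \<omega>)) * g (\<omega>, Z T t \<omega>) \<partial>M) = (\<integral>\<^sup>+\<omega>. g1 (\<omega>, ?Y \<omega>) \<partial>M)"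
    unfolding g1_def wt_def weight_def by simp
  also have "\<dots> = (\<integral>\<^sup>+\<omega>. \<integral>\<^sup>+y. g1 (\<omega>, y) \<partial>PY (?V \<omega>) \<partial>M)"
    by (rule cond_law_nn_integral[OF subalgebra_enlarge[OF F V] Y PY_EV law_Y g1])
  also have "\<dots> = (\<integral>\<^sup>+\<omega>. h1 (\<omega>, ?A \<omega>) \<partial>M)"
  proof (rule nn_integral_cong)
    fix \<omega> assume \<omega>: "\<omega> \<in> space M"
    have ca: "?V \<omega> \<in> space ?CA" by (rule measurable_space[OF V \<omega>])
    have sets_y: "sets (PY (?V \<omega>)) = sets borel" using measurable_space[OF PY ca] by (simp add: space_prob_algebra)
    have "(\<omega>, ?V \<omega>) \<in> space (?F \<Otimes>\<^sub>M ?CA)" using ca \<omega> spF by (simp add: space_pair_measure)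
    from measurable_compose[OF measurable_Pair1'[OF this] gassoc']
    have "(\<lambda>y. g (\<omega>, ?C \<omega>, ?A \<omega>, y)) \<in> borel_measurable (PY (?V \<omega>))"
      by (subst measurable_cong_sets[OF sets_y refl]) simp
    then show "(\<integral>\<^sup>+y. g1 (\<omega>, y) \<partial>PY (?V \<omega>)) = h1 (\<omega>, ?A \<omega>)"
      unfolding g1_def h1_def h_def by (simp add: nn_integral_cmult)
  qed
  also have "\<dots> = (\<integral>\<^sup>+\<omega>. \<integral>\<^sup>+a. h1 (\<omega>, a) \<partial>Pi T t \<omega> (?C \<omega>) \<partial>M)"
    by (rule cond_law_nn_integral[OF subalgebra_enlarge[OF F C] A Pi_EC act_law[OF t] h1])
  also have "\<dots> = (\<integral>\<^sup>+\<omega>. k (\<omega>, ?C \<omega>) \<partial>M)" unfolding h1_def k_def by simp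
  also have "\<dots> = (\<integral>\<^sup>+\<omega>. \<integral>\<^sup>+c. k (\<omega>, c) \<partial>PC \<partial>M)"
    by (rule cond_law_nn_integral[OF F C _ law_C k]) (use PC in simp)
  also have "\<dots> = (\<integral>\<^sup>+\<omega>. \<integral>\<^sup>+z. g (\<omega>, z) \<partial>Pe \<partial>M)"
  proof (rule nn_integral_cong_AE)
    show "AE \<omega> in M. (\<integral>\<^sup>+c. k (\<omega>, c) \<partial>PC) = (\<integral>\<^sup>+z. g (\<omega>, z) \<partial>Pe)"
      using overlap[OF t] AE_space
    proof eventually_elim
      case (elim \<omega>)
      have sp: "\<omega> \<in> space ?F" using elim spF by simp
      have g\<omega>: "(\<lambda>z. g (\<omega>, z)) \<in> borel_measurable Obs" using measurable_compose[OF measurable_Pair1'[OF sp] g] .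
      show ?case unfolding nn_integral_Pe[OF g\<omega>]
      proof (rule nn_integral_cong_AE)
        show "AE c in PC. k (\<omega>, c) = (\<integral>\<^sup>+a. \<integral>\<^sup>+y. g (\<omega>, c, a, y) \<partial>PY (c, a) \<partial>Pi_e c)"
          using elim(1) AE_space
        proof eventually_elim
          case (elim c)
          have c: "c \<in> space MC" using elim sets_eq_imp_space_eq[OF sets_PC] by simp
          have "(\<lambda>p. \<integral>\<^sup>+y. g (fst p, fst (snd p), snd (snd p), y) \<partial>PY (snd p)) \<in> borel_measurable (?F \<Otimes>\<^sub>M ?CA)"
          proof -
            have PY': "(\<lambda>p. PY (snd p)) \<in> ?F \<Otimes>\<^sub>M ?CA \<rightarrow>\<^sub>M subprob_algebra borel"
              by (rule measurable_compose[OF measurable_snd measurable_prob_algebraD[OF PY]])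
            show ?thesis
              by (rule nn_integral_measurable_subprob_algebra2[OF _ PY']) (use gassoc' in \<open>simp add: case_prod_beta'\<close>)
          qed
          from measurable_compose[OF measurable_Pair1'[OF c] measurable_compose[OF measurable_Pair1'[OF sp] this]]
          have "(\<lambda>a. \<integral>\<^sup>+y. g (\<omega>, c, a, y) \<partial>PY (c, a)) \<in> borel_measurable MA" by simp
          from nn_integral_change_policy[OF t \<open>\<omega> \<in> space M\<close> c elim(1) this]
          show ?case unfolding k_def h_def wt_def by simp
        qed
      qed
    qed
  qed
  finally show ?thesis .
qed

end

lemma (in sigma_finite_subalgebra) real_cond_exp_nonneg_eq:
  assumes [measurable]: "f \<in> borel_measurable M" and f: "\<And>x. x \<in> space M \<Longrightarrow> 0 \<le> f x"
  shows "AE x in M. real_cond_exp M F f x = enn2real (nn_cond_exp M F (\<lambda>x. ennreal (f x)) x)"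
proof -
  have "AE x in M. nn_cond_exp M F (\<lambda>x. ennreal (- f x)) x = nn_cond_exp M F (\<lambda>x. 0) x"
    by (rule nn_cond_exp_cong) (auto intro!: AE_I2 simp: ennreal_neg f)
  moreover have "AE x in M. 0 = nn_cond_exp M F (\<lambda>x. 0) x" by (rule nn_cond_exp_F_meas) simp
  ultimately show ?thesis unfolding real_cond_exp_def by eventually_elim simp
qed

section \<open>Conditional moments of weighted observations\<close>

context bandit_density
begin

lemma sigma_finite_past: "t \<in> {1..T} \<Longrightarrow> sigma_finite_subalgebra M (past T t)"
  by (intro sigma_finite_subalgebraI subalgebra_past)

lemma past_obs_measurable: "t \<in> {1..T} \<Longrightarrow> (\<lambda>\<omega>. (\<omega>, Z T t \<omega>)) \<in> M \<rightarrow>\<^sub>M past T t \<Otimes>\<^sub>M Obs"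
proof -
  assume t: "t \<in> {1..T}"
  have "(\<lambda>\<omega>. \<omega>) \<in> M \<rightarrow>\<^sub>M past T t" by (rule measurable_from_subalg[OF subalgebra_past[OF t]]) simp
  then show ?thesis using Z_measurable[OF t] by (rule measurable_Pair)
qed

lemma weight_obs_measurable: "t \<in> {1..T} \<Longrightarrow> (\<lambda>\<omega>. weight T t \<omega> (Z T t \<omega>)) \<in> borel_measurable M"
  using measurable_compose[OF past_obs_measurable weight_measurable] by simp

lemma weight_nonneg:
  assumes "t \<in> {1..T}" "\<omega> \<in> space M" "z \<in> space Obs"
  shows "0 \<le> weight T t \<omega> z"
proof -
  have "ctx z \<in> space MC" "act z \<in> space MA"
    using assms(3) by (auto simp: obs_space_def space_pair_measure)
  then show ?thesis unfolding weight_def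
    using dens_nonneg[OF assms(1,2)] dens_e_nonneg by (intro divide_nonneg_nonneg) auto
qed

lemma nn_integral_Pe_measurable:
  fixes N :: "'x measure"
  assumes "g \<in> borel_measurable (N \<Otimes>\<^sub>M Obs)"
  shows "(\<lambda>\<omega>. \<integral>\<^sup>+z. g (\<omega>, z) \<partial>Pe) \<in> borel_measurable N"
proof -
  interpret P: prob_space Pe by (rule prob_space_Pe)
  have "sets (N \<Otimes>\<^sub>M Pe) = sets (N \<Otimes>\<^sub>M Obs)" by (rule sets_pair_measure_cong[OF refl sets_Pe])
  then have "(\<lambda>(\<omega>, z). g (\<omega>, z)) \<in> borel_measurable (N \<Otimes>\<^sub>M Pe)"
    using assms by (subst measurable_cong_sets[OF _ refl]) (auto simp: case_prod_beta')
  then show ?thesis by (rule P.borel_measurable_nn_integral)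
qed

lemma integral_Pe_measurable:
  fixes N :: "'x measure" and g :: "_ \<Rightarrow> real"
  assumes "g \<in> borel_measurable (N \<Otimes>\<^sub>M Obs)"
  shows "(\<lambda>\<omega>. \<integral>z. g (\<omega>, z) \<partial>Pe) \<in> borel_measurable N"
proof -
  interpret P: prob_space Pe by (rule prob_space_Pe)
  have "sets (N \<Otimes>\<^sub>M Pe) = sets (N \<Otimes>\<^sub>M Obs)" by (rule sets_pair_measure_cong[OF refl sets_Pe])
  then have "(\<lambda>(\<omega>, z). g (\<omega>, z)) \<in> borel_measurable (N \<Otimes>\<^sub>M Pe)"
    using assms by (subst measurable_cong_sets[OF _ refl]) (auto simp: case_prod_beta')
  then show ?thesis by (rule P.borel_measurable_lebesgue_integral)
qed

text \<open>\<open>nn_integral_weight\<close> is applied to \<open>g\<close> times the indicator of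
  a past event; the integral under \<open>Pe\<close> is past-measurable, so it is the conditional
  expectation by uniqueness.\<close>

lemma nn_cond_exp_weight:
  assumes t: "t \<in> {1..T}" and g[measurable]: "g \<in> borel_measurable (past T t \<Otimes>\<^sub>M Obs)"
  shows "AE \<omega> in M. nn_cond_exp M (past T t) (\<lambda>\<omega>. ennreal (weight T t \<omega> (Z T t \<omega>)) * g (\<omega>, Z T t \<omega>)) \<omega>
    = (\<integral>\<^sup>+z. g (\<omega>, z) \<partial>Pe)"
proof -
  interpret sigma_finite_subalgebra M "past T t" by (rule sigma_finite_past[OF t])
  note [measurable] = weight_obs_measurable[OF t] measurable_compose[OF past_obs_measurable[OF t] g]
  have "AE \<omega> in M. (\<integral>\<^sup>+z. g (\<omega>, z) \<partial>Pe)
    = nn_cond_exp M (past T t) (\<lambda>\<omega>. ennreal (weight T t \<omega> (Z T t \<omega>)) * g (\<omega>, Z T t \<omega>)) \<omega>"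
  proof (rule nn_cond_exp_charact)
    show "(\<lambda>\<omega>. \<integral>\<^sup>+z. g (\<omega>, z) \<partial>Pe) \<in> borel_measurable (past T t)"
      by (rule nn_integral_Pe_measurable[OF g])
    fix A assume A[measurable]: "A \<in> sets (past T t)"
    let ?gA = "\<lambda>p. g p * indicator A (fst p)"
    have "(\<integral>\<^sup>+\<omega>\<in>A. (ennreal (weight T t \<omega> (Z T t \<omega>)) * g (\<omega>, Z T t \<omega>)) \<partial>M)
        = (\<integral>\<^sup>+\<omega>. ennreal (weight T t \<omega> (Z T t \<omega>)) * ?gA (\<omega>, Z T t \<omega>) \<partial>M)" by (simp add: mult.assoc)
    also have "\<dots> = (\<integral>\<^sup>+\<omega>. \<integral>\<^sup>+z. ?gA (\<omega>, z) \<partial>Pe \<partial>M)"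
      by (rule nn_integral_weight[OF t]) measurable
    also have "\<dots> = (\<integral>\<^sup>+\<omega>\<in>A. (\<integral>\<^sup>+z. g (\<omega>, z) \<partial>Pe) \<partial>M)"
      by (intro nn_integral_cong) (auto split: split_indicator)
    finally show "(\<integral>\<^sup>+\<omega>\<in>A. (ennreal (weight T t \<omega> (Z T t \<omega>)) * g (\<omega>, Z T t \<omega>)) \<partial>M)
        = (\<integral>\<^sup>+\<omega>\<in>A. (\<integral>\<^sup>+z. g (\<omega>, z) \<partial>Pe) \<partial>M)" .
  qed measurable
  then show ?thesis by eventually_elim simp
qed

lemma ennreal_weight_mult:
  "t \<in> {1..T} \<Longrightarrow> \<omega> \<in> space M \<Longrightarrow> ennreal (weight T t \<omega> (Z T t \<omega>) * x) = ennreal (weight T t \<omega> (Z T t \<omega>)) * ennreal x"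
  using weight_nonneg[of t T \<omega> "Z T t \<omega>"] measurable_space[OF Z_measurable[of t T]] by (simp add: ennreal_mult')

text \<open>Positive and negative parts are treated separately. Integrability holds because
  weighting turns the absolute mean into the mean of an integral under \<open>Pe\<close>, which is
  at most \<open>k\<close> at every sample point.\<close>

lemma real_cond_exp_weight:
  fixes g :: "_ \<Rightarrow> real"
  assumes t: "t \<in> {1..T}" and g[measurable]: "g \<in> borel_measurable (past T t \<Otimes>\<^sub>M Obs)"
    and int: "\<And>\<omega>. \<omega> \<in> space M \<Longrightarrow> integrable Pe (\<lambda>z. g (\<omega>, z))"
    and bound: "\<And>\<omega>. \<omega> \<in> space M \<Longrightarrow> (\<integral>z. \<bar>g (\<omega>, z)\<bar> \<partial>Pe) \<le> k"
  shows "integrable M (\<lambda>\<omega>. weight T t \<omega> (Z T t \<omega>) * g (\<omega>, Z T t \<omega>))"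
    and "AE \<omega> in M. real_cond_exp M (past T t) (\<lambda>\<omega>. weight T t \<omega> (Z T t \<omega>) * g (\<omega>, Z T t \<omega>)) \<omega>
      = (\<integral>z. g (\<omega>, z) \<partial>Pe)"
proof -
  interpret sigma_finite_subalgebra M "past T t" by (rule sigma_finite_past[OF t])
  note [measurable] = weight_obs_measurable[OF t] measurable_compose[OF past_obs_measurable[OF t] g]
  let ?w = "\<lambda>\<omega>. weight T t \<omega> (Z T t \<omega>)"
  have w: "0 \<le> ?w \<omega>" if "\<omega> \<in> space M" for \<omega>
    using weight_nonneg[OF t that measurable_space[OF Z_measurable[OF t] that]] .
  have "(\<integral>\<^sup>+\<omega>. ennreal (norm (?w \<omega> * g (\<omega>, Z T t \<omega>))) \<partial>M) = (\<integral>\<^sup>+\<omega>. ennreal (?w \<omega>) * ennreal \<bar>g (\<omega>, Z T t \<omega>)\<bar> \<partial>M)"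
    by (intro nn_integral_cong) (simp add: abs_mult w ennreal_mult)
  also have "\<dots> = (\<integral>\<^sup>+\<omega>. \<integral>\<^sup>+z. ennreal \<bar>g (\<omega>, z)\<bar> \<partial>Pe \<partial>M)"
    by (rule nn_integral_weight[OF t, of "\<lambda>p. ennreal \<bar>g p\<bar>"]) measurable
  also have "\<dots> \<le> (\<integral>\<^sup>+\<omega>. ennreal k \<partial>M)"
    using bound int by (intro nn_integral_mono) (auto simp: nn_integral_eq_integral ennreal_leI)
  also have "\<dots> < \<infinity>" by (simp add: emeasure_space_1 ennreal_mult_less_top)
  finally show "integrable M (\<lambda>\<omega>. ?w \<omega> * g (\<omega>, Z T t \<omega>))" by (intro integrableI_bounded) auto
  have pos: "AE \<omega> in M. nn_cond_exp M (past T t) (\<lambda>\<omega>. ennreal (?w \<omega>) * ennreal (g (\<omega>, Z T t \<omega>))) \<omega>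
      = (\<integral>\<^sup>+z. ennreal (g (\<omega>, z)) \<partial>Pe)"
    by (rule nn_cond_exp_weight[OF t, of "\<lambda>p. ennreal (g p)"]) measurable
  have neg: "AE \<omega> in M. nn_cond_exp M (past T t) (\<lambda>\<omega>. ennreal (?w \<omega>) * ennreal (- g (\<omega>, Z T t \<omega>))) \<omega>
      = (\<integral>\<^sup>+z. ennreal (- g (\<omega>, z)) \<partial>Pe)"
    by (rule nn_cond_exp_weight[OF t, of "\<lambda>p. ennreal (- g p)"]) measurable
  have "AE \<omega> in M. nn_cond_exp M (past T t) (\<lambda>\<omega>. ennreal (?w \<omega> * g (\<omega>, Z T t \<omega>))) \<omega>
      = nn_cond_exp M (past T t) (\<lambda>\<omega>. ennreal (?w \<omega>) * ennreal (g (\<omega>, Z T t \<omega>))) \<omega>"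
    by (rule nn_cond_exp_cong) (auto intro!: AE_I2 simp: ennreal_weight_mult[OF t])
  moreover have "AE \<omega> in M. nn_cond_exp M (past T t) (\<lambda>\<omega>. ennreal (- (?w \<omega> * g (\<omega>, Z T t \<omega>)))) \<omega>
      = nn_cond_exp M (past T t) (\<lambda>\<omega>. ennreal (?w \<omega>) * ennreal (- g (\<omega>, Z T t \<omega>))) \<omega>"
    by (rule nn_cond_exp_cong) (auto intro!: AE_I2 simp: ennreal_weight_mult[OF t, symmetric])
  ultimately show "AE \<omega> in M. real_cond_exp M (past T t) (\<lambda>\<omega>. ?w \<omega> * g (\<omega>, Z T t \<omega>)) \<omega> = (\<integral>z. g (\<omega>, z) \<partial>Pe)"
    using pos neg AE_space unfolding real_cond_exp_def
  proof eventually_elim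
    case (elim \<omega>)
    then show ?case using int[of \<omega>] by (simp add: real_lebesgue_integral_def)
  qed
qed

text \<open>A squared weight leaves one weight under \<open>Pe\<close>, since the other one is spent on the change of
  measure.\<close>

lemma nn_cond_exp_weight_sq:
  fixes g :: "_ \<Rightarrow> real"
  assumes t: "t \<in> {1..T}" and g[measurable]: "g \<in> borel_measurable (past T t \<Otimes>\<^sub>M Obs)"
  shows "AE \<omega> in M. nn_cond_exp M (past T t) (\<lambda>\<omega>. ennreal ((weight T t \<omega> (Z T t \<omega>) * g (\<omega>, Z T t \<omega>))\<^sup>2)) \<omega>
    = (\<integral>\<^sup>+z. ennreal (weight T t \<omega> z) * ennreal ((g (\<omega>, z))\<^sup>2) \<partial>Pe)"
proof -
  let ?w = "\<lambda>\<omega>. weight T t \<omega> (Z T t \<omega>)"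
  let ?h = "\<lambda>p. ennreal (weight T t (fst p) (snd p)) * ennreal ((g p)\<^sup>2)"
  have [measurable]: "(\<lambda>p. weight T t (fst p) (snd p)) \<in> borel_measurable (past T t \<Otimes>\<^sub>M Obs)"
    using weight_measurable[OF t] by (simp add: case_prod_beta')
  interpret sigma_finite_subalgebra M "past T t" by (rule sigma_finite_past[OF t])
  note [measurable] = weight_obs_measurable[OF t] measurable_compose[OF past_obs_measurable[OF t] g]
  have "AE \<omega> in M. nn_cond_exp M (past T t) (\<lambda>\<omega>. ennreal (?w \<omega>) * ?h (\<omega>, Z T t \<omega>)) \<omega> = (\<integral>\<^sup>+z. ?h (\<omega>, z) \<partial>Pe)"
    by (rule nn_cond_exp_weight[OF t]) measurable
  moreover have "AE \<omega> in M. nn_cond_exp M (past T t) (\<lambda>\<omega>. ennreal ((?w \<omega> * g (\<omega>, Z T t \<omega>))\<^sup>2)) \<omega>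
      = nn_cond_exp M (past T t) (\<lambda>\<omega>. ennreal (?w \<omega>) * ?h (\<omega>, Z T t \<omega>)) \<omega>"
  proof (rule nn_cond_exp_cong)
    show "AE \<omega> in M. ennreal ((?w \<omega> * g (\<omega>, Z T t \<omega>))\<^sup>2) = ennreal (?w \<omega>) * ?h (\<omega>, Z T t \<omega>)"
    proof (rule AE_I2)
      fix \<omega> assume \<omega>: "\<omega> \<in> space M"
      have "(?w \<omega> * g (\<omega>, Z T t \<omega>))\<^sup>2 = ?w \<omega> * (?w \<omega> * (g (\<omega>, Z T t \<omega>))\<^sup>2)"
        by (simp add: power2_eq_square algebra_simps)
      then show "ennreal ((?w \<omega> * g (\<omega>, Z T t \<omega>))\<^sup>2) = ennreal (?w \<omega>) * ?h (\<omega>, Z T t \<omega>)"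
        by (simp only: ennreal_weight_mult[OF t \<omega>] fst_conv snd_conv)
    qed
    have "?h \<in> borel_measurable (past T t \<Otimes>\<^sub>M Obs)" by measurable
    from measurable_compose[OF past_obs_measurable[OF t] this]
    have "(\<lambda>\<omega>. ?h (\<omega>, Z T t \<omega>)) \<in> borel_measurable M" .
    from borel_measurable_times_ennreal[OF _ this, of "\<lambda>\<omega>. ennreal (?w \<omega>)"]
    show "(\<lambda>\<omega>. ennreal (?w \<omega>) * ?h (\<omega>, Z T t \<omega>)) \<in> borel_measurable M"
      using weight_obs_measurable[OF t] by simp
  qed measurable
  ultimately show ?thesis by eventually_elim simp
qed

end

section \<open>Asymptotic normality\<close>

text \<open>The rates are restated for plain sums and the lower bound on the variance estimates is
  named, in the form in which they are used.\<close>

locale weighted_one_step = bandit_density M MC MA PC PY Z Pi Pi_e mu dens dens_e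
  + os: one_step "eval_law MC MA PC Pi_e PY" l m \<theta>\<^sub>0 \<eta>\<^sub>0 \<iota> \<alpha> \<rho> C
  for M :: "'w measure" and MC :: "'c measure" and MA :: "'a measure"
    and PC :: "'c measure" and PY :: "'c \<times> 'a \<Rightarrow> real measure"
    and Z :: "nat \<Rightarrow> nat \<Rightarrow> 'w \<Rightarrow> 'c \<times> 'a \<times> real"
    and Pi :: "nat \<Rightarrow> nat \<Rightarrow> 'w \<Rightarrow> 'c \<Rightarrow> 'a measure"
    and Pi_e :: "'c \<Rightarrow> 'a measure" and mu :: "'c \<Rightarrow> 'a measure"
    and dens :: "nat \<Rightarrow> nat \<Rightarrow> 'w \<Rightarrow> 'c \<Rightarrow> 'a \<Rightarrow> real" and dens_e :: "'c \<Rightarrow> 'a \<Rightarrow> real"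
    and l :: "'th::real_normed_vector \<Rightarrow> 'up::real_normed_vector \<Rightarrow> 'c \<times> 'a \<times> real \<Rightarrow> real"
    and m :: "'th \<Rightarrow> 'c \<times> 'a \<times> real \<Rightarrow> real"
    and \<theta>\<^sub>0 :: 'th and \<eta>\<^sub>0 :: 'up
    and \<iota> :: "'th \<Rightarrow> 'b::banach" and \<alpha> :: 'b and \<rho> :: real and C :: "'c \<times> 'a \<times> real \<Rightarrow> real" +
  fixes \<theta>h \<alpha>h :: "nat \<Rightarrow> nat \<Rightarrow> 'w \<Rightarrow> 'th" and \<eta>h :: "nat \<Rightarrow> nat \<Rightarrow> 'w \<Rightarrow> 'up"
    and \<sigma>h :: "nat \<Rightarrow> nat \<Rightarrow> 'w \<Rightarrow> real" and var_floor :: real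
  assumes \<theta>h[measurable]: "\<And>T t. t \<in> {1..T} \<Longrightarrow> \<theta>h T t \<in> past T t \<rightarrow>\<^sub>M borel"
    and \<eta>h[measurable]: "\<And>T t. t \<in> {1..T} \<Longrightarrow> \<eta>h T t \<in> past T t \<rightarrow>\<^sub>M borel"
    and \<alpha>h[measurable]: "\<And>T t. t \<in> {1..T} \<Longrightarrow> \<alpha>h T t \<in> past T t \<rightarrow>\<^sub>M borel"
    and \<sigma>h[measurable]: "\<And>T t. t \<in> {1..T} \<Longrightarrow> \<sigma>h T t \<in> past T t \<rightarrow>\<^sub>M borel"
    and var_floor: "0 < var_floor"
    and \<sigma>h_bound: "\<And>T. AE \<omega> in M. \<forall>t\<in>{1..T}. 0 \<le> \<sigma>h T t \<omega> \<and> var_floor < (\<sigma>h T t \<omega>)\<^sup>2"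
    and rate_\<theta>: "vanishes_in_prob M (\<lambda>T \<omega>. ennreal (\<Sum>t=1..T. norm (\<theta>h T t \<omega> - \<theta>\<^sub>0) ^ 4))"
    and rate_\<eta>: "vanishes_in_prob M (\<lambda>T \<omega>. ennreal (\<Sum>t=1..T. norm (\<eta>h T t \<omega> - \<eta>\<^sub>0) ^ 4))"
    and rate_\<alpha>: "vanishes_in_prob M (\<lambda>T \<omega>. ennreal (\<Sum>t=1..T. os.ext_dist (\<alpha>h T t \<omega>) ^ 4))"
    and weight_growth: "AE \<omega> in M. \<exists>K. \<forall>\<^sub>F T in sequentially.
      (SUP t\<in>{1..T}. SUP (c, a)\<in>space MC \<times> space MA. ennreal (dens_e c a) / ennreal (dens T t \<omega> c a))
        \<le> ennreal (K * real T powr (1 / 3))"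
begin

abbreviation infl where "infl \<equiv> influence Pe l m \<theta>\<^sub>0 \<eta>\<^sub>0 \<iota> \<alpha>"
abbreviation Hist where "Hist T \<equiv> history M Obs (Z T)"

definition obs_weight :: "nat \<Rightarrow> nat \<Rightarrow> 'w \<Rightarrow> real" where "obs_weight T t \<omega> = weight T t \<omega> (Z T t \<omega>)"

text \<open>Almost surely \<open>1 / \<sigma>h\<close>, but bounded everywhere.\<close>

definition inv_sigma :: "nat \<Rightarrow> nat \<Rightarrow> 'w \<Rightarrow> real" where
  "inv_sigma T t \<omega> = (if 0 \<le> \<sigma>h T t \<omega> \<and> var_floor < (\<sigma>h T t \<omega>)\<^sup>2 then inverse (\<sigma>h T t \<omega>) else 0)"

text \<open>The region where the perturbation bounds are available. It is a condition on
  past-measurable estimators, hence an event of the past.\<close>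

definition near_truth :: "nat \<Rightarrow> nat \<Rightarrow> 'w \<Rightarrow> bool" where
  "near_truth T t \<omega> \<longleftrightarrow> \<theta>h T t \<omega> \<in> ball \<theta>\<^sub>0 \<rho> \<and> \<eta>h T t \<omega> \<in> ball \<eta>\<^sub>0 \<rho> \<and> os.ext_dist (\<alpha>h T t \<omega>) \<le> 1"

text \<open>Setting the perturbation to 0 outside the region makes it integrable under
  \<open>Pe\<close> at every sample point; the event on which this changes anything is
  negligible.\<close>

definition pert :: "nat \<Rightarrow> nat \<Rightarrow> 'w \<times> 'c \<times> 'a \<times> real \<Rightarrow> real" where
  "pert T t p = (if near_truth T t (fst p)
     then os.perturbation (\<theta>h T t (fst p)) (\<eta>h T t (fst p)) (\<alpha>h T t (fst p)) (snd p) else 0)"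

definition err_at :: "nat \<Rightarrow> nat \<Rightarrow> 'w \<Rightarrow> real" where
  "err_at T t \<omega> = os.err (\<theta>h T t \<omega>) (\<eta>h T t \<omega>) (\<alpha>h T t \<omega>)"

text \<open>By importance weighting this is the conditional mean of the weighted perturbation given
  the past, in a version defined at every sample point.\<close>

definition bias :: "nat \<Rightarrow> nat \<Rightarrow> 'w \<Rightarrow> real" where
  "bias T t \<omega> = (\<integral>z. pert T t (\<omega>, z) \<partial>Pe)"

lemma inv_sigma_nonneg: "0 \<le> inv_sigma T t \<omega>" by (simp add: inv_sigma_def)

lemma inv_sigma_sq_le: "(inv_sigma T t \<omega>)\<^sup>2 \<le> 1 / var_floor"
proof (cases "0 \<le> \<sigma>h T t \<omega> \<and> var_floor < (\<sigma>h T t \<omega>)\<^sup>2")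
  case True
  then have "inverse ((\<sigma>h T t \<omega>)\<^sup>2) \<le> inverse var_floor" using var_floor by (intro le_imp_inverse_le) auto
  then show ?thesis using True by (simp add: inv_sigma_def power_inverse inverse_eq_divide[of var_floor])
qed (use var_floor in \<open>auto simp: inv_sigma_def\<close>)

lemma inv_sigma_le: "inv_sigma T t \<omega> \<le> 1 / sqrt var_floor"
  using real_le_rsqrt[OF inv_sigma_sq_le[of T t \<omega>]] by (simp add: real_sqrt_divide)

lemma inv_sigma_measurable[measurable]: "t \<in> {1..T} \<Longrightarrow> inv_sigma T t \<in> borel_measurable (past T t)"
  unfolding inv_sigma_def by measurable

lemma measurable_past_M: "t \<in> {1..T} \<Longrightarrow> f \<in> past T t \<rightarrow>\<^sub>M K \<Longrightarrow> f \<in> M \<rightarrow>\<^sub>M K"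
  by (rule measurable_from_subalg[OF subalgebra_past])

lemma err_at_nonneg: "0 \<le> err_at T t \<omega>" by (simp add: err_at_def os.err_nonneg)

lemma norm_\<theta>h_measurable: "t \<in> {1..T} \<Longrightarrow> (\<lambda>\<omega>. norm (\<theta>h T t \<omega> - \<theta>\<^sub>0)) \<in> borel_measurable (past T t)"
proof -
  assume t: "t \<in> {1..T}"
  have "(\<lambda>x. norm (x - \<theta>\<^sub>0)) \<in> borel_measurable borel"
    by (intro borel_measurable_continuous_onI continuous_intros)
  from measurable_compose[OF \<theta>h[OF t] this] show ?thesis .
qed

lemma norm_\<eta>h_measurable: "t \<in> {1..T} \<Longrightarrow> (\<lambda>\<omega>. norm (\<eta>h T t \<omega> - \<eta>\<^sub>0)) \<in> borel_measurable (past T t)"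
proof -
  assume t: "t \<in> {1..T}"
  have "(\<lambda>x. norm (x - \<eta>\<^sub>0)) \<in> borel_measurable borel"
    by (intro borel_measurable_continuous_onI continuous_intros)
  from measurable_compose[OF \<eta>h[OF t] this] show ?thesis .
qed

lemma ext_dist_\<alpha>h_measurable: "t \<in> {1..T} \<Longrightarrow> (\<lambda>\<omega>. os.ext_dist (\<alpha>h T t \<omega>)) \<in> borel_measurable (past T t)"
  by (rule measurable_compose[OF \<alpha>h os.ext_dist_measurable])

lemma err_at_measurable: "t \<in> {1..T} \<Longrightarrow> err_at T t \<in> borel_measurable (past T t)"
  using norm_\<theta>h_measurable norm_\<eta>h_measurable ext_dist_\<alpha>h_measurable
  unfolding err_at_def os.err_def by measurable

lemma err_at_measurable_M[measurable]: "t \<in> {1..T} \<Longrightarrow> err_at T t \<in> borel_measurable M"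
  using measurable_past_M err_at_measurable by blast

lemma near_truth_measurable: "t \<in> {1..T} \<Longrightarrow> {\<omega>\<in>space (past T t). near_truth T t \<omega>} \<in> sets (past T t)"
proof -
  assume t: "t \<in> {1..T}"
  note [measurable] = norm_\<theta>h_measurable[OF t] norm_\<eta>h_measurable[OF t] ext_dist_\<alpha>h_measurable[OF t]
  have near_truth_iff: "near_truth T t \<omega> \<longleftrightarrow> norm (\<theta>h T t \<omega> - \<theta>\<^sub>0) < \<rho> \<and> norm (\<eta>h T t \<omega> - \<eta>\<^sub>0) < \<rho> \<and> os.ext_dist (\<alpha>h T t \<omega>) \<le> 1" for \<omega>
    by (simp add: near_truth_def dist_norm norm_minus_commute)
  show ?thesis unfolding near_truth_iff by measurable
qed

text \<open>Used in contraposition: a sum of fourth powers below \<open>(min \<rho> 1) ^ 4\<close>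
  leaves no round outside the region.\<close>

lemma err_at_lower_bound: "\<not> near_truth T t \<omega> \<Longrightarrow> min \<rho> 1 \<le> err_at T t \<omega>"
  using os.ext_dist_nonneg[of "\<alpha>h T t \<omega>"] norm_ge_zero[of "\<theta>h T t \<omega> - \<theta>\<^sub>0"] norm_ge_zero[of "\<eta>h T t \<omega> - \<eta>\<^sub>0"]
  unfolding near_truth_def err_at_def os.err_def mem_ball dist_norm norm_minus_commute[of \<theta>\<^sub>0] norm_minus_commute[of \<eta>\<^sub>0]
  by linarith

lemma err_at_upper_bound: "near_truth T t \<omega> \<Longrightarrow> err_at T t \<omega> \<le> 2 * \<rho> + 1"
  unfolding near_truth_def err_at_def os.err_def mem_ball dist_norm norm_minus_commute[of \<theta>\<^sub>0] norm_minus_commute[of \<eta>\<^sub>0]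
  by linarith

lemma perturbation_joint_measurable:
  assumes a: "a \<in> N \<rightarrow>\<^sub>M borel" and b: "b \<in> N \<rightarrow>\<^sub>M borel" and c: "c \<in> N \<rightarrow>\<^sub>M borel" and z: "z \<in> N \<rightarrow>\<^sub>M Obs"
  shows "(\<lambda>x. m (a x) (z x)) \<in> borel_measurable N"
    and "(\<lambda>x. score l (a x) (b x) (z x) (c x)) \<in> borel_measurable N"
    and "(\<lambda>x. os.perturbation (a x) (b x) (c x) (z x)) \<in> borel_measurable N"
proof -
  have z': "z \<in> N \<rightarrow>\<^sub>M Pe" using z by (subst measurable_cong_sets[OF refl sets_Pe])
  have "(\<lambda>x. (a x, z x)) \<in> N \<rightarrow>\<^sub>M borel \<Otimes>\<^sub>M Pe" using a z' by (rule measurable_Pair)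
  from measurable_compose[OF this os.m_measurable] show 1: "(\<lambda>x. m (a x) (z x)) \<in> borel_measurable N" by simp
  have "(\<lambda>x. (a x, b x, c x, z x)) \<in> N \<rightarrow>\<^sub>M borel \<Otimes>\<^sub>M (borel \<Otimes>\<^sub>M (borel \<Otimes>\<^sub>M Pe))"
    by (intro measurable_Pair a b c z')
  from measurable_compose[OF this os.score_measurable]
  show 2: "(\<lambda>x. score l (a x) (b x) (z x) (c x)) \<in> borel_measurable N" by simp
  show "(\<lambda>x. os.perturbation (a x) (b x) (c x) (z x)) \<in> borel_measurable N"
    unfolding os.perturbation_def
    by (intro borel_measurable_diff 1 2 measurable_compose[OF z' os.m_section] measurable_compose[OF z' os.ext_score_measurable])
qed

lemma pert_measurable[measurable]: "t \<in> {1..T} \<Longrightarrow> pert T t \<in> borel_measurable (past T t \<Otimes>\<^sub>M Obs)"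
proof -
  assume t: "t \<in> {1..T}"
  let ?N = "past T t \<Otimes>\<^sub>M Obs"
  have [measurable]: "(\<lambda>p. os.perturbation (\<theta>h T t (fst p)) (\<eta>h T t (fst p)) (\<alpha>h T t (fst p)) (snd p)) \<in> borel_measurable ?N"
    using t by (intro perturbation_joint_measurable measurable_compose[OF measurable_fst] \<theta>h \<eta>h \<alpha>h measurable_snd)
  have "(\<lambda>p. near_truth T t (fst p)) \<in> measurable ?N (count_space UNIV)"
    by (rule measurable_compose[OF measurable_fst]) (use near_truth_measurable[OF t] in \<open>simp add: pred_def\<close>)
  then show ?thesis unfolding pert_def by measurable
qed

lemma space_Pe: "space Pe = space Obs" by (rule sets_eq_imp_space_eq[OF sets_Pe])

lemma pert_bound: "z \<in> space Pe \<Longrightarrow> \<bar>pert T t (\<omega>, z)\<bar> \<le> C z * ((2 + os.ext_dist 0) * err_at T t \<omega>)"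
  using os.perturbation_bound[of z "\<theta>h T t \<omega>" "\<eta>h T t \<omega>" "\<alpha>h T t \<omega>"] os.C_nonneg[of z] err_at_nonneg[of T t \<omega>] os.ext_dist_nonneg[of 0]
  by (auto simp: pert_def near_truth_def err_at_def)

text \<open>Unlike in \<open>pert_bound\<close>, the right side is free of \<omega>; this gives
  integrability over the whole probability space.\<close>

lemma pert_bound_uniform: "z \<in> space Pe \<Longrightarrow> \<bar>pert T t (\<omega>, z)\<bar> \<le> C z * ((2 + os.ext_dist 0) * (2 * \<rho> + 1))"
proof (cases "near_truth T t \<omega>")
  case True
  assume z: "z \<in> space Pe"
  show ?thesis
    by (rule order_trans[OF pert_bound[OF z]])
      (intro mult_left_mono err_at_upper_bound True os.C_nonneg z, simp_all add: os.ext_dist_nonneg)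
next
  case False
  assume z: "z \<in> space Pe"
  have "0 \<le> 2 * \<rho> + 1" using os.radius by linarith
  then have "0 \<le> (2 + os.ext_dist 0) * (2 * \<rho> + 1)" by (simp add: os.ext_dist_nonneg)
  then show ?thesis using os.C_nonneg[OF z] by (simp add: pert_def False)
qed

lemma pert_section:
  assumes t: "t \<in> {1..T}" and \<omega>: "\<omega> \<in> space M"
  shows "(\<lambda>z. pert T t (\<omega>, z)) \<in> borel_measurable Pe" and "integrable Pe (\<lambda>z. pert T t (\<omega>, z))"
proof -
  have "\<omega> \<in> space (past T t)" using \<omega> by (simp add: history_def)
  from measurable_compose[OF measurable_Pair1'[OF this] pert_measurable[OF t]]
  show "(\<lambda>z. pert T t (\<omega>, z)) \<in> borel_measurable Pe" by (subst measurable_cong_sets[OF sets_Pe refl])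
  then show "integrable Pe (\<lambda>z. pert T t (\<omega>, z))" by (rule os.integrable_le_C(1)[OF _ pert_bound])
qed

lemma bias_bound: "t \<in> {1..T} \<Longrightarrow> \<bar>bias T t \<omega>\<bar> \<le> (\<integral>z. C z \<partial>Pe) * (2 + os.ext_dist 0) * (err_at T t \<omega>)\<^sup>2"
proof (cases "near_truth T t \<omega>")
  case True
  then show ?thesis
    using os.integral_perturbation_bound[of "\<theta>h T t \<omega>" "\<eta>h T t \<omega>" "\<alpha>h T t \<omega>"]
    unfolding near_truth_def by (simp add: bias_def pert_def near_truth_def err_at_def)
next
  case False
  have "0 \<le> (\<integral>z. C z \<partial>Pe)" by (intro integral_nonneg_AE AE_I2 os.C_nonneg)
  then show ?thesis using os.ext_dist_nonneg[of 0] by (simp add: bias_def pert_def False)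
qed

lemma bias_measurable[measurable]: "t \<in> {1..T} \<Longrightarrow> bias T t \<in> borel_measurable (past T t)"
  unfolding bias_def by (rule integral_Pe_measurable[OF pert_measurable])

lemma obs_weight_measurable[measurable]: "t \<in> {1..T} \<Longrightarrow> obs_weight T t \<in> borel_measurable M"
  unfolding obs_weight_def by (rule weight_obs_measurable)

lemma obs_weight_nonneg: "t \<in> {1..T} \<Longrightarrow> \<omega> \<in> space M \<Longrightarrow> 0 \<le> obs_weight T t \<omega>"
  unfolding obs_weight_def using weight_nonneg measurable_space[OF Z_measurable] by blast

lemma infl_measurable: "infl \<in> borel_measurable Obs"
  using os.influence_measurable by (subst (asm) measurable_cong_sets[OF sets_Pe refl])

lemma infl_Z_measurable[measurable]: "t \<in> {1..T} \<Longrightarrow> (\<lambda>\<omega>. infl (Z T t \<omega>)) \<in> borel_measurable M"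
  by (rule measurable_compose[OF Z_measurable infl_measurable])

lemma pert_Z_measurable[measurable]: "t \<in> {1..T} \<Longrightarrow> (\<lambda>\<omega>. pert T t (\<omega>, Z T t \<omega>)) \<in> borel_measurable M"
  by (rule measurable_compose[OF past_obs_measurable pert_measurable])

lemma subalgebra_Hist: "t \<le> T \<Longrightarrow> subalgebra M (Hist T t)"
  by (intro subalgebra_history Z_measurable) auto

lemma subalgebra_Hist_mono: "s \<le> t \<Longrightarrow> t \<le> T \<Longrightarrow> subalgebra (Hist T t) (Hist T s)"
  by (intro subalgebra_history_mono Z_measurable) auto

lemma measurable_past_Hist: "t \<in> {1..T} \<Longrightarrow> f \<in> past T t \<rightarrow>\<^sub>M K \<Longrightarrow> f \<in> Hist T t \<rightarrow>\<^sub>M K"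
  by (rule measurable_from_subalg[OF subalgebra_Hist_mono]) auto

lemma past_obs_measurable_Hist: "t \<in> {1..T} \<Longrightarrow> (\<lambda>\<omega>. (\<omega>, Z T t \<omega>)) \<in> Hist T t \<rightarrow>\<^sub>M past T t \<Otimes>\<^sub>M Obs"
proof -
  assume t: "t \<in> {1..T}"
  have 1: "(\<lambda>\<omega>. \<omega>) \<in> Hist T t \<rightarrow>\<^sub>M past T t" by (rule measurable_past_Hist[OF t]) simp
  have 2: "Z T t \<in> Hist T t \<rightarrow>\<^sub>M Obs"
    by (rule measurable_history_component) (use t in \<open>auto intro!: Z_measurable\<close>)
  show ?thesis by (rule measurable_Pair[OF 1 2])
qed

lemma obs_weight_Hist: "t \<in> {1..T} \<Longrightarrow> obs_weight T t \<in> borel_measurable (Hist T t)"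
  unfolding obs_weight_def using measurable_compose[OF past_obs_measurable_Hist weight_measurable] by simp

text \<open>The factor in front is predictable and bounded, so it preserves integrability and can be
  taken out of the conditional mean.\<close>

lemma martingale_differencesI:
  assumes U_int: "\<And>t. t \<in> {1..T} \<Longrightarrow> integrable M (U t)"
    and U_ad: "\<And>t. t \<in> {1..T} \<Longrightarrow> U t \<in> borel_measurable (Hist T t)"
    and U_0: "\<And>t. t \<in> {1..T} \<Longrightarrow> AE \<omega> in M. real_cond_exp M (past T t) (U t) \<omega> = 0"
  shows "martingale_differences M (Hist T) (\<lambda>t \<omega>. inv_sigma T t \<omega> / sqrt (real T) * U t \<omega>) T"
proof
  fix t assume t: "t \<in> {1..T}"
  interpret sigma_finite_subalgebra M "past T t" by (rule sigma_finite_past[OF t])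
  let ?h = "\<lambda>\<omega>. inv_sigma T t \<omega> / sqrt (real T)"
  have h_past: "?h \<in> borel_measurable (past T t)" using t by measurable
  note h_M = measurable_past_M[OF t h_past] and h_hist = measurable_past_Hist[OF t h_past]
  show "(\<lambda>\<omega>. ?h \<omega> * U t \<omega>) \<in> borel_measurable (Hist T t)" using h_hist U_ad[OF t] by measurable
  show int: "integrable M (\<lambda>\<omega>. ?h \<omega> * U t \<omega>)"
  proof (rule Bochner_Integration.integrable_bound)
    show "integrable M (\<lambda>\<omega>. 1 / sqrt var_floor / sqrt (real T) * U t \<omega>)" using U_int[OF t] by simp
    show "(\<lambda>\<omega>. ?h \<omega> * U t \<omega>) \<in> borel_measurable M" using h_M U_int[OF t] by measurable
    show "AE \<omega> in M. norm (?h \<omega> * U t \<omega>) \<le> norm (1 / sqrt var_floor / sqrt (real T) * U t \<omega>)"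
    proof (rule AE_I2)
      fix \<omega>
      have "\<bar>?h \<omega>\<bar> \<le> \<bar>1 / sqrt var_floor / sqrt (real T)\<bar>"
        using divide_right_mono[OF inv_sigma_le[of T t \<omega>], of "sqrt (real T)"] inv_sigma_nonneg[of T t \<omega>] var_floor by simp
      then show "norm (?h \<omega> * U t \<omega>) \<le> norm (1 / sqrt var_floor / sqrt (real T) * U t \<omega>)"
        unfolding real_norm_def abs_mult[of _ "U t \<omega>"] by (rule mult_right_mono) simp
    qed
  qed
  have "AE \<omega> in M. real_cond_exp M (past T t) (\<lambda>\<omega>. ?h \<omega> * U t \<omega>) \<omega> = ?h \<omega> * real_cond_exp M (past T t) (U t) \<omega>"
    using U_int[OF t] by (intro real_cond_exp_mult h_past int) auto
  then show "AE \<omega> in M. real_cond_exp M (Hist T (t - 1)) (\<lambda>\<omega>. ?h \<omega> * U t \<omega>) \<omega> = 0"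
    using U_0[OF t] by eventually_elim simp
qed (auto intro: subalgebra_Hist subalgebra_Hist_mono)

definition infl_term :: "nat \<Rightarrow> nat \<Rightarrow> 'w \<Rightarrow> real" where
  "infl_term T t \<omega> = obs_weight T t \<omega> * infl (Z T t \<omega>)"

definition pert_term :: "nat \<Rightarrow> nat \<Rightarrow> 'w \<Rightarrow> real" where
  "pert_term T t \<omega> = obs_weight T t \<omega> * pert T t (\<omega>, Z T t \<omega>) - bias T t \<omega>"

text \<open>\<open>X\<close> is the oracle score, \<open>Y\<close> the centred effect of the estimation errors.\<close>

abbreviation X :: "nat \<Rightarrow> nat \<Rightarrow> 'w \<Rightarrow> real" where
  "X T \<equiv> \<lambda>t \<omega>. inv_sigma T t \<omega> / sqrt (real T) * infl_term T t \<omega>"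

abbreviation Y :: "nat \<Rightarrow> nat \<Rightarrow> 'w \<Rightarrow> real" where
  "Y T \<equiv> \<lambda>t \<omega>. inv_sigma T t \<omega> / sqrt (real T) * pert_term T t \<omega>"

lemma infl_snd_measurable[measurable]: "(\<lambda>p. infl (snd p)) \<in> borel_measurable (past T t \<Otimes>\<^sub>M Obs)"
  by (rule measurable_compose[OF measurable_snd infl_measurable])

lemma infl_term_centred:
  assumes t: "t \<in> {1..T}"
  shows "integrable M (infl_term T t)" "AE \<omega> in M. real_cond_exp M (past T t) (infl_term T t) \<omega> = 0"
    "infl_term T t \<in> borel_measurable (Hist T t)"
  using real_cond_exp_weight[OF t infl_snd_measurable, of "\<integral>z. \<bar>infl z\<bar> \<partial>Pe"] os.integrable_influence os.integral_influence
    obs_weight_Hist[OF t] measurable_compose[OF past_obs_measurable_Hist[OF t] infl_snd_measurable]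
  unfolding infl_term_def obs_weight_def[symmetric] by simp_all

lemma bias_integrable: "t \<in> {1..T} \<Longrightarrow> integrable M (bias T t)"
proof (rule integrable_const_bound)
  assume t: "t \<in> {1..T}"
  show "bias T t \<in> borel_measurable M" by (rule measurable_past_M[OF t bias_measurable[OF t]])
  show "AE \<omega> in M. norm (bias T t \<omega>) \<le> (\<integral>z. C z \<partial>Pe) * ((2 + os.ext_dist 0) * (2 * \<rho> + 1))"
    unfolding bias_def using pert_section(1)[OF t] pert_bound_uniform by (intro AE_I2) (auto intro!: os.integrable_le_C(2))
qed

lemma pert_term_centred:
  assumes t: "t \<in> {1..T}"
  shows "integrable M (pert_term T t)" "AE \<omega> in M. real_cond_exp M (past T t) (pert_term T t) \<omega> = 0"
    "pert_term T t \<in> borel_measurable (Hist T t)"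
proof -
  interpret sigma_finite_subalgebra M "past T t" by (rule sigma_finite_past[OF t])
  have abs: "(\<integral>z. \<bar>pert T t (\<omega>, z)\<bar> \<partial>Pe) \<le> (\<integral>z. C z \<partial>Pe) * ((2 + os.ext_dist 0) * (2 * \<rho> + 1))" if "\<omega> \<in> space M" for \<omega>
    using os.integrable_le_C(2)[of "\<lambda>z. \<bar>pert T t (\<omega>, z)\<bar>" "(2 + os.ext_dist 0) * (2 * \<rho> + 1)"] pert_section(1)[OF t that] pert_bound_uniform
    by auto
  have pert: "integrable M (\<lambda>\<omega>. weight T t \<omega> (Z T t \<omega>) * pert T t (\<omega>, Z T t \<omega>))"
    "AE \<omega> in M. real_cond_exp M (past T t) (\<lambda>\<omega>. weight T t \<omega> (Z T t \<omega>) * pert T t (\<omega>, Z T t \<omega>)) \<omega>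
      = (\<integral>z. pert T t (\<omega>, z) \<partial>Pe)"
    by (rule real_cond_exp_weight[OF t pert_measurable[OF t]]; (erule pert_section(2)[OF t] | erule abs))+
  note b = bias_integrable[OF t]
  show "integrable M (pert_term T t)" unfolding pert_term_def obs_weight_def using pert(1) b by simp
  have "AE \<omega> in M. real_cond_exp M (past T t) (pert_term T t) \<omega>
      = real_cond_exp M (past T t) (\<lambda>\<omega>. weight T t \<omega> (Z T t \<omega>) * pert T t (\<omega>, Z T t \<omega>)) \<omega> - real_cond_exp M (past T t) (bias T t) \<omega>"
    unfolding pert_term_def obs_weight_def by (rule real_cond_exp_diff[OF pert(1) b])
  moreover have "AE \<omega> in M. real_cond_exp M (past T t) (bias T t) \<omega> = bias T t \<omega>"
    by (rule real_cond_exp_F_meas[OF b bias_measurable[OF t]])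
  ultimately show "AE \<omega> in M. real_cond_exp M (past T t) (pert_term T t) \<omega> = 0"
    using pert(2) by eventually_elim (simp add: bias_def)
  show "pert_term T t \<in> borel_measurable (Hist T t)"
    unfolding pert_term_def
    using obs_weight_Hist[OF t] measurable_compose[OF past_obs_measurable_Hist[OF t] pert_measurable[OF t]] measurable_past_Hist[OF t bias_measurable[OF t]]
    by measurable
qed

lemma X_martingale: "martingale_differences M (Hist T) (X T) T"
  by (intro martingale_differencesI infl_term_centred)

lemma Y_martingale: "martingale_differences M (Hist T) (Y T) T"
  by (intro martingale_differencesI pert_term_centred)

sublocale X: martingale_differences M "Hist T" "X T" T for T by (rule X_martingale)
sublocale Y: martingale_differences M "Hist T" "Y T" T for T by (rule Y_martingale)

end

text \<open>The inequality (x + y + z)^2 <= 3 (x^2 + y^2 + z^2) is used twice; 27 is 9 times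
  3.\<close>

lemma sum3_pow4_le:
  fixes a b c :: real
  shows "(a + b + c) ^ 4 \<le> 27 * (a ^ 4 + b ^ 4 + c ^ 4)"
proof -
  have sq: "(x + y + z)\<^sup>2 \<le> 3 * (x\<^sup>2 + y\<^sup>2 + z\<^sup>2)" for x y z :: real
    using zero_le_power2[of "x - y"] zero_le_power2[of "y - z"] zero_le_power2[of "x - z"]
    unfolding power2_diff by (simp add: power2_eq_square algebra_simps)
  have "(a + b + c) ^ 4 = ((a + b + c)\<^sup>2)\<^sup>2" by simp
  also have "\<dots> \<le> (3 * (a\<^sup>2 + b\<^sup>2 + c\<^sup>2))\<^sup>2" by (intro power_mono sq) simp
  also have "\<dots> = 9 * (a\<^sup>2 + b\<^sup>2 + c\<^sup>2)\<^sup>2" unfolding power_mult_distrib by simp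
  also have "\<dots> \<le> 9 * (3 * ((a\<^sup>2)\<^sup>2 + (b\<^sup>2)\<^sup>2 + (c\<^sup>2)\<^sup>2))" by (intro mult_left_mono sq) simp
  finally show ?thesis by simp
qed

section \<open>Conditional variances and the negligible martingale\<close>

context weighted_one_step
begin

lemma cond_exp_scaled_sq:
  assumes t: "t \<in> {1..T}" and U[measurable]: "U \<in> borel_measurable M"
  shows "AE \<omega> in M. nn_cond_exp M (past T t) (\<lambda>\<omega>. ennreal ((inv_sigma T t \<omega> / sqrt (real T) * U \<omega>)\<^sup>2)) \<omega>
    = ennreal ((inv_sigma T t \<omega> / sqrt (real T))\<^sup>2) * nn_cond_exp M (past T t) (\<lambda>\<omega>. ennreal ((U \<omega>)\<^sup>2)) \<omega>"
proof -
  interpret sigma_finite_subalgebra M "past T t" by (rule sigma_finite_past[OF t])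
  note [measurable] = inv_sigma_measurable[OF t]
  have ae: "AE \<omega> in M. ennreal ((inv_sigma T t \<omega> / sqrt (real T))\<^sup>2) * nn_cond_exp M (past T t) (\<lambda>\<omega>. ennreal ((U \<omega>)\<^sup>2)) \<omega>
    = nn_cond_exp M (past T t) (\<lambda>\<omega>. ennreal ((inv_sigma T t \<omega> / sqrt (real T))\<^sup>2) * ennreal ((U \<omega>)\<^sup>2)) \<omega>"
    by (rule nn_cond_exp_prod) measurable
  have eq: "ennreal ((x * y)\<^sup>2) = ennreal (x\<^sup>2) * ennreal (y\<^sup>2)" for x y :: real
    by (subst power_mult_distrib, rule ennreal_mult) simp_all
  show ?thesis unfolding eq using ae by eventually_elim simp
qed

text \<open>A version of the conditional second moment of \<open>infl_term\<close>, after one of the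
  two weights has been spent on the change of measure. It may be infinite, as the other weight
  stays.\<close>

definition infl_var :: "nat \<Rightarrow> nat \<Rightarrow> 'w \<Rightarrow> ennreal" where
  "infl_var T t \<omega> = (\<integral>\<^sup>+z. ennreal (weight T t \<omega> z) * ennreal ((infl z)\<^sup>2) \<partial>Pe)"

definition pert_var :: "nat \<Rightarrow> nat \<Rightarrow> 'w \<Rightarrow> ennreal" where
  "pert_var T t \<omega> = (\<integral>\<^sup>+z. ennreal (weight T t \<omega> z) * ennreal ((pert T t (\<omega>, z))\<^sup>2) \<partial>Pe)"

lemma infl_term_measurable[measurable]: "t \<in> {1..T} \<Longrightarrow> infl_term T t \<in> borel_measurable M"
  unfolding infl_term_def by measurable

lemma pert_term_measurable[measurable]: "t \<in> {1..T} \<Longrightarrow> pert_term T t \<in> borel_measurable M"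
  using pert_term_centred(1) by auto

lemma infl_var_eq: "t \<in> {1..T} \<Longrightarrow> AE \<omega> in M. nn_cond_exp M (past T t) (\<lambda>\<omega>. ennreal ((infl_term T t \<omega>)\<^sup>2)) \<omega> = infl_var T t \<omega>"
  unfolding infl_term_def obs_weight_def infl_var_def using nn_cond_exp_weight_sq[OF _ infl_snd_measurable] by simp

lemma X_cvar: "t \<in> {1..T} \<Longrightarrow> AE \<omega> in M. X.cvar T t \<omega> = ennreal ((inv_sigma T t \<omega> / sqrt (real T))\<^sup>2) * infl_var T t \<omega>"
proof -
  assume t: "t \<in> {1..T}"
  show ?thesis unfolding X.cvar_def
    using cond_exp_scaled_sq[OF t infl_term_measurable[OF t]] infl_var_eq[OF t] by eventually_elim simp
qed

text \<open>The bound (x - y)^2 <= 2 x^2 + 2 y^2 separates the weighted perturbation from its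
  centring, and the bias, being past-measurable, comes out of the conditional expectation
  unchanged.\<close>

lemma Y_cvar_le:
  assumes t: "t \<in> {1..T}"
  shows "AE \<omega> in M. Y.cvar T t \<omega>
    \<le> ennreal ((inv_sigma T t \<omega> / sqrt (real T))\<^sup>2) * (2 * pert_var T t \<omega> + 2 * ennreal ((bias T t \<omega>)\<^sup>2))"
proof -
  interpret sigma_finite_subalgebra M "past T t" by (rule sigma_finite_past[OF t])
  let ?g = "\<lambda>\<omega>. ennreal ((obs_weight T t \<omega> * pert T t (\<omega>, Z T t \<omega>))\<^sup>2)"
  note [measurable] = obs_weight_measurable[OF t] pert_Z_measurable[OF t] bias_measurable[OF t] measurable_past_M[OF t bias_measurable[OF t]]
    pert_term_measurable[OF t]
  have "AE \<omega> in M. nn_cond_exp M (past T t) (\<lambda>\<omega>. ennreal ((pert_term T t \<omega>)\<^sup>2)) \<omega>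
      \<le> nn_cond_exp M (past T t) (\<lambda>\<omega>. 2 * ?g \<omega> + 2 * ennreal ((bias T t \<omega>)\<^sup>2)) \<omega>"
  proof (rule nn_cond_exp_mono)
    have "(x - y)\<^sup>2 \<le> 2 * x\<^sup>2 + 2 * y\<^sup>2" for x y :: real
      using zero_le_power2[of "x + y"] by (simp add: power2_sum power2_diff)
    then have "ennreal ((x - y)\<^sup>2) \<le> 2 * ennreal (x\<^sup>2) + 2 * ennreal (y\<^sup>2)" for x y :: real
      using ennreal_leI[of "(x - y)\<^sup>2" "2 * x\<^sup>2 + 2 * y\<^sup>2"] by (simp add: ennreal_plus ennreal_mult)
    then show "AE \<omega> in M. ennreal ((pert_term T t \<omega>)\<^sup>2) \<le> 2 * ?g \<omega> + 2 * ennreal ((bias T t \<omega>)\<^sup>2)"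
      unfolding pert_term_def by simp
  qed measurable
  moreover have "AE \<omega> in M. nn_cond_exp M (past T t) (\<lambda>\<omega>. 2 * ?g \<omega>) \<omega> + nn_cond_exp M (past T t) (\<lambda>\<omega>. 2 * ennreal ((bias T t \<omega>)\<^sup>2)) \<omega>
      = nn_cond_exp M (past T t) (\<lambda>\<omega>. 2 * ?g \<omega> + 2 * ennreal ((bias T t \<omega>)\<^sup>2)) \<omega>"
    by (rule nn_cond_exp_sum) measurable
  moreover have "AE \<omega> in M. 2 * nn_cond_exp M (past T t) ?g \<omega> = nn_cond_exp M (past T t) (\<lambda>\<omega>. 2 * ?g \<omega>) \<omega>"
    by (rule nn_cond_exp_prod) measurable
  moreover have "AE \<omega> in M. 2 * ennreal ((bias T t \<omega>)\<^sup>2) = nn_cond_exp M (past T t) (\<lambda>\<omega>. 2 * ennreal ((bias T t \<omega>)\<^sup>2)) \<omega>"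
    by (rule nn_cond_exp_F_meas) measurable
  moreover have "AE \<omega> in M. nn_cond_exp M (past T t) ?g \<omega> = pert_var T t \<omega>"
    unfolding obs_weight_def pert_var_def by (rule nn_cond_exp_weight_sq[OF t pert_measurable[OF t]])
  moreover note cond_exp_scaled_sq[OF t pert_term_measurable[OF t]]
  ultimately show ?thesis unfolding Y.cvar_def
    by eventually_elim (simp, intro mult_left_mono, auto)
qed

definition err4 :: "nat \<Rightarrow> 'w \<Rightarrow> real" where "err4 T \<omega> = (\<Sum>t=1..T. err_at T t \<omega> ^ 4)"
definition err2 :: "nat \<Rightarrow> 'w \<Rightarrow> real" where "err2 T \<omega> = (\<Sum>t=1..T. (err_at T t \<omega>)\<^sup>2) / sqrt (real T)"

lemma err4_measurable[measurable]: "err4 T \<in> borel_measurable M" and err2_measurable[measurable]: "err2 T \<in> borel_measurable M"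
  unfolding err4_def err2_def by measurable

lemma err4_nonneg: "0 \<le> err4 T \<omega>" and err2_nonneg: "0 \<le> err2 T \<omega>"
  by (auto simp: err4_def err2_def intro!: sum_nonneg divide_nonneg_nonneg)

lemma err4_vanishes: "vanishes_in_prob M (\<lambda>T \<omega>. ennreal (err4 T \<omega>))"
proof -
  let ?a = "\<lambda>T \<omega>. \<Sum>t=1..T. norm (\<theta>h T t \<omega> - \<theta>\<^sub>0) ^ 4" and ?b = "\<lambda>T \<omega>. \<Sum>t=1..T. norm (\<eta>h T t \<omega> - \<eta>\<^sub>0) ^ 4"
    and ?c = "\<lambda>T \<omega>. \<Sum>t=1..T. os.ext_dist (\<alpha>h T t \<omega>) ^ 4"
  have [measurable]: "?a T \<in> borel_measurable M" "?b T \<in> borel_measurable M" "?c T \<in> borel_measurable M" for T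
    using measurable_past_M[OF _ norm_\<theta>h_measurable] measurable_past_M[OF _ norm_\<eta>h_measurable] measurable_past_M[OF _ ext_dist_\<alpha>h_measurable]
    by (auto intro!: borel_measurable_sum borel_measurable_power)
  have "vanishes_in_prob M (\<lambda>T \<omega>. ennreal (?a T \<omega>) + ennreal (?b T \<omega>) + ennreal (?c T \<omega>))"
    by (intro vanishes_in_prob_add rate_\<theta> rate_\<eta> rate_\<alpha>) measurable
  then show ?thesis
  proof (rule vanishes_in_prob_random_bound)
    show "AE \<omega> in M. \<exists>K. \<forall>\<^sub>F T in sequentially. ennreal (err4 T \<omega>)
      \<le> ennreal K * (ennreal (?a T \<omega>) + ennreal (?b T \<omega>) + ennreal (?c T \<omega>))"
    proof (intro AE_I2 exI[of _ 27] always_eventually allI)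
      fix \<omega> T
      have "err4 T \<omega> \<le> (\<Sum>t=1..T. 27 * (norm (\<theta>h T t \<omega> - \<theta>\<^sub>0) ^ 4 + norm (\<eta>h T t \<omega> - \<eta>\<^sub>0) ^ 4 + os.ext_dist (\<alpha>h T t \<omega>) ^ 4))"
        unfolding err4_def err_at_def os.err_def by (intro sum_mono sum3_pow4_le)
      also have "\<dots> = 27 * (?a T \<omega> + ?b T \<omega> + ?c T \<omega>)"
        by (simp add: sum.distrib flip: sum_distrib_left)
      finally have "ennreal (err4 T \<omega>) \<le> ennreal (27 * (?a T \<omega> + ?b T \<omega> + ?c T \<omega>))" by (rule ennreal_leI)
      also have "\<dots> = ennreal 27 * (ennreal (?a T \<omega>) + ennreal (?b T \<omega>) + ennreal (?c T \<omega>))"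
      proof -
        have "ennreal (27 * (a + b + c)) = ennreal 27 * (ennreal a + ennreal b + ennreal c)"
          if "0 \<le> a" "0 \<le> b" "0 \<le> c" for a b c
          using that by (subst ennreal_mult) simp_all
        then show ?thesis by (simp add: sum_nonneg)
      qed
      finally show "ennreal (err4 T \<omega>) \<le> ennreal 27 * (ennreal (?a T \<omega>) + ennreal (?b T \<omega>) + ennreal (?c T \<omega>))" .
    qed
  qed measurable
qed

text \<open>By Cauchy-Schwarz against the constant 1, the squared sum of squares is at most
  \<open>T\<close> times the sum of fourth powers; the division by \<open>sqrt (real T)\<close> in
  \<open>err2\<close> absorbs exactly this \<open>T\<close>.\<close>

lemma err2_vanishes: "vanishes_in_prob M (\<lambda>T \<omega>. ennreal (err2 T \<omega>))"
proof (rule vanishes_in_prob_sqrt[OF vanishes_in_prob_le[OF err4_vanishes]])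
  show "AE \<omega> in M. ennreal ((err2 T \<omega>)\<^sup>2) \<le> ennreal (err4 T \<omega>)" for T
  proof (intro AE_I2 ennreal_leI)
    fix \<omega>
    show "(err2 T \<omega>)\<^sup>2 \<le> err4 T \<omega>"
    proof (cases "T = 0")
      case False
      have "(\<Sum>t=1..T. (err_at T t \<omega>)\<^sup>2)\<^sup>2 \<le> (\<Sum>t=1..T. ((err_at T t \<omega>)\<^sup>2)\<^sup>2) * (\<Sum>t=1..T. 1\<^sup>2)"
        using Cauchy_Schwarz_ineq_sum[of "\<lambda>t. (err_at T t \<omega>)\<^sup>2" "\<lambda>_. 1" "{1..T}"] by simp
      then have "(\<Sum>t=1..T. (err_at T t \<omega>)\<^sup>2)\<^sup>2 \<le> err4 T \<omega> * real T" by (simp add: err4_def)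
      then show ?thesis using False by (simp add: err2_def power_divide pos_divide_le_eq)
    qed (simp add: err2_def err4_def)
  qed
qed (auto simp: err2_nonneg)

lemma weight_bound:
  "AE \<omega> in M. \<exists>K\<ge>0. \<forall>\<^sub>F T in sequentially. \<forall>t\<in>{1..T}. \<forall>z\<in>space Obs.
    ennreal (weight T t \<omega> z) \<le> ennreal (K * real T powr (1 / 3))"
  using weight_growth AE_space
proof eventually_elim
  case (elim \<omega>)
  then obtain K where K: "\<forall>\<^sub>F T in sequentially.
      (SUP t\<in>{1..T}. SUP (c, a)\<in>space MC \<times> space MA. ennreal (dens_e c a) / ennreal (dens T t \<omega> c a))
        \<le> ennreal (K * real T powr (1 / 3))" by blast
  have "\<forall>\<^sub>F T in sequentially. \<forall>t\<in>{1..T}. \<forall>z\<in>space Obs.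
    ennreal (weight T t \<omega> z) \<le> ennreal (max K 0 * real T powr (1 / 3))"
    using K
  proof eventually_elim
    case (elim T)
    show ?case
    proof (intro ballI)
      fix t z assume t: "t \<in> {1..T}" and z: "z \<in> space Obs"
      have ca: "ctx z \<in> space MC" "act z \<in> space MA" using z by (auto simp: obs_space_def space_pair_measure)
      have nn: "0 \<le> dens T t \<omega> (ctx z) (act z)" "0 \<le> dens_e (ctx z) (act z)"
        using dens_nonneg[OF t \<open>\<omega> \<in> space M\<close> ca] dens_e_nonneg[OF ca] by auto
      \<comment> \<open>Only an inequality: for a vanishing density the real quotient is 0, whereas
        the quotient in \<open>ennreal\<close> is infinite unless the numerator is 0.\<close>
      have "ennreal (weight T t \<omega> z) \<le> ennreal (dens_e (ctx z) (act z)) / ennreal (dens T t \<omega> (ctx z) (act z))"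
      proof (cases "dens T t \<omega> (ctx z) (act z) = 0")
        case False
        then show ?thesis using nn unfolding weight_def by (subst divide_ennreal) auto
      qed (simp add: weight_def)
      also have "\<dots> \<le> (SUP (c, a)\<in>space MC \<times> space MA. ennreal (dens_e c a) / ennreal (dens T t \<omega> c a))"
        using ca by (intro SUP_upper2[of "(ctx z, act z)"]) auto
      also have "\<dots> \<le> (SUP t\<in>{1..T}. SUP (c, a)\<in>space MC \<times> space MA. ennreal (dens_e c a) / ennreal (dens T t \<omega> c a))"
        using t by (rule SUP_upper)
      also have "\<dots> \<le> ennreal (K * real T powr (1 / 3))" by (rule elim)
      also have "\<dots> \<le> ennreal (max K 0 * real T powr (1 / 3))" by (intro ennreal_leI mult_right_mono) auto
      finally show "ennreal (weight T t \<omega> z) \<le> ennreal (max K 0 * real T powr (1 / 3))" .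
    qed
  qed
  then show ?case by (intro exI[of _ "max K 0"]) auto
qed

lemma weighted_integral_le:
  assumes w: "\<forall>z\<in>space Obs. ennreal (weight T t \<omega> z) \<le> ennreal k" and k: "0 \<le> k"
    and g: "integrable Pe g" "\<And>z. z \<in> space Obs \<Longrightarrow> f z \<le> g z" "\<And>z. z \<in> space Obs \<Longrightarrow> 0 \<le> g z"
  shows "(\<integral>\<^sup>+z. ennreal (weight T t \<omega> z) * ennreal (f z) \<partial>Pe) \<le> ennreal (k * (\<integral>z. g z \<partial>Pe))"
proof -
  have "(\<integral>\<^sup>+z. ennreal (weight T t \<omega> z) * ennreal (f z) \<partial>Pe) \<le> (\<integral>\<^sup>+z. ennreal (k * g z) \<partial>Pe)"
    using w g k by (intro nn_integral_mono) (auto simp: space_Pe ennreal_mult intro!: mult_mono ennreal_leI)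
  also have "\<dots> = ennreal (\<integral>z. k * g z \<partial>Pe)"
    using g k by (intro nn_integral_eq_integral) (auto intro!: AE_I2 simp: space_Pe)
  finally show ?thesis by simp
qed

lemma infl_var_finite: "AE \<omega> in M. \<forall>\<^sub>F T in sequentially. \<forall>t\<in>{1..T}. infl_var T t \<omega> < top"
  using weight_bound
proof eventually_elim
  case (elim \<omega>)
  then obtain K where K: "0 \<le> K" "\<forall>\<^sub>F T in sequentially. \<forall>t\<in>{1..T}. \<forall>z\<in>space Obs.
    ennreal (weight T t \<omega> z) \<le> ennreal (K * real T powr (1 / 3))" by blast
  from K(2) show ?case
  proof eventually_elim
    case (elim T)
    show ?case
    proof
      fix t assume "t \<in> {1..T}"
      with elim have "infl_var T t \<omega> \<le> ennreal (K * real T powr (1 / 3) * (\<integral>z. (infl z)\<^sup>2 \<partial>Pe))"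
        unfolding infl_var_def using K(1) os.integrable_influence_sq by (intro weighted_integral_le) auto
      then show "infl_var T t \<omega> < top" by (rule order_le_less_trans) simp
    qed
  qed
qed

lemma infl_var_measurable[measurable]: "t \<in> {1..T} \<Longrightarrow> infl_var T t \<in> borel_measurable M"
proof -
  assume t: "t \<in> {1..T}"
  have [measurable]: "(\<lambda>p. weight T t (fst p) (snd p)) \<in> borel_measurable (past T t \<Otimes>\<^sub>M Obs)"
    using weight_measurable[OF t] by (simp add: case_prod_beta')
  have "(\<lambda>p. ennreal (weight T t (fst p) (snd p)) * ennreal ((infl (snd p))\<^sup>2)) \<in> borel_measurable (past T t \<Otimes>\<^sub>M Obs)"
    by measurable
  from nn_integral_Pe_measurable[OF this] show ?thesis
    unfolding infl_var_def by (intro measurable_past_M[OF t]) simp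
qed

text \<open>A penalty where real and extended conditional variances disagree: the real one reports 0
  when the extended one is infinite. Almost surely this happens at no large horizon, so the penalty
  vanishes in probability.\<close>

definition infinite_var :: "nat \<Rightarrow> 'w \<Rightarrow> ennreal" where
  "infinite_var T \<omega> = (if \<exists>t\<in>{1..T}. infl_var T t \<omega> = top then top else 0)"

lemma infinite_var_vanishes: "vanishes_in_prob M infinite_var"
proof (rule vanishes_in_prob_eventually_zero)
  show "AE \<omega> in M. \<forall>\<^sub>F T in sequentially. infinite_var T \<omega> = 0"
    using infl_var_finite
  proof eventually_elim
    case (elim \<omega>)
    then show ?case by eventually_elim (auto simp: infinite_var_def)
  qed
qed (unfold infinite_var_def, measurable)

lemma infinite_var_measurable[measurable]: "infinite_var T \<in> borel_measurable M"
  unfolding infinite_var_def by measurable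

lemma Y_qvar_vanishes: "vanishes_in_prob M (\<lambda>T. Y.qvar T T)"
proof (rule vanishes_in_prob_random_bound)
  show "vanishes_in_prob M (\<lambda>T \<omega>. ennreal (err2 T \<omega>) + ennreal (err4 T \<omega>))"
    by (intro vanishes_in_prob_add err2_vanishes err4_vanishes) measurable
  let ?kD = "2 + os.ext_dist 0" and ?kB = "(\<integral>z. C z \<partial>Pe) * (2 + os.ext_dist 0)" and ?k2 = "\<integral>z. (C z)\<^sup>2 \<partial>Pe"
  have "AE \<omega> in M. \<forall>T. \<forall>t\<in>{1..T}. Y.cvar T t \<omega>
    \<le> ennreal ((inv_sigma T t \<omega> / sqrt (real T))\<^sup>2) * (2 * pert_var T t \<omega> + 2 * ennreal ((bias T t \<omega>)\<^sup>2))"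
    using Y_cvar_le by (simp add: AE_all_countable AE_ball_countable)
  then show "AE \<omega> in M. \<exists>K. \<forall>\<^sub>F T in sequentially. Y.qvar T T \<omega> \<le> ennreal K * (ennreal (err2 T \<omega>) + ennreal (err4 T \<omega>))"
    using weight_bound AE_space
  proof eventually_elim
    case (elim \<omega>)
    note cvar_le = elim(1)
    from elim obtain K where K: "0 \<le> K" "\<forall>\<^sub>F T in sequentially. \<forall>t\<in>{1..T}. \<forall>z\<in>space Obs.
      ennreal (weight T t \<omega> z) \<le> ennreal (K * real T powr (1 / 3))" by blast
    \<comment> \<open>\<open>c1\<close> gathers the 2 of \<open>Y_cvar_le\<close>, the constant
      \<open>K\<close> of the weights and the perturbation bound; \<open>c2\<close> the 2 and the
      squared constant of the bias. Through \<open>K\<close> they depend on the sample point, which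
      \<open>vanishes_in_prob_random_bound\<close> permits.\<close>
    define c1 where "c1 = 2 * K * ?kD\<^sup>2 * ?k2"
    define c2 where "c2 = 2 * ?kB\<^sup>2"
    have k2: "0 \<le> ?k2" by (intro integral_nonneg_AE AE_I2) simp
    have c1: "0 \<le> c1" and c2: "0 \<le> c2" unfolding c1_def c2_def using K(1) k2 by auto
    have "\<forall>\<^sub>F T in sequentially. Y.qvar T T \<omega> \<le> ennreal ((c1 + c2) / var_floor) * (ennreal (err2 T \<omega>) + ennreal (err4 T \<omega>))"
      using K(2) eventually_gt_at_top[of 0]
    proof eventually_elim
      case (elim T)
      let ?T3 = "real T powr (1 / 3)"
      have T: "1 \<le> real T" using elim by simp
      have cv: "Y.cvar T t \<omega> \<le> ennreal (1 / (var_floor * real T) * (c1 * ?T3 * (err_at T t \<omega>)\<^sup>2 + c2 * err_at T t \<omega> ^ 4))" if t: "t \<in> {1..T}" for t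
      proof -
        have "pert_var T t \<omega> \<le> ennreal (K * ?T3 * (\<integral>z. (C z)\<^sup>2 * (?kD * err_at T t \<omega>)\<^sup>2 \<partial>Pe))"
          unfolding pert_var_def
        proof (rule weighted_integral_le)
          fix z assume "z \<in> space Obs"
          then have z: "z \<in> space Pe" by (simp add: space_Pe)
          have "(pert T t (\<omega>, z))\<^sup>2 \<le> (C z * (?kD * err_at T t \<omega>))\<^sup>2"
            using power_mono[OF pert_bound[OF z, of T t \<omega>], of 2] by simp
          then show "(pert T t (\<omega>, z))\<^sup>2 \<le> (C z)\<^sup>2 * (?kD * err_at T t \<omega>)\<^sup>2" by (simp add: power_mult_distrib)
        qed (use elim t K(1) os.integrable_C_sq in auto)
        then have vd: "pert_var T t \<omega> \<le> ennreal (K * ?T3 * (?k2 * (?kD * err_at T t \<omega>)\<^sup>2))" by simp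
        have "(bias T t \<omega>)\<^sup>2 \<le> (?kB * (err_at T t \<omega>)\<^sup>2)\<^sup>2"
          using power_mono[OF bias_bound[OF t, of \<omega>], of 2] by simp
        then have b: "(bias T t \<omega>)\<^sup>2 \<le> ?kB\<^sup>2 * err_at T t \<omega> ^ 4" by (simp add: power_mult_distrib)
        have s: "(inv_sigma T t \<omega> / sqrt (real T))\<^sup>2 \<le> 1 / (var_floor * real T)"
          using divide_right_mono[OF inv_sigma_sq_le[of T t \<omega>], of "real T"] by (simp add: power_divide)
        have "Y.cvar T t \<omega> \<le> ennreal ((inv_sigma T t \<omega> / sqrt (real T))\<^sup>2) * (2 * pert_var T t \<omega> + 2 * ennreal ((bias T t \<omega>)\<^sup>2))"
          using cvar_le t by blast
        also have "\<dots> \<le> ennreal (1 / (var_floor * real T)) *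
            (2 * ennreal (K * ?T3 * (?k2 * (?kD * err_at T t \<omega>)\<^sup>2)) + 2 * ennreal (?kB\<^sup>2 * err_at T t \<omega> ^ 4))"
          by (intro mult_mono add_mono ennreal_leI s b vd order_refl) auto
        also have "\<dots> = ennreal (1 / (var_floor * real T) * (2 * (K * ?T3 * (?k2 * (?kD * err_at T t \<omega>)\<^sup>2)) + 2 * (?kB\<^sup>2 * err_at T t \<omega> ^ 4)))"
          using K(1) k2 var_floor by (subst ennreal_mult) (auto simp: ennreal_plus ennreal_mult)
        also have "2 * (K * ?T3 * (?k2 * (?kD * err_at T t \<omega>)\<^sup>2)) + 2 * (?kB\<^sup>2 * err_at T t \<omega> ^ 4)
            = c1 * ?T3 * (err_at T t \<omega>)\<^sup>2 + c2 * err_at T t \<omega> ^ 4"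
          unfolding c1_def c2_def power_mult_distrib by (simp add: mult_ac)
        finally show ?thesis .
      qed
      have "Y.qvar T T \<omega> \<le> (\<Sum>t=1..T. ennreal (1 / (var_floor * real T) * (c1 * ?T3 * (err_at T t \<omega>)\<^sup>2 + c2 * err_at T t \<omega> ^ 4)))"
        unfolding Y.qvar_def by (intro sum_mono cv)
      also have "\<dots> = ennreal (\<Sum>t=1..T. 1 / (var_floor * real T) * (c1 * ?T3 * (err_at T t \<omega>)\<^sup>2 + c2 * err_at T t \<omega> ^ 4))"
        using var_floor c1 c2 by (intro sum_ennreal) (auto intro!: mult_nonneg_nonneg add_nonneg_nonneg)
      also have "(\<Sum>t=1..T. 1 / (var_floor * real T) * (c1 * ?T3 * (err_at T t \<omega>)\<^sup>2 + c2 * err_at T t \<omega> ^ 4))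
          = 1 / (var_floor * real T) * (c1 * ?T3 * (\<Sum>t=1..T. (err_at T t \<omega>)\<^sup>2) + c2 * err4 T \<omega>)"
        unfolding err4_def by (simp add: sum_distrib_left sum.distrib distrib_left)
      also have "\<dots> = (c1 * (?T3 / real T * (\<Sum>t=1..T. (err_at T t \<omega>)\<^sup>2)) + c2 * (err4 T \<omega> / real T)) / var_floor"
        using T var_floor by (simp add: field_simps)
      also have "\<dots> \<le> (c1 * err2 T \<omega> + c2 * err4 T \<omega>) / var_floor"
      proof (intro divide_right_mono add_mono mult_left_mono)
        \<comment> \<open>growth \<open>T\<^sup>1\<^sup>/\<^sup>3\<close> of the weights is more than enough: \<open>T\<^sup>1\<^sup>/\<^sup>2\<close> would do\<close>
        have "?T3 \<le> sqrt (real T)" using T by (simp add: powr_half_sqrt[symmetric] powr_mono)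
        then have "?T3 / real T \<le> sqrt (real T) / real T" by (rule divide_right_mono) simp
        also have "\<dots> = 1 / sqrt (real T)" using T by (simp add: real_div_sqrt field_simps)
        finally have "?T3 / real T * (\<Sum>t=1..T. (err_at T t \<omega>)\<^sup>2) \<le> 1 / sqrt (real T) * (\<Sum>t=1..T. (err_at T t \<omega>)\<^sup>2)"
          by (rule mult_right_mono) (simp add: sum_nonneg)
        then show "?T3 / real T * (\<Sum>t=1..T. (err_at T t \<omega>)\<^sup>2) \<le> err2 T \<omega>" by (simp add: err2_def)
        show "err4 T \<omega> / real T \<le> err4 T \<omega>" using T err4_nonneg[of T \<omega>] by (simp add: divide_le_eq mult_le_cancel_left1)
      qed (use var_floor c1 c2 in auto)
      also have "\<dots> \<le> (c1 + c2) / var_floor * (err2 T \<omega> + err4 T \<omega>)"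
      proof -
        have "0 \<le> c1 * err4 T \<omega>" "0 \<le> c2 * err2 T \<omega>" using c1 c2 err2_nonneg err4_nonneg by simp_all
        then have "c1 * err2 T \<omega> + c2 * err4 T \<omega> \<le> (c1 + c2) * (err2 T \<omega> + err4 T \<omega>)" by (simp add: algebra_simps)
        from divide_right_mono[OF this, of var_floor] show ?thesis using var_floor by simp
      qed
      finally have "Y.qvar T T \<omega> \<le> ennreal ((c1 + c2) / var_floor * (err2 T \<omega> + err4 T \<omega>))" by (simp add: ennreal_leI)
      also have "\<dots> = ennreal ((c1 + c2) / var_floor) * (ennreal (err2 T \<omega>) + ennreal (err4 T \<omega>))"
        using var_floor c1 c2 err2_nonneg[of T \<omega>] err4_nonneg[of T \<omega>] by (subst ennreal_mult) simp_all
      finally show ?case .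
    qed
    then show ?case by blast
  qed
qed measurable

lemma Y_sum_vanishes: "vanishes_in_prob M (\<lambda>T \<omega>. ennreal \<bar>\<Sum>t=1..T. Y T t \<omega>\<bar>)"
  by (rule martingale_sum_vanishes[OF Y_martingale Y_qvar_vanishes])

end

section \<open>Variance ratio, Lindeberg condition and limit law\<close>

context weighted_one_step
begin

definition \<sigma>sq :: "nat \<Rightarrow> nat \<Rightarrow> 'w \<Rightarrow> real" where
  "\<sigma>sq T t = cond_var M (past T t) (\<lambda>\<omega>. obs_weight T t \<omega> * infl (Z T t \<omega>))"

text \<open>The conditional mean of \<open>infl_term\<close> is 0, so variance and second moment
  agree. \<open>enn2real\<close> sends an infinite second moment to 0, which is why
  \<open>infinite_var\<close> accompanies the real variances below.\<close>

lemma \<sigma>sq_eq: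
  assumes t: "t \<in> {1..T}"
  shows "AE \<omega> in M. \<sigma>sq T t \<omega> = enn2real (infl_var T t \<omega>)"
proof -
  interpret sigma_finite_subalgebra M "past T t" by (rule sigma_finite_past[OF t])
  note [measurable] = infl_term_measurable[OF t]
  have "AE \<omega> in M. real_cond_exp M (past T t) (\<lambda>\<omega>. (infl_term T t \<omega> - real_cond_exp M (past T t) (infl_term T t) \<omega>)\<^sup>2) \<omega>
      = real_cond_exp M (past T t) (\<lambda>\<omega>. (infl_term T t \<omega>)\<^sup>2) \<omega>"
  proof (rule real_cond_exp_cong)
    show "AE \<omega> in M. (infl_term T t \<omega> - real_cond_exp M (past T t) (infl_term T t) \<omega>)\<^sup>2 = (infl_term T t \<omega>)\<^sup>2"
      using infl_term_centred(2)[OF t] by eventually_elim simp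
  qed measurable
  moreover have "AE \<omega> in M. real_cond_exp M (past T t) (\<lambda>\<omega>. (infl_term T t \<omega>)\<^sup>2) \<omega>
      = enn2real (nn_cond_exp M (past T t) (\<lambda>\<omega>. ennreal ((infl_term T t \<omega>)\<^sup>2)) \<omega>)"
    by (rule real_cond_exp_nonneg_eq) auto
  ultimately show ?thesis using infl_var_eq[OF t] unfolding \<sigma>sq_def cond_var_def infl_term_def[abs_def]
    by eventually_elim simp
qed

lemma \<sigma>sq_measurable[measurable]: "\<sigma>sq T t \<in> borel_measurable M"
  unfolding \<sigma>sq_def cond_var_def by simp

lemma \<sigma>h_measurable_M[measurable]: "t \<in> {1..T} \<Longrightarrow> \<sigma>h T t \<in> borel_measurable M"
  by (rule measurable_past_M[OF _ \<sigma>h])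

lemma inv_sigma_eq: "AE \<omega> in M. \<forall>T. \<forall>t\<in>{1..T}. inv_sigma T t \<omega> = inverse (\<sigma>h T t \<omega>) \<and> 0 < \<sigma>h T t \<omega>"
proof -
  have "AE \<omega> in M. \<forall>T. \<forall>t\<in>{1..T}. 0 \<le> \<sigma>h T t \<omega> \<and> var_floor < (\<sigma>h T t \<omega>)\<^sup>2"
    using \<sigma>h_bound by (simp add: AE_all_countable)
  then show ?thesis
  proof eventually_elim
    case (elim \<omega>)
    show ?case
    proof (intro allI ballI)
      fix T t :: nat assume "t \<in> {1..T}"
      with elim have *: "0 \<le> \<sigma>h T t \<omega>" "var_floor < (\<sigma>h T t \<omega>)\<^sup>2" by auto
      then have "\<sigma>h T t \<omega> \<noteq> 0" using var_floor by auto
      with * show "inv_sigma T t \<omega> = inverse (\<sigma>h T t \<omega>) \<and> 0 < \<sigma>h T t \<omega>" by (simp add: inv_sigma_def)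
    qed
  qed
qed

text \<open>Without infinite conditional variances, \<open>X.qvar T T\<close> is exactly the average
  of the variance ratios, so its distance from 1 is the quantity in \<open>ratio\<close>. At the
  other horizons \<open>infinite_var\<close> is \<open>top\<close> and the bound is trivial.\<close>

lemma X_qvar_vanishes:
  assumes ratio: "little_o_p M (\<lambda>T \<omega>. 1 / real T * (\<Sum>t=1..T. \<sigma>sq T t \<omega> / (\<sigma>h T t \<omega>)\<^sup>2) - 1) (\<lambda>T. 1)"
  shows "vanishes_in_prob M (\<lambda>T \<omega>. (X.qvar T T \<omega> - 1) + (1 - X.qvar T T \<omega>))"
proof (rule vanishes_in_prob_le)
  let ?r = "\<lambda>T \<omega>. 1 / real T * (\<Sum>t=1..T. \<sigma>sq T t \<omega> / (\<sigma>h T t \<omega>)\<^sup>2)"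
  have [measurable]: "?r T \<in> borel_measurable M" for T by measurable
  show "vanishes_in_prob M (\<lambda>T \<omega>. ennreal \<bar>?r T \<omega> - 1\<bar> + infinite_var T \<omega>)"
    by (intro vanishes_in_prob_add little_o_p_imp_vanishes[OF ratio] infinite_var_vanishes) measurable
  show "(\<lambda>\<omega>. ennreal \<bar>?r T \<omega> - 1\<bar> + infinite_var T \<omega>) \<in> borel_measurable M" for T by measurable
  fix T
  have "AE \<omega> in M. \<forall>t\<in>{1..T}. X.cvar T t \<omega> = ennreal ((inv_sigma T t \<omega> / sqrt (real T))\<^sup>2) * infl_var T t \<omega>
      \<and> \<sigma>sq T t \<omega> = enn2real (infl_var T t \<omega>)"
    using X_cvar \<sigma>sq_eq by (subst AE_ball_countable) auto
  then show "AE \<omega> in M. (X.qvar T T \<omega> - 1) + (1 - X.qvar T T \<omega>) \<le> ennreal \<bar>?r T \<omega> - 1\<bar> + infinite_var T \<omega>"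
    using inv_sigma_eq
  proof eventually_elim
    case (elim \<omega>)
    show ?case
    proof (cases "\<exists>t\<in>{1..T}. infl_var T t \<omega> = top")
      case False
      have cv: "X.cvar T t \<omega> = ennreal (1 / real T * (\<sigma>sq T t \<omega> / (\<sigma>h T t \<omega>)\<^sup>2))" if t: "t \<in> {1..T}" for t
      proof -
        have v: "infl_var T t \<omega> = ennreal (\<sigma>sq T t \<omega>)" using elim(1) False t by (auto simp: less_top[symmetric])
        have nn: "0 \<le> \<sigma>sq T t \<omega>" using elim(1) t by simp
        have sc: "(inv_sigma T t \<omega> / sqrt (real T))\<^sup>2 = 1 / real T * (1 / (\<sigma>h T t \<omega>)\<^sup>2)"
          using elim(2) t by (simp add: power_divide power_mult_distrib inverse_eq_divide)
        have "X.cvar T t \<omega> = ennreal ((inv_sigma T t \<omega> / sqrt (real T))\<^sup>2) * infl_var T t \<omega>" using elim(1) t by blast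
        also have "\<dots> = ennreal (1 / real T * (1 / (\<sigma>h T t \<omega>)\<^sup>2) * \<sigma>sq T t \<omega>)"
          unfolding v sc using nn by (intro ennreal_mult[symmetric]) auto
        finally show ?thesis by (simp add: mult.commute)
      qed
      have nn: "0 \<le> 1 / real T * (\<sigma>sq T t \<omega> / (\<sigma>h T t \<omega>)\<^sup>2)" if "t \<in> {1..T}" for t
        using elim(1) that by simp
      have "X.qvar T T \<omega> = (\<Sum>t=1..T. ennreal (1 / real T * (\<sigma>sq T t \<omega> / (\<sigma>h T t \<omega>)\<^sup>2)))"
        unfolding X.qvar_def by (rule sum.cong[OF refl cv])
      also have "\<dots> = ennreal (\<Sum>t=1..T. 1 / real T * (\<sigma>sq T t \<omega> / (\<sigma>h T t \<omega>)\<^sup>2))"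
        by (rule sum_ennreal[OF nn])
      also have "(\<Sum>t=1..T. 1 / real T * (\<sigma>sq T t \<omega> / (\<sigma>h T t \<omega>)\<^sup>2)) = ?r T \<omega>"
        by (rule sum_distrib_left[symmetric])
      finally have eq: "X.qvar T T \<omega> = ennreal (?r T \<omega>)" .
      have r: "0 \<le> ?r T \<omega>" using nn by (subst sum_distrib_left) (rule sum_nonneg)
      have "(ennreal x - 1) + (1 - ennreal x) = ennreal \<bar>x - 1\<bar>" if "0 \<le> x" for x
        using that by (cases "1 \<le> x") (auto simp: ennreal_minus ennreal_neg simp flip: ennreal_1)
      then show ?thesis unfolding eq using r by simp
    qed (simp add: infinite_var_def)
  qed
qed

text \<open>As \<open>inv_sigma\<close> is at most \<open>1 / sqrt var_floor\<close>, an increment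
  of \<open>X\<close> above \<epsilon> forces the weighted influence function above
  \<open>\<epsilon> * sqrt var_floor * sqrt (real T)\<close>. The hypothesis is therefore used at
  the level \<open>\<epsilon> * sqrt var_floor\<close>.\<close>

lemma X_lindeberg_vanishes:
  assumes b: "\<And>\<epsilon>. 0 < \<epsilon> \<Longrightarrow> little_o_p M
      (\<lambda>T \<omega>. 1 / real T * (\<Sum>t=1..T. real_cond_exp M (past T t)
         (\<lambda>\<omega>. (obs_weight T t \<omega>)\<^sup>2 * (infl (Z T t \<omega>))\<^sup>2 *
            (if \<bar>obs_weight T t \<omega> * infl (Z T t \<omega>)\<bar> > \<epsilon> * sqrt (real T) then 1 else 0)) \<omega>)) (\<lambda>T. 1)"
    and \<epsilon>: "0 < \<epsilon>"
  shows "vanishes_in_prob M (\<lambda>T \<omega>. \<Sum>t=1..T. X.lindeberg T \<epsilon> t \<omega>)"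
proof -
  define f where "f T t \<omega> = (obs_weight T t \<omega>)\<^sup>2 * (infl (Z T t \<omega>))\<^sup>2 *
     (if \<bar>obs_weight T t \<omega> * infl (Z T t \<omega>)\<bar> > (\<epsilon> * sqrt var_floor) * sqrt (real T) then 1 else 0)" for T t \<omega>
  let ?r = "\<lambda>T \<omega>. 1 / real T * (\<Sum>t=1..T. real_cond_exp M (past T t) (f T t) \<omega>)"
  have [measurable]: "?r T \<in> borel_measurable M" for T by measurable
  have r: "little_o_p M ?r (\<lambda>T. 1)"
    using b[of "\<epsilon> * sqrt var_floor"] \<epsilon> var_floor unfolding f_def[abs_def] by simp
  have term_le: "AE \<omega> in M. X.lindeberg T \<epsilon> t \<omega> \<le> ennreal (1 / (var_floor * real T)) * nn_cond_exp M (past T t) (\<lambda>\<omega>. ennreal (f T t \<omega>)) \<omega>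
      \<and> nn_cond_exp M (past T t) (\<lambda>\<omega>. ennreal (f T t \<omega>)) \<omega> \<le> infl_var T t \<omega>
      \<and> real_cond_exp M (past T t) (f T t) \<omega> = enn2real (nn_cond_exp M (past T t) (\<lambda>\<omega>. ennreal (f T t \<omega>)) \<omega>)"
    if t: "t \<in> {1..T}" for T t
  proof -
    interpret sigma_finite_subalgebra M "past T t" by (rule sigma_finite_past[OF t])
    note [measurable] = infl_term_measurable[OF t] obs_weight_measurable[OF t] infl_Z_measurable[OF t] inv_sigma_measurable[OF t]
      measurable_past_M[OF t inv_sigma_measurable[OF t]]
    have f_m[measurable]: "f T t \<in> borel_measurable M" unfolding f_def by measurable
    have f_nn: "0 \<le> f T t \<omega>" for \<omega> by (simp add: f_def)
    have T: "0 < real T" using t by simp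
    have le: "(inv_sigma T t \<omega> / sqrt (real T) * infl_term T t \<omega>)\<^sup>2 * (if \<epsilon> < \<bar>inv_sigma T t \<omega> / sqrt (real T) * infl_term T t \<omega>\<bar> then 1 else 0)
        \<le> 1 / (var_floor * real T) * f T t \<omega>" for \<omega>
    proof (cases "\<epsilon> < \<bar>inv_sigma T t \<omega> / sqrt (real T) * infl_term T t \<omega>\<bar>")
      case True
      have "\<bar>inv_sigma T t \<omega> / sqrt (real T) * infl_term T t \<omega>\<bar> = inv_sigma T t \<omega> * (\<bar>infl_term T t \<omega>\<bar> / sqrt (real T))"
        by (simp add: abs_mult inv_sigma_nonneg)
      also have "\<dots> \<le> 1 / sqrt var_floor * (\<bar>infl_term T t \<omega>\<bar> / sqrt (real T))"
        by (intro mult_right_mono inv_sigma_le) simp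
      finally have "\<epsilon> < 1 / sqrt var_floor * (\<bar>infl_term T t \<omega>\<bar> / sqrt (real T))" using True by simp
      then have "\<epsilon> * sqrt var_floor * sqrt (real T) < \<bar>infl_term T t \<omega>\<bar>" using var_floor T by (simp add: field_simps)
      then have f: "f T t \<omega> = (infl_term T t \<omega>)\<^sup>2" by (simp add: f_def infl_term_def power_mult_distrib)
      have "(inv_sigma T t \<omega> / sqrt (real T) * infl_term T t \<omega>)\<^sup>2 = (inv_sigma T t \<omega>)\<^sup>2 * ((infl_term T t \<omega>)\<^sup>2 / real T)"
        using T by (simp add: power_mult_distrib power_divide)
      also have "\<dots> \<le> 1 / var_floor * ((infl_term T t \<omega>)\<^sup>2 / real T)" by (intro mult_right_mono inv_sigma_sq_le) simp
      finally show ?thesis using True f by simp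
    next
      case False
      then show ?thesis using var_floor f_nn[of \<omega>] by simp
    qed
    have "AE \<omega> in M. X.lindeberg T \<epsilon> t \<omega> \<le> nn_cond_exp M (past T t) (\<lambda>\<omega>. ennreal (1 / (var_floor * real T)) * ennreal (f T t \<omega>)) \<omega>"
      unfolding X.lindeberg_def
    proof (rule nn_cond_exp_mono)
      show "AE \<omega> in M. ennreal ((inv_sigma T t \<omega> / sqrt (real T) * infl_term T t \<omega>)\<^sup>2 * (if \<epsilon> < \<bar>inv_sigma T t \<omega> / sqrt (real T) * infl_term T t \<omega>\<bar> then 1 else 0))
          \<le> ennreal (1 / (var_floor * real T)) * ennreal (f T t \<omega>)"
        using le var_floor f_nn by (intro AE_I2) (subst ennreal_mult[symmetric], auto intro: ennreal_leI)
    qed measurable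
    moreover have "AE \<omega> in M. ennreal (1 / (var_floor * real T)) * nn_cond_exp M (past T t) (\<lambda>\<omega>. ennreal (f T t \<omega>)) \<omega>
        = nn_cond_exp M (past T t) (\<lambda>\<omega>. ennreal (1 / (var_floor * real T)) * ennreal (f T t \<omega>)) \<omega>"
      by (rule nn_cond_exp_prod) measurable
    moreover have "AE \<omega> in M. nn_cond_exp M (past T t) (\<lambda>\<omega>. ennreal (f T t \<omega>)) \<omega> \<le> nn_cond_exp M (past T t) (\<lambda>\<omega>. ennreal ((infl_term T t \<omega>)\<^sup>2)) \<omega>"
      by (rule nn_cond_exp_mono) (auto intro!: ennreal_leI simp: f_def infl_term_def power_mult_distrib)
    moreover have "AE \<omega> in M. real_cond_exp M (past T t) (f T t) \<omega> = enn2real (nn_cond_exp M (past T t) (\<lambda>\<omega>. ennreal (f T t \<omega>)) \<omega>)"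
      by (rule real_cond_exp_nonneg_eq) (auto simp: f_nn)
    ultimately show ?thesis using infl_var_eq[OF t] by eventually_elim simp
  qed
  show ?thesis
  proof (rule vanishes_in_prob_random_bound)
    show "vanishes_in_prob M (\<lambda>T \<omega>. ennreal \<bar>?r T \<omega>\<bar> + infinite_var T \<omega>)"
      by (intro vanishes_in_prob_add little_o_p_imp_vanishes[OF r] infinite_var_vanishes) measurable
    show "(\<lambda>\<omega>. \<Sum>t=1..T. X.lindeberg T \<epsilon> t \<omega>) \<in> borel_measurable M" for T
      unfolding X.lindeberg_def by measurable
    have "AE \<omega> in M. \<forall>T. \<forall>t\<in>{1..T}. X.lindeberg T \<epsilon> t \<omega> \<le> ennreal (1 / (var_floor * real T)) * nn_cond_exp M (past T t) (\<lambda>\<omega>. ennreal (f T t \<omega>)) \<omega>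
      \<and> nn_cond_exp M (past T t) (\<lambda>\<omega>. ennreal (f T t \<omega>)) \<omega> \<le> infl_var T t \<omega>
      \<and> real_cond_exp M (past T t) (f T t) \<omega> = enn2real (nn_cond_exp M (past T t) (\<lambda>\<omega>. ennreal (f T t \<omega>)) \<omega>)"
      unfolding AE_all_countable by (intro allI) (subst AE_ball_countable, simp, intro ballI term_le)
    then show "AE \<omega> in M. \<exists>K. \<forall>\<^sub>F T in sequentially.
        (\<Sum>t=1..T. X.lindeberg T \<epsilon> t \<omega>) \<le> ennreal K * (ennreal \<bar>?r T \<omega>\<bar> + infinite_var T \<omega>)"
    proof eventually_elim
      case (elim \<omega>)
      have "(\<Sum>t=1..T. X.lindeberg T \<epsilon> t \<omega>) \<le> ennreal (1 / var_floor) * (ennreal \<bar>?r T \<omega>\<bar> + infinite_var T \<omega>)" for T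
      proof (cases "\<exists>t\<in>{1..T}. infl_var T t \<omega> = top")
        case True
        then have "ennreal (1 / var_floor) * (ennreal \<bar>?r T \<omega>\<bar> + infinite_var T \<omega>) = top"
          using var_floor by (simp add: infinite_var_def ennreal_mult_top)
        then show ?thesis by simp
      next
        case False
        let ?c = "\<lambda>t. real_cond_exp M (past T t) (f T t) \<omega>"
        have c_nn: "0 \<le> ?c t" if "t \<in> {1..T}" for t using elim that by simp
        have "(\<Sum>t=1..T. X.lindeberg T \<epsilon> t \<omega>) \<le> (\<Sum>t=1..T. ennreal (1 / (var_floor * real T) * ?c t))"
        proof (rule sum_mono)
          fix t assume t: "t \<in> {1..T}"
          have "infl_var T t \<omega> < top" using False t by (auto simp: less_top[symmetric])
          then have "nn_cond_exp M (past T t) (\<lambda>\<omega>. ennreal (f T t \<omega>)) \<omega> < top"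
            using elim t by (meson order_le_less_trans)
          then have "nn_cond_exp M (past T t) (\<lambda>\<omega>. ennreal (f T t \<omega>)) \<omega> = ennreal (?c t)" using elim t by simp
          moreover have "ennreal (1 / (var_floor * real T) * ?c t) = ennreal (1 / (var_floor * real T)) * ennreal (?c t)"
            using var_floor c_nn[OF t] by (intro ennreal_mult) auto
          moreover have "X.lindeberg T \<epsilon> t \<omega>
              \<le> ennreal (1 / (var_floor * real T)) * nn_cond_exp M (past T t) (\<lambda>\<omega>. ennreal (f T t \<omega>)) \<omega>"
            using elim t by blast
          ultimately show "X.lindeberg T \<epsilon> t \<omega> \<le> ennreal (1 / (var_floor * real T) * ?c t)"
            by (simp only:)
        qed
        also have "\<dots> = ennreal (\<Sum>t=1..T. 1 / (var_floor * real T) * ?c t)"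
          using var_floor c_nn by (intro sum_ennreal) auto
        also have "(\<Sum>t=1..T. 1 / (var_floor * real T) * ?c t) = 1 / var_floor * ?r T \<omega>"
          by (simp add: sum_distrib_left)
        also have "ennreal \<dots> = ennreal (1 / var_floor) * ennreal (?r T \<omega>)"
        proof (rule ennreal_mult)
          show "0 \<le> ?r T \<omega>" by (intro mult_nonneg_nonneg sum_nonneg c_nn) auto
        qed (use var_floor in simp)
        also have "\<dots> \<le> ennreal (1 / var_floor) * (ennreal \<bar>?r T \<omega>\<bar> + infinite_var T \<omega>)"
          by (intro mult_left_mono add_increasing2 ennreal_leI abs_ge_self) auto
        finally show ?thesis .
      qed
      then show ?case by (intro exI[of _ "1 / var_floor"] always_eventually allI)
    qed
  qed measurable
qed

definition stat :: "nat \<Rightarrow> 'w \<Rightarrow> real" where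
  "stat T \<omega> = A_hat obs_weight \<sigma>h T \<omega> / sqrt (real T) * (Psi_os l m Z obs_weight \<theta>h \<eta>h \<alpha>h \<sigma>h T \<omega> - (\<integral>z. m \<theta>\<^sub>0 z \<partial>Pe))"

lemma stat_measurable[measurable]: "stat T \<in> borel_measurable M"
proof -
  have [measurable]: "(\<lambda>\<omega>. m (\<theta>h T t \<omega>) (Z T t \<omega>)) \<in> borel_measurable M"
    "(\<lambda>\<omega>. score l (\<theta>h T t \<omega>) (\<eta>h T t \<omega>) (Z T t \<omega>) (\<alpha>h T t \<omega>)) \<in> borel_measurable M" if "t \<in> {1..T}" for t
    using perturbation_joint_measurable(1,2)[OF measurable_past_M[OF that \<theta>h[OF that]] measurable_past_M[OF that \<eta>h[OF that]]
      measurable_past_M[OF that \<alpha>h[OF that]] Z_measurable[OF that]] by auto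
  show ?thesis unfolding stat_def A_hat_def Psi_os_def by measurable
qed

text \<open>The identity is algebraic: on this event the influence function plus \<open>pert\<close>
  is the estimated score minus the target, and the bias subtracted in \<open>pert_term\<close> is
  added back.\<close>

lemma stat_decomposition:
  assumes \<omega>: "\<omega> \<in> space M" and s: "\<And>t. t \<in> {1..T} \<Longrightarrow> inv_sigma T t \<omega> = inverse (\<sigma>h T t \<omega>)"
    "\<And>t. t \<in> {1..T} \<Longrightarrow> 0 < \<sigma>h T t \<omega>"
    and near_truth: "\<And>t. t \<in> {1..T} \<Longrightarrow> near_truth T t \<omega>"
  shows "stat T \<omega> = (\<Sum>t=1..T. X T t \<omega>) + (\<Sum>t=1..T. Y T t \<omega>) + (\<Sum>t=1..T. inv_sigma T t \<omega> / sqrt (real T) * bias T t \<omega>)"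
proof -
  let ?\<Psi> = "\<integral>z. m \<theta>\<^sub>0 z \<partial>Pe" and ?A = "A_hat obs_weight \<sigma>h T \<omega>"
  let ?f = "\<lambda>t. m (\<theta>h T t \<omega>) (Z T t \<omega>) - score l (\<theta>h T t \<omega>) (\<eta>h T t \<omega>) (Z T t \<omega>) (\<alpha>h T t \<omega>)"
  let ?S = "\<Sum>t=1..T. inverse (\<sigma>h T t \<omega>) * obs_weight T t \<omega> * ?f t"
  have "(\<Sum>t=1..T. X T t \<omega>) + (\<Sum>t=1..T. Y T t \<omega>) + (\<Sum>t=1..T. inv_sigma T t \<omega> / sqrt (real T) * bias T t \<omega>)
      = (\<Sum>t=1..T. (inverse (\<sigma>h T t \<omega>) * obs_weight T t \<omega> * ?f t - inverse (\<sigma>h T t \<omega>) * obs_weight T t \<omega> * ?\<Psi>) / sqrt (real T))"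
    unfolding sum.distrib[symmetric]
  proof (rule sum.cong[OF refl])
    fix t assume t: "t \<in> {1..T}"
    have "pert T t (\<omega>, Z T t \<omega>) = ?f t - (m \<theta>\<^sub>0 (Z T t \<omega>) - os.ext_score (Z T t \<omega>))"
      using near_truth[OF t] by (simp add: pert_def os.perturbation_def)
    moreover have "infl (Z T t \<omega>) = m \<theta>\<^sub>0 (Z T t \<omega>) - ?\<Psi> - os.ext_score (Z T t \<omega>)"
      by (rule os.influence_eq)
    ultimately have pert: "infl (Z T t \<omega>) + pert T t (\<omega>, Z T t \<omega>) = ?f t - ?\<Psi>" by simp
    have "X T t \<omega> + Y T t \<omega> + inv_sigma T t \<omega> / sqrt (real T) * bias T t \<omega>
        = inv_sigma T t \<omega> / sqrt (real T) * (obs_weight T t \<omega> * (infl (Z T t \<omega>) + pert T t (\<omega>, Z T t \<omega>)))"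
      unfolding infl_term_def pert_term_def by (simp add: algebra_simps)
    also have "\<dots> = (inverse (\<sigma>h T t \<omega>) * obs_weight T t \<omega> * ?f t - inverse (\<sigma>h T t \<omega>) * obs_weight T t \<omega> * ?\<Psi>) / sqrt (real T)"
      unfolding pert s(1)[OF t] by (simp add: algebra_simps diff_divide_distrib add_divide_distrib)
    finally show "X T t \<omega> + Y T t \<omega> + inv_sigma T t \<omega> / sqrt (real T) * bias T t \<omega>
        = (inverse (\<sigma>h T t \<omega>) * obs_weight T t \<omega> * ?f t - inverse (\<sigma>h T t \<omega>) * obs_weight T t \<omega> * ?\<Psi>) / sqrt (real T)" .
  qed
  also have "\<dots> = (?S - ?A * ?\<Psi>) / sqrt (real T)"
    unfolding A_hat_def by (simp add: sum_subtractf sum_distrib_right flip: sum_divide_distrib)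
  also have "\<dots> = stat T \<omega>"
  proof (cases "?A = 0")
    \<comment> \<open>The summands of the normaliser are nonnegative, so each of them is 0 and the
      weighted sum of scores vanishes too; the convention \<open>inverse 0 = 0\<close> is
      harmless.\<close>
    case True
    have "inverse (\<sigma>h T t \<omega>) * obs_weight T t \<omega> = 0" if "t \<in> {1..T}" for t
      using True that s(2) obs_weight_nonneg \<omega> unfolding A_hat_def
      by (subst (asm) sum_nonneg_eq_0_iff) (auto simp: less_imp_le)
    then have "?S = 0" by (intro sum.neutral) auto
    then show ?thesis using True by (simp add: stat_def)
  next
    case False
    then have "?A * (inverse ?A * ?S - ?\<Psi>) = ?S - ?A * ?\<Psi>" by (simp add: right_diff_distrib mult.assoc[symmetric])
    then show ?thesis unfolding stat_def Psi_os_def times_divide_eq_left by simp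
  qed
  finally show ?thesis by simp
qed

text \<open>Outside \<open>?bad\<close> the remainder is the sum of \<open>Y\<close> plus the scaled
  bias, which \<open>bias_bound\<close> makes a multiple of \<open>err2\<close>. The event behind
  \<open>?bad\<close> is negligible because a single round outside the region keeps
  \<open>err4\<close> away from 0.\<close>

lemma remainder_vanishes: "vanishes_in_prob M (\<lambda>T \<omega>. ennreal \<bar>stat T \<omega> - (\<Sum>t=1..T. X T t \<omega>)\<bar>)"
proof (rule vanishes_in_prob_random_bound)
  let ?bad = "\<lambda>T \<omega>. if \<exists>t\<in>{1..T}. \<not> near_truth T t \<omega> then top else (0 :: ennreal)"
  let ?S = "\<lambda>T \<omega>. ennreal \<bar>\<Sum>t=1..T. Y T t \<omega>\<bar>"
  have [measurable]: "?bad T \<in> borel_measurable M" for T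
  proof -
    have "{\<omega>\<in>space M. near_truth T t \<omega>} \<in> sets M" if "t \<in> {1..T}" for t
      using near_truth_measurable[OF that] subalgebra_past[OF that] by (auto simp: subalgebra_def)
    then have [measurable]: "Measurable.pred M (near_truth T t)" if "t \<in> {1..T}" for t using that by (simp add: pred_def)
    show ?thesis by measurable
  qed
  have [measurable]: "?S T \<in> borel_measurable M" "(\<lambda>\<omega>. \<Sum>t=1..T. X T t \<omega>) \<in> borel_measurable M" for T
    using measurable_past_M[OF _ inv_sigma_measurable] by measurable
  have bad: "vanishes_in_prob M ?bad"
  proof (rule vanishes_in_prob_event[OF err4_vanishes])
    show "0 < (min \<rho> 1) ^ 4" by (rule zero_less_power) simp
    fix T \<omega> assume "\<exists>t\<in>{1..T}. \<not> near_truth T t \<omega>"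
    then obtain t where t: "t \<in> {1..T}" "\<not> near_truth T t \<omega>" by blast
    have "(min \<rho> 1) ^ 4 \<le> err_at T t \<omega> ^ 4"
      using err_at_lower_bound[OF t(2)] by (intro power_mono) (simp_all add: less_imp_le)
    also have "\<dots> \<le> err4 T \<omega>" unfolding err4_def using t by (intro member_le_sum) auto
    finally show "(min \<rho> 1) ^ 4 \<le> err4 T \<omega>" .
  qed measurable
  show "vanishes_in_prob M (\<lambda>T \<omega>. ?S T \<omega> + ennreal (err2 T \<omega>) + ?bad T \<omega>)"
    by (intro vanishes_in_prob_add Y_sum_vanishes err2_vanishes bad) measurable
  let ?kB = "(\<integral>z. C z \<partial>Pe) * (2 + os.ext_dist 0)"
  let ?K = "max 1 (?kB / sqrt var_floor)"
  show "AE \<omega> in M. \<exists>K. \<forall>\<^sub>F T in sequentially. ennreal \<bar>stat T \<omega> - (\<Sum>t=1..T. X T t \<omega>)\<bar>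
      \<le> ennreal K * (?S T \<omega> + ennreal (err2 T \<omega>) + ?bad T \<omega>)"
    using inv_sigma_eq AE_space
  proof eventually_elim
    case (elim \<omega>)
    have "ennreal \<bar>stat T \<omega> - (\<Sum>t=1..T. X T t \<omega>)\<bar> \<le> ennreal ?K * (?S T \<omega> + ennreal (err2 T \<omega>) + ?bad T \<omega>)" for T
    proof (cases "\<exists>t\<in>{1..T}. \<not> near_truth T t \<omega>")
      case True
      then have "ennreal ?K * (?S T \<omega> + ennreal (err2 T \<omega>) + ?bad T \<omega>) = top"
        by (simp add: ennreal_mult_top)
      then show ?thesis by simp
    next
      case False
      let ?b = "\<Sum>t=1..T. inv_sigma T t \<omega> / sqrt (real T) * bias T t \<omega>"
      have "stat T \<omega> - (\<Sum>t=1..T. X T t \<omega>) = (\<Sum>t=1..T. Y T t \<omega>) + ?b"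
        using elim False by (subst stat_decomposition) auto
      moreover have "\<bar>?b\<bar> \<le> ?kB / sqrt var_floor * err2 T \<omega>"
      proof -
        have "\<bar>?b\<bar> \<le> (\<Sum>t=1..T. \<bar>inv_sigma T t \<omega> / sqrt (real T) * bias T t \<omega>\<bar>)" by (rule sum_abs)
        also have "\<dots> \<le> (\<Sum>t=1..T. 1 / sqrt var_floor / sqrt (real T) * (?kB * (err_at T t \<omega>)\<^sup>2))"
        proof (rule sum_mono)
          fix t assume t: "t \<in> {1..T}"
          have "\<bar>inv_sigma T t \<omega> / sqrt (real T)\<bar> \<le> 1 / sqrt var_floor / sqrt (real T)"
            using divide_right_mono[OF inv_sigma_le[of T t \<omega>], of "sqrt (real T)"] inv_sigma_nonneg[of T t \<omega>] by simp
          then show "\<bar>inv_sigma T t \<omega> / sqrt (real T) * bias T t \<omega>\<bar> \<le> 1 / sqrt var_floor / sqrt (real T) * (?kB * (err_at T t \<omega>)\<^sup>2)"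
            unfolding abs_mult[of _ "bias T t \<omega>"] using bias_bound[OF t] var_floor by (intro mult_mono) auto
        qed
        also have "\<dots> = ?kB / sqrt var_floor * err2 T \<omega>"
          unfolding err2_def by (simp add: sum_distrib_left[symmetric] sum_divide_distrib[symmetric])
        finally show ?thesis .
      qed
      ultimately have "\<bar>stat T \<omega> - (\<Sum>t=1..T. X T t \<omega>)\<bar> \<le> 1 * \<bar>\<Sum>t=1..T. Y T t \<omega>\<bar> + ?kB / sqrt var_floor * err2 T \<omega>"
        by linarith
      also have "\<dots> \<le> ?K * \<bar>\<Sum>t=1..T. Y T t \<omega>\<bar> + ?K * err2 T \<omega>"
        by (intro add_mono mult_right_mono err2_nonneg) auto
      also have "\<dots> = ?K * (\<bar>\<Sum>t=1..T. Y T t \<omega>\<bar> + err2 T \<omega>)" by (simp only: distrib_left)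
      finally have "ennreal \<bar>stat T \<omega> - (\<Sum>t=1..T. X T t \<omega>)\<bar> \<le> ennreal (?K * (\<bar>\<Sum>t=1..T. Y T t \<omega>\<bar> + err2 T \<omega>))"
        by (rule ennreal_leI)
      also have "\<dots> = ennreal ?K * ennreal (\<bar>\<Sum>t=1..T. Y T t \<omega>\<bar> + err2 T \<omega>)"
        using err2_nonneg[of T \<omega>] by (intro ennreal_mult) auto
      also have "ennreal (\<bar>\<Sum>t=1..T. Y T t \<omega>\<bar> + err2 T \<omega>) = ?S T \<omega> + ennreal (err2 T \<omega>)"
        using err2_nonneg[of T \<omega>] by (intro ennreal_plus) auto
      finally show ?thesis using False by simp
    qed
    then show ?case by (intro exI[of _ ?K] always_eventually allI)
  qed
  show "(\<lambda>\<omega>. ?S T \<omega> + ennreal (err2 T \<omega>) + ?bad T \<omega>) \<in> borel_measurable M"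
    "(\<lambda>\<omega>. ennreal \<bar>stat T \<omega> - (\<Sum>t=1..T. X T t \<omega>)\<bar>) \<in> borel_measurable M" for T
    by measurable
qed

theorem stat_asymptotically_normal:
  assumes b: "\<And>\<epsilon>. 0 < \<epsilon> \<Longrightarrow> little_o_p M
      (\<lambda>T \<omega>. 1 / real T * (\<Sum>t=1..T. real_cond_exp M (past T t)
         (\<lambda>\<omega>. (obs_weight T t \<omega>)\<^sup>2 * (infl (Z T t \<omega>))\<^sup>2 *
            (if \<bar>obs_weight T t \<omega> * infl (Z T t \<omega>)\<bar> > \<epsilon> * sqrt (real T) then 1 else 0)) \<omega>)) (\<lambda>T. 1)"
    and ratio: "little_o_p M (\<lambda>T \<omega>. 1 / real T * (\<Sum>t=1..T. \<sigma>sq T t \<omega> / (\<sigma>h T t \<omega>)\<^sup>2) - 1) (\<lambda>T. 1)"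
  shows "weak_conv_m (\<lambda>T. distr M borel (stat T)) std_normal_distribution"
proof (rule levy_continuity)
  have S[measurable]: "(\<lambda>\<omega>. \<Sum>t=1..T. X T t \<omega>) \<in> borel_measurable M" for T
    using measurable_past_M[OF _ inv_sigma_measurable] by measurable
  fix r
  have "(\<lambda>T. char (distr M borel (\<lambda>\<omega>. \<Sum>t=1..T. X T t \<omega>)) r) \<longlonglongrightarrow> of_real (exp (- r\<^sup>2 / 2))"
    by (rule martingale_central_limit_theorem[OF X_martingale X_qvar_vanishes[OF ratio] X_lindeberg_vanishes[OF b]])
  from slutsky_char[OF S _ remainder_vanishes this]
  have "(\<lambda>T. char (distr M borel (\<lambda>\<omega>. (\<Sum>t=1..T. X T t \<omega>) + (stat T \<omega> - (\<Sum>t=1..T. X T t \<omega>)))) r)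
      \<longlonglongrightarrow> of_real (exp (- r\<^sup>2 / 2))"
    using S by simp
  then show "(\<lambda>T. char (distr M borel (stat T)) r) \<longlonglongrightarrow> char std_normal_distribution r"
    by (simp add: char_std_normal_distribution)
qed (auto intro: real_dist_normal_dist)

end

theorem theorem2:
  fixes M :: "'w measure" and MC :: "'c measure" and MA :: "'a measure"
    and PC :: "'c measure" and PY :: "'c \<times> 'a \<Rightarrow> real measure"
    and Z :: "nat \<Rightarrow> nat \<Rightarrow> 'w \<Rightarrow> 'c \<times> 'a \<times> real"
    and Pi :: "nat \<Rightarrow> nat \<Rightarrow> 'w \<Rightarrow> 'c \<Rightarrow> 'a measure"
    and Pi_e :: "'c \<Rightarrow> 'a measure" and mu :: "'c \<Rightarrow> 'a measure"
    and dens :: "nat \<Rightarrow> nat \<Rightarrow> 'w \<Rightarrow> 'c \<Rightarrow> 'a \<Rightarrow> real" and dens_e :: "'c \<Rightarrow> 'a \<Rightarrow> real"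
    and l :: "'th::real_normed_vector \<Rightarrow> 'up::real_normed_vector \<Rightarrow> 'c \<times> 'a \<times> real \<Rightarrow> real"
    and m :: "'th \<Rightarrow> 'c \<times> 'a \<times> real \<Rightarrow> real"
    and \<theta>\<^sub>0 :: 'th and \<eta>\<^sub>0 :: 'up
    and \<iota> :: "'th \<Rightarrow> 'b::banach" and \<alpha> :: 'b
    and \<theta>h \<alpha>h :: "nat \<Rightarrow> nat \<Rightarrow> 'w \<Rightarrow> 'th" and \<eta>h :: "nat \<Rightarrow> nat \<Rightarrow> 'w \<Rightarrow> 'up"
    and \<sigma>h :: "nat \<Rightarrow> nat \<Rightarrow> 'w \<Rightarrow> real"
    and Pe :: "('c \<times> 'a \<times> real) measure" and F :: "nat \<Rightarrow> nat \<Rightarrow> 'w measure"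
    and w \<phi> \<sigma>sq :: "nat \<Rightarrow> nat \<Rightarrow> 'w \<Rightarrow> real"
  assumes design: "bandit_density M MC MA PC PY Z Pi Pi_e mu dens dens_e"
    and Pe: "Pe = eval_law MC MA PC Pi_e PY"
    and regular: "regularity Pe l m \<theta>\<^sub>0 \<eta>\<^sub>0"
    and envelope: "envelope Pe l m \<theta>\<^sub>0 \<eta>\<^sub>0"
    and completion: "is_completion (\<lambda>h. sqrt (hessian Pe l \<theta>\<^sub>0 \<eta>\<^sub>0 h h)) \<iota>"
    and riesz: "riesz_representer Pe l m \<theta>\<^sub>0 \<eta>\<^sub>0 \<iota> \<alpha>"
    and F: "\<And>T t. F T t = history M (obs_space MC MA) (Z T) t"
    and w: "\<And>T t \<omega>. w T t \<omega> = dens_e (ctx (Z T t \<omega>)) (act (Z T t \<omega>)) /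
                        dens T t \<omega> (ctx (Z T t \<omega>)) (act (Z T t \<omega>))"
    and \<phi>: "\<And>T t \<omega>. \<phi> T t \<omega> = influence Pe l m \<theta>\<^sub>0 \<eta>\<^sub>0 \<iota> \<alpha> (Z T t \<omega>)"
    and \<sigma>sq: "\<And>T t. \<sigma>sq T t = cond_var M (F T (t - 1)) (\<lambda>\<omega>. w T t \<omega> * \<phi> T t \<omega>)"
    and estimators: "\<And>T t. t \<in> {1..T} \<Longrightarrow> \<theta>h T t \<in> F T (t - 1) \<rightarrow>\<^sub>M borel"
      "\<And>T t. t \<in> {1..T} \<Longrightarrow> \<eta>h T t \<in> F T (t - 1) \<rightarrow>\<^sub>M borel"
      "\<And>T t. t \<in> {1..T} \<Longrightarrow> \<alpha>h T t \<in> F T (t - 1) \<rightarrow>\<^sub>M borel"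
      "\<And>T t. t \<in> {1..T} \<Longrightarrow> \<sigma>h T t \<in> F T (t - 1) \<rightarrow>\<^sub>M borel"
    and \<sigma>h_nonneg: "\<And>T t. t \<in> {1..T} \<Longrightarrow> AE \<omega> in M. 0 \<le> \<sigma>h T t \<omega>"
    and a_theta: "little_o_p M (\<lambda>T \<omega>. 1 / real T * (\<Sum>t=1..T. norm (\<theta>h T t \<omega> - \<theta>\<^sub>0) ^ 4))
                    (\<lambda>T. 1 / real T)"
    and a_eta: "little_o_p M (\<lambda>T \<omega>. 1 / real T * (\<Sum>t=1..T. norm (\<eta>h T t \<omega> - \<eta>\<^sub>0) ^ 4))
                    (\<lambda>T. 1 / real T)"
    and a_alpha: "little_o_p M
                    (\<lambda>T \<omega>. 1 / real T * (\<Sum>t=1..T. cont_ext \<iota> norm (\<iota> (\<alpha>h T t \<omega>) - \<alpha>) ^ 4))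
                    (\<lambda>T. 1 / real T)"
    and b: "\<And>\<epsilon>. 0 < \<epsilon> \<Longrightarrow> little_o_p M
                    (\<lambda>T \<omega>. 1 / real T * (\<Sum>t=1..T. real_cond_exp M (F T (t - 1))
                       (\<lambda>\<omega>. (w T t \<omega>)\<^sup>2 * (\<phi> T t \<omega>)\<^sup>2 *
                            (if \<bar>w T t \<omega> * \<phi> T t \<omega>\<bar> > \<epsilon> * sqrt (real T) then 1 else 0)) \<omega>))
                    (\<lambda>T. 1)"
    and c: "AE \<omega> in M. \<exists>K. \<forall>\<^sub>F T in sequentially.
              (SUP t\<in>{1..T}. SUP (c, a)\<in>space MC \<times> space MA.
                 ennreal (dens_e c a) / ennreal (dens T t \<omega> c a))
              \<le> ennreal (K * real T powr (1 / 3))"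
    and d_ratio: "little_o_p M
                    (\<lambda>T \<omega>. 1 / real T * (\<Sum>t=1..T. \<sigma>sq T t \<omega> / (\<sigma>h T t \<omega>)\<^sup>2) - 1) (\<lambda>T. 1)"
    and d_bound: "\<exists>c>0. \<forall>T. AE \<omega> in M. \<forall>t\<in>{1..T}. (\<sigma>h T t \<omega>)\<^sup>2 > c"
  shows "weak_conv_m
           (\<lambda>T. distr M borel (\<lambda>\<omega>. A_hat w \<sigma>h T \<omega> / sqrt (real T) *
              (Psi_os l m Z w \<theta>h \<eta>h \<alpha>h \<sigma>h T \<omega> - (\<integral>z. m \<theta>\<^sub>0 z \<partial>Pe))))
           std_normal_distribution"
proof -
  interpret bd: bandit_density M MC MA PC PY Z Pi Pi_e mu dens dens_e by (rule design)
  interpret reg: regularity Pe l m \<theta>\<^sub>0 \<eta>\<^sub>0 by (rule regular)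
  have prob_Pe: "prob_space Pe" unfolding Pe by (rule bd.prob_space_Pe)
  obtain r1 where r1: "0 < r1" "\<forall>z\<in>space Pe. \<forall>\<eta>\<in>ball \<eta>\<^sub>0 r1. twice_frechet_differentiable_on (\<lambda>\<theta>. l \<theta> \<eta> z) (ball \<theta>\<^sub>0 r1)"
    using reg.loss_differentiable by blast
  obtain r2 where r2: "0 < r2" "\<forall>z\<in>space Pe. \<forall>\<theta>\<in>ball \<theta>\<^sub>0 r2. (\<lambda>\<theta>. m \<theta> z) differentiable (at \<theta>)"
    using reg.m_differentiable by blast
  obtain r3 where r3: "0 < r3" "\<forall>z\<in>space Pe. \<forall>\<theta>\<in>ball \<theta>\<^sub>0 r3. \<forall>\<eta>\<in>ball \<eta>\<^sub>0 r3. \<forall>h v.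
      (\<lambda>\<delta>::real. score l \<theta> (\<eta> + \<delta> *\<^sub>R v) z h) differentiable (at 0)"
    using reg.mixed by blast
  from envelope[unfolded envelope_def] obtain r4 r5 C where r45: "0 < r4" "0 < r5"
    and C: "C \<in> borel_measurable Pe" "\<forall>z\<in>space Pe. 0 \<le> C z" "integrable Pe (\<lambda>z. C z ^ 4)"
    and env: "\<forall>\<theta> \<theta>' \<eta> \<eta>'. norm (\<theta> - \<theta>\<^sub>0) \<le> r4 \<longrightarrow> norm (\<theta>' - \<theta>\<^sub>0) \<le> r4 \<longrightarrow>
         norm (\<eta> - \<eta>\<^sub>0) \<le> r5 \<longrightarrow> norm (\<eta>' - \<eta>\<^sub>0) \<le> r5 \<longrightarrow>
         (\<forall>z\<in>space Pe. \<forall>h u v.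
            \<bar>m \<theta> z\<bar> \<le> C z \<and>
            \<bar>d_theta m \<theta> z h\<bar> \<le> C z * norm h \<and>
            \<bar>score l \<theta>\<^sub>0 \<eta>\<^sub>0 z h\<bar> \<le> C z * norm h \<and>
            \<bar>score2 l \<theta> \<eta> z h u\<bar> \<le> C z * norm h * norm u \<and>
            \<bar>d_eta_theta l \<theta> \<eta> z h v\<bar> \<le> C z * norm h * norm v \<and>
            \<bar>d_theta m \<theta> z h - d_theta m \<theta>' z h\<bar> \<le> C z * norm (\<theta> - \<theta>') * norm h \<and>
            \<bar>d_eta_theta l \<theta> \<eta> z h v - d_eta_theta l \<theta>' \<eta>' z h v\<bar>
              \<le> C z * (norm (\<theta> - \<theta>') + norm (\<eta> - \<eta>')) * norm h * norm v \<and>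
            \<bar>score2 l \<theta> \<eta> z h u - score2 l \<theta>' \<eta>' z h u\<bar>
              \<le> C z * (norm (\<theta> - \<theta>') + norm (\<eta> - \<eta>')) * norm h * norm u)"
    by blast
  \<comment> \<open>Open balls of this radius lie in the neighbourhoods of all three
    differentiability conditions and in both closed balls of the envelope.\<close>
  define \<rho> where "\<rho> = min (min r1 r2) (min r3 (min r4 r5))"
  have \<rho>: "0 < \<rho>" "\<rho> \<le> r1" "\<rho> \<le> r2" "\<rho> \<le> r3" "\<rho> \<le> r4" "\<rho> \<le> r5"
    using r1(1) r2(1) r3(1) r45 by (auto simp: \<rho>_def)
  have ball_mono: "x \<in> ball y \<rho> \<Longrightarrow> \<rho> \<le> r \<Longrightarrow> x \<in> ball y r" for x y :: "'x::metric_space" and r by simp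
  interpret os: one_step Pe l m \<theta>\<^sub>0 \<eta>\<^sub>0 \<iota> \<alpha> \<rho> C
  proof (rule one_step.intro[OF prob_Pe], unfold_locales)
    show "(\<lambda>(\<theta>, \<eta>, h, z). score l \<theta> \<eta> z h) \<in> borel_measurable (borel \<Otimes>\<^sub>M (borel \<Otimes>\<^sub>M (borel \<Otimes>\<^sub>M Pe)))"
      by (rule reg.score_measurable)
    show "(\<lambda>(\<theta>, z). m \<theta> z) \<in> borel_measurable (borel \<Otimes>\<^sub>M Pe)" by (rule reg.m_measurable)
    show "twice_frechet_differentiable_on (\<lambda>\<theta>. l \<theta> \<eta> z) (ball \<theta>\<^sub>0 \<rho>)"
      if "z \<in> space Pe" "\<eta> \<in> ball \<eta>\<^sub>0 \<rho>" for z \<eta>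
    proof -
      have "twice_frechet_differentiable_on (\<lambda>\<theta>. l \<theta> \<eta> z) (ball \<theta>\<^sub>0 r1)"
        using r1(2) that ball_mono[OF _ \<rho>(2)] by blast
      moreover have "ball \<theta>\<^sub>0 \<rho> \<subseteq> ball \<theta>\<^sub>0 r1" using \<rho>(2) by (rule subset_ball)
      ultimately show ?thesis unfolding twice_frechet_differentiable_on_def by blast
    qed
    show "(\<lambda>\<theta>. m \<theta> z) differentiable (at \<theta>)" if "z \<in> space Pe" "\<theta> \<in> ball \<theta>\<^sub>0 \<rho>" for z \<theta>
      using r2(2) that ball_mono[OF _ \<rho>(3)] by blast
    show "(\<lambda>\<delta>::real. score l \<theta> (\<eta> + \<delta> *\<^sub>R v) z h) differentiable (at 0)"
      if "z \<in> space Pe" "\<theta> \<in> ball \<theta>\<^sub>0 \<rho>" "\<eta> \<in> ball \<eta>\<^sub>0 \<rho>" for z \<theta> \<eta> h v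
      by (rule r3(2)[rule_format, OF that(1) ball_mono[OF that(2) \<rho>(4)] ball_mono[OF that(3) \<rho>(4)]])
    show "(\<integral>z. score l \<theta>\<^sub>0 \<eta>\<^sub>0 z h \<partial>Pe) = 0" for h by (rule reg.first_order)
    show "(\<integral>z. d_eta_theta l \<theta>\<^sub>0 \<eta>\<^sub>0 z h u \<partial>Pe) = 0" for h u by (rule reg.orthogonality)
    show "\<exists>c>0. \<forall>h. c * (norm h)\<^sup>2 \<le> hessian Pe l \<theta>\<^sub>0 \<eta>\<^sub>0 h h" by (rule reg.coercive)
    fix \<theta> \<theta>' \<eta> \<eta>' z h u v
    assume "\<theta> \<in> ball \<theta>\<^sub>0 \<rho>" "\<theta>' \<in> ball \<theta>\<^sub>0 \<rho>" "\<eta> \<in> ball \<eta>\<^sub>0 \<rho>" "\<eta>' \<in> ball \<eta>\<^sub>0 \<rho>" and z: "z \<in> space Pe"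
    then have "norm (\<theta> - \<theta>\<^sub>0) \<le> r4" "norm (\<theta>' - \<theta>\<^sub>0) \<le> r4" "norm (\<eta> - \<eta>\<^sub>0) \<le> r5" "norm (\<eta>' - \<eta>\<^sub>0) \<le> r5"
      using \<rho> by (auto simp: dist_norm norm_minus_commute)
    from env[rule_format, OF this z, of h u v]
    show "\<bar>m \<theta> z\<bar> \<le> C z \<and>
        \<bar>d_theta m \<theta> z h\<bar> \<le> C z * norm h \<and>
        \<bar>score l \<theta>\<^sub>0 \<eta>\<^sub>0 z h\<bar> \<le> C z * norm h \<and>
        \<bar>score2 l \<theta> \<eta> z h u\<bar> \<le> C z * norm h * norm u \<and>
        \<bar>d_eta_theta l \<theta> \<eta> z h v\<bar> \<le> C z * norm h * norm v \<and>
        \<bar>d_theta m \<theta> z h - d_theta m \<theta>' z h\<bar> \<le> C z * norm (\<theta> - \<theta>') * norm h \<and>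
        \<bar>d_eta_theta l \<theta> \<eta> z h v - d_eta_theta l \<theta>' \<eta>' z h v\<bar>
          \<le> C z * (norm (\<theta> - \<theta>') + norm (\<eta> - \<eta>')) * norm h * norm v \<and>
        \<bar>score2 l \<theta> \<eta> z h u - score2 l \<theta>' \<eta>' z h u\<bar>
          \<le> C z * (norm (\<theta> - \<theta>') + norm (\<eta> - \<eta>')) * norm h * norm u"
      by blast
  qed (use \<rho>(1) C completion riesz in auto)
  obtain var_floor where var_floor: "0 < var_floor" "\<And>T. AE \<omega> in M. \<forall>t\<in>{1..T}. (\<sigma>h T t \<omega>)\<^sup>2 > var_floor" using d_bound by blast
  interpret fin: weighted_one_step M MC MA PC PY Z Pi Pi_e mu dens dens_e l m \<theta>\<^sub>0 \<eta>\<^sub>0 \<iota> \<alpha> \<rho> C \<theta>h \<alpha>h \<eta>h \<sigma>h var_floor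
  proof (intro weighted_one_step.intro design weighted_one_step_axioms.intro)
    show "one_step (eval_law MC MA PC Pi_e PY) l m \<theta>\<^sub>0 \<eta>\<^sub>0 \<iota> \<alpha> \<rho> C"
      using os.one_step_axioms unfolding Pe .
    \<comment> \<open>The lower bound concerns only the square; the sign comes from
      \<open>\<sigma>h_nonneg\<close>, and both together make \<open>\<sigma>h\<close>
      positive.\<close>
    show "AE \<omega> in M. \<forall>t\<in>{1..T}. 0 \<le> \<sigma>h T t \<omega> \<and> var_floor < (\<sigma>h T t \<omega>)\<^sup>2" for T
    proof -
      have "AE \<omega> in M. \<forall>t\<in>{1..T}. 0 \<le> \<sigma>h T t \<omega>"
        by (subst AE_ball_countable) (auto intro: \<sigma>h_nonneg)
      with var_floor(2)[of T] show ?thesis by eventually_elim auto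
    qed
    show "vanishes_in_prob M (\<lambda>T \<omega>. ennreal (\<Sum>t=1..T. norm (\<theta>h T t \<omega> - \<theta>\<^sub>0) ^ 4))"
      by (rule bd.little_o_p_inverse_imp_vanishes[OF a_theta]) (simp add: sum_nonneg)
    show "vanishes_in_prob M (\<lambda>T \<omega>. ennreal (\<Sum>t=1..T. norm (\<eta>h T t \<omega> - \<eta>\<^sub>0) ^ 4))"
      by (rule bd.little_o_p_inverse_imp_vanishes[OF a_eta]) (simp add: sum_nonneg)
    show "vanishes_in_prob M (\<lambda>T \<omega>. ennreal (\<Sum>t=1..T. one_step.ext_dist \<iota> \<alpha> (\<alpha>h T t \<omega>) ^ 4))"
      unfolding os.ext_dist_def
      by (rule bd.little_o_p_inverse_imp_vanishes[OF a_alpha]) (simp add: sum_nonneg)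
  qed (use estimators var_floor c in \<open>simp_all add: F\<close>)
  have w_eq: "w = fin.obs_weight"
    by (intro ext) (simp add: w fin.obs_weight_def bd.weight_def)
  have \<sigma>sq_eq: "\<sigma>sq = fin.\<sigma>sq"
    by (intro ext) (simp add: \<sigma>sq fin.\<sigma>sq_def w_eq \<phi> F Pe)
  have "weak_conv_m (\<lambda>T. distr M borel (fin.stat T)) std_normal_distribution"
    by (rule fin.stat_asymptotically_normal)
      (use b d_ratio in \<open>simp_all add: w_eq \<phi> F Pe \<sigma>sq_eq\<close>)
  then show ?thesis unfolding fin.stat_def[abs_def] w_eq Pe .
qed

end
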